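(* Let $0 \le \beta < \beta_c = \sqrt{2}$ and let $f:\mathbb{R}\to\mathbb{R}$ be continuous and bounded. Define $$W_t(\beta,f) = \sum_{u\in\mathcal{N}(t)} e^{\beta X_u(t) - c(\beta)t} f\!\left(\frac{X_u(t)-\beta t}{\sqrt{t}}\right).$$ Then, $\mathbb{P}$-almost surely and in $L^p$ for every $p\in[1,2]$ with $p<\beta_c^2/\beta^2$, $$\lim_{t\to\infty} W_t(\beta,f) = W_\infty(\beta)\int_{\mathbb{R}} f(x)\,\frac{e^{-x^2/2}}{\sqrt{2\pi}}\,dx.$$
   Context: Let $\mu=(\mu(k))_{k\ge0}$ be a probability distribution on $\mathbb{N}=\{0,1,2,\dots\}$ with $\sum_k k\mu(k)=2$ and $\sum_k k^2\mu(k)<\infty$. The branching Brownian motion (BBM) with offspring distribution $\mu$: at time $0$ a single particle starts a standard Brownian motion from the origin; after an independent exponential time with mean $1$ it dies and is replaced by a random number of children with law $\mu$, which start from the parent's death position and evolve independently in the same way (independent Brownian motions, exponential lifetimes, offspring numbers). $\mathcal{N}(t)$ denotes the set of particles alive at time $t$ and $X_u(t)$ the position of $u\in\mathcal{N}(t)$. We write $c(\beta)=1+\beta^2/2$, $\beta_c=\sqrt2$, and $W_t(\beta)=e^{-c(\beta)t}\sum_{u\in\mathcal{N}(t)}e^{\beta X_u(t)}$ (the additive martingale with respect to the natural filtration of the BBM); being a nonnegative martingale, it converges almost surely to a limit $W_\infty(\beta)$. For $\beta=0$ the condition $p<\beta_c^2/\beta^2$ is read as vacuous. *)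

theory Defs
  imports "HOL-Probability.Probability"
begin

text \<open>Ulam-Harris construction of branching Brownian motion. A label is a list of
naturals, most recent generation first: the i-th child of u is i # u.
Each label u carries a lifetime tau u, an offspring number L u and a driving
Brownian path B u.\<close>

definition std_brownian_motion :: "'a measure \<Rightarrow> ('a \<Rightarrow> real \<Rightarrow> real) \<Rightarrow> bool" where
  "std_brownian_motion M B \<longleftrightarrow>
     (\<forall>t. (\<lambda>\<omega>. B \<omega> t) \<in> borel_measurable M) \<and>
     (\<forall>\<omega>\<in>space M. B \<omega> 0 = 0 \<and> continuous_on UNIV (B \<omega>)) \<and>
     (\<forall>(ts :: nat \<Rightarrow> real) n. 0 \<le> ts 0 \<and> (\<forall>i<n. ts i < ts (Suc i)) \<longrightarrow>
        prob_space.indep_vars M (\<lambda>_. borel) (\<lambda>i \<omega>. B \<omega> (ts (Suc i)) - B \<omega> (ts i)) {..<n} \<and>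
        (\<forall>i<n. distributed M lborel (\<lambda>\<omega>. B \<omega> (ts (Suc i)) - B \<omega> (ts i))
                  (normal_density 0 (sqrt (ts (Suc i) - ts i)))))"

text \<open>Independence of two random variables with possibly different value spaces
  (the library's indep_var requires equal value types).\<close>
definition indep_rv2 :: "'a measure \<Rightarrow> 'b measure \<Rightarrow> ('a \<Rightarrow> 'b) \<Rightarrow> 'c measure \<Rightarrow> ('a \<Rightarrow> 'c) \<Rightarrow> bool" where
  "indep_rv2 M Ma X Mb Y \<longleftrightarrow> X \<in> measurable M Ma \<and> Y \<in> measurable M Mb \<and>
     prob_space.indep_set M (sets (vimage_algebra (space M) X Ma)) (sets (vimage_algebra (space M) Y Mb))"

definition BBM_randomness ::
  "'a measure \<Rightarrow> nat pmf \<Rightarrow> (nat list \<Rightarrow> 'a \<Rightarrow> real) \<Rightarrow> (nat list \<Rightarrow> 'a \<Rightarrow> nat)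
     \<Rightarrow> (nat list \<Rightarrow> 'a \<Rightarrow> real \<Rightarrow> real) \<Rightarrow> bool" where
  "BBM_randomness M \<mu> tau L B \<longleftrightarrow>
     prob_space M \<and>
     prob_space.indep_vars M
        (\<lambda>_. (borel \<Otimes>\<^sub>M count_space UNIV) \<Otimes>\<^sub>M (\<Pi>\<^sub>M s\<in>UNIV. borel))
        (\<lambda>u \<omega>. ((tau u \<omega>, L u \<omega>), B u \<omega>)) UNIV \<and>
     (\<forall>u. indep_rv2 M borel (tau u) (count_space UNIV) (L u)) \<and>
     (\<forall>u. indep_rv2 M (borel \<Otimes>\<^sub>M count_space UNIV) (\<lambda>\<omega>. (tau u \<omega>, L u \<omega>))
            (\<Pi>\<^sub>M s\<in>UNIV. borel) (B u)) \<and>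
     (\<forall>u. distributed M lborel (tau u) (exponential_density 1)) \<and>
     (\<forall>u. L u \<in> measurable M (count_space UNIV) \<and> distr M (count_space UNIV) (L u) = measure_pmf \<mu>) \<and>
     (\<forall>u. std_brownian_motion M (B u))"

fun bbm_exists :: "(nat list \<Rightarrow> nat) \<Rightarrow> nat list \<Rightarrow> bool" where
  "bbm_exists Lw [] = True"
| "bbm_exists Lw (i # u) = (bbm_exists Lw u \<and> i < Lw u)"

fun bbm_birth :: "(nat list \<Rightarrow> real) \<Rightarrow> nat list \<Rightarrow> real" where
  "bbm_birth tw [] = 0"
| "bbm_birth tw (i # u) = bbm_birth tw u + tw u"

definition bbm_death :: "(nat list \<Rightarrow> real) \<Rightarrow> nat list \<Rightarrow> real" where
  "bbm_death tw u = bbm_birth tw u + tw u"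

text \<open>Position of (the particle with label) u at time t, for t in its lifetime.\<close>
fun bbm_pos :: "(nat list \<Rightarrow> real) \<Rightarrow> (nat list \<Rightarrow> real \<Rightarrow> real) \<Rightarrow> nat list \<Rightarrow> real \<Rightarrow> real" where
  "bbm_pos tw Bw [] t = Bw [] t"
| "bbm_pos tw Bw (i # u) t =
     bbm_pos tw Bw u (bbm_death tw u) + Bw (i # u) (t - bbm_birth tw (i # u))"

definition bbm_alive :: "(nat list \<Rightarrow> real) \<Rightarrow> (nat list \<Rightarrow> nat) \<Rightarrow> real \<Rightarrow> nat list set" where
  "bbm_alive tw Lw t = {u. bbm_exists Lw u \<and> bbm_birth tw u \<le> t \<and> t < bbm_death tw u}"

definition c_beta :: "real \<Rightarrow> real" where
  "c_beta \<beta> = 1 + \<beta>\<^sup>2 / 2"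

definition W_add :: "(nat list \<Rightarrow> 'a \<Rightarrow> real) \<Rightarrow> (nat list \<Rightarrow> 'a \<Rightarrow> nat)
     \<Rightarrow> (nat list \<Rightarrow> 'a \<Rightarrow> real \<Rightarrow> real) \<Rightarrow> real \<Rightarrow> real \<Rightarrow> 'a \<Rightarrow> real" where
  "W_add tau L B \<beta> t \<omega> = exp (- c_beta \<beta> * t) *
     (\<Sum>u\<in>bbm_alive (\<lambda>v. tau v \<omega>) (\<lambda>v. L v \<omega>) t.
        exp (\<beta> * bbm_pos (\<lambda>v. tau v \<omega>) (\<lambda>v. B v \<omega>) u t))"

definition W_inf :: "(nat list \<Rightarrow> 'a \<Rightarrow> real) \<Rightarrow> (nat list \<Rightarrow> 'a \<Rightarrow> nat)
     \<Rightarrow> (nat list \<Rightarrow> 'a \<Rightarrow> real \<Rightarrow> real) \<Rightarrow> real \<Rightarrow> 'a \<Rightarrow> real" where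
  "W_inf tau L B \<beta> \<omega> = Lim at_top (\<lambda>t. W_add tau L B \<beta> t \<omega>)"

definition W_f :: "(nat list \<Rightarrow> 'a \<Rightarrow> real) \<Rightarrow> (nat list \<Rightarrow> 'a \<Rightarrow> nat)
     \<Rightarrow> (nat list \<Rightarrow> 'a \<Rightarrow> real \<Rightarrow> real) \<Rightarrow> real \<Rightarrow> (real \<Rightarrow> real) \<Rightarrow> real \<Rightarrow> 'a \<Rightarrow> real" where
  "W_f tau L B \<beta> f t \<omega> =
     (\<Sum>u\<in>bbm_alive (\<lambda>v. tau v \<omega>) (\<lambda>v. L v \<omega>) t.
        exp (\<beta> * bbm_pos (\<lambda>v. tau v \<omega>) (\<lambda>v. B v \<omega>) u t - c_beta \<beta> * t) *
        f ((bbm_pos (\<lambda>v. tau v \<omega>) (\<lambda>v. B v \<omega>) u t - \<beta> * t) / sqrt t))"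

end

theory Submission
  imports Defs
begin

text \<open>
  Write a particle \<open>u\<close> born at time \<open>s\<close> with weight \<open>A = exp (\<beta> X - c s)\<close>, and let \<open>F\<close> be the mean
  that \<open>u\<close> and its progeny contribute to \<open>W\<^sub>t(f)\<close>, divided by \<open>A\<close>. By Girsanov, \<open>F\<close> is a Gaussian
  average of \<open>f\<close>. If each particle contributes \<open>A\<close> times (what it contributes itself, plus the value of \<open>F\<close>
  passed on to its children at its death, minus its own \<open>F\<close>), the sum over the tree telescopes to
  \<open>W\<^sub>t(f)\<close> minus its mean. Given the strict ancestors of \<open>u\<close>, this contribution has mean zero. Adding
  labels in order of length and using a two-point inequality for \<open>|x + y|\<^sup>p\<close>, the \<open>p\<close>-th moment of such a
  sum is at most a constant times the sum of \<open>p\<close>-th moments, and this is finite since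
  \<open>p c(\<beta>) > c(p \<beta>)\<close> for \<open>1 < p < 2 / \<beta>\<^sup>2\<close>. No filtration and no Markov property at fixed times is needed,
  only that the data of \<open>u\<close> is independent of the data of all other labels.

  For \<open>f = 1\<close> this gives exponentially small increments of \<open>W\<^sub>t\<close> in \<open>L\<^sup>p\<close>. For a Lipschitz \<open>f\<close> of Gaussian
  mean zero and \<open>t = j \<delta>\<close>, one telescopes only from generation \<open>n \<approx> log j\<close> on: the tail is summable in \<open>j\<close>,
  and on generation \<open>n\<close> one has \<open>F = O((|X - \<beta> s| + s) / \<surd>t)\<close>. Between grid points, the total oscillation
  of the particles is compared in the same way with a small multiple of \<open>W\<close> at the end of the cell; a child
  born inside the cell is charged to its parent. General \<open>f\<close> follow by approximation, and the \<open>L\<^sup>p\<close>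
  statement by dominated convergence.
\<close>

text \<open>For p = 1 the expected total weight of a generation is exactly 1, so first moments give
  no decay. Every limit below rests on some p > 1 for which p-th powers of the weights lose a factor
  \<open>\<rho>\<close> < 1 per generation; \<beta> < \<surd>2 guarantees such a p, and the almost
  sure statement uses it as well. The logarithmic generation is a trade-off. The tail from
  generation n on has p-th moment of order \<rho>^n, which must be summable in j. The terms on
  generation n cost R^(-n) / \<surd>t, where R < 1 absorbs the growth of exponential moments over
  the generations and may be taken as close to 1 as desired. A large multiple of log j therefore
  serves the tail, while R^(-n) remains a small power of j. Between grid points the obstacle is a
  supremum over time of a sum over a random tree. It is moved inside the sum: the oscillation of
  each single path is bounded by chaining with fourth powers. Its weighted mean over a cell of
  length \<delta> is of order \<surd>\<delta>, hence only a small multiple of the total mass, and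
  what is left is a centred tree sum with exponentially small moments.\<close>

section \<open>Power inequalities\<close>

lemma powr_one_plus_le:
  fixes a z :: real
  assumes "0 \<le> a" "a \<le> 1" "-1 < z"
  shows "(1 + z) powr a \<le> 1 + a * z"
proof -
  \<comment> \<open>Bernoulli's inequality with an exponent in [0, 1] is convexity of exp between ln
    (1 + z) and 0.\<close>
  have "exp (a * ln (1 + z) + (1 - a) * 0) \<le> a * exp (ln (1 + z)) + (1 - a) * exp 0"
    using convex_onD[OF exp_convex, of "1 - a" "ln (1+z)" 0] assms by (simp add: algebra_simps)
  then show ?thesis using assms by (simp add: powr_def algebra_simps)
qed

text \<open>For |z| \<le> 1, split off one factor 1 + z and apply Bernoulli to the exponent p - 1;
  the error (p - 1) z^2 is at most |z|^p because p \<le> 2. For |z| > 1, the left side is at most 4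
  |z|^p, and a negative linear term costs at most another 2 |z|^p, which explains the 6.\<close>

lemma abs_one_plus_powr_le:
  fixes p z :: real
  assumes p: "1 \<le> p" "p \<le> 2"
  shows "\<bar>1 + z\<bar> powr p \<le> 1 + p * z + 6 * \<bar>z\<bar> powr p"
proof (cases "\<bar>z\<bar> \<le> 1")
  case True
  show ?thesis
  proof (cases "z = -1")
    case True
    then show ?thesis using p by simp
  next
    case False
    with True have z: "-1 < z" by linarith
    have "\<bar>1 + z\<bar> powr p = (1 + z) * (1 + z) powr (p - 1)"
      using z powr_add[of "1+z" 1 "p - 1"] by simp
    also have "\<dots> \<le> (1 + z) * (1 + (p - 1) * z)"
      using powr_one_plus_le[of "p - 1" z] z p by (intro mult_left_mono) auto
    also have "\<dots> = 1 + p * z + (p - 1) * z\<^sup>2" by (simp add: algebra_simps power2_eq_square)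
    also have "(p - 1) * z\<^sup>2 \<le> 1 * \<bar>z\<bar> powr 2"
      using p by (intro mult_mono) (auto simp: powr_numeral)
    also have "\<bar>z\<bar> powr 2 \<le> \<bar>z\<bar> powr p" using True p by (intro powr_mono') auto
    also have "\<dots> \<le> 6 * \<bar>z\<bar> powr p" by simp
    finally show ?thesis by simp
  qed
next
  case False
  have "\<bar>1 + z\<bar> powr p \<le> (2 * \<bar>z\<bar>) powr p" using False p by (intro powr_mono2) auto
  also have "\<dots> = 2 powr p * \<bar>z\<bar> powr p" by (simp add: powr_mult)
  also have "2 powr p \<le> 2 powr (2::real)" using p by (intro powr_mono) auto
  finally have 1: "\<bar>1 + z\<bar> powr p \<le> 4 * \<bar>z\<bar> powr p" by (simp add: mult_right_mono)
  have "\<bar>z\<bar> powr 1 \<le> \<bar>z\<bar> powr p" using False p by (intro powr_mono) auto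
  then have 2: "\<bar>z\<bar> \<le> \<bar>z\<bar> powr p" by simp
  have "- (p * z) \<le> p * \<bar>z\<bar>" using p mult_left_mono[of "-z" "\<bar>z\<bar>" p] by simp
  also have "\<dots> \<le> 2 * \<bar>z\<bar> powr p" using 2 p by (intro mult_mono) auto
  finally show ?thesis using 1 by linarith
qed

text \<open>Homogeneity: apply the previous inequality to z = y / x. The point is that the
  coefficient of y depends on x alone, so the middle term disappears in the mean when y is centred
  given x.\<close>

lemma abs_add_powr_le:
  fixes p x y :: real
  assumes p: "1 \<le> p" "p \<le> 2"
  shows "\<bar>x + y\<bar> powr p \<le> \<bar>x\<bar> powr p + p * (sgn x * \<bar>x\<bar> powr (p - 1)) * y + 6 * \<bar>y\<bar> powr p"
proof (cases "x = 0")
  case True then show ?thesis by simp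
next
  case False
  have eq: "\<bar>x + y\<bar> powr p = \<bar>x\<bar> powr p * \<bar>1 + y / x\<bar> powr p"
    using False by (simp add: powr_mult[symmetric] abs_mult[symmetric] distrib_left)
  have yx: "\<bar>y\<bar> powr p = \<bar>x\<bar> powr p * \<bar>y / x\<bar> powr p"
    using False by (simp add: powr_mult[symmetric] abs_mult[symmetric] del: abs_divide)
  have "\<bar>x\<bar> powr p = \<bar>x\<bar> powr (p - 1) * \<bar>x\<bar>" using False powr_add[of "\<bar>x\<bar>" "p - 1" 1] by simp
  then have lin: "(sgn x * \<bar>x\<bar> powr (p - 1)) * y = \<bar>x\<bar> powr p * (y / x)"
    using False by (auto simp: sgn_if abs_if field_simps)
  have "\<bar>x + y\<bar> powr p \<le> \<bar>x\<bar> powr p * (1 + p * (y / x) + 6 * \<bar>y / x\<bar> powr p)"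
    unfolding eq using abs_one_plus_powr_le[OF p, of "y / x"] by (intro mult_left_mono) auto
  also have "\<dots> = \<bar>x\<bar> powr p + p * ((sgn x * \<bar>x\<bar> powr (p - 1)) * y) + 6 * \<bar>y\<bar> powr p"
    unfolding lin yx by (simp add: algebra_simps)
  finally show ?thesis by (simp add: mult.assoc)
qed

lemma abs_add_powr_le_4:
  fixes p x y :: real
  assumes p: "1 \<le> p" "p \<le> 2"
  shows "\<bar>x + y\<bar> powr p \<le> 4 * (\<bar>x\<bar> powr p + \<bar>y\<bar> powr p)"
proof -
  have "\<bar>x + y\<bar> powr p \<le> (2 * max \<bar>x\<bar> \<bar>y\<bar>) powr p" using p by (intro powr_mono2) auto
  also have "\<dots> = 2 powr p * max \<bar>x\<bar> \<bar>y\<bar> powr p" by (simp add: powr_mult)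
  also have "\<dots> \<le> 2 powr (2::real) * (\<bar>x\<bar> powr p + \<bar>y\<bar> powr p)"
    using p by (intro mult_mono powr_mono) (auto simp: max_def)
  finally show ?thesis by simp
qed

text \<open>Above the threshold e one has |x| \<le> |x| (|x| / e)^(p - 1). With e at the right scale
  this turns p-th moments into first moments.\<close>

lemma abs_le_plus_powr:
  fixes x e p :: real
  assumes "0 < e" "1 \<le> p"
  shows "\<bar>x\<bar> \<le> e + e powr (1 - p) * \<bar>x\<bar> powr p"
proof (cases "\<bar>x\<bar> \<le> e")
  case True
  then show ?thesis using assms by (simp add: add_increasing2)
next
  case False
  then have x: "0 < \<bar>x\<bar>" "e < \<bar>x\<bar>" using assms by auto
  have "e powr (1 - p) * \<bar>x\<bar> powr p = (\<bar>x\<bar> / e) powr (p - 1) * \<bar>x\<bar>"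
    using assms x powr_add[of "\<bar>x\<bar>" "p - 1" 1] by (simp add: powr_divide powr_diff field_simps)
  moreover have "1 \<le> (\<bar>x\<bar> / e) powr (p - 1)" using assms x by (intro ge_one_powr_ge_zero) auto
  then have "1 * \<bar>x\<bar> \<le> (\<bar>x\<bar> / e) powr (p - 1) * \<bar>x\<bar>" by (intro mult_right_mono) auto
  ultimately show ?thesis using assms by linarith
qed

section \<open>Dyadic chaining\<close>

text \<open>The sum of fourth powers dominates the largest increment at level m and, unlike a
  maximum, can be integrated term by term.\<close>

definition dyadic_incr :: "(real \<Rightarrow> real) \<Rightarrow> nat \<Rightarrow> real" where
  "dyadic_incr z m = (\<Sum>k<2^m. \<bar>z (real (Suc k) / 2^m) - z (real k / 2^m)\<bar> ^ 4)"

text \<open>A point k / 2^m with k even already belongs to level m - 1; with k odd it is one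
  increment of level m away from such a point.\<close>

lemma dyadic_telescope:
  assumes "k \<le> 2^m"
  shows "\<bar>z (real k / 2^m) - z 0\<bar> \<le> (\<Sum>i\<le>m. root 4 (dyadic_incr z i))"
  using assms
proof (induction m arbitrary: k)
  have incr: "\<bar>z (real (Suc k) / 2^m) - z (real k / 2^m)\<bar> \<le> root 4 (dyadic_incr z m)" if "k < 2^m" for k m
  proof -
    have "\<bar>z (real (Suc k) / 2^m) - z (real k / 2^m)\<bar> ^ 4 \<le> dyadic_incr z m"
      unfolding dyadic_incr_def using that by (intro member_le_sum) auto
    then show ?thesis by (metis abs_ge_zero real_root_le_mono real_root_power_cancel zero_less_numeral)
  qed
  {
    case 0
    then have "k = 0 \<or> k = 1" by auto
    then show ?case
    proof
      assume "k = 0" then show ?thesis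
        by (auto simp: dyadic_incr_def intro!: real_root_ge_zero)
    next
      assume "k = 1" then show ?thesis using incr[of 0 0] by simp
    qed
  next
    case (Suc m)
    have nn: "0 \<le> root 4 (dyadic_incr z (Suc m))"
      by (auto simp: dyadic_incr_def intro!: real_root_ge_zero sum_nonneg)
    have half: "\<bar>z (real (2 * l) / 2 ^ Suc m) - z 0\<bar> \<le> (\<Sum>i\<le>m. root 4 (dyadic_incr z i))"
      if "2 * l \<le> 2 ^ Suc m" for l
      using Suc.IH[of l] that by simp
    show ?case
    proof (cases "even k")
      case True
      then obtain l where "k = 2 * l" by blast
      then have "\<bar>z (real k / 2^Suc m) - z 0\<bar> \<le> (\<Sum>i\<le>m. root 4 (dyadic_incr z i))"
        using half[of l] Suc.prems by blast
      then show ?thesis using nn unfolding sum.atMost_Suc by linarith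
    next
      case False
      then obtain l where k: "k = Suc (2 * l)" by (auto elim: oddE)
      have "\<bar>z (real k / 2^Suc m) - z 0\<bar> \<le> \<bar>z (real (Suc (2*l)) / 2^Suc m) - z (real (2*l) / 2^Suc m)\<bar>
          + \<bar>z (real (2*l) / 2^Suc m) - z 0\<bar>" unfolding k by linarith
      also have "\<dots> \<le> root 4 (dyadic_incr z (Suc m)) + (\<Sum>i\<le>m. root 4 (dyadic_incr z i))"
        using half[of l] incr[of "2*l" "Suc m"] Suc.prems k by (intro add_mono) auto
      finally show ?thesis by simp
    qed
  }
qed

text \<open>If X is the weighted sum, the fourth root at level i is at most (9/10)^i times the
  fourth root of X; the geometric series adds up to at most 10, and 10000 = 10^4. The weight has to
  grow more slowly than 2^i, since for Brownian increments level i has expected size 2^(-i): indeed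
  (10/9)^4 < 2.\<close>

lemma dyadic_chaining:
  assumes "k \<le> 2^m"
  shows "ennreal (\<bar>z (real k / 2^m) - z 0\<bar> ^ 4)
     \<le> 10000 * (\<Sum>i. ennreal ((10/9) ^ (4*i) * dyadic_incr z i))" (is "_ \<le> _ * ?X")
proof (cases "?X = \<infinity>")
  case True
  then show ?thesis by (simp add: ennreal_mult_eq_top_iff top.extremum_unique)
next
  case False
  then obtain X where X: "0 \<le> X" "?X = ennreal X" by (cases ?X) auto
  have d0: "0 \<le> dyadic_incr z i" for i by (auto simp: dyadic_incr_def intro!: sum_nonneg)
  have r: "root 4 (dyadic_incr z i) \<le> root 4 X * (9/10)^i" for i
  proof -
    have "(\<Sum>j\<in>{i}. ennreal ((10/9) ^ (4*j) * dyadic_incr z j)) \<le> ?X"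
      by (intro sum_le_suminf) auto
    then have "(10/9) ^ (4*i) * dyadic_incr z i \<le> X" using X d0 by (simp add: ennreal_le_iff)
    then have "root 4 ((10/9) ^ (4*i) * dyadic_incr z i) \<le> root 4 X" by (intro real_root_le_mono) auto
    also have "root 4 ((10/9) ^ (4*i) * dyadic_incr z i) = (10/9)^i * root 4 (dyadic_incr z i)"
    proof -
      have "root 4 ((10/9) ^ (4*i) :: real) = root 4 (((10/9)^i)^4)" by (simp add: power_mult[symmetric] mult.commute)
      also have "\<dots> = (10/9)^i" by (intro real_root_power_cancel) auto
      finally show ?thesis by (simp add: real_root_mult)
    qed
    finally have "(9/10)^i * ((10/9)^i * root 4 (dyadic_incr z i)) \<le> (9/10)^i * root 4 X"
      by (intro mult_left_mono) auto
    moreover have "(9/10)^i * ((10/9)^i * v) = v" for v :: real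
      by (simp add: mult.assoc[symmetric] power_mult_distrib[symmetric])
    ultimately show ?thesis by (metis mult.commute)
  qed
  have "\<bar>z (real k / 2^m) - z 0\<bar> \<le> (\<Sum>i\<le>m. root 4 X * (9/10)^i)"
    using dyadic_telescope[OF assms, of z] r by (meson order_trans sum_mono)
  also have "\<dots> = root 4 X * (\<Sum>i\<le>m. (9/10)^i)" by (simp add: sum_distrib_left)
  also have "(\<Sum>i\<le>m. (9/10::real)^i) = (1 - (9/10)^Suc m) / (1/10)"
    by (subst sum_gp0) simp
  also have "root 4 X * \<dots> \<le> root 4 X * 10"
    using X by (intro mult_left_mono) auto
  finally have "\<bar>z (real k / 2^m) - z 0\<bar> ^ 4 \<le> (root 4 X * 10) ^ 4" by (intro power_mono) auto
  also have "\<dots> = 10000 * X" using X by (simp add: power_mult_distrib)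
  finally have "ennreal (\<bar>z (real k / 2^m) - z 0\<bar> ^ 4) \<le> ennreal (10000 * X)" by (intro ennreal_leI)
  also have "\<dots> = 10000 * ennreal X" using X by (simp add: ennreal_mult)
  finally show ?thesis unfolding X(2) .
qed

section \<open>The Gaussian semigroup\<close>

text \<open>The integral of H against the centred normal law of variance q. Scaling a standard
  normal, instead of using the density of variance q, makes q = 0 the evaluation at 0.\<close>

definition gauss :: "real \<Rightarrow> (real \<Rightarrow> ennreal) \<Rightarrow> ennreal" where
  "gauss q H = (\<integral>\<^sup>+z. ennreal (std_normal_density z) * H (sqrt q * z) \<partial>lborel)"

lemma gauss_0 [simp]: "gauss 0 H = H 0"
proof -
  have "(\<integral>\<^sup>+z. ennreal (std_normal_density z) \<partial>lborel) = 1"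
    using prob_space.emeasure_space_1[OF prob_space_normal_density[of 1 0]]
    by (simp add: emeasure_density)
  then show ?thesis by (simp add: gauss_def nn_integral_multc)
qed

lemma gauss_cmult: "H \<in> borel_measurable borel \<Longrightarrow> gauss q (\<lambda>x. c * H x) = c * gauss q H"
  unfolding gauss_def by (subst nn_integral_cmult[symmetric]) (auto simp: ac_simps)

lemma gauss_const [simp]: "gauss q (\<lambda>x. c) = c"
  using gauss_0[of "\<lambda>_. c"] unfolding gauss_def .

lemma gauss_add: "H \<in> borel_measurable borel \<Longrightarrow> H' \<in> borel_measurable borel \<Longrightarrow>
   gauss q (\<lambda>x. H x + H' x) = gauss q H + gauss q H'"
  unfolding gauss_def by (subst nn_integral_add[symmetric]) (auto simp: distrib_left)

lemma measurable_gauss [measurable (raw)]: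
  assumes [measurable]: "q \<in> borel_measurable N" "(\<lambda>(x, y). H x y) \<in> borel_measurable (N \<Otimes>\<^sub>M borel)"
  shows "(\<lambda>x. gauss (q x) (H x)) \<in> borel_measurable N"
  unfolding gauss_def by measurable

lemma gauss_normal_density:
  assumes [measurable]: "H \<in> borel_measurable borel" and q: "0 < q"
  shows "gauss q H = (\<integral>\<^sup>+x. ennreal (normal_density 0 (sqrt q) x) * H x \<partial>lborel)"
proof -
  have "(\<integral>\<^sup>+x. ennreal (normal_density 0 (sqrt q) x) * H x \<partial>lborel) =
     ennreal (sqrt q) * (\<integral>\<^sup>+z. ennreal (normal_density 0 (sqrt q) (0 + sqrt q * z)) * H (0 + sqrt q * z) \<partial>lborel)"
    using q by (subst nn_integral_real_affine[where c="sqrt q" and t=0]) auto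
  also have "\<dots> = (\<integral>\<^sup>+z. ennreal (sqrt q) * (ennreal (normal_density 0 (sqrt q) (sqrt q * z)) * H (sqrt q * z)) \<partial>lborel)"
    by (subst nn_integral_cmult) auto
  also have "\<dots> = gauss q H"
    unfolding gauss_def
  proof (intro nn_integral_cong)
    fix z :: real
    have "sqrt q * normal_density 0 (sqrt q) (sqrt q * z) = std_normal_density z"
      using q by (simp add: normal_density_def real_sqrt_mult power_mult_distrib)
    then show "ennreal (sqrt q) * (ennreal (normal_density 0 (sqrt q) (sqrt q * z)) * H (sqrt q * z))
       = ennreal (std_normal_density z) * H (sqrt q * z)"
      using q by (simp add: mult.assoc[symmetric] ennreal_mult[symmetric])
  qed
  finally show ?thesis ..
qed

text \<open>Completing the square: the one-time form of Girsanov's theorem.\<close>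

lemma gauss_exp_tilt:
  assumes [measurable]: "H \<in> borel_measurable borel" and q: "0 \<le> q"
  shows "gauss q (\<lambda>x. ennreal (exp (l * x)) * H x) = ennreal (exp (l\<^sup>2 * q / 2)) * gauss q (\<lambda>x. H (x + l * q))"
proof -
  have "gauss q (\<lambda>x. ennreal (exp (l * x)) * H x) =
     (\<integral>\<^sup>+z. ennreal (exp (l\<^sup>2 * q / 2)) * (ennreal (std_normal_density (z - l * sqrt q)) * H (sqrt q * z)) \<partial>lborel)"
    unfolding gauss_def
  proof (intro nn_integral_cong)
    fix z :: real
    have "- z\<^sup>2 / 2 + l * (sqrt q * z) = l\<^sup>2 * q / 2 + - (z - l * sqrt q)\<^sup>2 / 2"
      using q by (simp add: power2_diff power_mult_distrib field_simps)
    then have "exp (- z\<^sup>2 / 2) * exp (l * (sqrt q * z)) = exp (l\<^sup>2 * q / 2) * exp (- (z - l * sqrt q)\<^sup>2 / 2)"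
      by (metis exp_add)
    then have "std_normal_density z * exp (l * (sqrt q * z)) = exp (l\<^sup>2 * q / 2) * std_normal_density (z - l * sqrt q)"
      by (simp add: normal_density_def field_simps)
    then show "ennreal (std_normal_density z) * (ennreal (exp (l * (sqrt q * z))) * H (sqrt q * z)) =
       ennreal (exp (l\<^sup>2 * q / 2)) * (ennreal (std_normal_density (z - l * sqrt q)) * H (sqrt q * z))"
      by (simp add: mult.assoc[symmetric] ennreal_mult[symmetric])
  qed
  also have "\<dots> = ennreal (exp (l\<^sup>2 * q / 2)) * (\<integral>\<^sup>+z. ennreal (std_normal_density (z - l * sqrt q)) * H (sqrt q * z) \<partial>lborel)"
    by (subst nn_integral_cmult) auto
  also have "(\<integral>\<^sup>+z. ennreal (std_normal_density (z - l * sqrt q)) * H (sqrt q * z) \<partial>lborel) =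
     (\<integral>\<^sup>+z. ennreal (std_normal_density z) * H (sqrt q * (l * sqrt q + z)) \<partial>lborel)"
    by (subst nn_integral_real_affine[where c=1 and t="l * sqrt q"]) (auto simp: algebra_simps)
  also have "\<dots> = gauss q (\<lambda>x. H (x + l * q))"
  proof -
    have "sqrt q * (l * sqrt q + z) = sqrt q * z + l * q" for z using q by (simp add: algebra_simps)
    then show ?thesis unfolding gauss_def by simp
  qed
  finally show ?thesis .
qed

lemma gauss_exp: "0 \<le> q \<Longrightarrow> gauss q (\<lambda>x. ennreal (exp (l * x))) = ennreal (exp (l\<^sup>2 * q / 2))"
  using gauss_exp_tilt[of "\<lambda>_. 1" q l] by simp

lemma gauss_semigroup:
  assumes [measurable]: "H \<in> borel_measurable borel" and q: "0 \<le> q" "0 \<le> q'"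
  shows "gauss q (\<lambda>x. gauss q' (\<lambda>x'. H (x + x'))) = gauss (q + q') H"
proof (cases "q = 0 \<or> q' = 0")
  case True then show ?thesis by auto
next
  case False
  with q have q: "0 < q" "0 < q'" by auto
  have "gauss q (\<lambda>x. gauss q' (\<lambda>x'. H (x + x'))) =
    (\<integral>\<^sup>+x. ennreal (normal_density 0 (sqrt q) x) * (\<integral>\<^sup>+x'. ennreal (normal_density 0 (sqrt q') x') * H (x + x') \<partial>lborel) \<partial>lborel)"
    using q by (simp add: gauss_normal_density)
  also have "\<dots> = (\<integral>\<^sup>+x. \<integral>\<^sup>+v. ennreal (normal_density 0 (sqrt q) x) * ennreal (normal_density 0 (sqrt q') (v - x)) * H v \<partial>lborel \<partial>lborel)"
  proof (intro nn_integral_cong)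
    fix x :: real
    have "(\<integral>\<^sup>+x'. ennreal (normal_density 0 (sqrt q') x') * H (x + x') \<partial>lborel) =
      (\<integral>\<^sup>+v. ennreal (normal_density 0 (sqrt q') (v - x)) * H v \<partial>lborel)"
      by (subst nn_integral_real_affine[where c=1 and t="-x"]) (auto simp: algebra_simps)
    then show "ennreal (normal_density 0 (sqrt q) x) * (\<integral>\<^sup>+x'. ennreal (normal_density 0 (sqrt q') x') * H (x + x') \<partial>lborel)
      = (\<integral>\<^sup>+v. ennreal (normal_density 0 (sqrt q) x) * ennreal (normal_density 0 (sqrt q') (v - x)) * H v \<partial>lborel)"
      by (simp only: mult.assoc) (subst nn_integral_cmult, auto)
  qed
  also have "\<dots> = (\<integral>\<^sup>+v. \<integral>\<^sup>+x. ennreal (normal_density 0 (sqrt q) x) * ennreal (normal_density 0 (sqrt q') (v - x)) * H v \<partial>lborel \<partial>lborel)"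
    by (subst lborel_pair.Fubini') auto
  also have "\<dots> = (\<integral>\<^sup>+v. ennreal (normal_density 0 (sqrt (q + q')) v) * H v \<partial>lborel)"
  proof (intro nn_integral_cong)
    fix v :: real
    have "(\<integral>\<^sup>+x. ennreal (normal_density 0 (sqrt q) x) * ennreal (normal_density 0 (sqrt q') (v - x)) * H v \<partial>lborel)
      = (\<integral>\<^sup>+x. ennreal (normal_density 0 (sqrt q') (v - x) * normal_density 0 (sqrt q) x) \<partial>lborel) * H v"
      by (subst nn_integral_multc[symmetric]) (auto simp: ennreal_mult ac_simps)
    also have "(\<integral>\<^sup>+x. ennreal (normal_density 0 (sqrt q') (v - x) * normal_density 0 (sqrt q) x) \<partial>lborel)
      = ennreal (normal_density 0 (sqrt ((sqrt q')\<^sup>2 + (sqrt q)\<^sup>2)) v)"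
      using fun_cong[OF conv_normal_density_zero_mean[of "sqrt q'" "sqrt q"]] q by simp
    finally show "(\<integral>\<^sup>+x. ennreal (normal_density 0 (sqrt q) x) * ennreal (normal_density 0 (sqrt q') (v - x)) * H v \<partial>lborel)
      = ennreal (normal_density 0 (sqrt (q + q')) v) * H v" using q by (simp add: add.commute)
  qed
  also have "\<dots> = gauss (q + q') H" using q by (simp add: gauss_normal_density)
  finally show ?thesis .
qed

text \<open>With q = exp (b^2 h / 2) the k-th exponential moment is q^(k^2), so the fourth moment
  equals q^16 - 4 q^9 + 6 q^4 - 4 q + 1. This polynomial has a double zero at q = 1, and q - 1 is of
  order h; this yields the factor h^2 needed for chaining.\<close>

lemma gauss_exp_minus_one_pow4_le:
  assumes h: "0 \<le> h" "h \<le> 1"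
  shows "gauss h (\<lambda>x. ennreal ((exp (b * x) - 1)^4)) \<le> ennreal (34 * exp (8 * b\<^sup>2) * b^4 * h\<^sup>2)"
proof -
  define q where "q = exp (b\<^sup>2 * h / 2)"
  have q1: "1 \<le> q" using h by (simp add: q_def)
  have e: "gauss h (\<lambda>x. ennreal (exp (real k * b * x))) = ennreal (q ^ (k*k))" for k
  proof -
    have "gauss h (\<lambda>x. ennreal (exp (real k * b * x))) = ennreal (exp (real (k*k) * (b\<^sup>2 * h / 2)))"
      using gauss_exp[OF h(1), of "real k * b"] by (simp add: power2_eq_square ac_simps)
    then show ?thesis by (simp only: q_def exp_of_nat_mult)
  qed
  \<comment> \<open>The two negative binomial terms are moved to the left, so that only nonnegative
    functions are integrated.\<close>
  have split: "ennreal ((exp (b*x) - 1)^4) + (4 * ennreal (exp (real 3 * b * x)) + 4 * ennreal (exp (real 1 * b * x)))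
    = ennreal (exp (real 4 * b * x)) + (6 * ennreal (exp (real 2 * b * x)) + 1)" for x
  proof -
    have "exp (real 4 * b * x) = exp (b*x)^4" "exp (real 3 * b * x) = exp (b*x)^3" "exp (real 2 * b * x) = exp (b*x)^2"
      by (simp_all add: exp_of_nat_mult[symmetric] mult.assoc)
    then have "(exp (b*x) - 1)^4 + (4 * exp (real 3 * b * x) + 4 * exp (real 1 * b * x))
        = exp (real 4 * b * x) + (6 * exp (real 2 * b * x) + 1)"
      by (simp add: algebra_simps power4_eq_xxxx power3_eq_cube power2_eq_square)
    moreover have "4 * ennreal v = ennreal (4 * v)" "6 * ennreal v = ennreal (6 * v)" if "v \<ge> 0" for v
      using that by (simp_all add: ennreal_mult)
    ultimately have "ennreal ((exp (b*x) - 1)^4) + ennreal (4 * exp (real 3 * b * x) + 4 * exp (real 1 * b * x))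
        = ennreal (exp (real 4 * b * x)) + ennreal (6 * exp (real 2 * b * x) + 1)"
      by (subst (1 2) ennreal_plus[symmetric]) auto
    then show ?thesis by (simp add: ennreal_plus ennreal_mult)
  qed
  let ?G = "gauss h (\<lambda>x. ennreal ((exp (b * x) - 1)^4))"
  have "?G + (4 * ennreal (q^(3*3)) + 4 * ennreal (q^(1*1))) =
     gauss h (\<lambda>x. ennreal ((exp (b*x) - 1)^4) + (4 * ennreal (exp (real 3 * b * x)) + 4 * ennreal (exp (real 1 * b * x))))"
    unfolding e[symmetric] by (simp add: gauss_add gauss_cmult)
  also have "\<dots> = ennreal (q^(4*4)) + (6 * ennreal (q^(2*2)) + 1)"
    unfolding split e[symmetric] by (simp add: gauss_add gauss_cmult)
  finally have G: "?G + ennreal (4 * q^9 + 4 * q) = ennreal (q^16 + (6 * q^4 + 1))"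
    using q1 by (simp add: ennreal_plus ennreal_mult)
  have "q^16 + (6 * q^4 + 1) = (4 * q^9 + 4 * q) + (q - 1)^2 * (1 - 2*q - 5*q^2 - 8*q^3 - 5*q^4 - 2*q^5 + q^6 + 4*q^7 + 7*q^8 + 6*q^9 + 5*q^10 + 4*q^11+3*q^12+2*q^13+q^14)"
    by algebra
  also have "\<dots> \<le> (4 * q^9 + 4 * q) + (q - 1)^2 * (34 * q^14)"
  proof -
    \<comment> \<open>34 is the sum of the positive coefficients of the cofactor of (q - 1)^2, each
      of its powers being at most q^14.\<close>
    have "1 \<le> q^14" "q^6 \<le> q^14" "q^7 \<le> q^14" "q^8 \<le> q^14" "q^9 \<le> q^14" "q^10 \<le> q^14" "q^11 \<le> q^14" "q^12 \<le> q^14" "q^13 \<le> q^14"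
      using q1 by (auto intro!: power_increasing)
    moreover have "0 \<le> q" "0 \<le> q^2" "0 \<le> q^3" "0 \<le> q^4" "0 \<le> q^5" using q1 by auto
    ultimately have "1 - 2*q - 5*q^2 - 8*q^3 - 5*q^4 - 2*q^5 + q^6 + 4*q^7 + 7*q^8 + 6*q^9 + 5*q^10 + 4*q^11+3*q^12+2*q^13+q^14 \<le> 34 * q^14"
      by linarith
    then show ?thesis by (intro add_left_mono mult_left_mono) auto
  qed
  finally have "?G + ennreal (4 * q^9 + 4 * q) \<le> ennreal ((q - 1)^2 * (34 * q^14)) + ennreal (4 * q^9 + 4 * q)"
    unfolding G using q1 by (subst ennreal_plus[of "(q - 1)^2 * (34 * q^14)", symmetric]) (auto intro!: ennreal_leI simp del: ennreal_plus)
  then have "?G \<le> ennreal ((q - 1)^2 * (34 * q^14))"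
    by (subst (asm) add.commute, subst (asm) add.commute[of "ennreal ((q - 1)^2 * (34 * q^14))"])
       (simp add: ennreal_add_left_cancel_le)
  also have "\<dots> \<le> ennreal ((b\<^sup>2 * h * q)^2 * (34 * q^14))"
  proof (intro ennreal_leI mult_right_mono power_mono)
    have "1 + - (b\<^sup>2 * h / 2) \<le> exp (- (b\<^sup>2 * h / 2))" by (rule exp_ge_add_one_self)
    then have "(1 - b\<^sup>2 * h / 2) * q \<le> exp (- (b\<^sup>2 * h / 2)) * q" using q1 by (intro mult_right_mono) auto
    also have "\<dots> = 1" by (simp add: q_def exp_add[symmetric])
    finally have "q - 1 \<le> b\<^sup>2 * h / 2 * q" by (simp add: algebra_simps)
    also have "\<dots> \<le> b\<^sup>2 * h * q" using q1 h by (intro mult_right_mono) auto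
    finally show "q - 1 \<le> b\<^sup>2 * h * q" .
  qed (use q1 in auto)
  also have "(b\<^sup>2 * h * q)^2 * (34 * q^14) = 34 * q^16 * b^4 * h\<^sup>2"
    by (simp add: power_mult_distrib power_mult[symmetric] power_add[symmetric] mult.assoc mult.left_commute)
  also have "ennreal \<dots> \<le> ennreal (34 * exp (8 * b\<^sup>2) * b^4 * h\<^sup>2)"
  proof (intro ennreal_leI mult_right_mono mult_left_mono)
    have "q^16 = exp (8 * b\<^sup>2 * h)" by (simp add: q_def exp_of_nat_mult[symmetric])
    also have "\<dots> \<le> exp (8 * b\<^sup>2)" using h by (simp add: mult_left_le)
    finally show "q^16 \<le> exp (8 * b\<^sup>2)" .
  qed auto
  finally show ?thesis .
qed

section \<open>Brownian paths\<close>

lemma indep_rv2_distr: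
  assumes "prob_space M" and ind: "indep_rv2 M Ma X Mb Y"
  shows "distr M (Ma \<Otimes>\<^sub>M Mb) (\<lambda>w. (X w, Y w)) = distr M Ma X \<Otimes>\<^sub>M distr M Mb Y"
proof -
  interpret prob_space M by fact
  have X[measurable]: "X \<in> measurable M Ma" and Y[measurable]: "Y \<in> measurable M Mb"
    and ind: "indep_set (sets (vimage_algebra (space M) X Ma)) (sets (vimage_algebra (space M) Y Mb))"
    using ind by (auto simp: indep_rv2_def)
  interpret X: prob_space "distr M Ma X" by (rule prob_space_distr) fact
  interpret Y: prob_space "distr M Mb Y" by (rule prob_space_distr) fact
  show ?thesis
  proof (rule sym, rule pair_measure_eqI)
    show "sigma_finite_measure (distr M Ma X)" "sigma_finite_measure (distr M Mb Y)" by unfold_locales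
    fix A B assume A: "A \<in> sets (distr M Ma X)" and B: "B \<in> sets (distr M Mb Y)"
    have "prob ((X -` A \<inter> space M) \<inter> (Y -` B \<inter> space M)) = prob (X -` A \<inter> space M) * prob (Y -` B \<inter> space M)"
      using A B X Y by (intro indep_setD[OF ind] in_vimage_algebra) (auto dest: measurable_space)
    moreover have "(\<lambda>w. (X w, Y w)) -` (A \<times> B) \<inter> space M = (X -` A \<inter> space M) \<inter> (Y -` B \<inter> space M)" by auto
    ultimately show "emeasure (distr M Ma X) A * emeasure (distr M Mb Y) B =
       emeasure (distr M (Ma \<Otimes>\<^sub>M Mb) (\<lambda>w. (X w, Y w))) (A \<times> B)"
      using A B by (simp add: emeasure_distr emeasure_eq_measure ennreal_mult)
  qed (simp cong: sets_pair_measure_cong)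
qed

lemma indep_rv2_nn_integral:
  assumes "prob_space M" and ind: "indep_rv2 M Ma X Mb Y"
    and h[measurable]: "h \<in> borel_measurable (Ma \<Otimes>\<^sub>M Mb)"
  shows "(\<integral>\<^sup>+w. h (X w, Y w) \<partial>M) = (\<integral>\<^sup>+w. \<integral>\<^sup>+w'. h (X w, Y w') \<partial>M \<partial>M)"
proof -
  interpret prob_space M by fact
  have [measurable]: "X \<in> measurable M Ma" "Y \<in> measurable M Mb"
    using ind by (auto simp: indep_rv2_def)
  interpret Y: prob_space "distr M Mb Y" by (rule prob_space_distr) fact
  have "(\<integral>\<^sup>+w. h (X w, Y w) \<partial>M) = (\<integral>\<^sup>+z. h z \<partial>distr M (Ma \<Otimes>\<^sub>M Mb) (\<lambda>w. (X w, Y w)))"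
    by (subst nn_integral_distr) auto
  also have "\<dots> = (\<integral>\<^sup>+x. \<integral>\<^sup>+y. h (x, y) \<partial>distr M Mb Y \<partial>distr M Ma X)"
    unfolding indep_rv2_distr[OF assms(1,2)] by (subst Y.nn_integral_fst[symmetric]) auto
  also have "\<dots> = (\<integral>\<^sup>+x. \<integral>\<^sup>+w'. h (x, Y w') \<partial>M \<partial>distr M Ma X)"
    by (intro nn_integral_cong, subst nn_integral_distr) auto
  also have "\<dots> = (\<integral>\<^sup>+w. \<integral>\<^sup>+w'. h (X w, Y w') \<partial>M \<partial>M)"
    by (subst nn_integral_distr) auto
  finally show ?thesis .
qed

text \<open>Evaluation of a path at a variable time is not measurable on the product space of paths;
  \<open>pev\<close> is, and it agrees with evaluation on continuous paths.\<close>

definition pev :: "(real \<Rightarrow> real) \<Rightarrow> real \<Rightarrow> real" where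
  "pev b q = lim (\<lambda>m. b (real_of_int \<lfloor>q * 2^m\<rfloor> / 2^m))"

lemma dyadic_floor_tendsto: "(\<lambda>m. real_of_int \<lfloor>q * 2^m\<rfloor> / 2^m) \<longlonglongrightarrow> q"
proof (rule real_tendsto_sandwich)
  show "\<forall>\<^sub>F m in sequentially. q - (1/2)^m \<le> real_of_int \<lfloor>q * 2^m\<rfloor> / 2^m"
  proof (intro always_eventually allI)
    fix m :: nat
    have "q * 2^m - 1 \<le> real_of_int \<lfloor>q * 2^m\<rfloor>" by linarith
    then have "(q * 2^m - 1) / 2^m \<le> real_of_int \<lfloor>q * 2^m\<rfloor> / 2^m" by (intro divide_right_mono) auto
    then show "q - (1/2)^m \<le> real_of_int \<lfloor>q * 2^m\<rfloor> / 2^m" by (simp add: diff_divide_distrib power_divide)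
  qed
  show "\<forall>\<^sub>F m in sequentially. real_of_int \<lfloor>q * 2^m\<rfloor> / 2^m \<le> q"
    by (intro always_eventually allI) (simp add: field_simps)
  have "(\<lambda>m. (1/2::real)^m) \<longlonglongrightarrow> 0" by (rule LIMSEQ_power_zero) auto
  then show "(\<lambda>m. q - (1/2::real)^m) \<longlonglongrightarrow> q" using tendsto_diff[OF tendsto_const[of q]] by fastforce
qed simp

lemma pev_continuous:
  assumes "continuous_on UNIV b"
  shows "pev b q = b q"
proof -
  have "isCont b q" using assms by (simp add: continuous_on_eq_continuous_at)
  then have "(\<lambda>m. b (real_of_int \<lfloor>q * 2^m\<rfloor> / 2^m)) \<longlonglongrightarrow> b q"
    by (rule isCont_tendsto_compose[OF _ dyadic_floor_tendsto])
  then show ?thesis unfolding pev_def by (rule limI)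
qed

lemma measurable_pev [measurable (raw)]:
  assumes b[measurable]: "b \<in> measurable N (\<Pi>\<^sub>M s\<in>(UNIV::real set). (borel :: real measure))"
    and q[measurable]: "q \<in> borel_measurable N"
  shows "(\<lambda>x. pev (b x) (q x)) \<in> borel_measurable N"
proof -
  have "(\<lambda>x. b x (real_of_int \<lfloor>q x * 2^m\<rfloor> / 2^m)) \<in> borel_measurable N" for m
    by (rule measurable_compose_countable[where f="\<lambda>i x. b x (real_of_int i / 2^m)"]) auto
  then show ?thesis unfolding pev_def by (rule borel_measurable_lim_metric)
qed

lemma bm_increments_nn_integral:
  assumes "prob_space M" and bm: "std_brownian_motion M B"
    and ts: "0 \<le> ts 0" "\<And>i. i < n \<Longrightarrow> ts i < ts (Suc i)"
    and H: "\<And>i. i < n \<Longrightarrow> H i \<in> borel_measurable borel"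
  shows "(\<integral>\<^sup>+w. (\<Prod>i<n. H i (B w (ts (Suc i)) - B w (ts i))) \<partial>M) = (\<Prod>i<n. gauss (ts (Suc i) - ts i) (H i))"
proof -
  interpret prob_space M by fact
  have ind: "indep_vars (\<lambda>_. borel) (\<lambda>i w. B w (ts (Suc i)) - B w (ts i)) {..<n}"
    and dis: "\<And>i. i < n \<Longrightarrow> distributed M lborel (\<lambda>w. B w (ts (Suc i)) - B w (ts i)) (normal_density 0 (sqrt (ts (Suc i) - ts i)))"
    using bm[unfolded std_brownian_motion_def, THEN conjunct2, THEN conjunct2, rule_format, of ts n] ts by blast+
  have "(\<integral>\<^sup>+w. (\<Prod>i<n. H i (B w (ts (Suc i)) - B w (ts i))) \<partial>M) =
    (\<Prod>i<n. (\<integral>\<^sup>+w. H i (B w (ts (Suc i)) - B w (ts i)) \<partial>M))"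
    using H by (intro indep_vars_nn_integral indep_vars_compose2[OF ind]) auto
  also have "\<dots> = (\<Prod>i<n. gauss (ts (Suc i) - ts i) (H i))"
  proof (intro prod.cong refl)
    fix i assume i: "i \<in> {..<n}"
    then have [measurable]: "H i \<in> borel_measurable borel" using H by auto
    have "(\<integral>\<^sup>+w. H i (B w (ts (Suc i)) - B w (ts i)) \<partial>M) =
      (\<integral>\<^sup>+x. ennreal (normal_density 0 (sqrt (ts (Suc i) - ts i)) x) * H i x \<partial>lborel)"
      using i by (intro distributed_nn_integral[symmetric] dis) auto
    also have "\<dots> = gauss (ts (Suc i) - ts i) (H i)"
      using i ts(2)[of i] by (subst gauss_normal_density) auto
    finally show "(\<integral>\<^sup>+w. H i (B w (ts (Suc i)) - B w (ts i)) \<partial>M) = gauss (ts (Suc i) - ts i) (H i)" .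
  qed
  finally show ?thesis .
qed

text \<open>The grids in the definition of Brownian motion are strictly increasing, whereas r or x
  may vanish here; each degenerate case drops an increment and uses that the path starts at
  0.\<close>

lemma bm_nn_integral3:
  assumes pM: "prob_space M" and bm: "std_brownian_motion M B"
    and q: "0 \<le> r" "0 \<le> x" "0 < h"
    and [measurable]: "H1 \<in> borel_measurable borel" "H2 \<in> borel_measurable borel" "H3 \<in> borel_measurable borel"
  shows "(\<integral>\<^sup>+w. H1 (B w r) * H2 (B w (r + x) - B w r) * H3 (B w (r + x + h) - B w (r + x)) \<partial>M)
     = gauss r H1 * gauss x H2 * gauss h H3"
proof -
  interpret prob_space M by fact
  have B0: "B w 0 = 0" if "w \<in> space M" for w using bm that by (auto simp: std_brownian_motion_def)
  have inc1: "(\<integral>\<^sup>+w. G (B w (a + d) - B w a) \<partial>M) = gauss d G"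
    if [measurable]: "G \<in> borel_measurable borel" and "0 \<le> a" "0 < d" for G a d
    using bm_increments_nn_integral[OF pM bm, of "\<lambda>i. a + d * real i" 1 "\<lambda>_. G"] that by simp
  have inc2: "(\<integral>\<^sup>+w. G (B w (a + d) - B w a) * G' (B w (a + d + e) - B w (a + d)) \<partial>M) = gauss d G * gauss e G'"
    if "G \<in> borel_measurable borel" "G' \<in> borel_measurable borel" and "0 \<le> a" "0 < d" "0 < e" for G G' a d e
  proof -
    define ts where "ts = (\<lambda>i::nat. if i = 0 then a else if i = 1 then a + d else a + d + e)"
    define H where "H = (\<lambda>i::nat. if i = 0 then G else G')"
    have "(\<integral>\<^sup>+w. (\<Prod>i<2. H i (B w (ts (Suc i)) - B w (ts i))) \<partial>M) = (\<Prod>i<2. gauss (ts (Suc i) - ts i) (H i))"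
      by (rule bm_increments_nn_integral[OF pM bm]) (use that in \<open>auto simp: ts_def H_def\<close>)
    then show ?thesis by (simp add: ts_def H_def lessThan_Suc numeral_2_eq_2 mult.commute)
  qed
  have inc3: "(\<integral>\<^sup>+w. H1 (B w (0 + r) - B w 0) * H2 (B w (r + x) - B w r) * H3 (B w (r + x + h) - B w (r + x)) \<partial>M)
     = gauss r H1 * gauss x H2 * gauss h H3" if "0 < r" "0 < x"
  proof -
    define ts where "ts = (\<lambda>i::nat. if i = 0 then 0 else if i = 1 then r else if i = 2 then r + x else r + x + h)"
    define H where "H = (\<lambda>i::nat. if i = 0 then H1 else if i = 1 then H2 else H3)"
    have "(\<integral>\<^sup>+w. (\<Prod>i<3. H i (B w (ts (Suc i)) - B w (ts i))) \<partial>M) = (\<Prod>i<3. gauss (ts (Suc i) - ts i) (H i))"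
      by (rule bm_increments_nn_integral[OF pM bm]) (use that q in \<open>auto simp: ts_def H_def\<close>)
    then show ?thesis by (simp add: ts_def H_def lessThan_Suc numeral_3_eq_3 numeral_2_eq_2 ac_simps)
  qed
  consider "r = 0" "x = 0" | "r = 0" "0 < x" | "0 < r" "x = 0" | "0 < r" "0 < x" using q by linarith
  then show ?thesis
  proof cases
    case 1
    have "(\<integral>\<^sup>+w. H1 (B w r) * H2 (B w (r + x) - B w r) * H3 (B w (r + x + h) - B w (r + x)) \<partial>M)
      = (\<integral>\<^sup>+w. (H1 0 * H2 0) * H3 (B w (0 + h) - B w 0) \<partial>M)"
      using 1 B0 by (intro nn_integral_cong) auto
    also have "\<dots> = H1 0 * H2 0 * gauss h H3"
      using inc1[of "\<lambda>y. (H1 0 * H2 0) * H3 y" 0 h] q by (simp add: gauss_cmult)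
    finally show ?thesis using 1 by simp
  next
    case 2
    have "(\<integral>\<^sup>+w. H1 (B w r) * H2 (B w (r + x) - B w r) * H3 (B w (r + x + h) - B w (r + x)) \<partial>M)
      = (\<integral>\<^sup>+w. (H1 0 * H2 (B w (0 + x) - B w 0)) * H3 (B w (0 + x + h) - B w (0 + x)) \<partial>M)"
      using 2 B0 by (intro nn_integral_cong) auto
    also have "\<dots> = H1 0 * gauss x H2 * gauss h H3"
      using inc2[of "\<lambda>y. H1 0 * H2 y" H3 0 x h] q 2 by (simp add: gauss_cmult)
    finally show ?thesis using 2 by simp
  next
    case 3
    have "(\<integral>\<^sup>+w. H1 (B w r) * H2 (B w (r + x) - B w r) * H3 (B w (r + x + h) - B w (r + x)) \<partial>M)
      = (\<integral>\<^sup>+w. (H2 0 * H1 (B w (0 + r) - B w 0)) * H3 (B w (0 + r + h) - B w (0 + r)) \<partial>M)"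
      using 3 B0 by (intro nn_integral_cong) (auto simp: ac_simps)
    also have "\<dots> = H2 0 * gauss r H1 * gauss h H3"
      using inc2[of "\<lambda>y. H2 0 * H1 y" H3 0 r h] q 3 by (simp add: gauss_cmult)
    finally show ?thesis using 3 by (simp add: mult.commute)
  next
    case 4
    have "(\<integral>\<^sup>+w. H1 (B w r) * H2 (B w (r + x) - B w r) * H3 (B w (r + x + h) - B w (r + x)) \<partial>M)
      = (\<integral>\<^sup>+w. H1 (B w (0 + r) - B w 0) * H2 (B w (r + x) - B w r) * H3 (B w (r + x + h) - B w (r + x)) \<partial>M)"
      using B0 by (intro nn_integral_cong) auto
    then show ?thesis using inc3[OF 4] by simp
  qed
qed

lemma bm_nn_integral:
  assumes pM: "prob_space M" and bm: "std_brownian_motion M B" and q: "0 \<le> q"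
    and [measurable]: "H \<in> borel_measurable borel"
  shows "(\<integral>\<^sup>+w. H (B w q) \<partial>M) = gauss q H"
  using bm_nn_integral3[OF pM bm q order_refl zero_less_one, of H "\<lambda>_. 1" "\<lambda>_. 1"] by simp

text \<open>A supremum over dyadic points is countable, hence measurable in the path, and for
  continuous paths it controls the whole interval. The quantity exp (\<kappa> |x|) - 1 bounds
  relative changes of exponential weights and, for \<kappa> \<ge> 1, also the displacement |x|
  itself.\<close>

definition osc4 :: "real \<Rightarrow> (real \<Rightarrow> real) \<Rightarrow> real \<Rightarrow> real \<Rightarrow> ennreal" where
  "osc4 \<kappa> b r \<delta> = (SUP m. SUP k\<in>{..2^m}. ennreal ((exp (\<kappa> * \<bar>pev b (r + \<delta> * (real k / 2^m)) - pev b r\<bar>) - 1) ^ 4))"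

lemma measurable_osc4 [measurable (raw)]:
  assumes [measurable]: "b \<in> measurable N (\<Pi>\<^sub>M s\<in>(UNIV::real set). (borel :: real measure))"
    "r \<in> borel_measurable N" "\<delta> \<in> borel_measurable N"
  shows "(\<lambda>x. osc4 \<kappa> (b x) (r x) (\<delta> x)) \<in> borel_measurable N"
  unfolding osc4_def by measurable

text \<open>Chaining is applied to the exponential of the path and not to the path. A dyadic
  increment of that exponential factors over three independent stretches of the path: the weight up
  to r, a tilt from r on, and the short increment, whose fourth moment is of order (\<delta> /
  2^i)^2. Summed over 2^i increments this beats the chaining weight. The constant is 34 * 5 * 20000:
  polynomial bound, geometric series with ratio 5000/6561, chaining constant for two signs.\<close>

lemma osc4_weighted_nn_integral_le:
  assumes pM: "prob_space M" and bm: "std_brownian_motion M B"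
    and r: "0 \<le> r" and d: "0 < \<delta>" "\<delta> \<le> 1"
  shows "(\<integral>\<^sup>+w. ennreal (exp (l * B w r)) * osc4 \<kappa> (B w) r \<delta> \<partial>M)
     \<le> ennreal (exp (l\<^sup>2 * r / 2) * (3400000 * exp (16 * \<kappa>\<^sup>2) * \<kappa>^4) * \<delta>\<^sup>2)"
proof -
  interpret prob_space M by fact
  have Bm[measurable]: "(\<lambda>w. B w t) \<in> borel_measurable M" for t
    using bm by (auto simp: std_brownian_motion_def)
  have cont: "continuous_on UNIV (B w)" if "w \<in> space M" for w
    using bm that by (auto simp: std_brownian_motion_def)
  define z where "z a w x = exp (a * (B w (r + \<delta> * x) - B w r))" for a w x
  have [measurable]: "(\<lambda>w. z a w x) \<in> borel_measurable M" for a x unfolding z_def by measurable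
  define X where "X a w = (\<Sum>i. ennreal ((10/9) ^ (4*i) * dyadic_incr (z a w) i))" for a w
  have [measurable]: "X a \<in> borel_measurable M" for a unfolding X_def dyadic_incr_def by measurable
  have incr: "(\<integral>\<^sup>+w. ennreal (exp (l * B w r)) * ennreal (\<bar>z a w (real (Suc k) / 2^i) - z a w (real k / 2^i)\<bar> ^ 4) \<partial>M)
     \<le> ennreal (exp (l\<^sup>2 * r / 2) * (34 * exp (16 * a\<^sup>2) * a^4) * (\<delta> / 2^i)\<^sup>2)" if k: "k < 2^i" for a i k
  proof -
    define x h where "x = \<delta> * (real k / 2^i)" and "h = \<delta> / 2^i"
    have xh: "0 \<le> x" "0 < h" "x \<le> 1" "h \<le> 1"
    proof -
      have "real k < 2^i" using k by (metis of_nat_less_iff of_nat_numeral of_nat_power)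
      then have "real k / 2^i \<le> 1" by (simp add: field_simps)
      then show "x \<le> 1" unfolding x_def using d by (intro mult_le_one) auto
      show "h \<le> 1" unfolding h_def using d by (simp add: field_simps) (meson dual_order.trans one_le_power one_le_numeral)
    qed (use d in \<open>auto simp: x_def h_def\<close>)
    have "\<delta> * (real (Suc k) / 2^i) = x + h" by (simp add: x_def h_def field_simps)
    then have zz: "\<bar>z a w (real (Suc k) / 2^i) - z a w (real k / 2^i)\<bar> ^ 4
       = exp ((4 * a) * (B w (r + x) - B w r)) * (exp (a * (B w (r + x + h) - B w (r + x))) - 1)^4" for w
    proof -
      have "exp (a * (B w (r + x + h) - B w r)) = exp (a * (B w (r + x) - B w r)) * exp (a * (B w (r + x + h) - B w (r + x)))"
        by (simp add: exp_add[symmetric] algebra_simps)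
      then have "z a w (real (Suc k) / 2^i) - z a w (real k / 2^i)
         = exp (a * (B w (r + x) - B w r)) * (exp (a * (B w (r + x + h) - B w (r + x))) - 1)"
        unfolding z_def x_def[symmetric] \<open>\<delta> * (real (Suc k) / 2^i) = x + h\<close> add.assoc
        by (simp add: algebra_simps)
      then show ?thesis
        by (simp add: abs_mult power_mult_distrib exp_of_nat_mult[symmetric] mult.assoc)
    qed
    have "(\<integral>\<^sup>+w. ennreal (exp (l * B w r)) * ennreal (\<bar>z a w (real (Suc k) / 2^i) - z a w (real k / 2^i)\<bar> ^ 4) \<partial>M)
      = (\<integral>\<^sup>+w. ennreal (exp (l * B w r)) * ennreal (exp ((4 * a) * (B w (r + x) - B w r))) *
          ennreal ((exp (a * (B w (r + x + h) - B w (r + x))) - 1)^4) \<partial>M)"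
      unfolding zz by (simp add: ennreal_mult mult.assoc)
    also have "\<dots> = gauss r (\<lambda>y. ennreal (exp (l * y))) * gauss x (\<lambda>y. ennreal (exp ((4*a) * y))) * gauss h (\<lambda>y. ennreal ((exp (a * y) - 1)^4))"
      using r xh by (intro bm_nn_integral3[OF pM bm]) auto
    \<comment> \<open>Because x \<le> 1, the tilt 4a over the stretch x costs exp (8 a^2); the short
      increment contributes the same factor again.\<close>
    also have "\<dots> \<le> ennreal (exp (l\<^sup>2 * r / 2)) * ennreal (exp (8 * a\<^sup>2)) * ennreal (34 * exp (8 * a\<^sup>2) * a^4 * h\<^sup>2)"
    proof (intro mult_mono)
      show "gauss x (\<lambda>y. ennreal (exp ((4*a) * y))) \<le> ennreal (exp (8 * a\<^sup>2))"
        using xh by (subst gauss_exp) (auto simp: power_mult_distrib intro!: mult_left_le_one_le)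
    qed (use r xh in \<open>auto simp: gauss_exp intro!: gauss_exp_minus_one_pow4_le\<close>)
    also have "\<dots> = ennreal (exp (l\<^sup>2 * r / 2) * (34 * exp (16 * a\<^sup>2) * a^4) * (\<delta> / 2^i)\<^sup>2)"
    proof -
      have "exp (16 * a\<^sup>2) = exp (8 * a\<^sup>2) * exp (8 * a\<^sup>2)" by (simp add: exp_add[symmetric])
      then show ?thesis by (simp add: ennreal_mult[symmetric] h_def ac_simps)
    qed
    finally show ?thesis .
  qed
  have EX: "(\<integral>\<^sup>+w. ennreal (exp (l * B w r)) * X a w \<partial>M) \<le> ennreal (exp (l\<^sup>2 * r / 2) * (170 * exp (16 * a\<^sup>2) * a^4) * \<delta>\<^sup>2)" for a
  proof -
    define C where "C = exp (l\<^sup>2 * r / 2) * (34 * exp (16 * a\<^sup>2) * a^4) * \<delta>\<^sup>2"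
    have C: "0 \<le> C" by (auto simp: C_def)
    have "(\<integral>\<^sup>+w. ennreal (exp (l * B w r)) * X a w \<partial>M) =
      (\<integral>\<^sup>+w. (\<Sum>i. ennreal (exp (l * B w r)) * ennreal ((10/9) ^ (4*i) * dyadic_incr (z a w) i)) \<partial>M)"
      unfolding X_def by simp
    also have "\<dots> = (\<Sum>i. \<integral>\<^sup>+w. ennreal (exp (l * B w r)) * ennreal ((10/9) ^ (4*i) * dyadic_incr (z a w) i) \<partial>M)"
      unfolding dyadic_incr_def by (subst nn_integral_suminf) auto
    also have "\<dots> \<le> (\<Sum>i. ennreal (C * (5000/6561)^i))"
    proof (intro suminf_le allI)
      fix i :: nat
      have "(\<integral>\<^sup>+w. ennreal (exp (l * B w r)) * ennreal ((10/9) ^ (4*i) * dyadic_incr (z a w) i) \<partial>M)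
        = (\<integral>\<^sup>+w. ennreal ((10/9) ^ (4*i)) * (\<Sum>k<2^i. ennreal (exp (l * B w r)) * ennreal (\<bar>z a w (real (Suc k) / 2^i) - z a w (real k / 2^i)\<bar> ^ 4)) \<partial>M)"
        unfolding dyadic_incr_def
        by (intro nn_integral_cong) (simp add: ennreal_mult sum_nonneg sum_ennreal[symmetric] sum_distrib_left ac_simps del: sum_ennreal)
      also have "\<dots> = ennreal ((10/9) ^ (4*i)) * (\<Sum>k<2^i. \<integral>\<^sup>+w. ennreal (exp (l * B w r)) * ennreal (\<bar>z a w (real (Suc k) / 2^i) - z a w (real k / 2^i)\<bar> ^ 4) \<partial>M)"
        by (subst nn_integral_cmult) (auto simp: nn_integral_sum)
      also have "\<dots> \<le> ennreal ((10/9) ^ (4*i)) * (\<Sum>k<(2::nat)^i. ennreal (C / (2^i)\<^sup>2))"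
        using incr by (intro mult_left_mono sum_mono) (auto simp: C_def power_divide)
      also have "\<dots> = ennreal (C * (5000/6561)^i)"
      proof -
        have "(10/9::real) ^ (4*i) * (2^i * (C / (2^i)\<^sup>2)) = C * (((10/9)^4)^i / 2^i)"
          by (simp add: power_mult power2_eq_square)
        also have "\<dots> = C * (5000/6561)^i" by (simp add: power_divide[symmetric]) (simp add: power_divide)
        finally have eq: "(10/9::real) ^ (4*i) * (2^i * (C / (2^i)\<^sup>2)) = C * (5000/6561)^i" .
        have "(\<Sum>k<(2::nat)^i. ennreal (C / (2^i)\<^sup>2)) = ennreal (2^i * (C / (2^i)\<^sup>2))"
          using C by (subst sum_ennreal) auto
        then show ?thesis using C eq by (simp add: ennreal_mult[symmetric])
      qed
      finally show "(\<integral>\<^sup>+w. ennreal (exp (l * B w r)) * ennreal ((10/9) ^ (4*i) * dyadic_incr (z a w) i) \<partial>M) \<le> ennreal (C * (5000/6561)^i)" .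
    qed auto
    also have "\<dots> = ennreal (\<Sum>i. C * (5000/6561)^i)"
      using C by (intro suminf_ennreal2) (auto intro!: summable_mult summable_geometric)
    also have "(\<Sum>i. C * (5000/6561)^i) = C * (1 / (1 - 5000/6561))"
      by (subst suminf_mult) (auto simp: suminf_geometric intro!: summable_geometric)
    also have "ennreal \<dots> \<le> ennreal (5 * C)" using C by (intro ennreal_leI) (auto simp: field_simps)
    also have "5 * C = exp (l\<^sup>2 * r / 2) * (170 * exp (16 * a\<^sup>2) * a^4) * \<delta>\<^sup>2" by (simp add: C_def)
    finally show ?thesis .
  qed
  \<comment> \<open>The sign of the displacement decides whether the chain for \<kappa> or the one
    for -\<kappa> is used.\<close>
  have osc: "osc4 \<kappa> (B w) r \<delta> \<le> 10000 * X \<kappa> w + 10000 * X (-\<kappa>) w" if w: "w \<in> space M" for w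
    unfolding osc4_def
  proof (intro SUP_least)
    fix m k assume k: "k \<in> {..(2::nat)^m}"
    let ?d = "B w (r + \<delta> * (real k / 2^m)) - B w r"
    have ch: "ennreal (\<bar>exp (a * ?d) - 1\<bar> ^ 4) \<le> 10000 * X a w" for a
      using dyadic_chaining[of k m "z a w"] k by (simp add: X_def z_def)
    have "ennreal ((exp (\<kappa> * \<bar>?d\<bar>) - 1) ^ 4) \<le> 10000 * X \<kappa> w + 10000 * X (-\<kappa>) w"
    proof (cases "0 \<le> ?d")
      case True
      then have "ennreal ((exp (\<kappa> * \<bar>?d\<bar>) - 1) ^ 4) \<le> 10000 * X \<kappa> w" using ch[of \<kappa>] by simp
      then show ?thesis by (simp add: add_increasing2)
    next
      case False
      then have "ennreal ((exp (\<kappa> * \<bar>?d\<bar>) - 1) ^ 4) \<le> 10000 * X (-\<kappa>) w"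
        using ch[of "-\<kappa>"] by (simp add: right_diff_distrib)
      then show ?thesis by (simp add: add_increasing)
    qed
    then show "ennreal ((exp (\<kappa> * \<bar>pev (B w) (r + \<delta> * (real k / 2^m)) - pev (B w) r\<bar>) - 1) ^ 4)
        \<le> 10000 * X \<kappa> w + 10000 * X (-\<kappa>) w"
      using cont[OF w] by (simp add: pev_continuous)
  qed
  have "(\<integral>\<^sup>+w. ennreal (exp (l * B w r)) * osc4 \<kappa> (B w) r \<delta> \<partial>M)
    \<le> (\<integral>\<^sup>+w. 10000 * (ennreal (exp (l * B w r)) * X \<kappa> w) + 10000 * (ennreal (exp (l * B w r)) * X (-\<kappa>) w) \<partial>M)"
  proof (rule nn_integral_mono)
    fix w assume "w \<in> space M"
    from mult_left_mono[OF osc[OF this], of "ennreal (exp (l * B w r))"]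
    show "ennreal (exp (l * B w r)) * osc4 \<kappa> (B w) r \<delta>
      \<le> 10000 * (ennreal (exp (l * B w r)) * X \<kappa> w) + 10000 * (ennreal (exp (l * B w r)) * X (-\<kappa>) w)"
      by (simp add: distrib_left ac_simps)
  qed
  also have "\<dots> = 10000 * (\<integral>\<^sup>+w. ennreal (exp (l * B w r)) * X \<kappa> w \<partial>M) + 10000 * (\<integral>\<^sup>+w. ennreal (exp (l * B w r)) * X (-\<kappa>) w \<partial>M)"
    by (simp add: nn_integral_add nn_integral_cmult)
  also have "\<dots> \<le> 10000 * ennreal (exp (l\<^sup>2 * r / 2) * (170 * exp (16 * \<kappa>\<^sup>2) * \<kappa>^4) * \<delta>\<^sup>2)
      + 10000 * ennreal (exp (l\<^sup>2 * r / 2) * (170 * exp (16 * \<kappa>\<^sup>2) * \<kappa>^4) * \<delta>\<^sup>2)"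
    using EX[of \<kappa>] EX[of "-\<kappa>"] by (intro add_mono mult_left_mono) auto
  also have "\<dots> = ennreal (20000 * (exp (l\<^sup>2 * r / 2) * (170 * exp (16 * \<kappa>\<^sup>2) * \<kappa>^4) * \<delta>\<^sup>2))"
    by (subst ennreal_mult) (auto simp: distrib_right[symmetric])
  also have "20000 * (exp (l\<^sup>2 * r / 2) * (170 * exp (16 * \<kappa>\<^sup>2) * \<kappa>^4) * \<delta>\<^sup>2)
     = exp (l\<^sup>2 * r / 2) * (3400000 * exp (16 * \<kappa>\<^sup>2) * \<kappa>^4) * \<delta>\<^sup>2" by simp
  finally show ?thesis .
qed

section \<open>Configurations of particle data\<close>

type_synonym pdata = "(real \<times> nat) \<times> (real \<Rightarrow> real)"

abbreviation pdata_space :: "pdata measure" where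
  "pdata_space \<equiv> (borel \<Otimes>\<^sub>M count_space UNIV) \<Otimes>\<^sub>M (\<Pi>\<^sub>M s\<in>UNIV. borel)"

abbreviation conf_space :: "(nat list \<Rightarrow> pdata) measure" where
  "conf_space \<equiv> \<Pi>\<^sub>M u\<in>UNIV. pdata_space"

definition life :: "pdata \<Rightarrow> real" where "life d = fst (fst d)"
definition kids :: "pdata \<Rightarrow> nat" where "kids d = snd (fst d)"
definition traj :: "pdata \<Rightarrow> real \<Rightarrow> real" where "traj d = snd d"

lemma measurable_life [measurable]: "life \<in> borel_measurable pdata_space"
  and measurable_kids [measurable]: "kids \<in> measurable pdata_space (count_space UNIV)"
  and measurable_traj [measurable]: "traj \<in> measurable pdata_space (\<Pi>\<^sub>M s\<in>UNIV. borel)"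
  unfolding life_def[abs_def] kids_def[abs_def] traj_def[abs_def] by measurable

definition dpos :: "pdata \<Rightarrow> real" where "dpos d = pev (traj d) (life d)"

lemma measurable_dpos [measurable]: "dpos \<in> borel_measurable pdata_space"
  unfolding dpos_def[abs_def] by measurable

fun cbirth :: "(nat list \<Rightarrow> pdata) \<Rightarrow> nat list \<Rightarrow> real" where
  "cbirth x [] = 0"
| "cbirth x (i # u) = cbirth x u + life (x u)"

fun cstart :: "(nat list \<Rightarrow> pdata) \<Rightarrow> nat list \<Rightarrow> real" where
  "cstart x [] = 0"
| "cstart x (i # u) = cstart x u + dpos (x u)"

fun cex :: "(nat list \<Rightarrow> pdata) \<Rightarrow> nat list \<Rightarrow> bool" where
  "cex x [] = True"
| "cex x (i # u) = (cex x u \<and> i < kids (x u))"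

text \<open>The weight of a label at its birth, set to 0 for labels outside the tree so that sums
  may run over all labels. Both parameters stay free because the family is closed under what is done
  to it: p-th powers multiply both by p, a factor exp (\<kappa> s) in the birth time s lowers
  \<open>th\<close> by \<kappa>, and an exponential tilt of the position changes
  \<open>l\<close>.\<close>

definition cw :: "real \<Rightarrow> real \<Rightarrow> (nat list \<Rightarrow> pdata) \<Rightarrow> nat list \<Rightarrow> real" where
  "cw l th x u = (if cex x u then exp (l * cstart x u - th * cbirth x u) else 0)"

lemma measurable_conf_component [measurable]: "(\<lambda>x. x u) \<in> measurable conf_space pdata_space"
  by (rule measurable_component_singleton) simp

lemma measurable_cbirth [measurable]: "(\<lambda>x. cbirth x u) \<in> borel_measurable conf_space"
  by (induction u) (auto intro!: borel_measurable_add measurable_compose[OF measurable_conf_component measurable_life])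

lemma measurable_cstart [measurable]: "(\<lambda>x. cstart x u) \<in> borel_measurable conf_space"
  by (induction u) (auto intro!: borel_measurable_add measurable_compose[OF measurable_conf_component measurable_dpos])

lemma measurable_cex [measurable]: "Measurable.pred conf_space (\<lambda>x. cex x u)"
proof (induction u)
  case (Cons i u)
  have [measurable]: "Measurable.pred conf_space (\<lambda>x. cex x u)" by fact
  have [measurable]: "(\<lambda>x. kids (x u)) \<in> measurable conf_space (count_space UNIV)"
    by (rule measurable_compose[OF measurable_conf_component measurable_kids])
  show ?case by simp
qed simp

lemma measurable_cw [measurable]: "(\<lambda>x. cw l th x u) \<in> borel_measurable conf_space"
  unfolding cw_def by measurable

lemma cw_nonneg [simp]: "0 \<le> cw l th x u" by (simp add: cw_def)

lemma cw_Cons: "cw l th x (i # u) = cw l th x u * (if i < kids (x u) then exp (l * dpos (x u) - th * life (x u)) else 0)"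
  by (simp add: cw_def exp_add[symmetric] algebra_simps)

lemma cw_powr: "0 < p \<Longrightarrow> cw l th x u powr p = cw (p * l) (p * th) x u"
  by (simp add: cw_def powr_def algebra_simps)

text \<open>Birth time, starting point and existence of v read the data of strict ancestors of v
  only. Those are shorter than v, hence different from u; this covers v = u.\<close>

lemma prefix_upd:
  assumes "length v \<le> length u"
  shows "cbirth (x(u := d)) v = cbirth x v" "cstart (x(u := d)) v = cstart x v" "cex (x(u := d)) v = cex x v"
  using assms by (induction v) auto

lemma cw_upd: "length v \<le> length u \<Longrightarrow> cw l th (x(u := d)) v = cw l th x v"
  by (simp add: cw_def prefix_upd)

text \<open>A finite exhaustion of the set of all labels: moment bounds are proved for finite
  deterministic sets, uniformly in m, and then passed to the limit.\<close>

definition lab :: "nat \<Rightarrow> nat list set" where "lab m = {u. length u \<le> m \<and> set u \<subseteq> {..<m}}"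

lemma finite_lab [simp]: "finite (lab m)"
  using finite_lists_length_le[of "{..<m}" m] by (simp add: lab_def conj_commute)

lemma lab_mono: "m \<le> m' \<Longrightarrow> lab m \<subseteq> lab m'" by (auto simp: lab_def)

lemma finite_subset_lab:
  assumes "finite U" shows "\<exists>m0. \<forall>m\<ge>m0. U \<subseteq> lab m"
proof -
  have "\<exists>m. u \<in> lab m" for u
  proof -
    have "\<forall>a\<in>set u. a < Suc (Max (insert 0 (set u)))" by (auto simp: less_Suc_eq_le)
    then show ?thesis unfolding lab_def
      by (intro exI[of _ "max (length u) (Suc (Max (insert 0 (set u))))"]) (auto simp: less_max_iff_disj)
  qed
  then obtain f where f: "\<And>u. u \<in> lab (f u)" by metis
  show ?thesis
  proof (intro exI[of _ "Max (insert 0 (f ` U))"] allI impI subsetI)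
    fix m u assume "Max (insert 0 (f ` U)) \<le> m" "u \<in> U"
    then have "f u \<le> m" using assms by auto
    then show "u \<in> lab m" using f lab_mono by blast
  qed
qed

lemma measurable_compose3:
  assumes "(\<lambda>(s, y, d). \<psi> s y d) \<in> borel_measurable (borel \<Otimes>\<^sub>M (borel \<Otimes>\<^sub>M pdata_space))"
    "s \<in> borel_measurable N" "y \<in> borel_measurable N" "d \<in> measurable N pdata_space"
  shows "(\<lambda>z. \<psi> (s z) (y z) (d z)) \<in> borel_measurable N"
proof -
  have "(\<lambda>z. (s z, y z, d z)) \<in> measurable N (borel \<Otimes>\<^sub>M (borel \<Otimes>\<^sub>M pdata_space))"
    using assms(2-) by measurable
  from measurable_compose[OF this assms(1)] show ?thesis by simp
qed

section \<open>The model and the resampling of a single label\<close>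

locale bbm_model =
  fixes M :: "'a measure" and \<mu> :: "nat pmf"
    and tau :: "nat list \<Rightarrow> 'a \<Rightarrow> real" and L :: "nat list \<Rightarrow> 'a \<Rightarrow> nat"
    and B :: "nat list \<Rightarrow> 'a \<Rightarrow> real \<Rightarrow> real"
  assumes mean: "measure_pmf.expectation \<mu> real = 2"
    and second: "integrable (measure_pmf \<mu>) (\<lambda>k. (real k)\<^sup>2)"
    and bbm: "BBM_randomness M \<mu> tau L B"
begin

sublocale prob_space M using bbm by (auto simp: BBM_randomness_def)

definition D :: "nat list \<Rightarrow> 'a \<Rightarrow> pdata" where "D u w = ((tau u w, L u w), B u w)"
definition conf :: "'a \<Rightarrow> nat list \<Rightarrow> pdata" where "conf w = (\<lambda>u. D u w)"

lemma D_indep: "indep_vars (\<lambda>_. pdata_space) D UNIV"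
  using bbm by (auto simp: BBM_randomness_def D_def[abs_def])

lemma measurable_D [measurable]: "D u \<in> measurable M pdata_space"
  using D_indep by (auto simp: indep_vars_def)

lemma measurable_conf [measurable]: "conf \<in> measurable M conf_space"
  unfolding conf_def by (rule measurable_PiM_single') (auto simp: space_pair_measure space_PiM)

lemma measurable_conf_upd:
  "(\<lambda>(w, w'). (conf w)(u := D u w')) \<in> measurable (M \<Otimes>\<^sub>M M) conf_space"
proof (rule measurable_PiM_single')
  fix v :: "nat list"
  have "(\<lambda>w. case w of (w, w') \<Rightarrow> ((conf w)(u := D u w')) v) = (if v = u then (\<lambda>z. D u (snd z)) else (\<lambda>z. D v (fst z)))"
    by (auto simp: conf_def fun_eq_iff)
  then show "(\<lambda>w. (case w of (w, w') \<Rightarrow> (conf w)(u := D u w')) v) \<in> measurable (M \<Otimes>\<^sub>M M) pdata_space"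
    by (simp add: case_prod_beta')
qed (auto simp: space_pair_measure space_PiM)

text \<open>Replacing the data of u by an independent copy, taken from a second sample point, does
  not change the law of the configuration. This takes the place of conditioning on all other
  labels.\<close>

lemma conf_resample_distr:
  "distr M conf_space conf = distr (M \<Otimes>\<^sub>M M) conf_space (\<lambda>(w, w'). (conf w)(u := D u w'))"
proof -
  define X where "X w = restrict (\<lambda>v. D v w) (-{u})" for w
  define Y where "Y w = restrict (\<lambda>v. D v w) {u}" for w
  let ?P = "PiM (-{u}) (\<lambda>_. pdata_space)" and ?Q = "PiM {u} (\<lambda>_. pdata_space)"
  have "indep_var ?P X ?Q Y"
    unfolding X_def[abs_def] Y_def[abs_def] by (rule indep_var_restrict[OF D_indep]) auto
  then have X[measurable]: "X \<in> measurable M ?P" and Y[measurable]: "Y \<in> measurable M ?Q"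
    and eq: "distr M ?P X \<Otimes>\<^sub>M distr M ?Q Y = distr M (?P \<Otimes>\<^sub>M ?Q) (\<lambda>w. (X w, Y w))"
    by (auto simp: indep_var_distribution_eq)
  interpret Y: prob_space "distr M ?Q Y" by (rule prob_space_distr) fact
  have mg: "merge (-{u}) {u} \<in> measurable (?P \<Otimes>\<^sub>M ?Q) conf_space"
  proof -
    have "-{u} \<union> {u} = UNIV" by auto
    then show ?thesis using measurable_merge[of "-{u}" "{u}" "\<lambda>_. pdata_space"] by (simp only:)
  qed
  have m1: "merge (-{u}) {u} (X w, Y w') = (conf w)(u := D u w')" for w w'
    by (auto simp: merge_def X_def Y_def conf_def fun_eq_iff)
  have m0: "(conf w)(u := D u w) = conf w" for w by (auto simp: conf_def)
  have "distr M conf_space conf = distr (distr M (?P \<Otimes>\<^sub>M ?Q) (\<lambda>w. (X w, Y w))) conf_space (merge (-{u}) {u})"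
    by (subst distr_distr[OF mg]) (auto simp: comp_def m1 m0)
  also have "\<dots> = distr (distr M ?P X \<Otimes>\<^sub>M distr M ?Q Y) conf_space (merge (-{u}) {u})" using eq by simp
  also have "distr M ?P X \<Otimes>\<^sub>M distr M ?Q Y = distr (M \<Otimes>\<^sub>M M) (?P \<Otimes>\<^sub>M ?Q) (\<lambda>(x, y). (X x, Y y))"
    by (rule pair_measure_distr[OF X Y]) unfold_locales
  also have "distr \<dots> conf_space (merge (-{u}) {u}) = distr (M \<Otimes>\<^sub>M M) conf_space (\<lambda>(w, w'). (conf w)(u := D u w'))"
    by (subst distr_distr[OF mg]) (auto simp: comp_def m1 case_prod_beta')
  finally show ?thesis .
qed

text \<open>The inner integral plays the role of the conditional expectation given all labels except
  u.\<close>

lemma resample_nn_integral: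
  assumes [measurable]: "h \<in> borel_measurable conf_space"
  shows "(\<integral>\<^sup>+w. h (conf w) \<partial>M) = (\<integral>\<^sup>+w. \<integral>\<^sup>+w'. h ((conf w)(u := D u w')) \<partial>M \<partial>M)"
proof -
  note [measurable] = measurable_conf_upd
  have "(\<integral>\<^sup>+w. h (conf w) \<partial>M) = (\<integral>\<^sup>+x. h x \<partial>distr M conf_space conf)"
    by (subst nn_integral_distr) auto
  also have "\<dots> = (\<integral>\<^sup>+z. h ((\<lambda>(w, w'). (conf w)(u := D u w')) z) \<partial>(M \<Otimes>\<^sub>M M))"
    unfolding conf_resample_distr[of u] by (subst nn_integral_distr) auto
  also have "\<dots> = (\<integral>\<^sup>+w. \<integral>\<^sup>+w'. h ((conf w)(u := D u w')) \<partial>M \<partial>M)"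
    by (subst nn_integral_fst[symmetric]) auto
  finally show ?thesis .
qed

lemma resample_integral:
  fixes h :: "_ \<Rightarrow> real"
  assumes [measurable]: "h \<in> borel_measurable conf_space" and int: "integrable M (\<lambda>w. h (conf w))"
  shows "(\<integral>w. h (conf w) \<partial>M) = (\<integral>w. (\<integral>w'. h ((conf w)(u := D u w')) \<partial>M) \<partial>M)"
proof -
  interpret P: pair_sigma_finite M M by unfold_locales
  note [measurable] = measurable_conf_upd
  have "integrable (distr M conf_space conf) h" using int by (subst integrable_distr_eq) auto
  then have int2: "integrable (M \<Otimes>\<^sub>M M) (\<lambda>z. h ((\<lambda>(w, w'). (conf w)(u := D u w')) z))"
    unfolding conf_resample_distr[of u] by (subst (asm) integrable_distr_eq) auto
  have "(\<integral>w. h (conf w) \<partial>M) = (\<integral>x. h x \<partial>distr M conf_space conf)"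
    by (subst integral_distr) auto
  also have "\<dots> = (\<integral>z. h ((\<lambda>(w, w'). (conf w)(u := D u w')) z) \<partial>(M \<Otimes>\<^sub>M M))"
    unfolding conf_resample_distr[of u] by (subst integral_distr) auto
  also have "\<dots> = (\<integral>w. (\<integral>w'. h ((conf w)(u := D u w')) \<partial>M) \<partial>M)"
    using P.integral_fst'[OF int2] by simp
  finally show ?thesis .
qed

section \<open>A single particle\<close>

lemma measurable_tau [measurable]: "tau u \<in> borel_measurable M"
  and measurable_L [measurable]: "L u \<in> measurable M (count_space UNIV)"
  and measurable_B [measurable]: "B u \<in> measurable M (\<Pi>\<^sub>M s\<in>UNIV. borel)"
  using bbm by (auto simp: BBM_randomness_def indep_rv2_def)

lemma brownian: "std_brownian_motion M (B u)"
  using bbm by (auto simp: BBM_randomness_def)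

lemma B_continuous: "w \<in> space M \<Longrightarrow> continuous_on UNIV (B u w)"
  and B_zero: "w \<in> space M \<Longrightarrow> B u w 0 = 0"
  using brownian[of u] by (auto simp: std_brownian_motion_def)

lemma life_D [simp]: "life (D u w) = tau u w" and kids_D [simp]: "kids (D u w) = L u w"
  and traj_D [simp]: "traj (D u w) = B u w"
  by (simp_all add: life_def kids_def traj_def D_def)

lemma pev_B [simp]: "w \<in> space M \<Longrightarrow> pev (B u w) q = B u w q"
  by (rule pev_continuous[OF B_continuous])

lemma dpos_D: "w \<in> space M \<Longrightarrow> dpos (D u w) = B u w (tau u w)"
  by (simp add: dpos_def)

lemma D_nn_integral:
  assumes h[measurable]: "h \<in> borel_measurable pdata_space"
  shows "(\<integral>\<^sup>+w. h (D u w) \<partial>M) = (\<integral>\<^sup>+w1. \<integral>\<^sup>+w2. \<integral>\<^sup>+w3. h ((tau u w1, L u w2), B u w3) \<partial>M \<partial>M \<partial>M)"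
proof -
  have i1: "indep_rv2 M borel (tau u) (count_space UNIV) (L u)"
    and i2: "indep_rv2 M (borel \<Otimes>\<^sub>M count_space UNIV) (\<lambda>w. (tau u w, L u w)) (\<Pi>\<^sub>M s\<in>UNIV. borel) (B u)"
    using bbm by (auto simp: BBM_randomness_def)
  have "(\<integral>\<^sup>+w. h (D u w) \<partial>M) = (\<integral>\<^sup>+w. \<integral>\<^sup>+w3. h ((tau u w, L u w), B u w3) \<partial>M \<partial>M)"
    unfolding D_def using indep_rv2_nn_integral[OF prob_space_axioms i2 h] .
  also have "\<dots> = (\<integral>\<^sup>+w1. \<integral>\<^sup>+w2. \<integral>\<^sup>+w3. h ((tau u w1, L u w2), B u w3) \<partial>M \<partial>M \<partial>M)"
    by (rule indep_rv2_nn_integral[OF prob_space_axioms i1, of "\<lambda>z. \<integral>\<^sup>+w3. h (z, B u w3) \<partial>M"]) measurable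
  finally show ?thesis .
qed

lemma tau_nn_integral:
  assumes [measurable]: "h \<in> borel_measurable borel"
  shows "(\<integral>\<^sup>+w. h (tau u w) \<partial>M) = (\<integral>\<^sup>+q. ennreal (exponential_density 1 q) * h q \<partial>lborel)"
  by (intro distributed_nn_integral[symmetric]) (use bbm in \<open>auto simp: BBM_randomness_def\<close>)

lemma L_nn_integral: "(\<integral>\<^sup>+w. h (L u w) \<partial>M) = (\<integral>\<^sup>+k. h k \<partial>measure_pmf \<mu>)"
proof -
  have "distr M (count_space UNIV) (L u) = measure_pmf \<mu>" using bbm by (auto simp: BBM_randomness_def)
  then show ?thesis using nn_integral_distr[of "L u" M "count_space UNIV" h] by simp
qed

lemma tau_pos: "AE w in M. 0 < tau u w"
proof -
  have "\<P>(x in M. 0 < tau u x) = 1"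
    using exponential_distributedD_gt[of "tau u" 1 0] bbm by (auto simp: BBM_randomness_def)
  then show ?thesis by (simp add: prob_Collect_eq_1)
qed

text \<open>Lifetime, offspring number and path are independent, so the path may be integrated with
  the lifetime frozen at q, where its position is Gaussian of variance q. The density then removes
  negative q.\<close>

lemma death_nn_integral:
  assumes h[measurable]: "(\<lambda>(q, k, x). h q k x) \<in> borel_measurable (borel \<Otimes>\<^sub>M count_space UNIV \<Otimes>\<^sub>M borel)"
  shows "(\<integral>\<^sup>+w. h (life (D u w)) (kids (D u w)) (dpos (D u w)) \<partial>M) =
     (\<integral>\<^sup>+q. ennreal (exponential_density 1 q) * (\<integral>\<^sup>+k. gauss q (h q k) \<partial>measure_pmf \<mu>) \<partial>lborel)"
proof -
  have [measurable]: "h q k \<in> borel_measurable borel" for q k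
    using measurable_compose[OF _ h, of "\<lambda>x. (q, k, x)" borel] by simp
  have gm: "(\<lambda>q. gauss q (h q k)) \<in> borel_measurable borel" for k
  proof -
    have [measurable]: "(\<lambda>z. h (fst z) k (snd z)) \<in> borel_measurable (borel \<Otimes>\<^sub>M borel)"
      using measurable_compose[OF _ h, of "\<lambda>z. (fst z, k, snd z)" "borel \<Otimes>\<^sub>M borel"] by simp
    show ?thesis by (rule measurable_gauss) (auto simp: case_prod_beta')
  qed
  have "(\<integral>\<^sup>+w. h (life (D u w)) (kids (D u w)) (dpos (D u w)) \<partial>M) =
    (\<integral>\<^sup>+w1. \<integral>\<^sup>+w2. \<integral>\<^sup>+w3. h (tau u w1) (L u w2) (pev (B u w3) (tau u w1)) \<partial>M \<partial>M \<partial>M)"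
  proof (subst D_nn_integral[where h="\<lambda>d. h (life d) (kids d) (dpos d)"])
    show "(\<lambda>d. h (life d) (kids d) (dpos d)) \<in> borel_measurable pdata_space"
      using measurable_compose[OF _ h, of "\<lambda>d. (life d, kids d, dpos d)" pdata_space] by simp
  qed (simp add: life_def kids_def dpos_def traj_def)
  also have "\<dots> = (\<integral>\<^sup>+w1. (if 0 \<le> tau u w1 then \<integral>\<^sup>+w2. gauss (tau u w1) (h (tau u w1) (L u w2)) \<partial>M else 0) \<partial>M)"
  proof (intro nn_integral_cong_AE, use tau_pos in eventually_elim)
    fix w assume t: "0 < tau u w"
    have "(\<integral>\<^sup>+w3. h (tau u w) k (pev (B u w3) (tau u w)) \<partial>M) = gauss (tau u w) (h (tau u w) k)" for k
    proof -
      have "(\<integral>\<^sup>+w3. h (tau u w) k (pev (B u w3) (tau u w)) \<partial>M) = (\<integral>\<^sup>+w3. h (tau u w) k (B u w3 (tau u w)) \<partial>M)"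
        by (intro nn_integral_cong) simp
      then show ?thesis using t by (simp add: bm_nn_integral[OF prob_space_axioms brownian])
    qed
    then show "(\<integral>\<^sup>+w2. \<integral>\<^sup>+w3. h (tau u w) (L u w2) (pev (B u w3) (tau u w)) \<partial>M \<partial>M)
      = (if 0 \<le> tau u w then \<integral>\<^sup>+w2. gauss (tau u w) (h (tau u w) (L u w2)) \<partial>M else 0)" using t by simp
  qed
  also have "\<dots> = (\<integral>\<^sup>+w1. (if 0 \<le> tau u w1 then \<integral>\<^sup>+k. gauss (tau u w1) (h (tau u w1) k) \<partial>measure_pmf \<mu> else 0) \<partial>M)"
    by (simp add: L_nn_integral[where h="\<lambda>k. gauss _ (h _ k)"] cong: if_cong)
  also have "\<dots> = (\<integral>\<^sup>+q. ennreal (exponential_density 1 q) * (if 0 \<le> q then \<integral>\<^sup>+k. gauss q (h q k) \<partial>measure_pmf \<mu> else 0) \<partial>lborel)"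
  proof (rule tau_nn_integral[where h="\<lambda>q. if 0 \<le> q then \<integral>\<^sup>+k. gauss q (h q k) \<partial>measure_pmf \<mu> else 0"])
    have "(\<lambda>q. \<integral>\<^sup>+k. gauss q (h q k) \<partial>measure_pmf \<mu>) = (\<lambda>q. \<Sum>k. ennreal (pmf \<mu> k) * gauss q (h q k))"
      by (simp add: nn_integral_measure_pmf nn_integral_count_space_nat)
    then have [measurable]: "(\<lambda>q. \<integral>\<^sup>+k. gauss q (h q k) \<partial>measure_pmf \<mu>) \<in> borel_measurable borel"
      using gm by simp
    show "(\<lambda>q. if 0 \<le> q then \<integral>\<^sup>+k. gauss q (h q k) \<partial>measure_pmf \<mu> else 0) \<in> borel_measurable borel" by measurable
  qed
  also have "\<dots> = (\<integral>\<^sup>+q. ennreal (exponential_density 1 q) * (\<integral>\<^sup>+k. gauss q (h q k) \<partial>measure_pmf \<mu>) \<partial>lborel)"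
    by (intro nn_integral_cong) (auto simp: exponential_density_def)
  finally show ?thesis .
qed

lemma exponential_density_nn_integral:
  assumes "0 < 1 + s"
  shows "(\<integral>\<^sup>+q. ennreal (exponential_density 1 q) * ennreal (exp (- s * q)) \<partial>lborel) = ennreal (1 / (1 + s))"
proof -
  have "(\<integral>\<^sup>+q. ennreal (exponential_density 1 q) * ennreal (exp (- s * q)) \<partial>lborel) =
    (\<integral>\<^sup>+q. ennreal (1 / (1 + s)) * ennreal (exponential_density (1 + s) q) \<partial>lborel)"
  proof (intro nn_integral_cong)
    fix q :: real
    have "exponential_density 1 q * exp (- s * q) = 1 / (1 + s) * exponential_density (1 + s) q"
    proof (cases "q < 0")
      case False
      have "exp (- q) * exp (- s * q) = exp (- q * (1 + s))" unfolding exp_add[symmetric] by (simp add: algebra_simps)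
      then show ?thesis unfolding exponential_density_def using assms False by auto
    qed (simp add: exponential_density_def)
    then show "ennreal (exponential_density 1 q) * ennreal (exp (- s * q)) = ennreal (1 / (1 + s)) * ennreal (exponential_density (1 + s) q)"
      using assms by (simp add: ennreal_mult[symmetric] exponential_density_nonneg)
  qed
  also have "\<dots> = ennreal (1 / (1 + s)) * (\<integral>\<^sup>+q. ennreal (exponential_density (1 + s) q) \<partial>lborel)"
    by (rule nn_integral_cmult) auto
  also have "(\<integral>\<^sup>+q. ennreal (exponential_density (1 + s) q) \<partial>lborel) = 1"
    using prob_space.emeasure_space_1[OF prob_space_exponential_density[OF assms]] by (simp add: emeasure_density)
  finally show ?thesis by simp
qed

text \<open>The position at death contributes exp (l^2 q / 2), so what remains is the Laplace
  transform of the lifetime at th - l^2 / 2, times the offspring factor.\<close>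

lemma death_exp_moment:
  assumes "0 < 1 + th - l\<^sup>2 / 2"
  shows "(\<integral>\<^sup>+w. g (kids (D u w)) * ennreal (exp (l * dpos (D u w) - th * life (D u w))) \<partial>M) =
     (\<integral>\<^sup>+k. g k \<partial>measure_pmf \<mu>) * ennreal (1 / (1 + th - l\<^sup>2 / 2))"
proof -
  have "(\<integral>\<^sup>+w. g (kids (D u w)) * ennreal (exp (l * dpos (D u w) - th * life (D u w))) \<partial>M) =
    (\<integral>\<^sup>+q. ennreal (exponential_density 1 q) * (\<integral>\<^sup>+k. gauss q (\<lambda>x. g k * ennreal (exp (l * x - th * q))) \<partial>measure_pmf \<mu>) \<partial>lborel)"
    by (rule death_nn_integral[where h="\<lambda>q k x. g k * ennreal (exp (l * x - th * q))"]) measurable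
  also have "\<dots> = (\<integral>\<^sup>+q. ennreal (exponential_density 1 q) * ennreal (exp (- (th - l\<^sup>2 / 2) * q)) * (\<integral>\<^sup>+k. g k \<partial>measure_pmf \<mu>) \<partial>lborel)"
  proof (intro nn_integral_cong)
    fix q :: real
    show "ennreal (exponential_density 1 q) * (\<integral>\<^sup>+k. gauss q (\<lambda>x. g k * ennreal (exp (l * x - th * q))) \<partial>measure_pmf \<mu>) =
      ennreal (exponential_density 1 q) * ennreal (exp (- (th - l\<^sup>2 / 2) * q)) * (\<integral>\<^sup>+k. g k \<partial>measure_pmf \<mu>)"
    proof (cases "0 \<le> q")
      case True
      have "gauss q (\<lambda>x. g k * ennreal (exp (l * x - th * q))) = ennreal (exp (- (th - l\<^sup>2 / 2) * q)) * g k" for k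
      proof -
        have "(\<lambda>x. g k * ennreal (exp (l * x - th * q))) = (\<lambda>x. (g k * ennreal (exp (- th * q))) * ennreal (exp (l * x)))"
          by (auto simp: mult.assoc ennreal_mult[symmetric] exp_add[symmetric])
        then have "gauss q (\<lambda>x. g k * ennreal (exp (l * x - th * q))) = (g k * ennreal (exp (- th * q))) * ennreal (exp (l\<^sup>2 * q / 2))"
          using True by (simp add: gauss_cmult gauss_exp)
        also have "\<dots> = ennreal (exp (- (th - l\<^sup>2 / 2) * q)) * g k"
          by (simp add: mult.assoc ennreal_mult[symmetric] exp_add[symmetric] algebra_simps)
        finally show ?thesis .
      qed
      then show ?thesis by (simp add: nn_integral_cmult mult.assoc)
    qed (simp add: exponential_density_def)
  qed
  also have "\<dots> = (\<integral>\<^sup>+q. ennreal (exponential_density 1 q) * ennreal (exp (- (th - l\<^sup>2 / 2) * q)) \<partial>lborel) * (\<integral>\<^sup>+k. g k \<partial>measure_pmf \<mu>)"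
    by (rule nn_integral_multc) auto
  also have "\<dots> = ennreal (1 / (1 + (th - l\<^sup>2/2))) * (\<integral>\<^sup>+k. g k \<partial>measure_pmf \<mu>)"
    using assms by (subst exponential_density_nn_integral) (auto simp: algebra_simps)
  finally show ?thesis by (simp add: mult.commute algebra_simps)
qed

lemma integrable_offspring: "integrable (measure_pmf \<mu>) real"
proof (rule Bochner_Integration.integrable_bound[OF second])
  have "real k \<le> (real k)\<^sup>2" for k by (cases k) (auto simp: power2_eq_square)
  then show "AE k in measure_pmf \<mu>. norm (real k) \<le> norm ((real k)\<^sup>2)" by auto
qed auto

lemma offspring_mean: "(\<integral>\<^sup>+k. ennreal (real k) \<partial>measure_pmf \<mu>) = 2"
  using nn_integral_eq_integral[OF integrable_offspring] mean by simp

lemma offspring_powr: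
  assumes "1 \<le> p" "p \<le> 2"
  shows "(\<integral>\<^sup>+k. ennreal (real k powr p) \<partial>measure_pmf \<mu>) \<le> ennreal (measure_pmf.expectation \<mu> (\<lambda>k. (real k)\<^sup>2))"
proof -
  have "real k powr p \<le> (real k)\<^sup>2" for k
    using powr_mono[of p 2 "real k"] assms by (cases "k = 0") (auto simp: powr_numeral)
  then have "(\<integral>\<^sup>+k. ennreal (real k powr p) \<partial>measure_pmf \<mu>) \<le> (\<integral>\<^sup>+k. ennreal ((real k)\<^sup>2) \<partial>measure_pmf \<mu>)"
    by (intro nn_integral_mono ennreal_leI)
  also have "\<dots> = ennreal (measure_pmf.expectation \<mu> (\<lambda>k. (real k)\<^sup>2))"
    using second by (intro nn_integral_eq_integral) auto
  finally show ?thesis .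
qed

section \<open>First moments over the tree\<close>

text \<open>The weight of u does not read the data of u, so resampling u separates it from the mean
  offspring number 2 and the discount at death. It is an inequality because only the first m
  children are counted.\<close>

lemma cw_children_moment:
  assumes "0 < 1 + th - l\<^sup>2 / 2"
  shows "(\<Sum>i<m. \<integral>\<^sup>+w. ennreal (cw l th (conf w) (i # u)) \<partial>M)
     \<le> ennreal (2 / (1 + th - l\<^sup>2 / 2)) * (\<integral>\<^sup>+w. ennreal (cw l th (conf w) u) \<partial>M)"
proof -
  have "(\<Sum>i<m. \<integral>\<^sup>+w. ennreal (cw l th (conf w) (i # u)) \<partial>M) =
    (\<integral>\<^sup>+w. (\<Sum>i<m. ennreal (cw l th (conf w) (i # u))) \<partial>M)"
    by (rule nn_integral_sum[symmetric]) measurable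
  also have "\<dots> = (\<integral>\<^sup>+w. \<integral>\<^sup>+w'. (\<Sum>i<m. ennreal (cw l th ((conf w)(u := D u w')) (i # u))) \<partial>M \<partial>M)"
    by (rule resample_nn_integral[where h="\<lambda>x. \<Sum>i<m. ennreal (cw l th x (i # u))"]) measurable
  also have "\<dots> \<le> (\<integral>\<^sup>+w. \<integral>\<^sup>+w'. ennreal (cw l th (conf w) u) * (ennreal (real (kids (D u w'))) * ennreal (exp (l * dpos (D u w') - th * life (D u w')))) \<partial>M \<partial>M)"
  proof (intro nn_integral_mono)
    fix w w'
    let ?e = "exp (l * dpos (D u w') - th * life (D u w'))"
    have "(\<Sum>i<m. cw l th ((conf w)(u := D u w')) (i # u)) = cw l th (conf w) u * (\<Sum>i<m. if i < kids (D u w') then ?e else 0)"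
      by (simp only: cw_Cons cw_upd[OF order_refl] fun_upd_same sum_distrib_left)
    moreover have "(\<Sum>i<m. if i < kids (D u w') then ?e else 0) = (\<Sum>i\<in>{..<m} \<inter> {..<kids (D u w')}. ?e)"
      by (subst sum.inter_restrict) auto
    moreover have "(\<Sum>i\<in>{..<m} \<inter> {..<kids (D u w')}. ?e) \<le> (\<Sum>i\<in>{..<kids (D u w')}. ?e)"
      by (intro sum_mono2) auto
    ultimately have "(\<Sum>i<m. cw l th ((conf w)(u := D u w')) (i # u)) \<le> cw l th (conf w) u * (real (kids (D u w')) * ?e)"
      by (simp add: mult_left_mono del: life_D kids_D)
    then have "ennreal (\<Sum>i<m. cw l th ((conf w)(u := D u w')) (i # u)) \<le> ennreal (cw l th (conf w) u * (real (kids (D u w')) * ?e))"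
      by (rule ennreal_leI)
    then show "(\<Sum>i<m. ennreal (cw l th ((conf w)(u := D u w')) (i # u))) \<le>
      ennreal (cw l th (conf w) u) * (ennreal (real (kids (D u w'))) * ennreal ?e)"
      by (simp add: sum_ennreal ennreal_mult)
  qed
  also have "\<dots> = (\<integral>\<^sup>+w. ennreal (cw l th (conf w) u) * (\<integral>\<^sup>+w'. ennreal (real (kids (D u w'))) * ennreal (exp (l * dpos (D u w') - th * life (D u w'))) \<partial>M) \<partial>M)"
    by (intro nn_integral_cong nn_integral_cmult) measurable
  also have "\<dots> = (\<integral>\<^sup>+w. ennreal (cw l th (conf w) u) * ennreal (2 / (1 + th - l\<^sup>2 / 2)) \<partial>M)"
    unfolding death_exp_moment[OF assms, where g="\<lambda>k. ennreal (real k)"] offspring_mean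
    using assms by (simp add: ennreal_mult[symmetric] ennreal_numeral[symmetric] del: ennreal_numeral)
  also have "\<dots> = ennreal (2 / (1 + th - l\<^sup>2 / 2)) * (\<integral>\<^sup>+w. ennreal (cw l th (conf w) u) \<partial>M)"
    by (subst nn_integral_multc) (auto simp: mult.commute)
  finally show ?thesis .
qed

lemma cw_generation_moment:
  assumes "0 < 1 + th - l\<^sup>2 / 2"
  shows "(\<Sum>u\<in>{u. set u \<subseteq> {..<m} \<and> length u = n}. \<integral>\<^sup>+w. ennreal (cw l th (conf w) u) \<partial>M)
     \<le> ennreal ((2 / (1 + th - l\<^sup>2 / 2)) ^ n)"
proof (induction n)
  case 0
  have "{u. set u \<subseteq> {..<m} \<and> length u = 0} = {[]}" by auto
  then show ?case by (simp add: cw_def emeasure_space_1)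
next
  case (Suc n)
  let ?r = "2 / (1 + th - l\<^sup>2 / 2)"
  let ?G = "\<lambda>n. {u. set u \<subseteq> {..<m} \<and> length u = n}"
  have fin: "finite (?G n)" for n using finite_lists_length_eq[of "{..<m}" n] by simp
  have "?G (Suc n) = (\<lambda>(u, i). i # u) ` (?G n \<times> {..<m})"
    by (auto simp: image_iff length_Suc_conv)
  then have "(\<Sum>u\<in>?G (Suc n). \<integral>\<^sup>+w. ennreal (cw l th (conf w) u) \<partial>M) =
     (\<Sum>u\<in>?G n. \<Sum>i<m. \<integral>\<^sup>+w. ennreal (cw l th (conf w) (i # u)) \<partial>M)"
    by (simp add: sum.reindex inj_on_def sum.cartesian_product case_prod_beta' comp_def)
  also have "\<dots> \<le> (\<Sum>u\<in>?G n. ennreal ?r * (\<integral>\<^sup>+w. ennreal (cw l th (conf w) u) \<partial>M))"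
    by (intro sum_mono cw_children_moment assms)
  also have "\<dots> = ennreal ?r * (\<Sum>u\<in>?G n. (\<integral>\<^sup>+w. ennreal (cw l th (conf w) u) \<partial>M))"
    by (simp add: sum_distrib_left)
  also have "\<dots> \<le> ennreal ?r * ennreal (?r ^ n)" by (intro mult_left_mono Suc.IH) auto
  also have "\<dots> = ennreal (?r ^ Suc n)" using assms by (subst ennreal_mult[symmetric]) auto
  finally show ?case .
qed

text \<open>A geometric series over generations, uniform in m. With R = 1 it serves subcritical
  weights; with R < 1 it also admits weights whose mean grows from one generation to the
  next.\<close>

lemma cw_lab_moment:
  assumes "0 < 1 + th - l\<^sup>2 / 2" and R: "0 \<le> R" "R * (2 / (1 + th - l\<^sup>2 / 2)) < 1"
  shows "(\<Sum>u\<in>lab m. ennreal (if n \<le> length u then R ^ length u else 0) * (\<integral>\<^sup>+w. ennreal (cw l th (conf w) u) \<partial>M))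
     \<le> ennreal ((R * (2 / (1 + th - l\<^sup>2 / 2))) ^ n / (1 - R * (2 / (1 + th - l\<^sup>2 / 2))))"
proof -
  let ?r = "2 / (1 + th - l\<^sup>2 / 2)"
  define e where "e u = (\<integral>\<^sup>+w. ennreal (cw l th (conf w) u) \<partial>M)" for u
  let ?G = "\<lambda>n. {u. set u \<subseteq> {..<m} \<and> length u = n}"
  have fin: "finite (?G n)" for n using finite_lists_length_eq[of "{..<m}" n] by simp
  have r: "0 \<le> ?r" using assms by auto
  have lab_eq: "lab m = (\<Union>k\<in>{..m}. ?G k)" by (auto simp: lab_def)
  have "(\<Sum>u\<in>lab m. ennreal (if n \<le> length u then R ^ length u else 0) * e u) =
    (\<Sum>k\<le>m. \<Sum>u\<in>?G k. ennreal (if n \<le> length u then R ^ length u else 0) * e u)"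
    unfolding lab_eq using fin by (subst sum.UNION_disjoint) auto
  also have "\<dots> = (\<Sum>k\<le>m. ennreal (if n \<le> k then R ^ k else 0) * (\<Sum>u\<in>?G k. e u))"
    unfolding sum_distrib_left by (intro sum.cong refl) auto
  also have "\<dots> \<le> (\<Sum>k\<le>m. ennreal (if n \<le> k then R ^ k else 0) * ennreal (?r ^ k))"
    unfolding e_def by (intro sum_mono mult_left_mono cw_generation_moment assms(1)) auto
  also have "\<dots> = ennreal (\<Sum>k\<le>m. if n \<le> k then (R * ?r) ^ k else 0)"
    using r R by (subst sum_ennreal[symmetric])
      (auto intro!: sum.cong simp: ennreal_mult[symmetric] power_mult_distrib power_divide simp del: sum_ennreal)
  also have "(\<Sum>k\<le>m. if n \<le> k then (R * ?r) ^ k else 0) = (\<Sum>k\<in>{n..m}. (R * ?r) ^ k)"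
    by (subst sum.inter_filter[symmetric]) (auto intro!: sum.cong)
  also have "ennreal \<dots> \<le> ennreal ((R * ?r) ^ n / (1 - R * ?r))"
  proof (rule ennreal_leI)
    have nn: "0 \<le> R * ?r" using r R by auto
    show "(\<Sum>k\<in>{n..m}. (R * ?r) ^ k) \<le> (R * ?r) ^ n / (1 - R * ?r)"
    proof (cases "n \<le> m")
      case True
      then have "(\<Sum>k\<in>{n..m}. (R * ?r) ^ k) = ((R * ?r) ^ n - (R * ?r) ^ Suc m) / (1 - R * ?r)"
        using R by (subst sum_gp) auto
      also have "\<dots> \<le> (R * ?r) ^ n / (1 - R * ?r)" using R zero_le_power[OF nn, of "Suc m"] by (intro divide_right_mono) linarith+
      finally show ?thesis .
    qed (use R nn in auto)
  qed
  finally show ?thesis unfolding e_def .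
qed

end

section \<open>Centred sums over the tree\<close>

context bbm_model begin

lemma cbirth_nonneg: "AE w in M. \<forall>u. 0 \<le> cbirth (conf w) u"
proof -
  have "AE w in M. \<forall>u. 0 < tau u w" using tau_pos by (simp add: AE_all_countable)
  then show ?thesis
  proof eventually_elim
    case (elim w)
    show ?case
    proof
      fix u show "0 \<le> cbirth (conf w) u"
        using elim by (induction u) (auto simp: conf_def less_imp_le intro!: add_nonneg_nonneg)
    qed
  qed
qed

text \<open>The labels are added in order of increasing length. The partial sum and the weight of the new
  label \<open>u\<close> then do not depend on the data of \<open>u\<close>, so the linear term of the two-point inequality has
  mean zero.\<close>

lemma centered_sum_moment:
  fixes \<psi> :: "nat list \<Rightarrow> real \<Rightarrow> real \<Rightarrow> pdata \<Rightarrow> real" and G :: "nat list \<Rightarrow> real \<Rightarrow> real \<Rightarrow> real"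
    and \<beta> c p :: real
  assumes meas: "\<And>u. (\<lambda>(s, y, d). \<psi> u s y d) \<in> borel_measurable (borel \<Otimes>\<^sub>M (borel \<Otimes>\<^sub>M pdata_space))"
    and p: "1 \<le> p" "p \<le> 2"
    and Gm: "\<And>u. (\<lambda>(s, y). G u s y) \<in> borel_measurable (borel \<Otimes>\<^sub>M borel)"
    and G: "\<And>u s y. 0 \<le> s \<Longrightarrow> 0 < G u s y"
    and bnd: "\<And>u s y. 0 \<le> s \<Longrightarrow> (\<integral>\<^sup>+w. ennreal (\<bar>\<psi> u s y (D u w)\<bar> powr p) \<partial>M) \<le> ennreal (G u s y)"
    and U: "finite U"
  defines "X \<equiv> \<lambda>x u. cw \<beta> c x u * (\<psi> u (cbirth x u) (cstart x u - \<beta> * cbirth x u) (x u)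
        - (\<integral>w. \<psi> u (cbirth x u) (cstart x u - \<beta> * cbirth x u) (D u w) \<partial>M))"
  shows "(\<integral>\<^sup>+w. ennreal (\<bar>\<Sum>u\<in>U. X (conf w) u\<bar> powr p) \<partial>M)
     \<le> 120 * (\<Sum>u\<in>U. \<integral>\<^sup>+w. ennreal (cw (p * \<beta>) (p * c) (conf w) u * G u (cbirth (conf w) u) (cstart (conf w) u - \<beta> * cbirth (conf w) u)) \<partial>M)"
proof -
  define m where "m u s y = (\<integral>w. \<psi> u s y (D u w) \<partial>M)" for u s y
  define yy where "yy x u = cstart x u - \<beta> * cbirth x u" for x u
  have yym[measurable]: "(\<lambda>x. yy x u) \<in> borel_measurable conf_space" for u unfolding yy_def by measurable
  have X: "X x u = cw \<beta> c x u * (\<psi> u (cbirth x u) (yy x u) (x u) - m u (cbirth x u) (yy x u))" for x u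
    by (simp add: X_def m_def yy_def)
  have psiD: "(\<lambda>w. \<psi> u s y (D u w)) \<in> borel_measurable M" for u s y
    by (rule measurable_compose3[OF meas]) auto
  have psiC: "(\<lambda>x. \<psi> u (cbirth x u) (yy x u) (x u)) \<in> borel_measurable conf_space" for u
    by (rule measurable_compose3[OF meas]) auto
  have mm: "(\<lambda>z. m u (fst z) (snd z)) \<in> borel_measurable (borel \<Otimes>\<^sub>M borel)" for u
    unfolding m_def
  proof (rule borel_measurable_lebesgue_integral)
    show "(\<lambda>(x, w). \<psi> u (fst x) (snd x) (D u w)) \<in> borel_measurable ((borel \<Otimes>\<^sub>M borel) \<Otimes>\<^sub>M M)"
      unfolding case_prod_beta' by (rule measurable_compose3[OF meas]) auto
  qed
  have mC: "(\<lambda>x. m u (cbirth x u) (yy x u)) \<in> borel_measurable conf_space" for u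
    using measurable_compose[OF _ mm, of "\<lambda>x. (cbirth x u, yy x u)" conf_space u] by simp
  have Xm[measurable]: "(\<lambda>x. X x u) \<in> borel_measurable conf_space" for u
    unfolding X using psiC mC by measurable
  have psi_int: "integrable M (\<lambda>w. \<psi> u s y (D u w))"
    and m_le: "\<bar>m u s y\<bar> powr p \<le> 4 * G u s y" if s: "0 \<le> s" for u s y
  proof -
    note [measurable] = psiD[of u s y]
    have pint: "integrable M (\<lambda>w. \<bar>\<psi> u s y (D u w)\<bar> powr p)"
      using bnd[OF s, of u y] by (intro integrableI_bounded) (auto intro: le_less_trans)
    have pE: "(\<integral>w. \<bar>\<psi> u s y (D u w)\<bar> powr p \<partial>M) \<le> G u s y"
      using bnd[OF s, of u y] nn_integral_eq_integral[OF pint] G[OF s, of u y] by simp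
    \<comment> \<open>At the scale e = G^(1/p) the interpolation gives |m| \<le> e + e^(1-p) e^p = 2
      e, that is, Jensen's inequality up to the factor 2^p \<le> 4. The same bound shows
      integrability.\<close>
    define e where "e = G u s y powr (1 / p)"
    have e: "0 < e" using G[OF s, of u y] by (simp add: e_def)
    have ep: "e powr p = G u s y" using p G[OF s, of u y] by (simp add: e_def powr_powr)
    show int: "integrable M (\<lambda>w. \<psi> u s y (D u w))"
      by (rule Bochner_Integration.integrable_bound[of _ "\<lambda>w. e + e powr (1 - p) * \<bar>\<psi> u s y (D u w)\<bar> powr p"])
         (use pint abs_le_plus_powr[OF e p(1)] in \<open>auto intro: order_trans abs_ge_self\<close>)
    have "\<bar>m u s y\<bar> \<le> (\<integral>w. \<bar>\<psi> u s y (D u w)\<bar> \<partial>M)" unfolding m_def by (rule integral_abs_bound)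
    also have "\<dots> \<le> (\<integral>w. e + e powr (1 - p) * \<bar>\<psi> u s y (D u w)\<bar> powr p \<partial>M)"
      using int pint abs_le_plus_powr[OF e p(1)] by (intro integral_mono) auto
    also have "\<dots> = e + e powr (1 - p) * (\<integral>w. \<bar>\<psi> u s y (D u w)\<bar> powr p \<partial>M)"
      using pint by (simp add: prob_space)
    also have "\<dots> \<le> e + e powr (1 - p) * e powr p" unfolding ep using pE by (intro add_left_mono mult_left_mono) auto
    also have "\<dots> = 2 * e" using e by (simp add: powr_add[symmetric])
    finally have "\<bar>m u s y\<bar> powr p \<le> (2 * e) powr p" using p by (intro powr_mono2) auto
    also have "\<dots> = 2 powr p * G u s y" using ep by (simp add: powr_mult)
    also have "\<dots> \<le> 2 powr (2::real) * G u s y" using p G[OF s, of u y] by (intro mult_right_mono powr_mono) auto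
    finally show "\<bar>m u s y\<bar> powr p \<le> 4 * G u s y" by simp
  qed
  \<comment> \<open>Centring costs 20 = 4 (1 + 4): the factor 4 for a sum of two terms, and the
    bound 4 G for the mean.\<close>
  have cen: "(\<integral>\<^sup>+w. ennreal (\<bar>\<psi> u s y (D u w) - m u s y\<bar> powr p) \<partial>M) \<le> ennreal (20 * G u s y)" if s: "0 \<le> s" for u s y
  proof -
    note [measurable] = psiD[of u s y]
    have "(\<integral>\<^sup>+w. ennreal (\<bar>\<psi> u s y (D u w) - m u s y\<bar> powr p) \<partial>M)
      \<le> (\<integral>\<^sup>+w. ennreal 4 * ennreal (\<bar>\<psi> u s y (D u w)\<bar> powr p) + ennreal (16 * G u s y) \<partial>M)"
    proof (intro nn_integral_mono)
      fix w
      have "\<bar>\<psi> u s y (D u w) - m u s y\<bar> powr p \<le> 4 * (\<bar>\<psi> u s y (D u w)\<bar> powr p + \<bar>- m u s y\<bar> powr p)"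
        using abs_add_powr_le_4[OF p, of "\<psi> u s y (D u w)" "- m u s y"] by simp
      also have "\<dots> \<le> 4 * \<bar>\<psi> u s y (D u w)\<bar> powr p + 16 * G u s y" using m_le[OF s, of u y] by simp
      finally have "ennreal (\<bar>\<psi> u s y (D u w) - m u s y\<bar> powr p) \<le> ennreal (4 * \<bar>\<psi> u s y (D u w)\<bar> powr p + 16 * G u s y)"
        by (rule ennreal_leI)
      then show "ennreal (\<bar>\<psi> u s y (D u w) - m u s y\<bar> powr p) \<le> ennreal 4 * ennreal (\<bar>\<psi> u s y (D u w)\<bar> powr p) + ennreal (16 * G u s y)"
        using G[OF s, of u y] by (simp add: ennreal_plus ennreal_mult less_imp_le)
    qed
    also have "\<dots> = ennreal 4 * (\<integral>\<^sup>+w. ennreal (\<bar>\<psi> u s y (D u w)\<bar> powr p) \<partial>M) + ennreal (16 * G u s y)"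
      by (subst nn_integral_add) (auto simp: nn_integral_cmult emeasure_space_1)
    also have "\<dots> \<le> ennreal 4 * ennreal (G u s y) + ennreal (16 * G u s y)"
      by (intro add_right_mono mult_left_mono bnd s) auto
    also have "\<dots> = ennreal (4 * G u s y + 16 * G u s y)" using G[OF s, of u y]
      by (subst ennreal_plus) (auto simp: ennreal_mult less_imp_le)
    also have "4 * G u s y + 16 * G u s y = 20 * G u s y" by simp
    finally show ?thesis .
  qed
  define T where "T u = (\<integral>\<^sup>+w. ennreal (cw (p * \<beta>) (p * c) (conf w) u * G u (cbirth (conf w) u) (yy (conf w) u)) \<partial>M)" for u
  have XT: "(\<integral>\<^sup>+w. ennreal (\<bar>X (conf w) u\<bar> powr p) \<partial>M) \<le> 20 * T u" for u
  proof -
    have "(\<integral>\<^sup>+w. ennreal (\<bar>X (conf w) u\<bar> powr p) \<partial>M) = (\<integral>\<^sup>+w. \<integral>\<^sup>+w'. ennreal (\<bar>X ((conf w)(u := D u w')) u\<bar> powr p) \<partial>M \<partial>M)"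
      by (rule resample_nn_integral[where h="\<lambda>x. ennreal (\<bar>X x u\<bar> powr p)"]) measurable
    also have "\<dots> \<le> (\<integral>\<^sup>+w. ennreal 20 * ennreal (cw (p * \<beta>) (p * c) (conf w) u * G u (cbirth (conf w) u) (yy (conf w) u)) \<partial>M)"
    proof (intro nn_integral_mono_AE, use cbirth_nonneg in eventually_elim)
      fix w assume s: "\<forall>u. 0 \<le> cbirth (conf w) u"
      let ?s = "cbirth (conf w) u" and ?y = "yy (conf w) u" and ?a = "cw (p * \<beta>) (p * c) (conf w) u"
      note [measurable] = psiD[of u ?s ?y]
      have "(\<integral>\<^sup>+w'. ennreal (\<bar>X ((conf w)(u := D u w')) u\<bar> powr p) \<partial>M)
         = (\<integral>\<^sup>+w'. ennreal ?a * ennreal (\<bar>\<psi> u ?s ?y (D u w') - m u ?s ?y\<bar> powr p) \<partial>M)"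
        using p by (intro nn_integral_cong)
          (simp add: X cw_upd prefix_upd yy_def abs_mult powr_mult cw_powr[symmetric] ennreal_mult)
      also have "\<dots> = ennreal ?a * (\<integral>\<^sup>+w'. ennreal (\<bar>\<psi> u ?s ?y (D u w') - m u ?s ?y\<bar> powr p) \<partial>M)"
        by (rule nn_integral_cmult) measurable
      also have "\<dots> \<le> ennreal ?a * ennreal (20 * G u ?s ?y)"
        using s by (intro mult_left_mono cen) auto
      also have "\<dots> = ennreal 20 * ennreal (?a * G u ?s ?y)"
        using G[of ?s u ?y] s by (simp add: ennreal_mult less_imp_le ac_simps)
      finally show "(\<integral>\<^sup>+w'. ennreal (\<bar>X ((conf w)(u := D u w')) u\<bar> powr p) \<partial>M) \<le> ennreal 20 * ennreal (?a * G u ?s ?y)" .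
    qed
    also have "\<dots> = 20 * T u"
    proof -
      have "(\<lambda>w. G u (cbirth (conf w) u) (yy (conf w) u)) \<in> borel_measurable M"
        using measurable_compose[OF _ Gm[of u], of "\<lambda>w. (cbirth (conf w) u, yy (conf w) u)" M] by simp
      then show ?thesis unfolding T_def by (subst nn_integral_cmult) auto
    qed
    finally show ?thesis .
  qed
  \<comment> \<open>Each new label adds 6 times its own moment by the two-point inequality, and that
    moment is at most 20 \<open>T u\<close>; hence the final constant 120.\<close>
  have "(\<integral>\<^sup>+w. ennreal (\<bar>\<Sum>u\<in>U. X (conf w) u\<bar> powr p) \<partial>M) \<le> 6 * (\<Sum>u\<in>U. 20 * T u)"
    using U
  proof (induction U rule: finite_ranking_induct[where f=length])
    case empty
    then show ?case by simp
  next
    case (insert u U)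
    show ?case
    proof (cases "u \<in> U")
      case True
      then show ?thesis using insert.IH by (simp add: insert_absorb)
    next
      case u: False
      define S where "S x = (\<Sum>v\<in>U. X x v)" for x
      have [measurable]: "S \<in> borel_measurable conf_space" unfolding S_def by measurable
      show ?thesis
      \<comment> \<open>An infinite bound is trivial. Otherwise both p-th moments are finite, so the
        linear term is integrable and may be separated from the rest.\<close>
      proof (cases "(\<Sum>v\<in>U. 20 * T v) = \<infinity> \<or> 20 * T u = \<infinity>")
        case True
        then have "(\<Sum>v\<in>insert u U. 20 * T v) = \<infinity>" using insert(1) u by auto
        then show ?thesis by (simp add: ennreal_mult_top)
      next
        case False
        have Sfin: "(\<integral>\<^sup>+w. ennreal (\<bar>S (conf w)\<bar> powr p) \<partial>M) < \<infinity>"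
        proof -
          have "6 * (\<Sum>v\<in>U. 20 * T v) < \<infinity>" using False
            by (auto simp: ennreal_mult_less_top less_top)
          then show ?thesis using insert.IH unfolding S_def by (rule le_less_trans[rotated])
        qed
        have Xfin: "(\<integral>\<^sup>+w. ennreal (\<bar>X (conf w) u\<bar> powr p) \<partial>M) < \<infinity>"
          using XT[of u] False by (auto simp: less_top intro: le_less_trans)
        have iS: "integrable M (\<lambda>w. \<bar>S (conf w)\<bar> powr p)" using Sfin by (intro integrableI_bounded) auto
        have iX: "integrable M (\<lambda>w. \<bar>X (conf w) u\<bar> powr p)" using Xfin by (intro integrableI_bounded) auto
        define h where "h x = p * (sgn (S x) * \<bar>S x\<bar> powr (p - 1)) * X x u" for x
        have [measurable]: "h \<in> borel_measurable conf_space" unfolding h_def by measurable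
        \<comment> \<open>Integrability follows from a^(p-1) b \<le> max(a, b)^p \<le> a^p +
          b^p.\<close>
        have ih: "integrable M (\<lambda>w. h (conf w))"
        proof (rule Bochner_Integration.integrable_bound[of _ "\<lambda>w. 2 * (\<bar>S (conf w)\<bar> powr p + \<bar>X (conf w) u\<bar> powr p)"])
          show "AE w in M. norm (h (conf w)) \<le> norm (2 * (\<bar>S (conf w)\<bar> powr p + \<bar>X (conf w) u\<bar> powr p))"
          proof (intro AE_I2)
            fix w
            define a b where "a = \<bar>S (conf w)\<bar>" and "b = \<bar>X (conf w) u\<bar>"
            have ab: "0 \<le> a" "0 \<le> b" by (auto simp: a_def b_def)
            have q: "t powr (p - 1) * t = t powr p" if "0 \<le> t" for t :: real
              using that powr_add[of t "p - 1" 1] by (cases "t = 0") (use p in auto)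
            have "a powr (p - 1) * b \<le> max a b powr (p - 1) * max a b"
              using ab p by (intro mult_mono powr_mono2) auto
            also have "\<dots> = max a b powr p" using q[of "max a b"] ab by auto
            also have "\<dots> \<le> a powr p + b powr p" by (auto simp: max_def)
            finally have ab': "a powr (p - 1) * b \<le> a powr p + b powr p" .
            have "\<bar>h (conf w)\<bar> = p * \<bar>sgn (S (conf w))\<bar> * (a powr (p - 1) * b)"
              unfolding h_def a_def b_def using p by (simp add: abs_mult)
            also have "\<dots> \<le> 2 * 1 * (a powr p + b powr p)"
              using p ab ab' by (intro mult_mono) (auto simp: abs_sgn_eq)
            finally show "norm (h (conf w)) \<le> norm (2 * (\<bar>S (conf w)\<bar> powr p + \<bar>X (conf w) u\<bar> powr p))"
              unfolding a_def b_def by simp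
          qed
        qed (use iS iX in auto)
        have h0: "(\<integral>w. h (conf w) \<partial>M) = 0"
        proof -
          have "(\<integral>w. h (conf w) \<partial>M) = (\<integral>w. (\<integral>w'. h ((conf w)(u := D u w')) \<partial>M) \<partial>M)"
            by (rule resample_integral) (auto simp: ih)
          also have "\<dots> = (\<integral>w. 0 \<partial>M)"
          proof (intro integral_cong_AE)
            show "(\<lambda>w. \<integral>w'. h ((conf w)(u := D u w')) \<partial>M) \<in> borel_measurable M"
              using measurable_conf_upd[of u] by (intro borel_measurable_lebesgue_integral) (auto simp: case_prod_beta')
            show "AE w in M. (\<integral>w'. h ((conf w)(u := D u w')) \<partial>M) = 0"
              using cbirth_nonneg
            proof eventually_elim
              case (elim w)
              let ?s = "cbirth (conf w) u" and ?y = "yy (conf w) u"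
              have "S ((conf w)(u := d)) = S (conf w)" for d
                unfolding S_def
              proof (intro sum.cong refl)
                fix v assume v: "v \<in> U"
                then have "v \<noteq> u" "length v \<le> length u" using u insert(2) by auto
                then show "X ((conf w)(u := d)) v = X (conf w) v" by (simp add: X cw_upd prefix_upd yy_def)
              qed
              then have "h ((conf w)(u := d)) = (p * (sgn (S (conf w)) * \<bar>S (conf w)\<bar> powr (p - 1)) * cw \<beta> c (conf w) u) * (\<psi> u ?s ?y d - m u ?s ?y)" for d
                by (simp add: h_def X cw_upd prefix_upd yy_def)
              then have "(\<integral>w'. h ((conf w)(u := D u w')) \<partial>M) =
                (p * (sgn (S (conf w)) * \<bar>S (conf w)\<bar> powr (p - 1)) * cw \<beta> c (conf w) u) * (\<integral>w'. \<psi> u ?s ?y (D u w') - m u ?s ?y \<partial>M)"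
                by simp
              also have "(\<integral>w'. \<psi> u ?s ?y (D u w') - m u ?s ?y \<partial>M) = 0"
                using psi_int[of ?s u ?y] elim by (simp add: m_def prob_space)
              finally show ?case by (simp add: fun_upd_def)
            qed
          qed simp
          finally show ?thesis by simp
        qed
        have isum: "integrable M (\<lambda>w. \<bar>S (conf w)\<bar> powr p + h (conf w) + 6 * \<bar>X (conf w) u\<bar> powr p)"
          using iS iX ih by auto
        have ptw: "\<bar>S (conf w) + X (conf w) u\<bar> powr p \<le> \<bar>S (conf w)\<bar> powr p + h (conf w) + 6 * \<bar>X (conf w) u\<bar> powr p" for w
          unfolding h_def by (rule abs_add_powr_le[OF p])
        have "(\<integral>\<^sup>+w. ennreal (\<bar>\<Sum>v\<in>insert u U. X (conf w) v\<bar> powr p) \<partial>M)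
          = (\<integral>\<^sup>+w. ennreal (\<bar>S (conf w) + X (conf w) u\<bar> powr p) \<partial>M)"
          using insert(1) u by (simp add: S_def add.commute)
        also have "\<dots> \<le> (\<integral>\<^sup>+w. ennreal (\<bar>S (conf w)\<bar> powr p + h (conf w) + 6 * \<bar>X (conf w) u\<bar> powr p) \<partial>M)"
          by (intro nn_integral_mono ennreal_leI ptw)
        also have "\<dots> = ennreal (\<integral>w. \<bar>S (conf w)\<bar> powr p + h (conf w) + 6 * \<bar>X (conf w) u\<bar> powr p \<partial>M)"
          by (rule nn_integral_eq_integral[OF isum]) (intro AE_I2 order_trans[OF powr_ge_zero ptw])
        also have "(\<integral>w. \<bar>S (conf w)\<bar> powr p + h (conf w) + 6 * \<bar>X (conf w) u\<bar> powr p \<partial>M)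
          = (\<integral>w. \<bar>S (conf w)\<bar> powr p \<partial>M) + 6 * (\<integral>w. \<bar>X (conf w) u\<bar> powr p \<partial>M)"
          using iS iX ih h0 by simp
        also have "ennreal \<dots> = (\<integral>\<^sup>+w. ennreal (\<bar>S (conf w)\<bar> powr p) \<partial>M) + 6 * (\<integral>\<^sup>+w. ennreal (\<bar>X (conf w) u\<bar> powr p) \<partial>M)"
          using nn_integral_eq_integral[OF iS] nn_integral_eq_integral[OF iX] by (simp add: ennreal_plus ennreal_mult)
        also have "\<dots> \<le> 6 * (\<Sum>v\<in>U. 20 * T v) + 6 * (20 * T u)"
          using insert.IH XT[of u] unfolding S_def by (intro add_mono mult_left_mono) auto
        also have "\<dots> = 6 * (\<Sum>v\<in>insert u U. 20 * T v)"
          using insert(1) u by (simp add: distrib_left add.commute)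
        finally show ?thesis .
      qed
    qed
  qed
  also have "\<dots> = 120 * (\<Sum>u\<in>U. T u)" by (simp add: sum_distrib_left[symmetric] mult.assoc[symmetric])
  finally show ?thesis unfolding T_def yy_def .
qed

end

section \<open>Non-explosion and moments of sums over the random tree\<close>

context bbm_model begin

lemma AE_lab_sum_finite:
  assumes [measurable]: "\<And>u. g u \<in> borel_measurable M" and le: "\<And>m. (\<Sum>u\<in>lab m. \<integral>\<^sup>+w. g u w \<partial>M) \<le> ennreal C"
  shows "AE w in M. \<exists>K. \<forall>m. (\<Sum>u\<in>lab m. g u w) \<le> ennreal K"
proof -
  have "(\<integral>\<^sup>+w. (SUP m. \<Sum>u\<in>lab m. g u w) \<partial>M) = (SUP m. \<integral>\<^sup>+w. (\<Sum>u\<in>lab m. g u w) \<partial>M)"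
    by (rule nn_integral_monotone_convergence_SUP)
       (auto simp: incseq_def le_fun_def intro!: sum_mono2 lab_mono)
  also have "\<dots> \<le> ennreal C" using le by (intro SUP_least) (simp add: nn_integral_sum)
  finally have "(\<integral>\<^sup>+w. (SUP m. \<Sum>u\<in>lab m. g u w) \<partial>M) \<noteq> \<infinity>" by (metis ennreal_less_top infinity_ennreal_def leD)
  then have "AE w in M. (SUP m. \<Sum>u\<in>lab m. g u w) \<noteq> \<infinity>"
    by (intro nn_integral_noteq_infinite) auto
  then show ?thesis
  proof eventually_elim
    case (elim w)
    then obtain K where "(SUP m. \<Sum>u\<in>lab m. g u w) = ennreal K"
      by (cases "SUP m. \<Sum>u\<in>lab m. g u w") auto
    then show ?case by (metis SUP_upper UNIV_I)
  qed
qed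

definition born :: "'a \<Rightarrow> real \<Rightarrow> nat list set" where
  "born w T = {u. cex (conf w) u \<and> cbirth (conf w) u \<le> T}"

text \<open>The almost sure event on which the whole path-by-path analysis takes place: positive
  lifetimes and no explosion.\<close>

definition good :: "'a \<Rightarrow> bool" where
  "good w \<longleftrightarrow> w \<in> space M \<and> (\<forall>u. 0 < tau u w) \<and> (\<forall>T. finite (born w T))"

text \<open>With l = 0 and th = 3 the generation factor is 2 / 4, so the sum of exp (-3 s) over all
  birth times s has mean at most 2. Infinitely many births before T would each contribute at least
  exp (-3 T).\<close>

lemma AE_good: "AE w in M. good w"
proof -
  have "AE w in M. \<exists>K. \<forall>m. (\<Sum>u\<in>lab m. ennreal (cw 0 3 (conf w) u)) \<le> ennreal K"
  proof (rule AE_lab_sum_finite)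
    fix m
    show "(\<Sum>u\<in>lab m. \<integral>\<^sup>+w. ennreal (cw 0 3 (conf w) u) \<partial>M) \<le> ennreal 2"
      using cw_lab_moment[of 3 0 1 0 m] by simp
  qed measurable
  moreover have "AE w in M. \<forall>u. 0 < tau u w" using tau_pos by (simp add: AE_all_countable)
  ultimately show ?thesis using AE_space
  proof eventually_elim
    case (elim w)
    then obtain K where K: "\<And>m. (\<Sum>u\<in>lab m. ennreal (cw 0 3 (conf w) u)) \<le> ennreal K" by blast
    have "finite (born w T)" for T
    proof (rule ccontr)
      assume inf: "infinite (born w T)"
      obtain N :: nat where N: "\<bar>K\<bar> * exp (3 * T) < real N" using reals_Archimedean2 by blast
      obtain F where F: "finite F" "card F = N" "F \<subseteq> born w T"
        using infinite_arbitrarily_large[OF inf] by blast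
      obtain m where m: "F \<subseteq> lab m" using finite_subset_lab[OF F(1)] by blast
      have "real N * exp (- 3 * T) = (\<Sum>u\<in>F. exp (- 3 * T))" using F by simp
      also have "\<dots> \<le> (\<Sum>u\<in>F. cw 0 3 (conf w) u)"
        using F by (intro sum_mono) (auto simp: born_def cw_def)
      also have "\<dots> \<le> (\<Sum>u\<in>lab m. cw 0 3 (conf w) u)" using m by (intro sum_mono2) auto
      also have "\<dots> \<le> \<bar>K\<bar>"
      proof -
        have "ennreal (\<Sum>u\<in>lab m. cw 0 3 (conf w) u) \<le> ennreal \<bar>K\<bar>"
          using K[of m] by (auto simp: sum_ennreal[symmetric] simp del: sum_ennreal intro: order_trans ennreal_leI)
        then show ?thesis by (subst (asm) ennreal_le_iff) auto
      qed
      finally have "real N * exp (- 3 * T) * exp (3 * T) \<le> \<bar>K\<bar> * exp (3 * T)" by (intro mult_right_mono) auto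
      then show False using N by (simp add: mult.assoc exp_add[symmetric])
    qed
    then show ?case using elim by (simp add: good_def)
  qed
qed

lemma cbirth_conf: "bbm_birth (\<lambda>v. tau v w) u = cbirth (conf w) u"
  by (induction u) (auto simp: conf_def)

lemma cex_conf: "bbm_exists (\<lambda>v. L v w) u = cex (conf w) u"
  by (induction u) (auto simp: conf_def)

lemma cstart_conf:
  assumes "w \<in> space M"
  shows "bbm_pos (\<lambda>v. tau v w) (\<lambda>v. B v w) u t = cstart (conf w) u + B u w (t - cbirth (conf w) u)"
proof (induction u arbitrary: t)
  case (Cons i u)
  have "bbm_pos (\<lambda>v. tau v w) (\<lambda>v. B v w) u (bbm_death (\<lambda>v. tau v w) u) = cstart (conf w) (i # u)"
    unfolding Cons.IH using assms by (simp add: bbm_death_def cbirth_conf conf_def dpos_D)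
  then show ?case using cbirth_conf[of w "i # u"] by simp
qed simp

lemma finite_born: "good w \<Longrightarrow> finite (born w T)" by (simp add: good_def)

text \<open>The starting point in the frame that moves with speed \<beta>, the drift which the
  exponential weight produces.\<close>

definition yst :: "real \<Rightarrow> (nat list \<Rightarrow> pdata) \<Rightarrow> nat list \<Rightarrow> real" where
  "yst \<beta> x u = cstart x u - \<beta> * cbirth x u"

text \<open>The weight of all children together at their birth, relative to the weight of the parent
  at its own birth.\<close>

definition kidw :: "real \<Rightarrow> real \<Rightarrow> pdata \<Rightarrow> real" where
  "kidw \<beta> c d = real (kids d) * exp (\<beta> * dpos d - c * life d)"

lemma measurable_kidw [measurable]: "kidw \<beta> c \<in> borel_measurable pdata_space"
  unfolding kidw_def[abs_def] by measurable

lemma kidw_nonneg [simp]: "0 \<le> kidw \<beta> c d" by (simp add: kidw_def)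

text \<open>Regrouping by parents: siblings share birth time and starting point, and a child born by
  time T has a parent born before T because lifetimes are positive. This identity drives the
  telescoping and also moves initial weights from children to parents.\<close>

lemma born_children:
  assumes "good w"
  shows "(\<Sum>v\<in>{v\<in>born w T. Suc n \<le> length v}. cw \<beta> c (conf w) v * G (cbirth (conf w) v) (yst \<beta> (conf w) v)) =
    (\<Sum>u\<in>{u\<in>born w T. n \<le> length u}. cw \<beta> c (conf w) u * (if cbirth (conf w) u + life (D u w) \<le> T
       then kidw \<beta> c (D u w) * G (cbirth (conf w) u + life (D u w)) (yst \<beta> (conf w) u + dpos (D u w) - \<beta> * life (D u w)) else 0))"
proof -
  let ?x = "conf w"
  let ?U = "{u\<in>born w T. n \<le> length u \<and> cbirth ?x u + tau u w \<le> T}"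
  have fin: "finite (born w T)" using assms by (rule finite_born)
  have pos: "0 < tau u w" for u using assms by (simp add: good_def)
  have "{v\<in>born w T. Suc n \<le> length v} = (\<lambda>(u, i). i # u) ` (SIGMA u:?U. {..<L u w})"
  proof (intro equalityI subsetI)
    fix v assume v: "v \<in> {v\<in>born w T. Suc n \<le> length v}"
    then obtain i u where vu: "v = i # u" by (cases v) auto
    have "(u, i) \<in> (SIGMA u:?U. {..<L u w})"
      using v pos[of u] by (auto simp: vu born_def conf_def)
    then show "v \<in> (\<lambda>(u, i). i # u) ` (SIGMA u:?U. {..<L u w})" using vu by force
  qed (auto simp: born_def conf_def)
  then have "(\<Sum>v\<in>{v\<in>born w T. Suc n \<le> length v}. cw \<beta> c ?x v * G (cbirth ?x v) (yst \<beta> ?x v)) =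
     (\<Sum>(u, i)\<in>(SIGMA u:?U. {..<L u w}). cw \<beta> c ?x (i # u) * G (cbirth ?x (i # u)) (yst \<beta> ?x (i # u)))"
    by (simp add: sum.reindex inj_on_def case_prod_beta' comp_def)
  also have "\<dots> = (\<Sum>u\<in>?U. \<Sum>i<L u w. cw \<beta> c ?x (i # u) * G (cbirth ?x (i # u)) (yst \<beta> ?x (i # u)))"
    using fin by (subst sum.Sigma) auto
  also have "\<dots> = (\<Sum>u\<in>?U. cw \<beta> c ?x u * (kidw \<beta> c (D u w) * G (cbirth ?x u + life (D u w)) (yst \<beta> ?x u + dpos (D u w) - \<beta> * life (D u w))))"
  proof (intro sum.cong refl)
    fix u assume "u \<in> ?U"
    have "(\<Sum>i<L u w. cw \<beta> c ?x (i # u) * G (cbirth ?x (i # u)) (yst \<beta> ?x (i # u))) =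
      (\<Sum>i<L u w. cw \<beta> c ?x u * exp (\<beta> * dpos (D u w) - c * tau u w) * G (cbirth ?x u + tau u w) (yst \<beta> ?x u + dpos (D u w) - \<beta> * tau u w))"
      by (intro sum.cong refl) (auto simp: cw_Cons conf_def yst_def algebra_simps)
    then show "(\<Sum>i<L u w. cw \<beta> c ?x (i # u) * G (cbirth ?x (i # u)) (yst \<beta> ?x (i # u))) =
       cw \<beta> c ?x u * (kidw \<beta> c (D u w) * G (cbirth ?x u + life (D u w)) (yst \<beta> ?x u + dpos (D u w) - \<beta> * life (D u w)))"
      by (simp add: kidw_def)
  qed
  also have "\<dots> = (\<Sum>u\<in>{u\<in>born w T. n \<le> length u}. cw \<beta> c ?x u * (if cbirth ?x u + life (D u w) \<le> T
       then kidw \<beta> c (D u w) * G (cbirth ?x u + life (D u w)) (yst \<beta> ?x u + dpos (D u w) - \<beta> * life (D u w)) else 0))"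
    using fin by (intro sum.mono_neutral_cong_left) auto
  finally show ?thesis .
qed

text \<open>The bound for finite label sets extends to the random set of particles born by time T:
  since \<psi> vanishes for births after T, the sums over \<open>lab m\<close> are eventually
  constant, and Fatou's lemma applies. The permitted growth exp (\<kappa> s) is absorbed by lowering
  the discount from p c to p c - \<kappa>; summing only from generation n on leaves
  \<rho>^n.\<close>

lemma tree_sum_moment:
  fixes \<psi> :: "nat list \<Rightarrow> real \<Rightarrow> real \<Rightarrow> pdata \<Rightarrow> real"
  assumes meas: "\<And>u. (\<lambda>(s, y, d). \<psi> u s y d) \<in> borel_measurable (borel \<Otimes>\<^sub>M (borel \<Otimes>\<^sub>M pdata_space))"
    and p: "1 \<le> p" "p \<le> 2"
    and K: "0 < K"
    and bnd: "\<And>u s y. 0 \<le> s \<Longrightarrow> (\<integral>\<^sup>+w. ennreal (\<bar>\<psi> u s y (D u w)\<bar> powr p) \<partial>M) \<le> ennreal (K * exp (\<kappa> * s))"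
    and sup: "\<And>u s y d. T < s \<Longrightarrow> \<psi> u s y d = 0"
    and \<rho>: "2 < 1 + (p * c - \<kappa>) - (p * \<beta>)\<^sup>2 / 2"
  defines "\<rho> \<equiv> 2 / (1 + (p * c - \<kappa>) - (p * \<beta>)\<^sup>2 / 2)"
  shows "(\<integral>\<^sup>+w. ennreal (\<bar>\<Sum>u\<in>{u\<in>born w T. n \<le> length u}. cw \<beta> c (conf w) u *
         (\<psi> u (cbirth (conf w) u) (yst \<beta> (conf w) u) (D u w)
        - (\<integral>w'. \<psi> u (cbirth (conf w) u) (yst \<beta> (conf w) u) (D u w') \<partial>M))\<bar> powr p) \<partial>M)
     \<le> ennreal (120 * K * \<rho> ^ n / (1 - \<rho>))"
proof -
  define X where "X x u = cw \<beta> c x u * (\<psi> u (cbirth x u) (cstart x u - \<beta> * cbirth x u) (x u)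
        - (\<integral>w. \<psi> u (cbirth x u) (cstart x u - \<beta> * cbirth x u) (D u w) \<partial>M))" for x u
  let ?U = "\<lambda>m. {u\<in>lab m. n \<le> length u}"
  define S where "S m w = ennreal (\<bar>\<Sum>u\<in>?U m. X (conf w) u\<bar> powr p)" for m w
  have \<rho>1: "\<rho> < 1" "0 \<le> \<rho>" using \<rho> by (auto simp: \<rho>_def)
  have le: "(\<integral>\<^sup>+w. S m w \<partial>M) \<le> ennreal (120 * K * \<rho> ^ n / (1 - \<rho>))" for m
  proof -
    have "(\<integral>\<^sup>+w. S m w \<partial>M) \<le> 120 * (\<Sum>u\<in>?U m. \<integral>\<^sup>+w. ennreal (cw (p * \<beta>) (p * c) (conf w) u * (K * exp (\<kappa> * cbirth (conf w) u))) \<partial>M)"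
      unfolding S_def X_def by (rule centered_sum_moment[where G="\<lambda>u s y. K * exp (\<kappa> * s)", OF meas p _ _ bnd]) (auto simp: K)
    also have "(\<Sum>u\<in>?U m. \<integral>\<^sup>+w. ennreal (cw (p * \<beta>) (p * c) (conf w) u * (K * exp (\<kappa> * cbirth (conf w) u))) \<partial>M)
      = (\<Sum>u\<in>?U m. \<integral>\<^sup>+w. ennreal K * ennreal (cw (p * \<beta>) (p * c - \<kappa>) (conf w) u) \<partial>M)"
    proof (intro sum.cong refl nn_integral_cong)
      fix u w
      have "cw (p * \<beta>) (p * c) (conf w) u * (K * exp (\<kappa> * cbirth (conf w) u)) = K * cw (p * \<beta>) (p * c - \<kappa>) (conf w) u"
        by (simp add: cw_def exp_add[symmetric] algebra_simps)
      then show "ennreal (cw (p * \<beta>) (p * c) (conf w) u * (K * exp (\<kappa> * cbirth (conf w) u))) = ennreal K * ennreal (cw (p * \<beta>) (p * c - \<kappa>) (conf w) u)"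
        using K by (simp add: ennreal_mult[symmetric])
    qed
    also have "\<dots> = ennreal K * (\<Sum>u\<in>?U m. \<integral>\<^sup>+w. ennreal (cw (p * \<beta>) (p * c - \<kappa>) (conf w) u) \<partial>M)"
      by (simp add: nn_integral_cmult sum_distrib_left)
    also have "(\<Sum>u\<in>?U m. \<integral>\<^sup>+w. ennreal (cw (p * \<beta>) (p * c - \<kappa>) (conf w) u) \<partial>M) =
      (\<Sum>u\<in>lab m. ennreal (if n \<le> length u then 1 ^ length u else 0) * (\<integral>\<^sup>+w. ennreal (cw (p * \<beta>) (p * c - \<kappa>) (conf w) u) \<partial>M))"
      by (intro sum.mono_neutral_cong_left) auto
    also have "\<dots> \<le> ennreal (\<rho> ^ n / (1 - \<rho>))"
      using cw_lab_moment[of "p * c - \<kappa>" "p * \<beta>" 1 n m] \<rho> \<rho>1 by (simp add: \<rho>_def)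
    finally have "(\<integral>\<^sup>+w. S m w \<partial>M) \<le> 120 * (ennreal K * ennreal (\<rho> ^ n / (1 - \<rho>)))"
      by (simp add: mult_left_mono)
    also have "\<dots> = ennreal (120 * K * \<rho> ^ n / (1 - \<rho>))"
      using K \<rho>1 by (simp add: ennreal_mult[symmetric] ennreal_numeral[symmetric] del: ennreal_numeral)
    finally show ?thesis .
  qed
  have Sm[measurable]: "S m \<in> borel_measurable M" for m
  proof -
    have "(\<lambda>x. X x u) \<in> borel_measurable conf_space" for u
    proof -
      have 1: "(\<lambda>x. \<psi> u (cbirth x u) (cstart x u - \<beta> * cbirth x u) (x u)) \<in> borel_measurable conf_space"
        by (rule measurable_compose3[OF meas]) auto
      have 2: "(\<lambda>x. \<integral>w. \<psi> u (cbirth x u) (cstart x u - \<beta> * cbirth x u) (D u w) \<partial>M) \<in> borel_measurable conf_space"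
        by (intro borel_measurable_lebesgue_integral)
           (auto simp: case_prod_beta' intro!: measurable_compose3[OF meas])
      show ?thesis unfolding X_def using 1 2 by measurable
    qed
    then have "(\<lambda>x. \<Sum>u\<in>?U m. X x u) \<in> borel_measurable conf_space" by measurable
    from measurable_compose[OF measurable_conf this] show ?thesis unfolding S_def by measurable
  qed
  have "(\<integral>\<^sup>+w. ennreal (\<bar>\<Sum>u\<in>{u\<in>born w T. n \<le> length u}. cw \<beta> c (conf w) u *
         (\<psi> u (cbirth (conf w) u) (yst \<beta> (conf w) u) (D u w)
        - (\<integral>w'. \<psi> u (cbirth (conf w) u) (yst \<beta> (conf w) u) (D u w') \<partial>M))\<bar> powr p) \<partial>M)
     = (\<integral>\<^sup>+w. liminf (\<lambda>m. S m w) \<partial>M)"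
  proof (intro nn_integral_cong_AE, use AE_good in eventually_elim)
    fix w assume g: "good w"
    obtain m0 where m0: "\<And>m. m0 \<le> m \<Longrightarrow> born w T \<subseteq> lab m" using finite_subset_lab[OF finite_born[OF g, of T]] by blast
    have eq: "(\<Sum>u\<in>?U m. X (conf w) u) = (\<Sum>u\<in>{u\<in>born w T. n \<le> length u}. X (conf w) u)" if "m0 \<le> m" for m
    proof (rule sum.mono_neutral_right)
      show "\<forall>u\<in>?U m - {u \<in> born w T. n \<le> length u}. X (conf w) u = 0"
      proof
        fix u assume u: "u \<in> ?U m - {u \<in> born w T. n \<le> length u}"
        then have "\<not> cex (conf w) u \<or> T < cbirth (conf w) u" by (auto simp: born_def)
        then show "X (conf w) u = 0" using sup by (auto simp: X_def cw_def)
      qed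
    qed (use m0[OF that] in auto)
    have ev: "\<forall>\<^sub>F m in sequentially. S m w = ennreal (\<bar>\<Sum>u\<in>{u\<in>born w T. n \<le> length u}. X (conf w) u\<bar> powr p)"
      unfolding S_def eventually_sequentially by (intro exI[of _ m0] allI impI) (simp only: eq)
    have "liminf (\<lambda>m. S m w) = ennreal (\<bar>\<Sum>u\<in>{u\<in>born w T. n \<le> length u}. X (conf w) u\<bar> powr p)"
      using lim_imp_Liminf[OF _ tendsto_eventually[OF ev]] by simp
    then show "ennreal (\<bar>\<Sum>u\<in>{u\<in>born w T. n \<le> length u}. cw \<beta> c (conf w) u *
         (\<psi> u (cbirth (conf w) u) (yst \<beta> (conf w) u) (D u w)
        - (\<integral>w'. \<psi> u (cbirth (conf w) u) (yst \<beta> (conf w) u) (D u w') \<partial>M))\<bar> powr p) = liminf (\<lambda>m. S m w)"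
      by (simp add: X_def yst_def conf_def)
  qed
  also have "\<dots> \<le> liminf (\<lambda>m. \<integral>\<^sup>+w. S m w \<partial>M)" by (rule nn_integral_liminf) measurable
  also have "\<dots> \<le> ennreal (120 * K * \<rho> ^ n / (1 - \<rho>))"
    using le by (intro Liminf_le) auto
  finally show ?thesis .
qed

end

section \<open>One-particle expectations\<close>

context bbm_model begin

lemma life_path_nn_integral:
  assumes [measurable]: "g \<in> borel_measurable borel" "\<Phi> \<in> borel_measurable (\<Pi>\<^sub>M s\<in>UNIV. borel)"
  shows "(\<integral>\<^sup>+w. g (life (D u w)) * \<Phi> (traj (D u w)) \<partial>M) = (\<integral>\<^sup>+w. g (tau u w) \<partial>M) * (\<integral>\<^sup>+w. \<Phi> (B u w) \<partial>M)"
proof -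
  have "(\<integral>\<^sup>+w. g (life (D u w)) * \<Phi> (traj (D u w)) \<partial>M) =
    (\<integral>\<^sup>+w1. \<integral>\<^sup>+w2. \<integral>\<^sup>+w3. g (tau u w1) * \<Phi> (B u w3) \<partial>M \<partial>M \<partial>M)"
    by (subst D_nn_integral[where h="\<lambda>d. g (life d) * \<Phi> (traj d)"]) (auto simp: life_def traj_def)
  also have "\<dots> = (\<integral>\<^sup>+w1. g (tau u w1) * (\<integral>\<^sup>+w3. \<Phi> (B u w3) \<partial>M) \<partial>M)"
    by (simp add: nn_integral_cmult emeasure_space_1)
  also have "\<dots> = (\<integral>\<^sup>+w. g (tau u w) \<partial>M) * (\<integral>\<^sup>+w. \<Phi> (B u w) \<partial>M)"
    by (rule nn_integral_multc) measurable
  finally show ?thesis .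
qed

lemma tau_gt: "0 \<le> r \<Longrightarrow> (\<integral>\<^sup>+w. indicator {r<..} (tau u w) \<partial>M) = ennreal (exp (- r))"
proof -
  assume r: "0 \<le> r"
  have "(\<integral>\<^sup>+w. indicator {r<..} (tau u w) \<partial>M) = (\<integral>\<^sup>+w. indicator {w\<in>space M. r < tau u w} w \<partial>M)"
    by (intro nn_integral_cong) (auto simp: indicator_def)
  also have "\<dots> = emeasure M {w\<in>space M. r < tau u w}" by (rule nn_integral_indicator) measurable
  also have "\<dots> = ennreal (exp (- r))"
    using exponential_distributedD_gt[of "tau u" 1 r] r bbm
    by (auto simp: BBM_randomness_def emeasure_eq_measure)
  finally show ?thesis .
qed

lemma tau_between:
  assumes "0 \<le> r" "0 \<le> \<delta>"
  shows "(\<integral>\<^sup>+w. indicator {r<..r+\<delta>} (tau u w) \<partial>M) \<le> ennreal (exp (- r) * \<delta>)"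
proof -
  have "(\<integral>\<^sup>+w. indicator {r<..r+\<delta>} (tau u w) \<partial>M) + ennreal (exp (- (r + \<delta>))) =
    (\<integral>\<^sup>+w. indicator {r<..r+\<delta>} (tau u w) + indicator {r+\<delta><..} (tau u w) \<partial>M)"
    using assms by (subst nn_integral_add) (auto simp: tau_gt)
  also have "\<dots> = (\<integral>\<^sup>+w. indicator {r<..} (tau u w) \<partial>M)"
    using assms by (intro nn_integral_cong) (auto simp: indicator_def)
  also have "\<dots> = ennreal (exp (- r))" using assms by (simp add: tau_gt)
  also have "\<dots> \<le> ennreal (exp (- r) * \<delta> + exp (- (r + \<delta>)))"
  proof (rule ennreal_leI)
    have "exp (- r) * (1 + - \<delta>) \<le> exp (- r) * exp (- \<delta>)" by (intro mult_left_mono exp_ge_add_one_self) auto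
    then show "exp (- r) \<le> exp (- r) * \<delta> + exp (- (r + \<delta>))" by (simp add: exp_add[symmetric] algebra_simps)
  qed
  also have "\<dots> = ennreal (exp (- r) * \<delta>) + ennreal (exp (- (r + \<delta>)))" using assms by (subst ennreal_plus) auto
  finally show ?thesis by (simp add: add.commute[of _ "ennreal (exp (- (r + \<delta>)))"] ennreal_add_left_cancel_le)
qed

text \<open>Girsanov's theorem at a fixed time; it is used with tilt \<beta> for means and with tilt
  p \<beta> for p-th moments.\<close>

lemma path_tilt:
  assumes r: "0 \<le> r" and [measurable]: "H \<in> borel_measurable borel"
  shows "(\<integral>\<^sup>+w. ennreal (exp (l * pev (B u w) r - th * r)) * H (pev (B u w) r - l * r) \<partial>M) =
    ennreal (exp (- (th - l\<^sup>2 / 2) * r)) * gauss r H"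
proof -
  have "(\<integral>\<^sup>+w. ennreal (exp (l * pev (B u w) r - th * r)) * H (pev (B u w) r - l * r) \<partial>M) =
    (\<integral>\<^sup>+w. (\<lambda>x. ennreal (exp (- th * r)) * (ennreal (exp (l * x)) * H (x - l * r))) (B u w r) \<partial>M)"
    by (intro nn_integral_cong) (simp add: mult.assoc[symmetric] ennreal_mult[symmetric] exp_add[symmetric])
  also have "\<dots> = gauss r (\<lambda>x. ennreal (exp (- th * r)) * (ennreal (exp (l * x)) * H (x - l * r)))"
    using r by (intro bm_nn_integral[OF prob_space_axioms brownian]) auto
  also have "\<dots> = ennreal (exp (- th * r)) * (ennreal (exp (l\<^sup>2 * r / 2)) * gauss r H)"
    using r by (simp add: gauss_cmult gauss_exp_tilt)
  also have "\<dots> = ennreal (exp (- (th - l\<^sup>2 / 2) * r)) * gauss r H"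
    by (simp add: mult.assoc[symmetric] ennreal_mult[symmetric] exp_add[symmetric] algebra_simps)
  finally show ?thesis .
qed

text \<open>The density exp (-q), the mean offspring 2, the discount exp (-c q) and the Gaussian
  factor exp (l^2 q / 2) combine to 2 exp (-2 q): in the weighted picture a particle dies at rate 2,
  and its displacement loses the drift.\<close>

lemma death_tilt:
  assumes r: "0 \<le> r" and [measurable]: "(\<lambda>(q, x). H q x) \<in> borel_measurable (borel \<Otimes>\<^sub>M borel)"
    and a: "0 \<le> a"
    and c: "c = 1 + l\<^sup>2 / 2"
  shows "(\<integral>\<^sup>+w. (if a < life (D u w) \<and> life (D u w) \<le> r then ennreal (kidw l c (D u w)) * H (life (D u w)) (dpos (D u w) - l * life (D u w)) else 0) \<partial>M)
    = (\<integral>\<^sup>+q. ennreal (2 * exp (- 2 * q)) * gauss q (H q) * indicator {a<..r} q \<partial>lborel)"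
proof -
  have Hm[measurable]: "H q \<in> borel_measurable borel" for q
    using measurable_compose[OF _ assms(2), of "\<lambda>x. (q, x)" borel] by simp
  let ?h = "\<lambda>q k x. if a < q \<and> q \<le> r then ennreal (real k) * (ennreal (exp (l * x - c * q)) * H q (x - l * q)) else 0"
  have "(\<integral>\<^sup>+w. (if a < life (D u w) \<and> life (D u w) \<le> r then ennreal (kidw l c (D u w)) * H (life (D u w)) (dpos (D u w) - l * life (D u w)) else 0) \<partial>M)
    = (\<integral>\<^sup>+w. ?h (life (D u w)) (kids (D u w)) (dpos (D u w)) \<partial>M)"
    by (intro nn_integral_cong) (auto simp: kidw_def ennreal_mult mult.assoc)
  also have "\<dots> = (\<integral>\<^sup>+q. ennreal (exponential_density 1 q) * (\<integral>\<^sup>+k. gauss q (?h q k) \<partial>measure_pmf \<mu>) \<partial>lborel)"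
  proof (rule death_nn_integral)
    have "(\<lambda>z. H (fst z) (snd (snd z) - l * fst z)) \<in> borel_measurable (borel \<Otimes>\<^sub>M count_space UNIV \<Otimes>\<^sub>M borel)"
      using measurable_compose[OF _ assms(2), of "\<lambda>z. (fst z, snd (snd z) - l * fst z)" "borel \<Otimes>\<^sub>M count_space UNIV \<Otimes>\<^sub>M borel"] by simp
    then show "(\<lambda>(q, k, x). ?h q k x) \<in> borel_measurable (borel \<Otimes>\<^sub>M count_space UNIV \<Otimes>\<^sub>M borel)"
      unfolding case_prod_beta' by measurable
  qed
  also have "\<dots> = (\<integral>\<^sup>+q. ennreal (2 * exp (- 2 * q)) * gauss q (H q) * indicator {a<..r} q \<partial>lborel)"
  proof (intro nn_integral_cong)
    fix q :: real
    show "ennreal (exponential_density 1 q) * (\<integral>\<^sup>+k. gauss q (?h q k) \<partial>measure_pmf \<mu>) =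
       ennreal (2 * exp (- 2 * q)) * gauss q (H q) * indicator {a<..r} q"
    proof (cases "a < q \<and> q \<le> r")
      case True
      then have q: "0 \<le> q" using a by simp
      have g: "gauss q (?h q k) = ennreal (real k) * (ennreal (exp (- q)) * gauss q (H q))" for k
      proof -
        have "gauss q (?h q k) = gauss q (\<lambda>x. ennreal (real k) * (ennreal (exp (- c * q)) * (ennreal (exp (l * x)) * H q (x - l * q))))"
          using True by (simp add: mult.assoc[symmetric] ennreal_mult[symmetric] exp_add[symmetric])
        also have "\<dots> = ennreal (real k) * (ennreal (exp (- c * q)) * (ennreal (exp (l\<^sup>2 * q / 2)) * gauss q (H q)))"
          using q by (simp add: gauss_cmult gauss_exp_tilt)
        also have "ennreal (exp (- c * q)) * (ennreal (exp (l\<^sup>2 * q / 2)) * gauss q (H q)) = ennreal (exp (- q)) * gauss q (H q)"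
        proof -
          have "exp (- c * q) * exp (l\<^sup>2 * q / 2) = exp (- q)"
            unfolding exp_add[symmetric] c by (simp add: field_simps)
          then show ?thesis by (simp only: mult.assoc[symmetric] ennreal_mult[OF exp_ge_zero exp_ge_zero, symmetric])
        qed
        finally show ?thesis .
      qed
      have "(\<integral>\<^sup>+k. gauss q (?h q k) \<partial>measure_pmf \<mu>) = 2 * (ennreal (exp (- q)) * gauss q (H q))"
        unfolding g by (subst nn_integral_multc) (auto simp: offspring_mean)
      then have "ennreal (exponential_density 1 q) * (\<integral>\<^sup>+k. gauss q (?h q k) \<partial>measure_pmf \<mu>) = ennreal (exp (- q)) * (2 * (ennreal (exp (- q)) * gauss q (H q)))"
        using q by (simp add: exponential_density_def)
      also have "\<dots> = 2 * (ennreal (exp (- q)) * ennreal (exp (- q))) * gauss q (H q)" by (simp add: ac_simps)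
      also have "2 * (ennreal (exp (- q)) * ennreal (exp (- q))) = ennreal (2 * exp (- 2 * q))"
        by (simp add: ennreal_mult ennreal_mult[symmetric] exp_add[symmetric])
      finally show ?thesis using True by simp
    next
      case False
      then show ?thesis by auto
    qed
  qed
  finally show ?thesis .
qed

lemma nn_integral_exp2:
  assumes "0 \<le> a" "a \<le> r"
  shows "(\<integral>\<^sup>+q. ennreal (2 * exp (- 2 * q)) * indicator {a<..r} q \<partial>lborel) = ennreal (exp (- 2 * a) - exp (- 2 * r))"
proof -
  have "(\<integral>\<^sup>+q. ennreal (2 * exp (- 2 * q)) * indicator {a<..r} q \<partial>lborel) = (\<integral>\<^sup>+q. ennreal (2 * exp (- 2 * q)) * indicator {a..r} q \<partial>lborel)"
  proof (rule nn_integral_cong_AE)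
    show "AE q in lborel. ennreal (2 * exp (- 2 * q)) * indicator {a<..r} q = ennreal (2 * exp (- 2 * q)) * indicator {a..r} q"
      using AE_lborel_singleton[of a] by eventually_elim (auto simp: indicator_def)
  qed
  also have "\<dots> = ennreal (- exp (- 2 * r) - (- exp (- 2 * a)))"
    using assms by (intro nn_integral_FTC_Icc) (auto intro!: derivative_eq_intros)
  finally show ?thesis by simp
qed

end

text \<open>The parameter \<kappa> is a slack in the strict inequality that makes p-th powers of the
  weights subcritical. Leaving it open allows moments to grow like exp (\<kappa> s) in the birth
  time s, and this is what produces decay like exp (-\<kappa> t) in the time t.\<close>

locale bbm_beta = bbm_model M \<mu> tau L B
  for M :: "'a measure" and \<mu> :: "nat pmf" and tau L B +
  fixes \<beta> p \<kappa> :: real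
  assumes \<beta>: "0 \<le> \<beta>" and p: "1 < p" "p \<le> 2"
    and \<kappa>: "0 < \<kappa>" "2 < 1 + (p * c_beta \<beta> - \<kappa>) - (p * \<beta>)\<^sup>2 / 2"
begin

abbreviation "c \<equiv> c_beta \<beta>"

definition m2 :: real where "m2 = measure_pmf.expectation \<mu> (\<lambda>k. (real k)\<^sup>2)"

lemma m2_nonneg: "0 \<le> m2" by (auto simp: m2_def)

definition own :: "real \<Rightarrow> real \<Rightarrow> pdata \<Rightarrow> real" where
  "own t s d = (if s \<le> t \<and> t < s + life d then exp (\<beta> * pev (traj d) (t - s) - c * (t - s)) else 0)"

definition npos :: "real \<Rightarrow> real \<Rightarrow> real \<Rightarrow> pdata \<Rightarrow> real" where
  "npos t s y d = (y + (pev (traj d) (t - s) - \<beta> * (t - s))) / sqrt t"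

lemma own_nonneg [simp]: "0 \<le> own t s d" by (simp add: own_def)

lemma measurable_own [measurable (raw)]:
  assumes [measurable]: "s \<in> borel_measurable N" "d \<in> measurable N pdata_space"
  shows "(\<lambda>x. own t (s x) (d x)) \<in> borel_measurable N"
proof -
  have [measurable]: "(\<lambda>x. life (d x)) \<in> borel_measurable N" "(\<lambda>x. traj (d x)) \<in> measurable N (\<Pi>\<^sub>M s\<in>UNIV. borel)"
    by measurable
  show ?thesis unfolding own_def by measurable
qed

lemma measurable_npos [measurable (raw)]:
  assumes [measurable]: "s \<in> borel_measurable N" "y \<in> borel_measurable N" "d \<in> measurable N pdata_space"
  shows "(\<lambda>x. npos t (s x) (y x) (d x)) \<in> borel_measurable N"
proof -
  have [measurable]: "(\<lambda>x. traj (d x)) \<in> measurable N (\<Pi>\<^sub>M s\<in>UNIV. borel)" by measurable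
  show ?thesis unfolding npos_def by measurable
qed

text \<open>Survival up to t and the mean of the weight contribute one factor exp (-(t - s))
  each.\<close>

lemma own_nn_integral:
  assumes st: "s \<le> t" and [measurable]: "H \<in> borel_measurable borel"
  shows "(\<integral>\<^sup>+w. ennreal (own t s (D u w)) * H (npos t s y (D u w)) \<partial>M)
     = ennreal (exp (- 2 * (t - s))) * gauss (t - s) (\<lambda>x. H ((y + x) / sqrt t))"
proof -
  let ?r = "t - s"
  let ?\<Phi> = "\<lambda>b. ennreal (exp (\<beta> * pev b ?r - c * ?r)) * H ((y + (pev b ?r - \<beta> * ?r)) / sqrt t)"
  have "(\<integral>\<^sup>+w. ennreal (own t s (D u w)) * H (npos t s y (D u w)) \<partial>M)
    = (\<integral>\<^sup>+w. indicator {?r<..} (life (D u w)) * ?\<Phi> (traj (D u w)) \<partial>M)"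
    using st by (intro nn_integral_cong) (auto simp: own_def npos_def indicator_def)
  also have "\<dots> = (\<integral>\<^sup>+w. indicator {?r<..} (tau u w) \<partial>M) * (\<integral>\<^sup>+w. ?\<Phi> (B u w) \<partial>M)"
    by (rule life_path_nn_integral) measurable
  also have "(\<integral>\<^sup>+w. ?\<Phi> (B u w) \<partial>M) = ennreal (exp (- (c - \<beta>\<^sup>2 / 2) * ?r)) * gauss ?r (\<lambda>x. H ((y + x) / sqrt t))"
    using st by (intro path_tilt) auto
  also have "(\<integral>\<^sup>+w. indicator {?r<..} (tau u w) \<partial>M) = ennreal (exp (- ?r))"
    using st by (intro tau_gt) simp
  also have "ennreal (exp (- ?r)) * (ennreal (exp (- (c - \<beta>\<^sup>2 / 2) * ?r)) * gauss ?r (\<lambda>x. H ((y + x) / sqrt t))) =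
    ennreal (exp (- 2 * ?r)) * gauss ?r (\<lambda>x. H ((y + x) / sqrt t))"
    by (simp add: mult.assoc[symmetric] ennreal_mult[symmetric] exp_add[symmetric] c_beta_def)
  finally show ?thesis .
qed

lemma own_mean: "s \<le> t \<Longrightarrow> (\<integral>\<^sup>+w. ennreal (own t s (D u w)) \<partial>M) = ennreal (exp (- 2 * (t - s)))"
  using own_nn_integral[of s t "\<lambda>_. 1" u 0] by simp

text \<open>The true rate is 1 + p c - (p \<beta>)^2 / 2, which exceeds \<kappa>; the weaker rate is
  the one that tree sums can absorb.\<close>

lemma own_powr_moment:
  assumes st: "s \<le> t"
  shows "(\<integral>\<^sup>+w. ennreal (own t s (D u w) powr p) \<partial>M) \<le> ennreal (exp (- \<kappa> * (t - s)))"
proof -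
  let ?r = "t - s"
  let ?\<Phi> = "\<lambda>b. ennreal (exp ((p * \<beta>) * pev b ?r - (p * c) * ?r)) * (\<lambda>_. 1) (pev b ?r - (p * \<beta>) * ?r)"
  have "(\<integral>\<^sup>+w. ennreal (own t s (D u w) powr p) \<partial>M)
    = (\<integral>\<^sup>+w. indicator {?r<..} (life (D u w)) * ?\<Phi> (traj (D u w)) \<partial>M)"
    using st p by (intro nn_integral_cong) (auto simp: own_def indicator_def powr_def algebra_simps)
  also have "\<dots> = (\<integral>\<^sup>+w. indicator {?r<..} (tau u w) \<partial>M) * (\<integral>\<^sup>+w. ?\<Phi> (B u w) \<partial>M)"
    by (rule life_path_nn_integral) measurable
  also have "(\<integral>\<^sup>+w. ?\<Phi> (B u w) \<partial>M) = ennreal (exp (- (p * c - (p * \<beta>)\<^sup>2 / 2) * ?r)) * gauss ?r (\<lambda>_. 1)"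
    using st by (intro path_tilt) auto
  also have "(\<integral>\<^sup>+w. indicator {?r<..} (tau u w) \<partial>M) = ennreal (exp (- ?r))"
    using st by (intro tau_gt) simp
  also have "ennreal (exp (- ?r)) * (ennreal (exp (- (p * c - (p * \<beta>)\<^sup>2 / 2) * ?r)) * gauss ?r (\<lambda>_. 1)) =
    ennreal (exp (- (1 + (p * c - (p * \<beta>)\<^sup>2 / 2)) * ?r))"
    by (simp add: ennreal_mult[symmetric] exp_add[symmetric] algebra_simps)
  also have "\<dots> \<le> ennreal (exp (- \<kappa> * ?r))"
  proof (intro ennreal_leI, subst exp_le_cancel_iff)
    have "\<kappa> * ?r \<le> (1 + (p * c - (p * \<beta>)\<^sup>2 / 2)) * ?r" using st \<kappa> by (intro mult_right_mono) auto
    then show "- (1 + (p * c - (p * \<beta>)\<^sup>2 / 2)) * ?r \<le> - \<kappa> * ?r" unfolding mult_minus_left by linarith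
  qed
  finally show ?thesis .
qed

text \<open>The p-th moment of the offspring number is at most its second moment, and the Laplace
  factor is below 1 by the choice of \<kappa>. The additional exp (\<kappa> life) is there to bound
  late deaths afterwards.\<close>

lemma kidw_powr_moment:
  "(\<integral>\<^sup>+w. ennreal (kidw \<beta> c (D u w) powr p * exp (\<kappa> * life (D u w))) \<partial>M) \<le> ennreal m2"
proof -
  have "(\<integral>\<^sup>+w. ennreal (kidw \<beta> c (D u w) powr p * exp (\<kappa> * life (D u w))) \<partial>M) =
    (\<integral>\<^sup>+w. ennreal (real (kids (D u w)) powr p) * ennreal (exp ((p * \<beta>) * dpos (D u w) - (p * c - \<kappa>) * life (D u w))) \<partial>M)"
  proof (intro nn_integral_cong)
    fix w
    let ?d = "D u w"
    have "kidw \<beta> c ?d powr p * exp (\<kappa> * life ?d) = real (kids ?d) powr p * (exp ((\<beta> * dpos ?d - c * life ?d) * p) * exp (\<kappa> * life ?d))"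
      unfolding kidw_def by (simp add: powr_mult exp_powr_real)
    also have "exp ((\<beta> * dpos ?d - c * life ?d) * p) * exp (\<kappa> * life ?d) = exp ((p * \<beta>) * dpos ?d - (p * c - \<kappa>) * life ?d)"
      unfolding exp_add[symmetric] by (simp add: algebra_simps)
    finally show "ennreal (kidw \<beta> c ?d powr p * exp (\<kappa> * life ?d)) =
      ennreal (real (kids ?d) powr p) * ennreal (exp ((p * \<beta>) * dpos ?d - (p * c - \<kappa>) * life ?d))"
      by (simp add: ennreal_mult)
  qed
  also have "\<dots> = (\<integral>\<^sup>+k. ennreal (real k powr p) \<partial>measure_pmf \<mu>) * ennreal (1 / (1 + (p * c - \<kappa>) - (p * \<beta>)\<^sup>2 / 2))"
    by (rule death_exp_moment) (use \<kappa> in linarith)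
  also have "\<dots> \<le> ennreal m2 * ennreal 1"
    using offspring_powr[of p] p \<kappa> by (intro mult_mono ennreal_leI) (auto simp: m2_def)
  finally show ?thesis by simp
qed

lemma kidw_powr_after:
  "(\<integral>\<^sup>+w. ennreal ((if t < s + life (D u w) then kidw \<beta> c (D u w) else 0) powr p) \<partial>M) \<le> ennreal (m2 * exp (- \<kappa> * (t - s)))"
proof -
  have "(\<integral>\<^sup>+w. ennreal ((if t < s + life (D u w) then kidw \<beta> c (D u w) else 0) powr p) \<partial>M)
    \<le> (\<integral>\<^sup>+w. ennreal (exp (- \<kappa> * (t - s))) * ennreal (kidw \<beta> c (D u w) powr p * exp (\<kappa> * life (D u w))) \<partial>M)"
  proof (intro nn_integral_mono)
    fix w
    \<comment> \<open>An exponential Markov inequality: on the event of dying after t, the factor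
      exp (\<kappa> (s + life - t)) is at least 1.\<close>
    have "(if t < s + life (D u w) then kidw \<beta> c (D u w) else 0) powr p \<le> exp (\<kappa> * (s + life (D u w) - t)) * kidw \<beta> c (D u w) powr p"
    proof (cases "t < s + life (D u w)")
      case True
      then have "1 \<le> exp (\<kappa> * (s + life (D u w) - t))" using \<kappa> by simp
      then have "1 * kidw \<beta> c (D u w) powr p \<le> exp (\<kappa> * (s + life (D u w) - t)) * kidw \<beta> c (D u w) powr p"
        by (intro mult_right_mono) auto
      then show ?thesis using True by simp
    qed (use p in auto)
    also have "\<dots> = exp (- \<kappa> * (t - s)) * (kidw \<beta> c (D u w) powr p * exp (\<kappa> * life (D u w)))"
      by (simp add: exp_add[symmetric] exp_diff algebra_simps)
    finally show "ennreal ((if t < s + life (D u w) then kidw \<beta> c (D u w) else 0) powr p) \<le> ennreal (exp (- \<kappa> * (t - s))) * ennreal (kidw \<beta> c (D u w) powr p * exp (\<kappa> * life (D u w)))"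
      by (simp add: ennreal_mult[symmetric] ennreal_leI)
  qed
  also have "\<dots> = ennreal (exp (- \<kappa> * (t - s))) * (\<integral>\<^sup>+w. ennreal (kidw \<beta> c (D u w) powr p * exp (\<kappa> * life (D u w))) \<partial>M)"
    by (rule nn_integral_cmult) measurable
  also have "\<dots> \<le> ennreal (exp (- \<kappa> * (t - s))) * ennreal m2"
    by (intro mult_left_mono kidw_powr_moment) auto
  finally show ?thesis by (simp add: ennreal_mult[symmetric] m2_nonneg mult.commute)
qed

lemma kidw_between:
  assumes "0 \<le> a" "a \<le> r"
  shows "(\<integral>\<^sup>+w. ennreal (if a < life (D u w) \<and> life (D u w) \<le> r then kidw \<beta> c (D u w) else 0) \<partial>M) = ennreal (exp (- 2 * a) - exp (- 2 * r))"
proof -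
  have "(\<integral>\<^sup>+w. ennreal (if a < life (D u w) \<and> life (D u w) \<le> r then kidw \<beta> c (D u w) else 0) \<partial>M)
   = (\<integral>\<^sup>+w. (if a < life (D u w) \<and> life (D u w) \<le> r then ennreal (kidw \<beta> c (D u w)) * (\<lambda>_ _. 1) (life (D u w)) (dpos (D u w) - \<beta> * life (D u w)) else 0) \<partial>M)"
    by (intro nn_integral_cong) auto
  also have "\<dots> = (\<integral>\<^sup>+q. ennreal (2 * exp (- 2 * q)) * gauss q (\<lambda>_. 1) * indicator {a<..r} q \<partial>lborel)"
    using assms by (intro death_tilt) (auto simp: c_beta_def)
  finally show ?thesis using nn_integral_exp2[OF assms] by simp
qed

end

section \<open>The additive martingale and its increments\<close>

lemma powr_le_sum3:
  fixes p :: real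
  assumes "1 \<le> p" "p \<le> 2" "\<bar>x\<bar> \<le> a + b + d" "0 \<le> a" "0 \<le> b" "0 \<le> d"
  shows "\<bar>x\<bar> powr p \<le> 16 * (a powr p + b powr p + d powr p)"
proof -
  have "\<bar>x\<bar> powr p \<le> \<bar>a + (b + d)\<bar> powr p" using assms by (intro powr_mono2) auto
  also have "\<dots> \<le> 4 * (\<bar>a\<bar> powr p + \<bar>b + d\<bar> powr p)" by (rule abs_add_powr_le_4) fact+
  also have "\<bar>b + d\<bar> powr p \<le> 4 * (\<bar>b\<bar> powr p + \<bar>d\<bar> powr p)" by (rule abs_add_powr_le_4) fact+
  finally have "\<bar>x\<bar> powr p \<le> 4 * (a powr p + 4 * (b powr p + d powr p))" using assms by simp
  also have "\<dots> \<le> 16 * (a powr p + b powr p + d powr p)" by (simp add: distrib_left)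
  finally show ?thesis .
qed

lemma integrable_gauss_mult:
  fixes h :: "real \<Rightarrow> real"
  assumes [measurable]: "h \<in> borel_measurable borel" and K: "\<And>x. \<bar>h x\<bar> \<le> K"
  shows "integrable lborel (\<lambda>z. std_normal_density z * h z)"
proof (rule Bochner_Integration.integrable_bound[of _ "\<lambda>z. std_normal_density z * K"])
  show "AE z in lborel. norm (std_normal_density z * h z) \<le> norm (std_normal_density z * K)"
    using K by (auto simp: abs_mult intro!: mult_left_mono order_trans[OF K abs_ge_self])
qed auto

text \<open>In the moving frame, the position at time t of a particle that started in y at time s is
  y plus a centred Gaussian of variance t - s.\<close>

definition Ff :: "(real \<Rightarrow> real) \<Rightarrow> real \<Rightarrow> real \<Rightarrow> real \<Rightarrow> real" where
  "Ff f t s y = (\<integral>z. std_normal_density z * f ((y + sqrt (t - s) * z) / sqrt t) \<partial>lborel)"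

lemma Ff_abs_le:
  assumes [measurable]: "f \<in> borel_measurable borel" and K: "\<And>x. \<bar>f x\<bar> \<le> K"
  shows "\<bar>Ff f t s y\<bar> \<le> K"
proof -
  have "\<bar>Ff f t s y\<bar> \<le> (\<integral>z. \<bar>std_normal_density z * f ((y + sqrt (t - s) * z) / sqrt t)\<bar> \<partial>lborel)"
    unfolding Ff_def by (rule integral_abs_bound)
  also have "\<dots> \<le> (\<integral>z. std_normal_density z * K \<partial>lborel)"
    using K order_trans[OF abs_ge_zero K]
    by (intro integral_mono integrable_abs integrable_gauss_mult[where K=K]) (auto simp: abs_mult intro!: mult_left_mono)
  also have "\<dots> = K" by simp
  finally show ?thesis .
qed

lemma Ff_const [simp]: "Ff (\<lambda>_. K) t s y = K"
  by (simp add: Ff_def)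

lemma Ff_add_const:
  assumes [measurable]: "f \<in> borel_measurable borel" and K: "\<And>x. \<bar>f x\<bar> \<le> K"
  shows "Ff (\<lambda>x. f x + k) t s y = Ff f t s y + k"
proof -
  have "integrable lborel (\<lambda>z. std_normal_density z * f ((y + sqrt (t - s) * z) / sqrt t))"
    using K by (intro integrable_gauss_mult[where K=K]) auto
  then show ?thesis by (simp add: Ff_def distrib_left)
qed

lemma measurable_Ff [measurable (raw)]:
  assumes [measurable]: "f \<in> borel_measurable borel" "s \<in> borel_measurable N" "y \<in> borel_measurable N"
  shows "(\<lambda>x. Ff f t (s x) (y x)) \<in> borel_measurable N"
  unfolding Ff_def by measurable

lemma gauss_Ff:
  assumes [measurable]: "f \<in> borel_measurable borel" and K: "\<And>x. \<bar>f x\<bar> \<le> K" and nn: "\<And>x. 0 \<le> f x"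
  shows "gauss (t - s) (\<lambda>x. ennreal (f ((y + x) / sqrt t))) = ennreal (Ff f t s y)"
proof -
  have "(\<integral>\<^sup>+z. ennreal (std_normal_density z * f ((y + sqrt (t - s) * z) / sqrt t)) \<partial>lborel) = ennreal (Ff f t s y)"
    unfolding Ff_def using K nn by (intro nn_integral_eq_integral integrable_gauss_mult[where K=K]) auto
  then show ?thesis using nn by (simp add: gauss_def ennreal_mult)
qed

context bbm_beta begin

text \<open>What a particle contributes to \<open>W\<^sub>t(f)\<close> itself, plus the conditional mean that it passes on to its
  children at its death, both relative to its weight at birth. The mean of \<open>psiF\<close> is again \<open>Ff\<close>, which makes
  the sums over the tree telescope.\<close>

definition psiF :: "(real \<Rightarrow> real) \<Rightarrow> real \<Rightarrow> real \<Rightarrow> real \<Rightarrow> pdata \<Rightarrow> real" where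
  "psiF f t s y d = own t s d * f (npos t s y d) +
     (if s \<le> t \<and> 0 < life d \<and> s + life d \<le> t then kidw \<beta> c d * Ff f t (s + life d) (y + dpos d - \<beta> * life d) else 0)"

lemma measurable_psiF [measurable]:
  assumes [measurable]: "f \<in> borel_measurable borel"
  shows "(\<lambda>(s, y, d). psiF f t s y d) \<in> borel_measurable (borel \<Otimes>\<^sub>M (borel \<Otimes>\<^sub>M pdata_space))"
  unfolding psiF_def case_prod_beta' by measurable

lemma measurable_psiF_D: "f \<in> borel_measurable borel \<Longrightarrow> (\<lambda>w. psiF f t s y (D u w)) \<in> borel_measurable M"
  by (rule measurable_compose3[OF measurable_psiF]) auto

text \<open>Surviving until t gives exp (-2 (t - s)) times F. Dying after a time q gives 2 exp (-2
  q) dq times a Gaussian average of a later F, and this is the same F by the semigroup property. The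
  two coefficients add up to 1.\<close>

lemma psiF_nn_integral:
  assumes [measurable]: "f \<in> borel_measurable borel" and K: "\<And>x. \<bar>f x\<bar> \<le> K" and nn: "\<And>x. 0 \<le> f x"
    and st: "s \<le> t"
  shows "(\<integral>\<^sup>+w. ennreal (psiF f t s y (D u w)) \<partial>M) = ennreal (Ff f t s y)"
proof -
  let ?r = "t - s" and ?I = "ennreal (Ff f t s y)"
  have Fnn: "0 \<le> Ff f t s' y'" for s' y'
    unfolding Ff_def using nn by (intro integral_nonneg_AE) auto
  let ?H = "\<lambda>q x. ennreal (Ff f t (s + q) (y + x))"
  have "(\<integral>\<^sup>+w. ennreal (psiF f t s y (D u w)) \<partial>M) =
    (\<integral>\<^sup>+w. ennreal (own t s (D u w)) * ennreal (f (npos t s y (D u w))) +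
       (if 0 < life (D u w) \<and> life (D u w) \<le> ?r then ennreal (kidw \<beta> c (D u w)) * ?H (life (D u w)) (dpos (D u w) - \<beta> * life (D u w)) else 0) \<partial>M)"
    using st nn Fnn by (intro nn_integral_cong) (auto simp: psiF_def ennreal_plus ennreal_mult algebra_simps)
  also have "\<dots> = (\<integral>\<^sup>+w. ennreal (own t s (D u w)) * ennreal (f (npos t s y (D u w))) \<partial>M) +
     (\<integral>\<^sup>+w. (if 0 < life (D u w) \<and> life (D u w) \<le> ?r then ennreal (kidw \<beta> c (D u w)) * ?H (life (D u w)) (dpos (D u w) - \<beta> * life (D u w)) else 0) \<partial>M)"
    by (rule nn_integral_add) measurable
  also have "(\<integral>\<^sup>+w. ennreal (own t s (D u w)) * ennreal (f (npos t s y (D u w))) \<partial>M) = ennreal (exp (- 2 * ?r)) * ?I"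
    using st own_nn_integral[of s t "\<lambda>x. ennreal (f x)" u y] gauss_Ff[OF assms(1) K nn, of t s y] by simp
  also have "(\<integral>\<^sup>+w. (if 0 < life (D u w) \<and> life (D u w) \<le> ?r then ennreal (kidw \<beta> c (D u w)) * ?H (life (D u w)) (dpos (D u w) - \<beta> * life (D u w)) else 0) \<partial>M)
     = (\<integral>\<^sup>+q. ennreal (2 * exp (- 2 * q)) * gauss q (?H q) * indicator {0<..?r} q \<partial>lborel)"
    using st by (intro death_tilt) (auto simp: c_beta_def case_prod_beta')
  also have "\<dots> = (\<integral>\<^sup>+q. ennreal (2 * exp (- 2 * q)) * indicator {0<..?r} q * ?I \<partial>lborel)"
  proof (intro nn_integral_cong)
    fix q :: real
    show "ennreal (2 * exp (- 2 * q)) * gauss q (?H q) * indicator {0<..?r} q = ennreal (2 * exp (- 2 * q)) * indicator {0<..?r} q * ?I"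
    proof (cases "q \<in> {0<..?r}")
      case True
      have "gauss q (?H q) = gauss q (\<lambda>x. gauss (?r - q) (\<lambda>x'. ennreal (f ((y + (x + x')) / sqrt t))))"
      proof -
        have "ennreal (Ff f t (s + q) (y + x)) = gauss (?r - q) (\<lambda>x'. ennreal (f ((y + (x + x')) / sqrt t)))" for x
          using gauss_Ff[OF assms(1) K nn, of t "s + q" "y + x"] by (simp add: add.assoc diff_diff_eq)
        then show ?thesis by (simp only:)
      qed
      also have "\<dots> = gauss (q + (?r - q)) (\<lambda>x. ennreal (f ((y + x) / sqrt t)))"
        using True by (intro gauss_semigroup) auto
      also have "\<dots> = ?I" using gauss_Ff[OF assms(1) K nn, of t s y] by simp
      finally show ?thesis using True by simp
    qed auto
  qed
  also have "\<dots> = ennreal (exp (- 2 * 0) - exp (- 2 * ?r)) * ?I"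
    using st nn_integral_exp2[of 0 ?r] by (subst nn_integral_multc) auto
  also have "ennreal (exp (- 2 * ?r)) * ?I + \<dots> = ennreal (exp (- 2 * ?r) + (exp (- 2 * 0) - exp (- 2 * ?r))) * ?I"
    using st by (subst ennreal_plus) (auto simp: distrib_right)
  finally show ?thesis by simp
qed

text \<open>Signed f is reduced to nonnegative functions by adding the constant K;
  \<open>psiF\<close> is linear in f.\<close>

lemma psiF_mean:
  assumes f[measurable]: "f \<in> borel_measurable borel" and K: "\<And>x. \<bar>f x\<bar> \<le> K" and st: "s \<le> t"
  shows "integrable M (\<lambda>w. psiF f t s y (D u w))" "(\<integral>w. psiF f t s y (D u w) \<partial>M) = Ff f t s y"
proof -
  have K0: "0 \<le> K" using K[of 0] by linarith
  have nonneg: "integrable M (\<lambda>w. psiF g t s y (D u w)) \<and> (\<integral>w. psiF g t s y (D u w) \<partial>M) = Ff g t s y"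
    if g[measurable]: "g \<in> borel_measurable borel" and g2: "\<And>x. 0 \<le> g x" "\<And>x. \<bar>g x\<bar> \<le> 2 * K" for g
  proof -
    note [measurable] = measurable_psiF_D[OF g]
    have Fnn: "0 \<le> Ff g t s' y'" for s' y' unfolding Ff_def using g2 by (intro integral_nonneg_AE) auto
    have pnn: "0 \<le> psiF g t s y d" for d unfolding psiF_def using g2 Fnn by (auto intro!: add_nonneg_nonneg mult_nonneg_nonneg)
    have eq: "(\<integral>\<^sup>+w. ennreal (psiF g t s y (D u w)) \<partial>M) = ennreal (Ff g t s y)"
      by (rule psiF_nn_integral[OF g g2(2,1) st])
    then have int: "integrable M (\<lambda>w. psiF g t s y (D u w))"
      using pnn by (intro integrableI_nonneg) auto
    moreover have "ennreal (\<integral>w. psiF g t s y (D u w) \<partial>M) = ennreal (Ff g t s y)"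
      using nn_integral_eq_integral[OF int] pnn eq by simp
    then have "(\<integral>w. psiF g t s y (D u w) \<partial>M) = Ff g t s y"
      using Fnn pnn by (subst (asm) ennreal_inj) (auto intro!: integral_nonneg_AE)
    ultimately show ?thesis by blast
  qed
  have eq: "psiF f t s y d = psiF (\<lambda>x. f x + K) t s y d - psiF (\<lambda>_. K) t s y d" for d
    using Ff_add_const[OF f K, of K] by (auto simp: psiF_def algebra_simps)
  have 1: "integrable M (\<lambda>w. psiF (\<lambda>x. f x + K) t s y (D u w)) \<and> (\<integral>w. psiF (\<lambda>x. f x + K) t s y (D u w) \<partial>M) = Ff (\<lambda>x. f x + K) t s y"
  proof (rule nonneg)
    show "0 \<le> f x + K" "\<bar>f x + K\<bar> \<le> 2 * K" for x using K[of x] by linarith+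
  qed simp
  have 2: "integrable M (\<lambda>w. psiF (\<lambda>_. K) t s y (D u w)) \<and> (\<integral>w. psiF (\<lambda>_. K) t s y (D u w) \<partial>M) = Ff (\<lambda>_. K) t s y"
    by (rule nonneg) (use K0 in auto)
  show "integrable M (\<lambda>w. psiF f t s y (D u w))" unfolding eq using 1 2 by auto
  show "(\<integral>w. psiF f t s y (D u w) \<partial>M) = Ff f t s y"
    unfolding eq using 1 2 Ff_add_const[OF f K, of K] by simp
qed

lemma psiF_zero: "t < s \<Longrightarrow> psiF f t s y d = 0" by (simp add: psiF_def own_def)

definition Wsum :: "(real \<Rightarrow> real) \<Rightarrow> real \<Rightarrow> 'a \<Rightarrow> real" where
  "Wsum f t w = (\<Sum>u\<in>born w t. cw \<beta> c (conf w) u * (own t (cbirth (conf w) u) (D u w) * f (npos t (cbirth (conf w) u) (yst \<beta> (conf w) u) (D u w))))"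

lemma W_f_eq_Wsum:
  assumes g: "good w"
  shows "W_f tau L B \<beta> f t w = Wsum f t w"
proof -
  have w: "w \<in> space M" using g by (simp add: good_def)
  let ?x = "conf w"
  have al: "bbm_alive (\<lambda>v. tau v w) (\<lambda>v. L v w) t = {u\<in>born w t. t < cbirth ?x u + tau u w}"
    by (auto simp: bbm_alive_def bbm_death_def born_def cbirth_conf cex_conf)
  have "W_f tau L B \<beta> f t w = (\<Sum>u\<in>{u\<in>born w t. t < cbirth ?x u + tau u w}.
      cw \<beta> c ?x u * (own t (cbirth ?x u) (D u w) * f (npos t (cbirth ?x u) (yst \<beta> ?x u) (D u w))))"
    unfolding W_f_def al
  proof (intro sum.cong refl)
    fix u assume u: "u \<in> {u\<in>born w t. t < cbirth ?x u + tau u w}"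
    let ?P = "cstart ?x u + B u w (t - cbirth ?x u)"
    have "exp (\<beta> * ?P - c * t) = cw \<beta> c ?x u * own t (cbirth ?x u) (D u w)"
      using u w by (auto simp: cw_def own_def born_def exp_add[symmetric] algebra_simps)
    moreover have "(?P - \<beta> * t) / sqrt t = npos t (cbirth ?x u) (yst \<beta> ?x u) (D u w)"
      using w by (simp add: npos_def yst_def algebra_simps)
    ultimately show "exp (\<beta> * bbm_pos (\<lambda>v. tau v w) (\<lambda>v. B v w) u t - c * t) *
        f ((bbm_pos (\<lambda>v. tau v w) (\<lambda>v. B v w) u t - \<beta> * t) / sqrt t) =
       cw \<beta> c ?x u * (own t (cbirth ?x u) (D u w) * f (npos t (cbirth ?x u) (yst \<beta> ?x u) (D u w)))"
      by (simp add: cstart_conf[OF w])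
  qed
  also have "\<dots> = Wsum f t w"
    unfolding Wsum_def using finite_born[OF g] by (intro sum.mono_neutral_left) (auto simp: own_def)
  finally show ?thesis .
qed

lemma W_add_eq_Wsum:
  assumes g: "good w"
  shows "W_add tau L B \<beta> t w = Wsum (\<lambda>_. 1) t w"
proof -
  have "W_add tau L B \<beta> t w = W_f tau L B \<beta> (\<lambda>_. 1) t w"
    by (simp add: W_add_def W_f_def sum_distrib_left exp_add[symmetric] algebra_simps)
  then show ?thesis using W_f_eq_Wsum[OF g] by simp
qed

text \<open>The terms passed on by generations at least n are exactly the terms F of generations at
  least n + 1, so subtracting the means leaves only the terms F of generation n.\<close>

lemma late_sum_eq:
  assumes g: "good w" and f: "f \<in> borel_measurable borel" "\<And>x. \<bar>f x\<bar> \<le> K"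
  shows "(\<Sum>u\<in>{u\<in>born w t. n \<le> length u}. cw \<beta> c (conf w) u * (psiF f t (cbirth (conf w) u) (yst \<beta> (conf w) u) (D u w)
        - (\<integral>w'. psiF f t (cbirth (conf w) u) (yst \<beta> (conf w) u) (D u w') \<partial>M))) =
    (\<Sum>u\<in>{u\<in>born w t. n \<le> length u}. cw \<beta> c (conf w) u * (own t (cbirth (conf w) u) (D u w) * f (npos t (cbirth (conf w) u) (yst \<beta> (conf w) u) (D u w))))
    - (\<Sum>u\<in>{u\<in>born w t. length u = n}. cw \<beta> c (conf w) u * Ff f t (cbirth (conf w) u) (yst \<beta> (conf w) u))"
proof -
  let ?x = "conf w"
  let ?A = "\<lambda>u. cw \<beta> c ?x u" and ?s = "\<lambda>u. cbirth ?x u" and ?y = "\<lambda>u. yst \<beta> ?x u"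
  let ?E = "{u\<in>born w t. n \<le> length u}"
  let ?own = "\<lambda>u. own t (?s u) (D u w) * f (npos t (?s u) (?y u) (D u w))"
  let ?kid = "\<lambda>u. if ?s u + life (D u w) \<le> t then kidw \<beta> c (D u w) * Ff f t (?s u + life (D u w)) (?y u + dpos (D u w) - \<beta> * life (D u w)) else 0"
  have fin: "finite (born w t)" using finite_born[OF g] .
  have pos: "0 < tau u w" for u using g by (simp add: good_def)
  have "(\<Sum>u\<in>?E. ?A u * (psiF f t (?s u) (?y u) (D u w) - (\<integral>w'. psiF f t (?s u) (?y u) (D u w') \<partial>M))) =
    (\<Sum>u\<in>?E. ?A u * ?own u + ?A u * ?kid u - ?A u * Ff f t (?s u) (?y u))"
  proof (intro sum.cong refl)
    fix u assume u: "u \<in> ?E"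
    then have st: "?s u \<le> t" by (simp add: born_def)
    show "?A u * (psiF f t (?s u) (?y u) (D u w) - (\<integral>w'. psiF f t (?s u) (?y u) (D u w') \<partial>M)) = ?A u * ?own u + ?A u * ?kid u - ?A u * Ff f t (?s u) (?y u)"
      unfolding psiF_mean(2)[OF f st] using st pos[of u] by (simp add: psiF_def algebra_simps)
  qed
  also have "\<dots> = (\<Sum>u\<in>?E. ?A u * ?own u) + (\<Sum>u\<in>?E. ?A u * ?kid u) - (\<Sum>u\<in>?E. ?A u * Ff f t (?s u) (?y u))"
    by (simp add: sum.distrib sum_subtractf)
  also have "(\<Sum>u\<in>?E. ?A u * ?kid u) = (\<Sum>v\<in>{v\<in>born w t. Suc n \<le> length v}. ?A v * Ff f t (?s v) (?y v))"
    by (rule born_children[OF g, symmetric])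
  also have "(\<Sum>u\<in>?E. ?A u * Ff f t (?s u) (?y u)) = (\<Sum>u\<in>{u\<in>born w t. length u = n}. ?A u * Ff f t (?s u) (?y u))
      + (\<Sum>v\<in>{v\<in>born w t. Suc n \<le> length v}. ?A v * Ff f t (?s v) (?y v))"
    using fin by (subst sum.union_disjoint[symmetric]) (auto intro!: sum.cong)
  finally show ?thesis by simp
qed

definition \<rho> :: real where "\<rho> = 2 / (1 + (p * c - \<kappa>) - (p * \<beta>)\<^sup>2 / 2)"

lemma \<rho>: "0 < \<rho>" "\<rho> < 1" using \<kappa> by (auto simp: \<rho>_def)

text \<open>Here |psiF| \<le> K (own + kidw), with p-th moments bounded uniformly in t, so the
  entire gain is the factor \<rho>^n. Using \<open>K + 1\<close> keeps the constant positive when K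
  = 0.\<close>

lemma late_moment:
  assumes f: "f \<in> borel_measurable borel" "\<And>x. \<bar>f x\<bar> \<le> K" and t: "0 \<le> t"
  shows "(\<integral>\<^sup>+w. ennreal (\<bar>(\<Sum>u\<in>{u\<in>born w t. n \<le> length u}. cw \<beta> c (conf w) u * (own t (cbirth (conf w) u) (D u w) * f (npos t (cbirth (conf w) u) (yst \<beta> (conf w) u) (D u w))))
    - (\<Sum>u\<in>{u\<in>born w t. length u = n}. cw \<beta> c (conf w) u * Ff f t (cbirth (conf w) u) (yst \<beta> (conf w) u))\<bar> powr p) \<partial>M)
    \<le> ennreal (120 * ((K + 1) powr p * (4 * (1 + m2) * exp (\<kappa> * 1))) * \<rho> ^ n / (1 - \<rho>))"
  (is "?lhs \<le> _")
proof -
  have K: "0 \<le> K" using f(2)[of 0] by linarith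
  have p': "1 \<le> p" "p \<le> 2" using p by auto
  let ?K = "(K + 1) powr p * (4 * (1 + m2) * exp (\<kappa> * 1))"
  have "?lhs = (\<integral>\<^sup>+w. ennreal (\<bar>\<Sum>u\<in>{u\<in>born w t. n \<le> length u}. cw \<beta> c (conf w) u * (psiF f t (cbirth (conf w) u) (yst \<beta> (conf w) u) (D u w)
        - (\<integral>w'. psiF f t (cbirth (conf w) u) (yst \<beta> (conf w) u) (D u w') \<partial>M))\<bar> powr p) \<partial>M)"
    by (intro nn_integral_cong_AE, use AE_good in eventually_elim) (simp only: late_sum_eq[OF _ f])
  also have "\<dots> \<le> ennreal (120 * ?K * \<rho> ^ n / (1 - \<rho>))"
    unfolding \<rho>_def
  proof (rule tree_sum_moment[where \<psi>="\<lambda>u. psiF f t", OF measurable_psiF[OF f(1)] p'])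
    show "0 < ?K" using K m2_nonneg by (simp add: add_nonneg_pos)
    fix u s y assume s: "0 \<le> (s::real)"
    show "(\<integral>\<^sup>+w. ennreal (\<bar>psiF f t s y (D u w)\<bar> powr p) \<partial>M) \<le> ennreal (?K * exp (\<kappa> * s))"
    proof (cases "s \<le> t")
      case False
      then show ?thesis using p by (simp add: psiF_zero)
    next
      case True
      have F: "\<bar>Ff f t s' y'\<bar> \<le> K" for s' y' by (rule Ff_abs_le[OF f])
      have "(\<integral>\<^sup>+w. ennreal (\<bar>psiF f t s y (D u w)\<bar> powr p) \<partial>M) \<le>
         (\<integral>\<^sup>+w. ennreal (4 * K powr p) * (ennreal (own t s (D u w) powr p) + ennreal (kidw \<beta> c (D u w) powr p)) \<partial>M)"
      proof (intro nn_integral_mono)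
        fix w
        let ?d = "D u w"
        have "\<bar>psiF f t s y ?d\<bar> \<le> own t s ?d * K + kidw \<beta> c ?d * K"
          unfolding psiF_def using f(2) F
          by (auto simp: abs_mult intro!: order_trans[OF abs_triangle_ineq] add_mono mult_left_mono mult_nonneg_nonneg K)
             (auto simp: abs_mult intro!: mult_left_mono add_increasing2 mult_nonneg_nonneg K)
        then have "\<bar>psiF f t s y ?d\<bar> powr p \<le> \<bar>own t s ?d * K + kidw \<beta> c ?d * K\<bar> powr p" using p by (intro powr_mono2) auto
        also have "\<dots> \<le> 4 * (\<bar>own t s ?d * K\<bar> powr p + \<bar>kidw \<beta> c ?d * K\<bar> powr p)" by (rule abs_add_powr_le_4[OF p'])
        also have "\<dots> = 4 * K powr p * (own t s ?d powr p + kidw \<beta> c ?d powr p)"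
          using K by (simp add: abs_mult powr_mult algebra_simps)
        finally show "ennreal (\<bar>psiF f t s y ?d\<bar> powr p) \<le> ennreal (4 * K powr p) * (ennreal (own t s ?d powr p) + ennreal (kidw \<beta> c ?d powr p))"
          by (subst ennreal_plus[symmetric]) (auto simp: ennreal_mult[symmetric] intro!: ennreal_leI simp del: ennreal_plus)
      qed
      also have "\<dots> = ennreal (4 * K powr p) * ((\<integral>\<^sup>+w. ennreal (own t s (D u w) powr p) \<partial>M) + (\<integral>\<^sup>+w. ennreal (kidw \<beta> c (D u w) powr p) \<partial>M))"
        by (simp add: nn_integral_cmult nn_integral_add)
      also have "\<dots> \<le> ennreal (4 * K powr p) * (ennreal 1 + ennreal m2)"
      proof (intro mult_left_mono add_mono)
        show "(\<integral>\<^sup>+w. ennreal (own t s (D u w) powr p) \<partial>M) \<le> ennreal 1"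
          using True \<kappa> by (intro order_trans[OF own_powr_moment]) (auto intro!: ennreal_leI)
        have "(\<integral>\<^sup>+w. ennreal (kidw \<beta> c (D u w) powr p) \<partial>M) \<le> (\<integral>\<^sup>+w. ennreal (kidw \<beta> c (D u w) powr p * exp (\<kappa> * life (D u w))) \<partial>M)"
          using tau_pos[of u]
          by (intro nn_integral_mono_AE, eventually_elim) (use \<kappa> in \<open>auto intro!: ennreal_leI mult_right_mono[of 1, simplified] simp: mult_le_cancel_left1 mult_less_0_iff\<close>)
        also have "\<dots> \<le> ennreal m2" by (rule kidw_powr_moment)
        finally show "(\<integral>\<^sup>+w. ennreal (kidw \<beta> c (D u w) powr p) \<partial>M) \<le> ennreal m2" .
      qed auto
      also have "\<dots> = ennreal (4 * K powr p * (1 + m2))"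
        using m2_nonneg by (subst ennreal_plus[symmetric]) (auto simp: ennreal_mult[symmetric] simp del: ennreal_plus)
      also have "\<dots> \<le> ennreal (?K * exp (\<kappa> * s))"
      proof (rule ennreal_leI)
        have "K powr p * (4 * (1 + m2) * 1) * 1 \<le> (K + 1) powr p * (4 * (1 + m2) * exp (\<kappa> * 1)) * exp (\<kappa> * s)"
          using K m2_nonneg \<kappa> p s by (intro mult_mono powr_mono2) auto
        then show "4 * K powr p * (1 + m2) \<le> ?K * exp (\<kappa> * s)" by (simp add: algebra_simps)
      qed
      finally show ?thesis .
    qed
  qed (use \<kappa> psiF_zero in auto)
  finally show ?thesis .
qed

lemma Wsum_one_eq:
  assumes g: "good w" and t: "0 \<le> t"
  shows "(\<Sum>u\<in>born w t. cw \<beta> c (conf w) u * (psiF (\<lambda>_. 1) t (cbirth (conf w) u) (yst \<beta> (conf w) u) (D u w) - 1)) = Wsum (\<lambda>_. 1) t w - 1"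
proof -
  have "{u\<in>born w t. length u = 0} = {[]}" using t by (auto simp: born_def)
  then have *: "(\<Sum>u\<in>{u\<in>born w t. length u = 0}. cw \<beta> c (conf w) u * Ff (\<lambda>_. 1) t (cbirth (conf w) u) (yst \<beta> (conf w) u)) = 1"
    by (simp add: cw_def)
  have "(\<Sum>u\<in>{u\<in>born w t. 0 \<le> length u}. cw \<beta> c (conf w) u * (psiF (\<lambda>_. 1) t (cbirth (conf w) u) (yst \<beta> (conf w) u) (D u w)
        - (\<integral>w'. psiF (\<lambda>_. 1) t (cbirth (conf w) u) (yst \<beta> (conf w) u) (D u w') \<partial>M))) = Wsum (\<lambda>_. 1) t w - 1"
    unfolding late_sum_eq[OF g, of "\<lambda>_. 1" 1, simplified] using * by (simp add: Wsum_def)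
  moreover have "(\<integral>w'. psiF (\<lambda>_. 1) t (cbirth (conf w) u) (yst \<beta> (conf w) u) (D u w') \<partial>M) = 1" if "u \<in> born w t" for u
    using that by (subst psiF_mean(2)[where K=1]) (auto simp: born_def)
  ultimately show ?thesis by simp
qed

text \<open>Subtract the representations of W at the two times. A particle that dies by time t
  passes on the same amount in both, since F = 1, and cancels. What remains comes from particles
  alive at t or t' or dying after t, whose p-th moments are of order exp (-\<kappa> (t -
  s)).\<close>

lemma W_increment_moment:
  assumes t: "0 \<le> t" "t \<le> t'"
  shows "(\<integral>\<^sup>+w. ennreal (\<bar>Wsum (\<lambda>_. 1) t' w - Wsum (\<lambda>_. 1) t w\<bar> powr p) \<partial>M)
    \<le> ennreal (120 * (16 * (2 + m2)) / (1 - \<rho>) * exp (- \<kappa> * t))"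
proof -
  have p': "1 \<le> p" "p \<le> 2" using p by auto
  let ?\<psi> = "\<lambda>s y d. psiF (\<lambda>_. 1) t' s y d - psiF (\<lambda>_. 1) t s y d"
  let ?K = "16 * (2 + m2) * exp (- \<kappa> * t)"
  \<comment> \<open>For a birth after t the term of time t vanishes, so the mean of the difference
    is 1 there and 0 otherwise.\<close>
  have mean: "(\<integral>w'. ?\<psi> s y (D u w') \<partial>M) = 1 - (if s \<le> t then 1 else 0)" if "s \<le> t'" for s y u
  proof -
    have 1: "integrable M (\<lambda>w. psiF (\<lambda>_. 1) t' s y (D u w))" "(\<integral>w'. psiF (\<lambda>_. 1) t' s y (D u w') \<partial>M) = 1"
      using psiF_mean[of "\<lambda>_. 1" 1 s t'] that by auto
    show ?thesis
    proof (cases "s \<le> t")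
      case True
      then have 2: "integrable M (\<lambda>w. psiF (\<lambda>_. 1) t s y (D u w))" "(\<integral>w'. psiF (\<lambda>_. 1) t s y (D u w') \<partial>M) = 1"
        using psiF_mean[of "\<lambda>_. 1" 1 s t] by auto
      show ?thesis using 1 2 True by simp
    next
      case False
      then show ?thesis using 1 by (simp add: psiF_zero)
    qed
  qed
  have "(\<integral>\<^sup>+w. ennreal (\<bar>Wsum (\<lambda>_. 1) t' w - Wsum (\<lambda>_. 1) t w\<bar> powr p) \<partial>M) =
    (\<integral>\<^sup>+w. ennreal (\<bar>\<Sum>u\<in>{u\<in>born w t'. 0 \<le> length u}. cw \<beta> c (conf w) u * (?\<psi> (cbirth (conf w) u) (yst \<beta> (conf w) u) (D u w)
        - (\<integral>w'. ?\<psi> (cbirth (conf w) u) (yst \<beta> (conf w) u) (D u w') \<partial>M))\<bar> powr p) \<partial>M)"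
  proof (intro nn_integral_cong_AE, use AE_good in eventually_elim)
    fix w assume g: "good w"
    let ?A = "\<lambda>u. cw \<beta> c (conf w) u" and ?s = "\<lambda>u. cbirth (conf w) u" and ?y = "\<lambda>u. yst \<beta> (conf w) u"
    have "(\<Sum>u\<in>{u\<in>born w t'. 0 \<le> length u}. ?A u * (?\<psi> (?s u) (?y u) (D u w) - (\<integral>w'. ?\<psi> (?s u) (?y u) (D u w') \<partial>M)))
      = (\<Sum>u\<in>born w t'. ?A u * (psiF (\<lambda>_. 1) t' (?s u) (?y u) (D u w) - 1) - (if ?s u \<le> t then ?A u * (psiF (\<lambda>_. 1) t (?s u) (?y u) (D u w) - 1) else 0))"
      by (intro sum.cong) (auto simp: mean born_def psiF_zero algebra_simps)
    also have "\<dots> = (\<Sum>u\<in>born w t'. ?A u * (psiF (\<lambda>_. 1) t' (?s u) (?y u) (D u w) - 1)) -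
      (\<Sum>u\<in>born w t'. (if ?s u \<le> t then ?A u * (psiF (\<lambda>_. 1) t (?s u) (?y u) (D u w) - 1) else 0))"
      by (rule sum_subtractf)
    also have "(\<Sum>u\<in>born w t'. (if ?s u \<le> t then ?A u * (psiF (\<lambda>_. 1) t (?s u) (?y u) (D u w) - 1) else 0)) =
      (\<Sum>u\<in>born w t. ?A u * (psiF (\<lambda>_. 1) t (?s u) (?y u) (D u w) - 1))"
      using t finite_born[OF g] by (intro sum.mono_neutral_cong_right) (auto simp: born_def)
    finally show "ennreal (\<bar>Wsum (\<lambda>_. 1) t' w - Wsum (\<lambda>_. 1) t w\<bar> powr p) =
      ennreal (\<bar>\<Sum>u\<in>{u\<in>born w t'. 0 \<le> length u}. ?A u * (?\<psi> (?s u) (?y u) (D u w) - (\<integral>w'. ?\<psi> (?s u) (?y u) (D u w') \<partial>M))\<bar> powr p)"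
      using Wsum_one_eq[OF g] t by simp
  qed
  also have "\<dots> \<le> ennreal (120 * ?K * \<rho> ^ 0 / (1 - \<rho>))"
    unfolding \<rho>_def
  proof (rule tree_sum_moment[where \<psi>="\<lambda>u. ?\<psi>", OF _ p'])
    show "(\<lambda>(s, y, d). ?\<psi> s y d) \<in> borel_measurable (borel \<Otimes>\<^sub>M (borel \<Otimes>\<^sub>M pdata_space))"
      using measurable_psiF[of "\<lambda>_. 1" t'] measurable_psiF[of "\<lambda>_. 1" t] unfolding case_prod_beta' by measurable
    show "0 < ?K" using m2_nonneg by simp
    fix u s y assume s: "0 \<le> (s::real)"
    show "(\<integral>\<^sup>+w. ennreal (\<bar>?\<psi> s y (D u w)\<bar> powr p) \<partial>M) \<le> ennreal (?K * exp (\<kappa> * s))"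
    proof (cases "s \<le> t'")
      case False
      then show ?thesis using p t by (simp add: psiF_zero)
    next
      case True
      let ?k = "\<lambda>w. if t < s + life (D u w) then kidw \<beta> c (D u w) else 0"
      have "(\<integral>\<^sup>+w. ennreal (\<bar>?\<psi> s y (D u w)\<bar> powr p) \<partial>M) \<le>
         (\<integral>\<^sup>+w. ennreal 16 * (ennreal (own t' s (D u w) powr p) + ennreal (own t s (D u w) powr p) + ennreal (?k w powr p)) \<partial>M)"
      proof (intro nn_integral_mono)
        fix w
        let ?d = "D u w"
        \<comment> \<open>The cancellation: for s + life \<le> t both \<open>own\<close> terms are
          zero and both children terms are equal.\<close>
        have "\<bar>?\<psi> s y ?d\<bar> \<le> own t' s ?d + own t s ?d + ?k w"
          using t by (auto simp: psiF_def own_def intro: order_trans[OF abs_triangle_ineq4])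
        then have "\<bar>?\<psi> s y ?d\<bar> powr p \<le> 16 * (own t' s ?d powr p + own t s ?d powr p + ?k w powr p)"
          using p by (intro powr_le_sum3) auto
        then have "ennreal (\<bar>?\<psi> s y ?d\<bar> powr p) \<le> ennreal (16 * (own t' s ?d powr p + own t s ?d powr p + ?k w powr p))" by (rule ennreal_leI)
        then show "ennreal (\<bar>?\<psi> s y ?d\<bar> powr p) \<le> ennreal 16 * (ennreal (own t' s ?d powr p) + ennreal (own t s ?d powr p) + ennreal (?k w powr p))"
          by (simp add: ennreal_mult ennreal_plus)
      qed
      also have "\<dots> = ennreal 16 * ((\<integral>\<^sup>+w. ennreal (own t' s (D u w) powr p) \<partial>M) + (\<integral>\<^sup>+w. ennreal (own t s (D u w) powr p) \<partial>M) + (\<integral>\<^sup>+w. ennreal (?k w powr p) \<partial>M))"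
        by (simp add: nn_integral_cmult nn_integral_add)
      also have "\<dots> \<le> ennreal 16 * (ennreal (exp (- \<kappa> * (t - s))) + ennreal (exp (- \<kappa> * (t - s))) + ennreal (m2 * exp (- \<kappa> * (t - s))))"
      proof (intro mult_left_mono add_mono kidw_powr_after)
        show "(\<integral>\<^sup>+w. ennreal (own t' s (D u w) powr p) \<partial>M) \<le> ennreal (exp (- \<kappa> * (t - s)))"
          using True t \<kappa> by (intro order_trans[OF own_powr_moment]) (auto intro!: ennreal_leI)
        show "(\<integral>\<^sup>+w. ennreal (own t s (D u w) powr p) \<partial>M) \<le> ennreal (exp (- \<kappa> * (t - s)))"
        proof (cases "s \<le> t")
          case True then show ?thesis by (rule own_powr_moment)
        qed (use p in \<open>simp add: own_def\<close>)
      qed auto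
      also have "\<dots> = ennreal (16 * (exp (- \<kappa> * (t - s)) + exp (- \<kappa> * (t - s)) + m2 * exp (- \<kappa> * (t - s))))"
      proof -
        have *: "ennreal 16 * (ennreal a + ennreal b + ennreal d) = ennreal (16 * (a + b + d))" if "0 \<le> a" "0 \<le> b" "0 \<le> d" for a b d
          using that by (simp add: ennreal_mult ennreal_plus)
        show ?thesis by (rule *) (use m2_nonneg in auto)
      qed
      also have "16 * (exp (- \<kappa> * (t - s)) + exp (- \<kappa> * (t - s)) + m2 * exp (- \<kappa> * (t - s))) = ?K * exp (\<kappa> * s)"
      proof -
        have e: "exp (- \<kappa> * (t - s)) = exp (- \<kappa> * t) * exp (\<kappa> * s)" unfolding exp_add[symmetric] by (simp add: algebra_simps)
        show ?thesis unfolding e by (simp add: algebra_simps)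
      qed
      finally show ?thesis .
    qed
  qed (use \<kappa> psiF_zero t in auto)
  finally show ?thesis by (simp add: algebra_simps)
qed

end

section \<open>Oscillation within a time cell\<close>

text \<open>The fourth root brings the quantity back to the scale of the oscillation.
  \<open>enn2real\<close> would send an infinite value to 0, but for continuous paths the value is
  finite.\<close>

definition osc_root :: "real \<Rightarrow> real \<Rightarrow> (real \<Rightarrow> real) \<Rightarrow> real \<Rightarrow> real" where
  "osc_root b0 \<delta> b r = root 4 (enn2real (osc4 b0 b r \<delta>))"

lemma osc_root_nonneg [simp]: "0 \<le> osc_root b0 \<delta> b r" by (simp add: osc_root_def)

lemma osc_root_pow4: "ennreal (osc_root b0 \<delta> b r ^ 4) \<le> osc4 b0 b r \<delta>"
  by (cases "osc4 b0 b r \<delta>") (auto simp: osc_root_def)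

lemma measurable_osc_root [measurable (raw)]:
  assumes [measurable]: "b \<in> measurable N (\<Pi>\<^sub>M s\<in>(UNIV::real set). (borel :: real measure))" "r \<in> borel_measurable N"
  shows "(\<lambda>x. osc_root b0 \<delta> (b x) (r x)) \<in> borel_measurable N"
  unfolding osc_root_def by measurable

text \<open>A continuous path is bounded on the interval, so \<open>osc4\<close> is finite and
  \<open>enn2real\<close> is faithful; dyadic points are dense, and continuity carries the bound to
  every q.\<close>

lemma osc_root_bound:
  assumes cont: "continuous_on UNIV b" and b0: "0 \<le> b0" and d: "0 < \<delta>" and q: "0 \<le> q" "q \<le> \<delta>"
  shows "exp (b0 * \<bar>b (r + q) - b r\<bar>) - 1 \<le> osc_root b0 \<delta> b r"
proof -
  have "compact ((\<lambda>x. b x - b r) ` {r..r+\<delta>})"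
    by (intro compact_continuous_image continuous_intros continuous_on_subset[OF cont]) auto
  then obtain K where K: "\<And>x. x \<in> {r..r+\<delta>} \<Longrightarrow> \<bar>b x - b r\<bar> \<le> K"
    by (meson bounded_real compact_imp_bounded image_eqI)
  have in01: "r + \<delta> * (real k / 2^m) \<in> {r..r+\<delta>}" if "k \<le> 2^m" for k m :: nat
  proof -
    have "real k \<le> 2^m" using that by (metis of_nat_le_iff of_nat_numeral of_nat_power)
    then have "real k / 2^m \<le> 1" by (simp add: field_simps)
    then have "\<delta> * (real k / 2^m) \<le> \<delta> * 1" using d by (intro mult_left_mono) auto
    moreover have "0 \<le> \<delta> * (real k / 2^m)" using d by auto
    ultimately show ?thesis unfolding atLeastAtMost_iff by linarith
  qed
  have "osc4 b0 b r \<delta> \<le> ennreal ((exp (b0 * K) - 1) ^ 4)"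
    unfolding osc4_def
  proof (intro SUP_least ennreal_leI power_mono)
    fix m k assume k: "k \<in> {..(2::nat)^m}"
    show "exp (b0 * \<bar>pev b (r + \<delta> * (real k / 2^m)) - pev b r\<bar>) - 1 \<le> exp (b0 * K) - 1"
      using K[OF in01[of k m]] k b0 by (simp add: pev_continuous[OF cont] mult_left_mono)
  qed (use b0 in auto)
  then have fin: "osc4 b0 b r \<delta> < \<top>" using ennreal_less_top le_less_trans by blast
  have dy: "exp (b0 * \<bar>b (r + \<delta> * (real k / 2^m)) - b r\<bar>) - 1 \<le> osc_root b0 \<delta> b r" if "k \<le> 2^m" for k m
  proof -
    have "ennreal ((exp (b0 * \<bar>pev b (r + \<delta> * (real k / 2^m)) - pev b r\<bar>) - 1) ^ 4) \<le> osc4 b0 b r \<delta>"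
      unfolding osc4_def using that by (intro SUP_upper2[of m] SUP_upper) auto
    then have "(exp (b0 * \<bar>b (r + \<delta> * (real k / 2^m)) - b r\<bar>) - 1) ^ 4 \<le> enn2real (osc4 b0 b r \<delta>)"
      using fin by (cases "osc4 b0 b r \<delta>") (auto simp: pev_continuous[OF cont])
    then have "root 4 ((exp (b0 * \<bar>b (r + \<delta> * (real k / 2^m)) - b r\<bar>) - 1) ^ 4) \<le> osc_root b0 \<delta> b r"
      unfolding osc_root_def by (intro real_root_le_mono) auto
    then show ?thesis using b0 by (subst (asm) real_root_power_cancel) auto
  qed
  define x where "x = q / \<delta>"
  have x: "0 \<le> x" "x \<le> 1" "q = \<delta> * x" using d q by (auto simp: x_def)
  have "(\<lambda>m. exp (b0 * \<bar>b (r + \<delta> * (real_of_int \<lfloor>x * 2^m\<rfloor> / 2^m)) - b r\<bar>) - 1) \<longlonglongrightarrow> exp (b0 * \<bar>b (r + \<delta> * x) - b r\<bar>) - 1"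
  proof (intro tendsto_intros)
    have "isCont b (r + \<delta> * x)" using cont by (simp add: continuous_on_eq_continuous_at)
    then show "(\<lambda>m. b (r + \<delta> * (real_of_int \<lfloor>x * 2^m\<rfloor> / 2^m))) \<longlonglongrightarrow> b (r + \<delta> * x)"
      by (rule isCont_tendsto_compose) (intro tendsto_intros dyadic_floor_tendsto)
  qed
  then show ?thesis unfolding x(3)
  proof (rule LIMSEQ_le_const2, intro exI[of _ 0] allI impI)
    fix m :: nat
    define k where "k = nat \<lfloor>x * 2^m\<rfloor>"
    have k0: "0 \<le> \<lfloor>x * 2^m\<rfloor>" using x by simp
    have "\<lfloor>x * 2^m\<rfloor> \<le> \<lfloor>(2::real)^m\<rfloor>" using x by (intro floor_mono) (simp add: mult_left_le_one_le)
    also have "\<dots> = 2^m" by (metis floor_of_int of_int_numeral of_int_power)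
    finally have "k \<le> 2^m" unfolding k_def using k0 by (simp add: nat_le_iff)
    moreover have "real_of_int \<lfloor>x * 2^m\<rfloor> = real k" using k0 by (simp add: k_def)
    ultimately show "exp (b0 * \<bar>b (r + \<delta> * (real_of_int \<lfloor>x * 2^m\<rfloor> / 2^m)) - b r\<bar>) - 1 \<le> osc_root b0 \<delta> b r"
      using dy[of k m] by simp
  qed
qed

context bbm_beta begin

text \<open>At least \<beta> and at least 1, so that exp (b0 |x|) - 1 dominates both |exp (\<beta>
  x) - 1| and |x|.\<close>

definition b0 :: real where "b0 = max \<beta> 1"
definition Kv :: real where "Kv = 3400000 * exp (16 * b0\<^sup>2) * b0^4"
text \<open>A bound for the relative change of weight plus the displacement in the moving frame
  during a time \<delta>: one \<open>osc_root\<close> for each of them, c \<delta> for the discount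
  and \<beta> \<delta> for the drift.\<close>

definition Osc :: "real \<Rightarrow> (real \<Rightarrow> real) \<Rightarrow> real \<Rightarrow> real" where "Osc \<delta> b r = 2 * osc_root b0 \<delta> b r + (c + \<beta>) * \<delta>"
definition Co :: real where "Co = 2 + 2 * Kv + c + \<beta>"
definition Cp :: real where "Cp = 16 * (1 + Kv) + 4 * (c + \<beta> + 1) powr p"
text \<open>The rate \<surd>\<delta> is that of a Brownian oscillation; the 3 covers deaths
  (\<delta>) and births (2 \<delta>) in the cell, and exp 2 pays for measuring the mass at the end
  of the cell rather than at its beginning.\<close>

definition eps :: "real \<Rightarrow> real" where "eps \<delta> = (Co + 3) * sqrt \<delta> * exp 2"

lemma c_pos: "1 \<le> c" by (simp add: c_beta_def)
lemma b0: "1 \<le> b0" "\<beta> \<le> b0" "0 \<le> b0" by (auto simp: b0_def)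
lemma Kv_nonneg: "0 \<le> Kv" by (simp add: Kv_def)
lemma Co_nonneg: "0 \<le> Co" using c_pos \<beta> Kv_nonneg by (simp add: Co_def)
lemma Cp_pos: "0 < Cp" using Kv_nonneg by (simp add: Cp_def add_pos_nonneg)
lemma eps_nonneg: "0 \<le> \<delta> \<Longrightarrow> 0 \<le> eps \<delta>" using Co_nonneg by (simp add: eps_def)
lemma Osc_nonneg: "0 \<le> \<delta> \<Longrightarrow> 0 \<le> Osc \<delta> b r" using c_pos \<beta> by (simp add: Osc_def)

lemma measurable_Osc [measurable (raw)]:
  assumes [measurable]: "b \<in> measurable N (\<Pi>\<^sub>M s\<in>(UNIV::real set). (borel :: real measure))" "r \<in> borel_measurable N"
  shows "(\<lambda>x. Osc \<delta> (b x) (r x)) \<in> borel_measurable N"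
  unfolding Osc_def by measurable

lemma osc_root_moment:
  assumes r: "0 \<le> r" and d: "0 < \<delta>" "\<delta> \<le> 1"
  shows "(\<integral>\<^sup>+w. ennreal (exp (l * pev (B u w) r)) * ennreal (osc_root b0 \<delta> (B u w) r ^ 4) \<partial>M) \<le> ennreal (exp (l\<^sup>2 * r / 2) * (Kv * \<delta>\<^sup>2))"
proof -
  have "(\<integral>\<^sup>+w. ennreal (exp (l * pev (B u w) r)) * ennreal (osc_root b0 \<delta> (B u w) r ^ 4) \<partial>M)
    \<le> (\<integral>\<^sup>+w. ennreal (exp (l * B u w r)) * osc4 b0 (B u w) r \<delta> \<partial>M)"
    by (intro nn_integral_mono mult_mono osc_root_pow4) auto
  also have "\<dots> \<le> ennreal (exp (l\<^sup>2 * r / 2) * (3400000 * exp (16 * b0\<^sup>2) * b0^4) * \<delta>\<^sup>2)"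
    by (rule osc4_weighted_nn_integral_le[OF prob_space_axioms brownian r d])
  finally show ?thesis by (simp add: Kv_def mult.assoc)
qed

lemma weighted_affine_osc_root:
  assumes r: "0 \<le> r" and d: "0 < \<delta>" "\<delta> \<le> 1" and ab: "0 \<le> a" "0 \<le> b"
  shows "(\<integral>\<^sup>+w. ennreal (exp (l * pev (B u w) r)) * ennreal (a + b * osc_root b0 \<delta> (B u w) r ^ 4) \<partial>M) \<le> ennreal (exp (l\<^sup>2 * r / 2) * (a + b * (Kv * \<delta>\<^sup>2)))"
proof -
  have "(\<integral>\<^sup>+w. ennreal (exp (l * pev (B u w) r)) * ennreal (a + b * osc_root b0 \<delta> (B u w) r ^ 4) \<partial>M) =
    (\<integral>\<^sup>+w. ennreal a * ennreal (exp (l * pev (B u w) r)) + ennreal b * (ennreal (exp (l * pev (B u w) r)) * ennreal (osc_root b0 \<delta> (B u w) r ^ 4)) \<partial>M)"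
    using ab by (intro nn_integral_cong) (simp add: ennreal_plus ennreal_mult distrib_left ac_simps)
  also have "\<dots> = ennreal a * (\<integral>\<^sup>+w. ennreal (exp (l * pev (B u w) r)) \<partial>M) + ennreal b * (\<integral>\<^sup>+w. ennreal (exp (l * pev (B u w) r)) * ennreal (osc_root b0 \<delta> (B u w) r ^ 4) \<partial>M)"
    by (simp add: nn_integral_add nn_integral_cmult)
  also have "(\<integral>\<^sup>+w. ennreal (exp (l * pev (B u w) r)) \<partial>M) = ennreal (exp (l\<^sup>2 * r / 2))"
    using path_tilt[OF r, of "\<lambda>_. 1" l u 0] by simp
  also have "ennreal a * ennreal (exp (l\<^sup>2 * r / 2)) + ennreal b * (\<integral>\<^sup>+w. ennreal (exp (l * pev (B u w) r)) * ennreal (osc_root b0 \<delta> (B u w) r ^ 4) \<partial>M)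
     \<le> ennreal a * ennreal (exp (l\<^sup>2 * r / 2)) + ennreal b * ennreal (exp (l\<^sup>2 * r / 2) * (Kv * \<delta>\<^sup>2))"
    by (intro add_left_mono mult_left_mono osc_root_moment r d) auto
  also have "\<dots> = ennreal (a * exp (l\<^sup>2 * r / 2) + b * (exp (l\<^sup>2 * r / 2) * (Kv * \<delta>\<^sup>2)))"
    using ab Kv_nonneg by (simp add: ennreal_plus ennreal_mult)
  finally show ?thesis by (simp add: algebra_simps)
qed

lemma Osc_weighted_mean:
  assumes r: "0 \<le> r" and d: "0 < \<delta>" "\<delta> \<le> 1"
  shows "(\<integral>\<^sup>+w. ennreal (exp (l * pev (B u w) r)) * ennreal (Osc \<delta> (B u w) r) \<partial>M) \<le> ennreal (exp (l\<^sup>2 * r / 2) * (Co * sqrt \<delta>))"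
proof -
  define e where "e = sqrt \<delta>"
  have e: "0 < e" "e \<le> 1" "e\<^sup>2 = \<delta>" using d by (auto simp: e_def)
  have de: "\<delta> \<le> e" using e by (simp add: power2_eq_square e(3)[symmetric] mult_left_le)
  have "(\<integral>\<^sup>+w. ennreal (exp (l * pev (B u w) r)) * ennreal (Osc \<delta> (B u w) r) \<partial>M) \<le>
    (\<integral>\<^sup>+w. ennreal (exp (l * pev (B u w) r)) * ennreal ((2 + c + \<beta>) * e + 2 / e^3 * osc_root b0 \<delta> (B u w) r ^ 4) \<partial>M)"
  proof (intro nn_integral_mono mult_left_mono ennreal_leI)
    fix w
    define v where "v = osc_root b0 \<delta> (B u w) r"
    have v: "0 \<le> v" by (simp add: v_def)
    \<comment> \<open>With e = \<surd>\<delta>, a fourth moment of order \<delta>^2 becomes a first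
      moment of order \<delta>^2 / \<delta>^(3/2) = \<surd>\<delta>.\<close>
    have "v \<le> e + v^4 / e^3"
    proof (cases "v \<le> e")
      case True then show ?thesis using v e by (simp add: add_increasing2)
    next
      case False
      then have "e^3 \<le> v^3" using e by (intro power_mono) auto
      then have "v * e^3 \<le> v * v^3" using v by (intro mult_left_mono) auto
      then have "v \<le> v^4 / e^3" using e by (simp add: field_simps power4_eq_xxxx power3_eq_cube)
      then show ?thesis using e by linarith
    qed
    then have "2 * v \<le> 2 * e + 2 / e^3 * v^4" by (simp add: field_simps)
    moreover have "(c + \<beta>) * \<delta> \<le> (c + \<beta>) * e" using de c_pos \<beta> by (intro mult_left_mono) auto
    ultimately show "Osc \<delta> (B u w) r \<le> (2 + c + \<beta>) * e + 2 / e^3 * osc_root b0 \<delta> (B u w) r ^ 4"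
      unfolding Osc_def v_def[symmetric] by (simp add: algebra_simps)
  qed auto
  also have "\<dots> \<le> ennreal (exp (l\<^sup>2 * r / 2) * ((2 + c + \<beta>) * e + 2 / e^3 * (Kv * \<delta>\<^sup>2)))"
    using e c_pos \<beta> by (intro weighted_affine_osc_root r d) auto
  also have "2 / e^3 * (Kv * \<delta>\<^sup>2) = 2 * Kv * e"
    unfolding e(3)[symmetric] using e(1) by (simp add: power2_eq_square power3_eq_cube)
  finally show ?thesis by (simp add: e_def[symmetric] Co_def algebra_simps)
qed

text \<open>Only a bound uniform in \<delta> is wanted, for which v^p \<le> 1 + v^4
  suffices.\<close>

lemma Osc_weighted_powr:
  assumes r: "0 \<le> r" and d: "0 < \<delta>" "\<delta> \<le> 1"
  shows "(\<integral>\<^sup>+w. ennreal (exp (l * pev (B u w) r)) * ennreal ((Osc \<delta> (B u w) r + 1) powr p) \<partial>M) \<le> ennreal (exp (l\<^sup>2 * r / 2) * Cp)"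
proof -
  let ?C = "c + \<beta> + 1"
  have "(\<integral>\<^sup>+w. ennreal (exp (l * pev (B u w) r)) * ennreal ((Osc \<delta> (B u w) r + 1) powr p) \<partial>M) \<le>
    (\<integral>\<^sup>+w. ennreal (exp (l * pev (B u w) r)) * ennreal ((16 + 4 * ?C powr p) + 16 * osc_root b0 \<delta> (B u w) r ^ 4) \<partial>M)"
  proof (intro nn_integral_mono mult_left_mono ennreal_leI)
    fix w
    define v where "v = osc_root b0 \<delta> (B u w) r"
    have v: "0 \<le> v" by (simp add: v_def)
    have "(c + \<beta>) * \<delta> \<le> c + \<beta>" using d c_pos \<beta> by (simp add: mult_left_le)
    then have "(Osc \<delta> (B u w) r + 1) powr p \<le> \<bar>2 * v + ?C\<bar> powr p"
      using d p Osc_nonneg[of \<delta>] unfolding Osc_def v_def[symmetric]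
      by (intro powr_mono2) (auto simp: v_def add_increasing2 mult_nonneg_nonneg c_pos \<beta> order_trans[OF zero_le_one c_pos] intro!: add_nonneg_nonneg)
    also have "\<dots> \<le> 4 * (\<bar>2 * v\<bar> powr p + \<bar>?C\<bar> powr p)" using p by (intro abs_add_powr_le_4) auto
    also have "\<bar>2 * v\<bar> powr p \<le> 4 * (1 + v^4)"
    proof -
      have "\<bar>2 * v\<bar> powr p = 2 powr p * v powr p" using v by (simp add: powr_mult)
      also have "\<dots> \<le> 2 powr (2::real) * (1 + v^4)"
      proof (intro mult_mono powr_mono)
        show "v powr p \<le> 1 + v^4"
        proof (cases "v \<le> 1")
          case True
          then have "v powr p \<le> 1 powr p" using v p by (intro powr_mono2) auto
          then show ?thesis using v by (simp add: add_increasing2)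
        next
          case False
          then have "v powr p \<le> v powr 4" using p by (intro powr_mono) auto
          also have "\<dots> = v^4" using False by (simp add: powr_numeral)
          finally show ?thesis by simp
        qed
      qed (use p in auto)
      finally show ?thesis by simp
    qed
    finally show "(Osc \<delta> (B u w) r + 1) powr p \<le> (16 + 4 * ?C powr p) + 16 * osc_root b0 \<delta> (B u w) r ^ 4"
      using c_pos \<beta> unfolding v_def[symmetric] by simp
  qed auto
  also have "\<dots> \<le> ennreal (exp (l\<^sup>2 * r / 2) * ((16 + 4 * ?C powr p) + 16 * (Kv * \<delta>\<^sup>2)))"
    by (intro weighted_affine_osc_root r d) auto
  also have "\<dots> \<le> ennreal (exp (l\<^sup>2 * r / 2) * Cp)"
  proof (intro ennreal_leI mult_left_mono)
    have "Kv * \<delta>\<^sup>2 \<le> Kv" using d Kv_nonneg by (intro mult_left_le) (auto simp: power_le_one)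
    then show "(16 + 4 * ?C powr p) + 16 * (Kv * \<delta>\<^sup>2) \<le> Cp" by (simp add: Cp_def)
  qed auto
  finally show ?thesis .
qed

text \<open>\<open>psiV\<close> dominates the change of the contribution of a particle within the cell \<open>[t, t + \<delta>]\<close>. For a
  particle born inside the cell the initial weight is not small and is charged to its parent (last summand);
  only the oscillation after its birth is charged to the particle itself.\<close>

definition psiV :: "real \<Rightarrow> real \<Rightarrow> real \<Rightarrow> pdata \<Rightarrow> real" where
  "psiV \<delta> t s d = own t s d * (Osc \<delta> (traj d) (t - s) + (if life d \<le> t - s + \<delta> then 1 else 0))
     + (if t < s \<and> s \<le> t + \<delta> then Osc \<delta> (traj d) 0 else 0)
     + (if s \<le> t + \<delta> \<and> t < s + life d \<and> s + life d \<le> t + \<delta> then kidw \<beta> c d else 0)"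

lemma measurable_psiV [measurable (raw)]:
  assumes [measurable]: "s \<in> borel_measurable N" "d \<in> measurable N pdata_space"
  shows "(\<lambda>x. psiV \<delta> t (s x) (d x)) \<in> borel_measurable N"
proof -
  have [measurable]: "(\<lambda>x. life (d x)) \<in> borel_measurable N" "(\<lambda>x. traj (d x)) \<in> measurable N (\<Pi>\<^sub>M s\<in>UNIV. borel)"
    "(\<lambda>x. kidw \<beta> c (d x)) \<in> borel_measurable N"
    by measurable
  show ?thesis unfolding psiV_def by measurable
qed

lemma psiV_nonneg: "0 \<le> \<delta> \<Longrightarrow> 0 \<le> psiV \<delta> t s d"
  unfolding psiV_def by (intro add_nonneg_nonneg mult_nonneg_nonneg) (auto simp: Osc_nonneg)

lemma kid_cell_mean:
  assumes d: "0 < \<delta>" and s: "s \<le> t + \<delta>"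
  shows "(\<integral>\<^sup>+w. ennreal (if s \<le> t + \<delta> \<and> t < s + life (D u w) \<and> s + life (D u w) \<le> t + \<delta> then kidw \<beta> c (D u w) else 0) \<partial>M)
     \<le> ennreal (2 * \<delta> * exp (- 2 * max 0 (t - s)))"
proof -
  let ?a = "max 0 (t - s)" and ?r = "t - s + \<delta>"
  have ar: "0 \<le> ?a" "?a \<le> ?r" "?r - ?a \<le> \<delta>" using d s by auto
  have "(\<integral>\<^sup>+w. ennreal (if s \<le> t + \<delta> \<and> t < s + life (D u w) \<and> s + life (D u w) \<le> t + \<delta> then kidw \<beta> c (D u w) else 0) \<partial>M)
    = (\<integral>\<^sup>+w. ennreal (if ?a < life (D u w) \<and> life (D u w) \<le> ?r then kidw \<beta> c (D u w) else 0) \<partial>M)"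
    using s by (intro nn_integral_cong_AE, use tau_pos[of u] in eventually_elim) auto
  also have "\<dots> = ennreal (exp (- 2 * ?a) - exp (- 2 * ?r))" by (rule kidw_between[OF ar(1,2)])
  also have "\<dots> \<le> ennreal (2 * \<delta> * exp (- 2 * ?a))"
  proof (rule ennreal_leI)
    have "exp (- 2 * ?a) * (1 + - 2 * \<delta>) \<le> exp (- 2 * ?a) * exp (- 2 * \<delta>)"
      using exp_ge_add_one_self[of "- 2 * \<delta>"] by (intro mult_left_mono) auto
    also have "\<dots> = exp (- 2 * (?a + \<delta>))" by (simp add: exp_add[symmetric] algebra_simps)
    also have "\<dots> \<le> exp (- 2 * ?r)" using ar by simp
    finally show "exp (- 2 * ?a) - exp (- 2 * ?r) \<le> 2 * \<delta> * exp (- 2 * ?a)" by (simp add: algebra_simps)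
  qed
  finally show ?thesis .
qed

text \<open>The right-hand side is \<open>eps \<delta>\<close> times the mean of
  \<open>own (t + \<delta>) s\<close>, so that mass at the end of the cell can compensate it. For s
  \<le> t the three summands contribute Co \<surd>\<delta>, \<delta> and 2 \<delta>, all times exp
  (-2 (t - s)). For a birth inside the cell only the oscillation from birth and the children
  remain.\<close>

lemma psiV_mean:
  assumes d: "0 < \<delta>" "\<delta> \<le> 1" and s: "s \<le> t + \<delta>"
  shows "(\<integral>\<^sup>+w. ennreal (psiV \<delta> t s (D u w)) \<partial>M) \<le> ennreal (eps \<delta> * exp (- 2 * (t + \<delta> - s)))"
proof -
  let ?T3 = "\<lambda>w. if s \<le> t + \<delta> \<and> t < s + life (D u w) \<and> s + life (D u w) \<le> t + \<delta> then kidw \<beta> c (D u w) else 0"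
  have dsq: "\<delta> \<le> sqrt \<delta>" using d by (simp add: real_le_rsqrt power2_eq_square mult_left_le)
  show ?thesis
  proof (cases "s \<le> t")
    case True
    let ?r = "t - s"
    have r: "0 \<le> ?r" using True by simp
    let ?\<Phi> = "\<lambda>b. ennreal (exp (- c * ?r)) * (ennreal (exp (\<beta> * pev b ?r)) * ennreal (Osc \<delta> b ?r))"
    let ?\<Phi>2 = "\<lambda>b. ennreal (exp (\<beta> * pev b ?r - c * ?r))"
    have ex: "exp (\<beta> * x - c * ?r) = exp (- c * ?r) * exp (\<beta> * x)" for x by (simp add: exp_add[symmetric])
    have "(\<integral>\<^sup>+w. ennreal (psiV \<delta> t s (D u w)) \<partial>M) =
      (\<integral>\<^sup>+w. indicator {?r<..} (life (D u w)) * ?\<Phi> (traj (D u w)) + indicator {?r<..?r+\<delta>} (life (D u w)) * ?\<Phi>2 (traj (D u w)) + ennreal (?T3 w) \<partial>M)"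
      using True d by (intro nn_integral_cong)
        (auto simp: psiV_def own_def indicator_def ex Osc_nonneg ennreal_plus ennreal_mult distrib_left mult.assoc)
    also have "\<dots> = (\<integral>\<^sup>+w. indicator {?r<..} (life (D u w)) * ?\<Phi> (traj (D u w)) \<partial>M) + (\<integral>\<^sup>+w. indicator {?r<..?r+\<delta>} (life (D u w)) * ?\<Phi>2 (traj (D u w)) \<partial>M) + (\<integral>\<^sup>+w. ennreal (?T3 w) \<partial>M)"
      by (simp add: nn_integral_add)
    also have "(\<integral>\<^sup>+w. indicator {?r<..} (life (D u w)) * ?\<Phi> (traj (D u w)) \<partial>M) = (\<integral>\<^sup>+w. indicator {?r<..} (tau u w) \<partial>M) * (\<integral>\<^sup>+w. ?\<Phi> (B u w) \<partial>M)"
      by (rule life_path_nn_integral) measurable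
    also have "(\<integral>\<^sup>+w. indicator {?r<..?r+\<delta>} (life (D u w)) * ?\<Phi>2 (traj (D u w)) \<partial>M) = (\<integral>\<^sup>+w. indicator {?r<..?r+\<delta>} (tau u w) \<partial>M) * (\<integral>\<^sup>+w. ?\<Phi>2 (B u w) \<partial>M)"
      by (rule life_path_nn_integral) measurable
    also have "(\<integral>\<^sup>+w. indicator {?r<..} (tau u w) \<partial>M) * (\<integral>\<^sup>+w. ?\<Phi> (B u w) \<partial>M) +
       (\<integral>\<^sup>+w. indicator {?r<..?r+\<delta>} (tau u w) \<partial>M) * (\<integral>\<^sup>+w. ?\<Phi>2 (B u w) \<partial>M) + (\<integral>\<^sup>+w. ennreal (?T3 w) \<partial>M)
       \<le> ennreal (exp (- ?r)) * (ennreal (exp (- c * ?r)) * ennreal (exp (\<beta>\<^sup>2 * ?r / 2) * (Co * sqrt \<delta>)))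
        + ennreal (exp (- ?r) * \<delta>) * ennreal (exp (- ?r)) + ennreal (2 * \<delta> * exp (- 2 * ?r))"
    proof (intro add_mono mult_mono)
      show "(\<integral>\<^sup>+w. indicator {?r<..} (tau u w) \<partial>M) \<le> ennreal (exp (- ?r))" using r by (simp add: tau_gt)
      show "(\<integral>\<^sup>+w. ?\<Phi> (B u w) \<partial>M) \<le> ennreal (exp (- c * ?r)) * ennreal (exp (\<beta>\<^sup>2 * ?r / 2) * (Co * sqrt \<delta>))"
        by (subst nn_integral_cmult) (auto intro!: mult_left_mono Osc_weighted_mean r d)
      show "(\<integral>\<^sup>+w. indicator {?r<..?r+\<delta>} (tau u w) \<partial>M) \<le> ennreal (exp (- ?r) * \<delta>)" using r d by (intro tau_between) auto
      show "(\<integral>\<^sup>+w. ?\<Phi>2 (B u w) \<partial>M) \<le> ennreal (exp (- ?r))"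
        using path_tilt[OF r, of "\<lambda>_. 1" \<beta> u c] by (simp add: c_beta_def)
      show "(\<integral>\<^sup>+w. ennreal (?T3 w) \<partial>M) \<le> ennreal (2 * \<delta> * exp (- 2 * ?r))"
        using kid_cell_mean[OF d(1) s, of u] r by simp
    qed auto
    also have "\<dots> = ennreal (exp (- 2 * ?r) * (Co * sqrt \<delta> + \<delta> + 2 * \<delta>))"
    proof -
      have e1: "exp (- ?r) * (exp (- c * ?r) * exp (\<beta>\<^sup>2 * ?r / 2)) = exp (- 2 * ?r)"
        unfolding exp_add[symmetric] c_beta_def by (simp add: field_simps)
      have e2: "exp (- ?r) * exp (- ?r) = exp (- 2 * ?r)" unfolding exp_add[symmetric] by simp
      have "ennreal (exp (- ?r)) * (ennreal (exp (- c * ?r)) * ennreal (exp (\<beta>\<^sup>2 * ?r / 2) * (Co * sqrt \<delta>))) = ennreal (exp (- 2 * ?r) * (Co * sqrt \<delta>))"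
        unfolding e1[symmetric] using Co_nonneg d by (simp add: ennreal_mult[symmetric] mult.assoc)
      moreover have "ennreal (exp (- ?r) * \<delta>) * ennreal (exp (- ?r)) = ennreal (exp (- 2 * ?r) * \<delta>)"
        unfolding e2[symmetric] using d by (simp add: ennreal_mult[symmetric] ac_simps)
      moreover have "ennreal (exp (- 2 * ?r) * (Co * sqrt \<delta>)) + ennreal (exp (- 2 * ?r) * \<delta>) + ennreal (2 * \<delta> * exp (- 2 * ?r))
        = ennreal (exp (- 2 * ?r) * (Co * sqrt \<delta>) + exp (- 2 * ?r) * \<delta> + 2 * \<delta> * exp (- 2 * ?r))"
        using Co_nonneg d by (simp only: ennreal_plus add_nonneg_nonneg mult_nonneg_nonneg exp_ge_zero real_sqrt_ge_zero less_imp_le zero_le_numeral)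
      moreover have "exp (- 2 * ?r) * (Co * sqrt \<delta>) + exp (- 2 * ?r) * \<delta> + 2 * \<delta> * exp (- 2 * ?r) = exp (- 2 * ?r) * (Co * sqrt \<delta> + \<delta> + 2 * \<delta>)"
        by (simp add: algebra_simps)
      ultimately show ?thesis by (simp only:)
    qed
    also have "\<dots> \<le> ennreal (eps \<delta> * exp (- 2 * (t + \<delta> - s)))"
    proof (rule ennreal_leI)
      \<comment> \<open>Passing to the end of the cell costs exp (2 \<delta>) \<le> exp 2.\<close>
      have "exp (- 2 * ?r) = exp (2 * \<delta>) * exp (- 2 * (t + \<delta> - s))" unfolding exp_add[symmetric] by (simp add: algebra_simps)
      also have "\<dots> \<le> exp 2 * exp (- 2 * (t + \<delta> - s))" using d by (intro mult_right_mono) auto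
      finally have e: "exp (- 2 * ?r) \<le> exp 2 * exp (- 2 * (t + \<delta> - s))" .
      have "Co * sqrt \<delta> + \<delta> + 2 * \<delta> \<le> (Co + 3) * sqrt \<delta>" using dsq by (simp add: algebra_simps)
      then have "exp (- 2 * ?r) * (Co * sqrt \<delta> + \<delta> + 2 * \<delta>) \<le> (exp 2 * exp (- 2 * (t + \<delta> - s))) * ((Co + 3) * sqrt \<delta>)"
        using e Co_nonneg d by (intro mult_mono) auto
      then show "exp (- 2 * ?r) * (Co * sqrt \<delta> + \<delta> + 2 * \<delta>) \<le> eps \<delta> * exp (- 2 * (t + \<delta> - s))" by (simp add: eps_def ac_simps)
    qed
    finally show ?thesis .
  next
    case False
    have "(\<integral>\<^sup>+w. ennreal (psiV \<delta> t s (D u w)) \<partial>M) = (\<integral>\<^sup>+w. ennreal (Osc \<delta> (traj (D u w)) 0) + ennreal (?T3 w) \<partial>M)"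
      using False s d by (intro nn_integral_cong) (auto simp: psiV_def own_def Osc_nonneg ennreal_plus)
    also have "\<dots> = (\<integral>\<^sup>+w. ennreal (Osc \<delta> (traj (D u w)) 0) \<partial>M) + (\<integral>\<^sup>+w. ennreal (?T3 w) \<partial>M)"
      by (rule nn_integral_add) measurable
    also have "\<dots> \<le> ennreal (Co * sqrt \<delta>) + ennreal (2 * \<delta>)"
    proof (intro add_mono)
      show "(\<integral>\<^sup>+w. ennreal (Osc \<delta> (traj (D u w)) 0) \<partial>M) \<le> ennreal (Co * sqrt \<delta>)"
        using Osc_weighted_mean[of 0 \<delta> 0 u] d by simp
      show "(\<integral>\<^sup>+w. ennreal (?T3 w) \<partial>M) \<le> ennreal (2 * \<delta>)"
        using kid_cell_mean[OF d(1) s, of u] False by simp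
    qed
    also have "\<dots> = ennreal (Co * sqrt \<delta> + 2 * \<delta>)" using Co_nonneg d by (subst ennreal_plus) auto
    also have "\<dots> \<le> ennreal (eps \<delta> * exp (- 2 * (t + \<delta> - s)))"
    proof (rule ennreal_leI)
      have "Co * sqrt \<delta> + 2 * \<delta> \<le> (Co + 3) * sqrt \<delta> * 1" using dsq d by (simp add: algebra_simps)
      also have "\<dots> \<le> (Co + 3) * sqrt \<delta> * (exp 2 * exp (- 2 * (t + \<delta> - s)))"
        using Co_nonneg d False by (intro mult_left_mono) (auto simp: exp_add[symmetric])
      finally show "Co * sqrt \<delta> + 2 * \<delta> \<le> eps \<delta> * exp (- 2 * (t + \<delta> - s))" by (simp add: eps_def ac_simps)
    qed
    finally show ?thesis .
  qed
qed

end

text \<open>The last clause of \<open>nice\<close> holds for constants and for compactly supported Lipschitz functions;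
  it absorbs the change of the scale \<open>\<surd>t\<close> within a cell.\<close>

definition nice :: "real \<Rightarrow> (real \<Rightarrow> real) \<Rightarrow> bool" where
  "nice K f \<longleftrightarrow> (\<forall>x. \<bar>f x\<bar> \<le> K) \<and> (\<forall>x y. \<bar>f x - f y\<bar> \<le> K * \<bar>x - y\<bar>) \<and>
     (\<forall>\<theta> x. 1/2 \<le> \<theta> \<longrightarrow> \<theta> \<le> 1 \<longrightarrow> \<bar>f (\<theta> * x) - f x\<bar> \<le> K * (1 - \<theta>))"

context bbm_beta begin

text \<open>The subtracted term, \<open>eps \<delta>\<close> times the mass alive at the end of the cell, makes the mean nonpositive.\<close>

definition psiT :: "real \<Rightarrow> real \<Rightarrow> real \<Rightarrow> pdata \<Rightarrow> real" where
  "psiT \<delta> t s d = psiV \<delta> t s d - eps \<delta> * own (t + \<delta>) s d"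

lemma measurable_psiT [measurable (raw)]:
  assumes [measurable]: "s \<in> borel_measurable N" "d \<in> measurable N pdata_space"
  shows "(\<lambda>x. psiT \<delta> t (s x) (d x)) \<in> borel_measurable N"
  unfolding psiT_def by measurable

lemma psiT_zero: "0 < \<delta> \<Longrightarrow> t + \<delta> < s \<Longrightarrow> psiT \<delta> t s d = 0"
  by (simp add: psiT_def psiV_def own_def)

lemma psiT_mean:
  assumes d: "0 < \<delta>" "\<delta> \<le> 1" and s: "s \<le> t + \<delta>"
  shows "(\<integral>w. psiT \<delta> t s (D u w) \<partial>M) \<le> 0"
proof -
  have 1: "integrable M (\<lambda>w. psiV \<delta> t s (D u w))"
    using psiV_mean[OF d s, of u] d by (intro integrableI_nonneg) (auto simp: psiV_nonneg intro: le_less_trans)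
  have 2: "integrable M (\<lambda>w. own (t + \<delta>) s (D u w))"
    using own_mean[OF s, of u] by (intro integrableI_nonneg) auto
  have "ennreal (\<integral>w. psiV \<delta> t s (D u w) \<partial>M) \<le> ennreal (eps \<delta> * exp (- 2 * (t + \<delta> - s)))"
    using psiV_mean[OF d s, of u] nn_integral_eq_integral[OF 1] d by (simp add: psiV_nonneg)
  then have 3: "(\<integral>w. psiV \<delta> t s (D u w) \<partial>M) \<le> eps \<delta> * exp (- 2 * (t + \<delta> - s))"
    using d eps_nonneg[of \<delta>] by (subst (asm) ennreal_le_iff) auto
  have "ennreal (\<integral>w. own (t + \<delta>) s (D u w) \<partial>M) = ennreal (exp (- 2 * (t + \<delta> - s)))"
    using own_mean[OF s, of u] nn_integral_eq_integral[OF 2] by simp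
  then have 4: "(\<integral>w. own (t + \<delta>) s (D u w) \<partial>M) = exp (- 2 * (t + \<delta> - s))"
    by (subst (asm) ennreal_inj) (auto intro!: integral_nonneg_AE)
  show ?thesis unfolding psiT_def using 1 2 3 4 by simp
qed

lemma Osc_powr_alive:
  assumes d: "0 < \<delta>" "\<delta> \<le> 1"
  shows "(\<integral>\<^sup>+w. ennreal ((own t s (D u w) * (Osc \<delta> (traj (D u w)) (t - s) + 1) + (if t < s \<and> s \<le> t + \<delta> then Osc \<delta> (traj (D u w)) 0 else 0)) powr p) \<partial>M)
    \<le> ennreal (Cp * exp (- \<kappa> * (t - s)))"
proof (cases "s \<le> t")
  case True
  let ?r = "t - s"
  have r: "0 \<le> ?r" using True by simp
  let ?\<Phi> = "\<lambda>b. ennreal (exp (- (p * c) * ?r)) * (ennreal (exp ((p * \<beta>) * pev b ?r)) * ennreal ((Osc \<delta> b ?r + 1) powr p))"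
  have "(\<integral>\<^sup>+w. ennreal ((own t s (D u w) * (Osc \<delta> (traj (D u w)) (t - s) + 1) + (if t < s \<and> s \<le> t + \<delta> then Osc \<delta> (traj (D u w)) 0 else 0)) powr p) \<partial>M)
    = (\<integral>\<^sup>+w. indicator {?r<..} (life (D u w)) * ?\<Phi> (traj (D u w)) \<partial>M)"
  proof (intro nn_integral_cong)
    fix w
    have e: "exp (\<beta> * x - c * ?r) powr p = exp (- (p * c) * ?r) * exp ((p * \<beta>) * x)" for x
      unfolding exp_powr_real exp_add[symmetric] by (simp add: algebra_simps)
    show "ennreal ((own t s (D u w) * (Osc \<delta> (traj (D u w)) (t - s) + 1) + (if t < s \<and> s \<le> t + \<delta> then Osc \<delta> (traj (D u w)) 0 else 0)) powr p)
      = indicator {?r<..} (life (D u w)) * ?\<Phi> (traj (D u w))"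
    proof (cases "t < s + life (D u w)")
      case T: True
      have "(exp (\<beta> * pev (B u w) ?r - c * ?r) * (Osc \<delta> (B u w) ?r + 1)) powr p =
        exp (- (p * c) * ?r) * (exp ((p * \<beta>) * pev (B u w) ?r) * (Osc \<delta> (B u w) ?r + 1) powr p)"
        unfolding powr_mult e by (simp only: mult.assoc)
      then show ?thesis using True T by (simp add: own_def ennreal_mult)
    next
      case False
      then show ?thesis using True p by (simp add: own_def)
    qed
  qed
  also have "\<dots> = (\<integral>\<^sup>+w. indicator {?r<..} (tau u w) \<partial>M) * (\<integral>\<^sup>+w. ?\<Phi> (B u w) \<partial>M)"
    by (rule life_path_nn_integral) measurable
  also have "\<dots> \<le> ennreal (exp (- ?r)) * (ennreal (exp (- (p * c) * ?r)) * ennreal (exp ((p * \<beta>)\<^sup>2 * ?r / 2) * Cp))"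
  proof (intro mult_mono)
    show "(\<integral>\<^sup>+w. indicator {?r<..} (tau u w) \<partial>M) \<le> ennreal (exp (- ?r))" using r by (simp add: tau_gt)
    show "(\<integral>\<^sup>+w. ?\<Phi> (B u w) \<partial>M) \<le> ennreal (exp (- (p * c) * ?r)) * ennreal (exp ((p * \<beta>)\<^sup>2 * ?r / 2) * Cp)"
      by (subst nn_integral_cmult) (auto intro!: mult_left_mono Osc_weighted_powr r d)
  qed auto
  also have "\<dots> = ennreal (exp (- (1 + (p * c - (p * \<beta>)\<^sup>2 / 2)) * ?r) * Cp)"
  proof -
    have e: "exp (- (1 + (p * c - (p * \<beta>)\<^sup>2 / 2)) * ?r) = exp (- ?r) * (exp (- (p * c) * ?r) * exp ((p * \<beta>)\<^sup>2 * ?r / 2))"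
      unfolding exp_add[symmetric] by (simp add: field_simps)
    show ?thesis unfolding e using Cp_pos by (simp add: ennreal_mult[symmetric] mult.assoc)
  qed
  also have "\<dots> \<le> ennreal (Cp * exp (- \<kappa> * ?r))"
  proof (rule ennreal_leI)
    have "\<kappa> * ?r \<le> (1 + (p * c - (p * \<beta>)\<^sup>2 / 2)) * ?r" using r \<kappa> by (intro mult_right_mono) auto
    then have "exp (- (1 + (p * c - (p * \<beta>)\<^sup>2 / 2)) * ?r) \<le> exp (- \<kappa> * ?r)"
      unfolding exp_le_cancel_iff mult_minus_left by linarith
    then show "exp (- (1 + (p * c - (p * \<beta>)\<^sup>2 / 2)) * ?r) * Cp \<le> Cp * exp (- \<kappa> * ?r)"
      using Cp_pos by (simp add: mult.commute)
  qed
  finally show ?thesis .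
next
  case False
  have "(\<integral>\<^sup>+w. ennreal ((own t s (D u w) * (Osc \<delta> (traj (D u w)) (t - s) + 1) + (if t < s \<and> s \<le> t + \<delta> then Osc \<delta> (traj (D u w)) 0 else 0)) powr p) \<partial>M)
    \<le> (\<integral>\<^sup>+w. ennreal (exp (0 * pev (B u w) 0)) * ennreal ((Osc \<delta> (B u w) 0 + 1) powr p) \<partial>M)"
  proof (intro nn_integral_mono)
    fix w
    have "0 \<le> Osc \<delta> (B u w) 0" using d by (simp add: Osc_nonneg)
    then have "Osc \<delta> (B u w) 0 powr p \<le> (Osc \<delta> (B u w) 0 + 1) powr p" using p by (intro powr_mono2) auto
    then show "ennreal ((own t s (D u w) * (Osc \<delta> (traj (D u w)) (t - s) + 1) + (if t < s \<and> s \<le> t + \<delta> then Osc \<delta> (traj (D u w)) 0 else 0)) powr p)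
       \<le> ennreal (exp (0 * pev (B u w) 0)) * ennreal ((Osc \<delta> (B u w) 0 + 1) powr p)"
      using False p by (auto simp: own_def intro: ennreal_leI)
  qed
  also have "\<dots> \<le> ennreal (exp (0\<^sup>2 * 0 / 2) * Cp)" by (rule Osc_weighted_powr) (use d in auto)
  also have "\<dots> \<le> ennreal (Cp * exp (- \<kappa> * (t - s)))"
  proof (rule ennreal_leI)
    have "\<kappa> * (t - s) \<le> 0" using False \<kappa> by (intro mult_nonneg_nonpos) auto
    then have "1 \<le> exp (- \<kappa> * (t - s))" by simp
    then have "Cp * 1 \<le> Cp * exp (- \<kappa> * (t - s))" using Cp_pos by (intro mult_left_mono) auto
    then show "exp (0\<^sup>2 * 0 / 2) * Cp \<le> Cp * exp (- \<kappa> * (t - s))" by simp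
  qed
  finally show ?thesis .
qed

lemma psiT_moment:
  assumes d: "0 < \<delta>" "\<delta> \<le> 1" and s: "s \<le> t + \<delta>"
  shows "(\<integral>\<^sup>+w. ennreal (\<bar>psiT \<delta> t s (D u w)\<bar> powr p) \<partial>M) \<le> ennreal (16 * (Cp + m2 + eps \<delta> powr p) * exp (- \<kappa> * (t - s)))"
proof -
  let ?a = "\<lambda>w. own t s (D u w) * (Osc \<delta> (traj (D u w)) (t - s) + 1) + (if t < s \<and> s \<le> t + \<delta> then Osc \<delta> (traj (D u w)) 0 else 0)"
  let ?k = "\<lambda>w. if t < s + life (D u w) then kidw \<beta> c (D u w) else 0"
  let ?e = "\<lambda>w. eps \<delta> * own (t + \<delta>) s (D u w)"
  have an: "0 \<le> ?a w" for w using d by (auto simp: Osc_nonneg intro!: add_nonneg_nonneg mult_nonneg_nonneg)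
  have "(\<integral>\<^sup>+w. ennreal (\<bar>psiT \<delta> t s (D u w)\<bar> powr p) \<partial>M) \<le>
    (\<integral>\<^sup>+w. ennreal 16 * (ennreal (?a w powr p) + ennreal (?k w powr p) + ennreal (?e w powr p)) \<partial>M)"
  proof (intro nn_integral_mono)
    fix w
    have "own t s (D u w) * (Osc \<delta> (traj (D u w)) (t - s) + (if life (D u w) \<le> t - s + \<delta> then 1 else 0)) \<le> own t s (D u w) * (Osc \<delta> (traj (D u w)) (t - s) + 1)"
      by (intro mult_left_mono) auto
    moreover have "(if s \<le> t + \<delta> \<and> t < s + life (D u w) \<and> s + life (D u w) \<le> t + \<delta> then kidw \<beta> c (D u w) else 0) \<le> ?k w" by auto
    ultimately have "psiV \<delta> t s (D u w) \<le> ?a w + ?k w" unfolding psiV_def by linarith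
    moreover have "0 \<le> psiV \<delta> t s (D u w)" using d by (simp add: psiV_nonneg)
    moreover have "0 \<le> ?e w" using d by (simp add: eps_nonneg)
    ultimately have "\<bar>psiT \<delta> t s (D u w)\<bar> \<le> ?a w + ?k w + ?e w" unfolding psiT_def by linarith
    then have "\<bar>psiT \<delta> t s (D u w)\<bar> powr p \<le> 16 * (?a w powr p + ?k w powr p + ?e w powr p)"
      using p an d by (intro powr_le_sum3) (auto simp: eps_nonneg)
    then have "ennreal (\<bar>psiT \<delta> t s (D u w)\<bar> powr p) \<le> ennreal (16 * (?a w powr p + ?k w powr p + ?e w powr p))" by (rule ennreal_leI)
    also have "\<dots> = ennreal 16 * (ennreal (?a w powr p) + ennreal (?k w powr p) + ennreal (?e w powr p))"
      by (simp only: ennreal_mult ennreal_plus zero_le_numeral powr_ge_zero add_nonneg_nonneg)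
    finally show "ennreal (\<bar>psiT \<delta> t s (D u w)\<bar> powr p) \<le> ennreal 16 * (ennreal (?a w powr p) + ennreal (?k w powr p) + ennreal (?e w powr p))" .
  qed
  also have "\<dots> = ennreal 16 * ((\<integral>\<^sup>+w. ennreal (?a w powr p) \<partial>M) + (\<integral>\<^sup>+w. ennreal (?k w powr p) \<partial>M) + (\<integral>\<^sup>+w. ennreal (?e w powr p) \<partial>M))"
    by (subst nn_integral_cmult) (auto simp: nn_integral_add)
  also have "\<dots> \<le> ennreal 16 * (ennreal (Cp * exp (- \<kappa> * (t - s))) + ennreal (m2 * exp (- \<kappa> * (t - s))) + ennreal (eps \<delta> powr p * exp (- \<kappa> * (t - s))))"
  proof (intro mult_left_mono add_mono kidw_powr_after Osc_powr_alive d)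
    have "(\<integral>\<^sup>+w. ennreal (?e w powr p) \<partial>M) = (\<integral>\<^sup>+w. ennreal (eps \<delta> powr p) * ennreal (own (t + \<delta>) s (D u w) powr p) \<partial>M)"
      using d by (simp add: powr_mult ennreal_mult eps_nonneg)
    also have "\<dots> = ennreal (eps \<delta> powr p) * (\<integral>\<^sup>+w. ennreal (own (t + \<delta>) s (D u w) powr p) \<partial>M)"
      by (rule nn_integral_cmult) measurable
    also have "\<dots> \<le> ennreal (eps \<delta> powr p) * ennreal (exp (- \<kappa> * (t - s)))"
      using s d \<kappa> by (intro mult_left_mono order_trans[OF own_powr_moment]) (auto intro!: ennreal_leI)
    finally show "(\<integral>\<^sup>+w. ennreal (?e w powr p) \<partial>M) \<le> ennreal (eps \<delta> powr p * exp (- \<kappa> * (t - s)))" by (simp add: ennreal_mult)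
  qed auto
  also have "\<dots> = ennreal (16 * (Cp * exp (- \<kappa> * (t - s)) + m2 * exp (- \<kappa> * (t - s)) + eps \<delta> powr p * exp (- \<kappa> * (t - s))))"
    using Cp_pos m2_nonneg by (simp only: ennreal_mult ennreal_plus zero_le_numeral powr_ge_zero add_nonneg_nonneg mult_nonneg_nonneg exp_ge_zero less_imp_le)
  finally show ?thesis by (simp add: algebra_simps)
qed

section \<open>Comparison of the whole tree over a cell\<close>

definition Zcell :: "real \<Rightarrow> real \<Rightarrow> 'a \<Rightarrow> real" where
  "Zcell \<delta> t w = (\<Sum>u\<in>born w (t + \<delta>). cw \<beta> c (conf w) u * (psiT \<delta> t (cbirth (conf w) u) (D u w) - (\<integral>w'. psiT \<delta> t (cbirth (conf w) u) (D u w') \<partial>M)))"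

definition Vcell :: "real \<Rightarrow> real \<Rightarrow> 'a \<Rightarrow> real" where
  "Vcell \<delta> t w = (\<Sum>u\<in>born w (t + \<delta>). cw \<beta> c (conf w) u * psiV \<delta> t (cbirth (conf w) u) (D u w))"

lemma Zcell_moment:
  assumes d: "0 < \<delta>" "\<delta> \<le> 1"
  shows "(\<integral>\<^sup>+w. ennreal (\<bar>Zcell \<delta> t w\<bar> powr p) \<partial>M) \<le> ennreal (120 * (16 * (Cp + m2 + eps \<delta> powr p)) / (1 - \<rho>) * exp (- \<kappa> * t))"
proof -
  have p': "1 \<le> p" "p \<le> 2" using p by auto
  let ?K = "16 * (Cp + m2 + eps \<delta> powr p) * exp (- \<kappa> * t)"
  have "(\<integral>\<^sup>+w. ennreal (\<bar>\<Sum>u\<in>{u\<in>born w (t + \<delta>). 0 \<le> length u}. cw \<beta> c (conf w) u *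
         ((\<lambda>u s y d. psiT \<delta> t s d) u (cbirth (conf w) u) (yst \<beta> (conf w) u) (D u w)
        - (\<integral>w'. (\<lambda>u s y d. psiT \<delta> t s d) u (cbirth (conf w) u) (yst \<beta> (conf w) u) (D u w') \<partial>M))\<bar> powr p) \<partial>M)
     \<le> ennreal (120 * ?K * \<rho> ^ 0 / (1 - \<rho>))"
    unfolding \<rho>_def
  proof (rule tree_sum_moment[OF _ p'])
    show "(\<lambda>(s, y, d). psiT \<delta> t s d) \<in> borel_measurable (borel \<Otimes>\<^sub>M (borel \<Otimes>\<^sub>M pdata_space))"
      unfolding case_prod_beta' by measurable
    show "0 < ?K" using Cp_pos m2_nonneg by (simp add: add_pos_nonneg)
    fix u and s y :: real
    show "(\<integral>\<^sup>+w. ennreal (\<bar>psiT \<delta> t s (D u w)\<bar> powr p) \<partial>M) \<le> ennreal (?K * exp (\<kappa> * s))"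
    proof (cases "s \<le> t + \<delta>")
      case True
      have e: "exp (- \<kappa> * (t - s)) = exp (- \<kappa> * t) * exp (\<kappa> * s)" unfolding exp_add[symmetric] by (simp add: algebra_simps)
      show ?thesis using psiT_moment[OF d True, of u] unfolding e by (simp only: mult.assoc)
    next
      case False
      then show ?thesis using d p by (simp add: psiT_zero)
    qed
  qed (use \<kappa> psiT_zero d in auto)
  then show ?thesis by (simp add: Zcell_def algebra_simps)
qed

text \<open>Write \<open>psiV\<close> as \<open>psiT\<close> plus \<open>eps \<delta>\<close> times
  the final mass. As the means of \<open>psiT\<close> are nonpositive, subtracting them only
  increases the sum, and the centred sum is \<open>Zcell\<close>.\<close>

lemma Vcell_le:
  assumes g: "good w" and d: "0 < \<delta>" "\<delta> \<le> 1"
  shows "Vcell \<delta> t w \<le> eps \<delta> * Wsum (\<lambda>_. 1) (t + \<delta>) w + Zcell \<delta> t w"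
proof -
  let ?A = "\<lambda>u. cw \<beta> c (conf w) u" and ?s = "\<lambda>u. cbirth (conf w) u"
  have "Vcell \<delta> t w = (\<Sum>u\<in>born w (t + \<delta>). ?A u * psiT \<delta> t (?s u) (D u w) + eps \<delta> * (?A u * (own (t + \<delta>) (?s u) (D u w) * 1)))"
    unfolding Vcell_def psiT_def by (intro sum.cong refl) (simp add: algebra_simps)
  also have "\<dots> \<le> (\<Sum>u\<in>born w (t + \<delta>). ?A u * (psiT \<delta> t (?s u) (D u w) - (\<integral>w'. psiT \<delta> t (?s u) (D u w') \<partial>M)) + eps \<delta> * (?A u * (own (t + \<delta>) (?s u) (D u w) * 1)))"
  proof (intro sum_mono add_right_mono mult_left_mono)
    fix u assume "u \<in> born w (t + \<delta>)"
    then have "(\<integral>w'. psiT \<delta> t (?s u) (D u w') \<partial>M) \<le> 0" by (intro psiT_mean d) (simp add: born_def)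
    then show "psiT \<delta> t (?s u) (D u w) \<le> psiT \<delta> t (?s u) (D u w) - (\<integral>w'. psiT \<delta> t (?s u) (D u w') \<partial>M)" by simp
  qed simp
  also have "\<dots> = Zcell \<delta> t w + eps \<delta> * Wsum (\<lambda>_. 1) (t + \<delta>) w"
    by (simp add: Zcell_def Wsum_def sum.distrib sum_distrib_left)
  finally show ?thesis by simp
qed

lemma path_cell_bound:
  assumes cont: "continuous_on UNIV b" and d: "0 < \<delta>" and q: "0 \<le> q" "q \<le> \<delta>"
  shows "\<bar>exp (\<beta> * (b (r + q) - b r) - c * q) - 1\<bar> + \<bar>(b (r + q) - b r) - \<beta> * q\<bar> \<le> Osc \<delta> b r"
    and "\<bar>exp (\<beta> * (b (r + q) - b r) - c * q) - 1\<bar> \<le> Osc \<delta> b r"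
proof -
  define x where "x = b (r + q) - b r"
  have v: "exp (b0 * \<bar>x\<bar>) - 1 \<le> osc_root b0 \<delta> b r" unfolding x_def by (rule osc_root_bound[OF cont b0(3) d q])
  have ex: "exp (\<beta> * \<bar>x\<bar>) \<le> exp (b0 * \<bar>x\<bar>)" using b0 by (simp add: mult_right_mono)
  have 1: "\<bar>exp (\<beta> * x) - 1\<bar> \<le> exp (\<beta> * \<bar>x\<bar>) - 1"
  proof (cases "0 \<le> x")
    case True then show ?thesis using \<beta> by simp
  next
    case False
    then have nx: "\<bar>x\<bar> = - x" "\<beta> * x \<le> 0" using \<beta> by (auto simp: mult_nonneg_nonpos)
    \<comment> \<open>For negative x this is exp z + exp (-z) \<ge> 2 in disguise.\<close>
    have "1 + \<beta> * x \<le> exp (\<beta> * x)" "1 + - (\<beta> * x) \<le> exp (- (\<beta> * x))" by (rule exp_ge_add_one_self)+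
    then have "2 \<le> exp (\<beta> * x) + exp (- (\<beta> * x))" by linarith
    moreover have "\<bar>exp (\<beta> * x) - 1\<bar> = 1 - exp (\<beta> * x)" using nx(2) by simp
    moreover have "exp (\<beta> * \<bar>x\<bar>) = exp (- (\<beta> * x))" unfolding nx(1) by simp
    ultimately show ?thesis by linarith
  qed
  have cq: "0 \<le> c * q" using c_pos q by simp
  have "exp (\<beta> * x - c * q) - 1 = exp (- (c * q)) * (exp (\<beta> * x) - 1) - (1 - exp (- (c * q)))"
    by (simp add: exp_diff exp_minus field_simps)
  then have "\<bar>exp (\<beta> * x - c * q) - 1\<bar> \<le> exp (- (c * q)) * \<bar>exp (\<beta> * x) - 1\<bar> + (1 - exp (- (c * q)))"
    using abs_triangle_ineq4[of "exp (- (c * q)) * (exp (\<beta> * x) - 1)" "1 - exp (- (c * q))"] cq by (simp add: abs_mult)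
  also have "\<dots> \<le> 1 * \<bar>exp (\<beta> * x) - 1\<bar> + c * q"
    using cq exp_ge_add_one_self[of "- (c * q)"] by (intro add_mono mult_right_mono) auto
  also have "\<dots> \<le> osc_root b0 \<delta> b r + c * \<delta>"
  proof -
    have "c * q \<le> c * \<delta>" using c_pos q by (intro mult_left_mono) auto
    moreover have "\<bar>exp (\<beta> * x) - 1\<bar> \<le> osc_root b0 \<delta> b r"
      using order_trans[OF 1 order_trans[OF diff_right_mono[OF ex, of 1] v]] .
    ultimately show ?thesis by simp
  qed
  finally have A: "\<bar>exp (\<beta> * x - c * q) - 1\<bar> \<le> osc_root b0 \<delta> b r + c * \<delta>" .
  have "\<bar>x\<bar> \<le> b0 * \<bar>x\<bar>" using b0 by (simp add: mult_right_mono[of 1, simplified] mult_le_cancel_right1)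
  also have "\<dots> \<le> exp (b0 * \<bar>x\<bar>) - 1" using exp_ge_add_one_self[of "b0 * \<bar>x\<bar>"] by linarith
  finally have "\<bar>x\<bar> \<le> osc_root b0 \<delta> b r" using v by linarith
  moreover have "\<beta> * q \<le> \<beta> * \<delta>" "0 \<le> \<beta> * q" using \<beta> q by (auto intro: mult_left_mono)
  ultimately have Bd: "\<bar>x - \<beta> * q\<bar> \<le> osc_root b0 \<delta> b r + \<beta> * \<delta>" by linarith
  show "\<bar>exp (\<beta> * (b (r + q) - b r) - c * q) - 1\<bar> + \<bar>(b (r + q) - b r) - \<beta> * q\<bar> \<le> Osc \<delta> b r"
    using A Bd unfolding x_def[symmetric] Osc_def by (simp add: algebra_simps)
  then show "\<bar>exp (\<beta> * (b (r + q) - b r) - c * q) - 1\<bar> \<le> Osc \<delta> b r" by linarith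
qed

text \<open>Five cases for birth and death relative to t and t'. A particle born in the cell has
  weight up to 1 + \<open>Osc\<close>, and the 1 is the part to be charged to its parent. A particle
  dying in the cell loses its whole weight. A surviving one changes weight and position, both
  bounded by \<open>Osc\<close>, and sees the scale \<surd>t change, which costs K / t.\<close>

lemma particle_cell:
  assumes cont: "continuous_on UNIV (traj d)" and b00: "traj d 0 = 0"
    and f: "nice K f" and t: "1 \<le> t" and \<delta>: "0 < \<delta>" "\<delta> \<le> 1" and t': "t \<le> t'" "t' \<le> t + \<delta>"
  shows "\<bar>own t' s d * f (npos t' s y d) - own t s d * f (npos t s y d)\<bar> \<le>
    K * (own t s d * (Osc \<delta> (traj d) (t - s) + (if life d \<le> t - s + \<delta> then 1 else 0)) + (if t < s \<and> s \<le> t + \<delta> then Osc \<delta> (traj d) 0 + 1 else 0))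
    + K / t * own t s d"
proof -
  have fK: "\<And>x. \<bar>f x\<bar> \<le> K" and fL: "\<And>x y. \<bar>f x - f y\<bar> \<le> K * \<bar>x - y\<bar>"
    and fS: "\<And>\<theta> x. 1/2 \<le> \<theta> \<Longrightarrow> \<theta> \<le> 1 \<Longrightarrow> \<bar>f (\<theta> * x) - f x\<bar> \<le> K * (1 - \<theta>)"
    using f by (auto simp: nice_def)
  have K: "0 \<le> K" using fK[of 0] by linarith
  let ?b = "traj d"
  have pe: "pev ?b q = ?b q" for q by (rule pev_continuous[OF cont])
  have On: "0 \<le> Osc \<delta> ?b r" for r using \<delta> by (simp add: Osc_nonneg)
  define q where "q = t' - t"
  have q: "0 \<le> q" "q \<le> \<delta>" using t' by (auto simp: q_def)
  consider (late) "t' < s" | (new) "t < s" "s \<le> t'" | (dead) "s \<le> t" "s + life d \<le> t" | (dies) "s \<le> t" "t < s + life d" "s + life d \<le> t'"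
    | (alive) "s \<le> t" "t < s + life d" "t' < s + life d" by linarith
  then show ?thesis
  proof cases
    case late
    then show ?thesis using t' K On[of 0] by (auto simp: own_def)
  next
    case new
    have "\<bar>own t' s d\<bar> \<le> Osc \<delta> ?b 0 + 1"
    proof (cases "t' < s + life d")
      case True
      have "\<bar>exp (\<beta> * (?b (0 + (t' - s)) - ?b 0) - c * (t' - s)) - 1\<bar> \<le> Osc \<delta> ?b 0"
        by (rule path_cell_bound(2)[OF cont \<delta>(1)]) (use new t' in auto)
      then show ?thesis using True new by (simp add: own_def pe b00)
    qed (use On in \<open>auto simp: own_def\<close>)
    then have "\<bar>own t' s d\<bar> * \<bar>f (npos t' s y d)\<bar> \<le> (Osc \<delta> ?b 0 + 1) * K"
      using fK On[of 0] by (intro mult_mono) auto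
    moreover have "own t s d = 0" using new by (simp add: own_def)
    ultimately show ?thesis using new t' by (simp add: abs_mult mult.commute)
  next
    case dead
    then show ?thesis using t' by (simp add: own_def)
  next
    case dies
    then have "own t' s d = 0" "life d \<le> t - s + \<delta>" using t' by (auto simp: own_def)
    moreover have "own t s d * \<bar>f (npos t s y d)\<bar> \<le> own t s d * (K * (Osc \<delta> ?b (t - s) + 1) + K / t)"
      using fK[of "npos t s y d"] K On[of "t - s"] t
      by (intro mult_left_mono) (auto simp: distrib_left intro: order_trans add_increasing add_increasing2)
    ultimately show ?thesis using dies by (simp add: abs_mult algebra_simps)
  next
    case alive
    define r where "r = t - s"
    have tr: "t' - s = r + q" by (simp add: r_def q_def)
    define E where "E = exp (\<beta> * (?b (r + q) - ?b r) - c * q)"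
    \<comment> \<open>Only the change of scale: the new normalised position is \<theta> times
      \<open>n'\<close>, the new position at the old scale.\<close>
    define \<theta> where "\<theta> = sqrt t / sqrt t'"
    have t0: "0 < t" "0 < t'" using t t' by auto
    have own': "own t' s d = own t s d * E"
      using alive t' unfolding own_def E_def pe tr r_def[symmetric] by (simp add: exp_add[symmetric] algebra_simps)
    have \<theta>1: "\<theta> \<le> 1" using t0 t' by (simp add: \<theta>_def)
    have \<theta>0: "0 \<le> \<theta>" using t0 by (simp add: \<theta>_def)
    have \<theta>2: "\<theta>\<^sup>2 = t / t'" using t0 by (simp add: \<theta>_def power_divide)
    have "t / t' \<le> \<theta>" using \<theta>0 \<theta>1 unfolding \<theta>2[symmetric] by (simp add: power2_eq_square mult_left_le)
    moreover have "1 - 1 / t \<le> t / t'"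
    proof -
      have "t / (t + 1) \<le> t / t'" using t0 t' \<delta> by (intro divide_left_mono) auto
      moreover have "1 - 1 / t \<le> t / (t + 1)" using t0 by (simp add: field_simps)
      ultimately show ?thesis by linarith
    qed
    \<comment> \<open>Here t' \<le> t + 1 \<le> 2 t, which gives the range of \<theta> covered by
      \<open>nice\<close>.\<close>
    moreover have "1/2 \<le> t / t'"
      using t0 t' \<delta> t by (simp add: field_simps)
    ultimately have \<theta>b: "1/2 \<le> \<theta>" "1 - \<theta> \<le> 1 / t" by linarith+
    define n' where "n' = (y + (?b (r + q) - \<beta> * (r + q))) / sqrt t"
    have np: "npos t' s y d = \<theta> * n'" using t0 by (simp add: npos_def pe tr \<theta>_def n'_def)
    have "\<bar>n' - npos t s y d\<bar> = \<bar>(?b (r + q) - ?b r) - \<beta> * q\<bar> / sqrt t"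
    proof -
      have "n' - npos t s y d = ((?b (r + q) - ?b r) - \<beta> * q) / sqrt t"
        by (simp add: n'_def npos_def pe r_def[symmetric] diff_divide_distrib[symmetric] algebra_simps)
      then show ?thesis by (simp add: t0 less_imp_le)
    qed
    also have "\<dots> \<le> \<bar>(?b (r + q) - ?b r) - \<beta> * q\<bar> / 1" using t by (intro divide_left_mono) auto
    finally have nd: "\<bar>n' - npos t s y d\<bar> \<le> \<bar>(?b (r + q) - ?b r) - \<beta> * q\<bar>" by simp
    have "\<bar>f (npos t' s y d) - f (npos t s y d)\<bar> \<le> \<bar>f (\<theta> * n') - f n'\<bar> + \<bar>f n' - f (npos t s y d)\<bar>" unfolding np by linarith
    also have "\<dots> \<le> K * (1 - \<theta>) + K * \<bar>n' - npos t s y d\<bar>" by (intro add_mono fS fL \<theta>b(1) \<theta>1)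
    also have "\<dots> \<le> K * (1 / t) + K * \<bar>(?b (r + q) - ?b r) - \<beta> * q\<bar>" using K \<theta>b(2) nd by (intro add_mono mult_left_mono) auto
    finally have fd: "\<bar>f (npos t' s y d) - f (npos t s y d)\<bar> \<le> K / t + K * \<bar>(?b (r + q) - ?b r) - \<beta> * q\<bar>" by simp
    have "own t' s d * f (npos t' s y d) - own t s d * f (npos t s y d) = own t s d * ((E - 1) * f (npos t' s y d) + (f (npos t' s y d) - f (npos t s y d)))"
      unfolding own' by (simp add: algebra_simps)
    then have "\<bar>own t' s d * f (npos t' s y d) - own t s d * f (npos t s y d)\<bar> = own t s d * \<bar>(E - 1) * f (npos t' s y d) + (f (npos t' s y d) - f (npos t s y d))\<bar>"
      by (simp add: abs_mult)
    also have "\<dots> \<le> own t s d * (K * Osc \<delta> ?b r + K / t)"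
    proof (intro mult_left_mono)
      have "\<bar>(E - 1) * f (npos t' s y d) + (f (npos t' s y d) - f (npos t s y d))\<bar> \<le> \<bar>E - 1\<bar> * \<bar>f (npos t' s y d)\<bar> + \<bar>f (npos t' s y d) - f (npos t s y d)\<bar>"
        using abs_triangle_ineq[of "(E - 1) * f (npos t' s y d)" "f (npos t' s y d) - f (npos t s y d)"] by (simp add: abs_mult)
      also have "\<dots> \<le> \<bar>E - 1\<bar> * K + (K / t + K * \<bar>(?b (r + q) - ?b r) - \<beta> * q\<bar>)"
        using fK fd by (intro add_mono mult_left_mono) auto
      also have "\<dots> = K * (\<bar>E - 1\<bar> + \<bar>(?b (r + q) - ?b r) - \<beta> * q\<bar>) + K / t" by (simp add: algebra_simps)
      also have "\<dots> \<le> K * Osc \<delta> ?b r + K / t"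
        unfolding E_def using K by (intro add_right_mono mult_left_mono path_cell_bound(1)[OF cont \<delta>(1) q]) auto
      finally show "\<bar>(E - 1) * f (npos t' s y d) + (f (npos t' s y d) - f (npos t s y d))\<bar> \<le> K * Osc \<delta> ?b r + K / t" .
    qed simp
    also have "\<dots> \<le> K * (own t s d * (Osc \<delta> ?b (t - s) + (if life d \<le> t - s + \<delta> then 1 else 0)) + (if t < s \<and> s \<le> t + \<delta> then Osc \<delta> ?b 0 + 1 else 0))
      + K / t * own t s d"
      using alive K by (simp add: r_def algebra_simps)
    finally show ?thesis .
  qed
qed

text \<open>Sum the bounds for single particles. The unit weights of particles born inside the cell
  are regrouped at their parents and turn into the last summand of \<open>psiV\<close>; the change
  of scale gives the term of order 1 / t.\<close>

lemma cell_bound: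
  assumes g: "good w" and f: "nice K f" and t: "1 \<le> t" and \<delta>: "0 < \<delta>" "\<delta> \<le> 1" and t': "t \<le> t'" "t' \<le> t + \<delta>"
  shows "\<bar>Wsum f t' w - Wsum f t w\<bar> \<le> K * Vcell \<delta> t w + K / t * Wsum (\<lambda>_. 1) t w"
proof -
  let ?A = "\<lambda>u. cw \<beta> c (conf w) u" and ?s = "\<lambda>u. cbirth (conf w) u" and ?y = "\<lambda>u. yst \<beta> (conf w) u"
  let ?E = "born w (t + \<delta>)"
  have w: "w \<in> space M" using g by (simp add: good_def)
  have fin: "finite ?E" by (rule finite_born[OF g])
  have Wext: "Wsum h t'' w = (\<Sum>u\<in>?E. ?A u * (own t'' (?s u) (D u w) * h (npos t'' (?s u) (?y u) (D u w))))" if "t'' \<le> t + \<delta>" for h t''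
    unfolding Wsum_def using that fin by (intro sum.mono_neutral_left) (auto simp: born_def own_def)
  let ?W = "\<lambda>u. own t (?s u) (D u w) * (Osc \<delta> (traj (D u w)) (t - ?s u) + (if life (D u w) \<le> t - ?s u + \<delta> then 1 else 0))"
  have "\<bar>Wsum f t' w - Wsum f t w\<bar> = \<bar>\<Sum>u\<in>?E. ?A u * (own t' (?s u) (D u w) * f (npos t' (?s u) (?y u) (D u w)) - own t (?s u) (D u w) * f (npos t (?s u) (?y u) (D u w)))\<bar>"
    using t' \<delta> by (subst (1 2) Wext) (auto simp: sum_subtractf[symmetric] right_diff_distrib)
  also have "\<dots> \<le> (\<Sum>u\<in>?E. ?A u * \<bar>own t' (?s u) (D u w) * f (npos t' (?s u) (?y u) (D u w)) - own t (?s u) (D u w) * f (npos t (?s u) (?y u) (D u w))\<bar>)"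
    by (rule order_trans[OF sum_abs]) (simp add: abs_mult)
  also have "\<dots> \<le> (\<Sum>u\<in>?E. ?A u * (K * (?W u + (if t < ?s u \<and> ?s u \<le> t + \<delta> then Osc \<delta> (traj (D u w)) 0 + 1 else 0)) + K / t * own t (?s u) (D u w)))"
    using B_continuous[OF w] B_zero[OF w] by (intro sum_mono mult_left_mono particle_cell[OF _ _ f t \<delta> t']) auto
  also have "\<dots> = K * ((\<Sum>u\<in>?E. ?A u * (?W u + (if t < ?s u \<and> ?s u \<le> t + \<delta> then Osc \<delta> (traj (D u w)) 0 else 0))) + (\<Sum>u\<in>?E. ?A u * (if t < ?s u then 1 else 0)))
     + K / t * (\<Sum>u\<in>?E. ?A u * (own t (?s u) (D u w) * 1))"
    unfolding sum_distrib_left sum.distrib[symmetric] by (intro sum.cong refl) (auto simp: born_def algebra_simps)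
  also have "(\<Sum>u\<in>?E. ?A u * (own t (?s u) (D u w) * 1)) = Wsum (\<lambda>_. 1) t w" using \<delta> by (subst Wext) auto
  \<comment> \<open>The root is born at time 0 < t, so every particle counted here has a
    parent.\<close>
  also have "(\<Sum>u\<in>?E. ?A u * (if t < ?s u then 1 else 0)) = (\<Sum>v\<in>{v\<in>?E. Suc 0 \<le> length v}. ?A v * (\<lambda>s y. if t < s then 1 else 0) (?s v) (?y v))"
    using fin t by (intro sum.mono_neutral_cong_right) (auto simp: Suc_le_eq)
  also have "\<dots> = (\<Sum>u\<in>{u\<in>?E. 0 \<le> length u}. ?A u * (if ?s u + life (D u w) \<le> t + \<delta> then kidw \<beta> c (D u w) * (\<lambda>s y. if t < s then 1 else 0) (?s u + life (D u w)) (?y u + dpos (D u w) - \<beta> * life (D u w)) else 0))"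
    by (rule born_children[OF g])
  also have "(\<Sum>u\<in>?E. ?A u * (?W u + (if t < ?s u \<and> ?s u \<le> t + \<delta> then Osc \<delta> (traj (D u w)) 0 else 0))) + \<dots> = Vcell \<delta> t w"
    unfolding Vcell_def psiV_def by (simp add: sum.distrib[symmetric] distrib_left[symmetric]) (intro sum.cong refl, auto simp: born_def)
  finally show ?thesis .
qed

end

section \<open>Convergence along a time grid\<close>

context prob_space begin

text \<open>Sums over the random set \<open>born\<close> are identified with limits of measurable
  finite sums only on the almost sure event \<open>good\<close>. Upper integrals do not see the
  difference.\<close>

definition ae_meas :: "('a \<Rightarrow> real) \<Rightarrow> bool" where
  "ae_meas X \<longleftrightarrow> (\<exists>g. g \<in> borel_measurable M \<and> (AE w in M. X w = g w))"

lemma ae_meas_compose: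
  assumes "ae_meas X" "h \<in> borel_measurable borel" shows "ae_meas (\<lambda>w. h (X w))"
proof -
  obtain g where g: "g \<in> borel_measurable M" "AE w in M. X w = g w"
    using assms(1) unfolding ae_meas_def by blast
  have "AE w in M. h (X w) = h (g w)" using g(2) by eventually_elim simp
  then show ?thesis unfolding ae_meas_def using measurable_compose[OF g(1) assms(2)] by blast
qed

lemma ae_meas_diff:
  assumes "ae_meas X" "ae_meas Y" shows "ae_meas (\<lambda>w. X w - Y w)"
proof -
  obtain g where g: "g \<in> borel_measurable M" "AE w in M. X w = g w"
    using assms(1) unfolding ae_meas_def by blast
  obtain g' where g': "g' \<in> borel_measurable M" "AE w in M. Y w = g' w"
    using assms(2) unfolding ae_meas_def by blast
  have "AE w in M. X w - Y w = g w - g' w" using g(2) g'(2) by eventually_elim simp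
  then show ?thesis unfolding ae_meas_def using borel_measurable_diff[OF g(1) g'(1)] by blast
qed

lemma AE_summable_abs:
  assumes X: "\<And>j. ae_meas (X j)" and le: "\<And>j. (\<integral>\<^sup>+w. ennreal \<bar>X j w\<bar> \<partial>M) \<le> ennreal (a j)"
    and a: "summable a" "\<And>j. 0 \<le> a j"
  shows "AE w in M. summable (\<lambda>j::nat. \<bar>X j w\<bar>)"
proof -
  obtain g where g[measurable]: "\<And>j. g j \<in> borel_measurable M" and eq: "\<And>j. AE w in M. X j w = g j w"
    using X unfolding ae_meas_def by metis
  have "(\<integral>\<^sup>+w. (\<Sum>j. ennreal \<bar>g j w\<bar>) \<partial>M) = (\<Sum>j. \<integral>\<^sup>+w. ennreal \<bar>g j w\<bar> \<partial>M)"
    by (rule nn_integral_suminf) measurable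
  also have "\<dots> = (\<Sum>j. \<integral>\<^sup>+w. ennreal \<bar>X j w\<bar> \<partial>M)"
  proof (intro suminf_cong nn_integral_cong_AE)
    show "AE w in M. ennreal \<bar>g j w\<bar> = ennreal \<bar>X j w\<bar>" for j using eq[of j] by eventually_elim simp
  qed
  also have "\<dots> \<le> (\<Sum>j. ennreal (a j))" by (intro suminf_le le) auto
  also have "\<dots> = ennreal (\<Sum>j. a j)" by (rule suminf_ennreal2[OF a(2,1)])
  finally have "(\<integral>\<^sup>+w. (\<Sum>j. ennreal \<bar>g j w\<bar>) \<partial>M) \<noteq> \<infinity>" by (auto simp: top_unique)
  then have "AE w in M. (\<Sum>j. ennreal \<bar>g j w\<bar>) \<noteq> \<infinity>" by (intro nn_integral_noteq_infinite) auto
  moreover have "AE w in M. \<forall>j. X j w = g j w" using eq by (simp add: AE_all_countable)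
  ultimately show ?thesis
  proof eventually_elim
    case (elim w)
    then have "summable (\<lambda>j. \<bar>g j w\<bar>)" by (intro summable_suminf_not_top) auto
    then show ?case using elim by simp
  qed
qed

text \<open>Summable p-th moments make the sum of the p-th powers finite almost surely, so its terms
  tend to 0.\<close>

lemma AE_tendsto_zero_moment:
  assumes X: "\<And>j. ae_meas (X j)" and p: "0 < p"
    and le: "\<And>j. (\<integral>\<^sup>+w. ennreal (\<bar>X j w\<bar> powr p) \<partial>M) \<le> ennreal (a j)"
    and a: "summable a" "\<And>j. 0 \<le> a j"
  shows "AE w in M. (\<lambda>j::nat. X j w) \<longlonglongrightarrow> 0"
proof -
  have "AE w in M. summable (\<lambda>j. \<bar>\<bar>X j w\<bar> powr p\<bar>)"
  proof (rule AE_summable_abs[OF _ _ a])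
    show "ae_meas (\<lambda>w. \<bar>X j w\<bar> powr p)" for j
      by (rule ae_meas_compose[OF X, of "\<lambda>x. \<bar>x\<bar> powr p"]) simp
  qed (use le in simp)
  then show ?thesis
  proof eventually_elim
    case (elim w)
    then have "(\<lambda>j. \<bar>X j w\<bar> powr p) \<longlonglongrightarrow> 0" using summable_LIMSEQ_zero by fastforce
    then have "(\<lambda>j. (\<bar>X j w\<bar> powr p) powr (1 / p)) \<longlonglongrightarrow> 0 powr (1 / p)"
      using p by (intro tendsto_powr') auto
    then have "(\<lambda>j. \<bar>X j w\<bar>) \<longlonglongrightarrow> 0" using p by (simp add: powr_powr)
    then show ?case by (rule tendsto_rabs_zero_cancel)
  qed
qed

end

lemma (in bbm_model) ae_meas_born_sum:
  assumes h[measurable]: "\<And>u. h u \<in> borel_measurable conf_space"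
  shows "ae_meas (\<lambda>w. \<Sum>u\<in>{u\<in>born w T. P u}. h u (conf w))"
  unfolding ae_meas_def
proof (intro exI conjI)
  define S where "S m x = (\<Sum>u\<in>{u\<in>lab m. P u}. if cex x u \<and> cbirth x u \<le> T then h u x else 0)" for m x
  have "S m \<in> borel_measurable conf_space" for m unfolding S_def by measurable
  then have [measurable]: "(\<lambda>w. S m (conf w)) \<in> borel_measurable M" for m
    by (rule measurable_compose[OF measurable_conf])
  show "(\<lambda>w. lim (\<lambda>m. S m (conf w))) \<in> borel_measurable M" by measurable
  show "AE w in M. (\<Sum>u\<in>{u\<in>born w T. P u}. h u (conf w)) = lim (\<lambda>m. S m (conf w))"
    using AE_good
  proof eventually_elim
    case (elim w)
    obtain m0 where m0: "\<And>m. m0 \<le> m \<Longrightarrow> born w T \<subseteq> lab m" using finite_subset_lab[OF finite_born[OF elim, of T]] by blast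
    have "S m (conf w) = (\<Sum>u\<in>{u\<in>born w T. P u}. h u (conf w))" if "m0 \<le> m" for m
      unfolding S_def using m0[OF that] by (intro sum.mono_neutral_cong_right) (auto simp: born_def)
    then have "\<forall>\<^sub>F m in sequentially. S m (conf w) = (\<Sum>u\<in>{u\<in>born w T. P u}. h u (conf w))"
      unfolding eventually_sequentially by blast
    then have "(\<lambda>m. S m (conf w)) \<longlonglongrightarrow> (\<Sum>u\<in>{u\<in>born w T. P u}. h u (conf w))" by (rule tendsto_eventually)
    then show ?case by (simp add: limI)
  qed
qed

context bbm_beta begin

lemma ae_meas_own_sum:
  assumes [measurable]: "f \<in> borel_measurable borel"
  shows "ae_meas (\<lambda>w. \<Sum>u\<in>{u\<in>born w t. P u}. cw \<beta> c (conf w) u * (own t (cbirth (conf w) u) (D u w) * f (npos t (cbirth (conf w) u) (yst \<beta> (conf w) u) (D u w))))"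
proof -
  have "ae_meas (\<lambda>w. \<Sum>u\<in>{u\<in>born w t. P u}. (\<lambda>x. cw \<beta> c x u * (own t (cbirth x u) (x u) * f (npos t (cbirth x u) (yst \<beta> x u) (x u)))) (conf w))"
    by (rule ae_meas_born_sum) (simp add: yst_def)
  then show ?thesis by (simp add: conf_def)
qed

lemma ae_meas_Wsum: "f \<in> borel_measurable borel \<Longrightarrow> ae_meas (Wsum f t)"
  using ae_meas_own_sum[of f t "\<lambda>_. True"] by (simp add: Wsum_def[abs_def])

lemma ae_meas_Zcell: "ae_meas (Zcell \<delta> t)"
proof -
  have "ae_meas (\<lambda>w. \<Sum>u\<in>{u\<in>born w (t + \<delta>). True}. (\<lambda>x. cw \<beta> c x u * (psiT \<delta> t (cbirth x u) (x u) - (\<integral>w'. psiT \<delta> t (cbirth x u) (D u w') \<partial>M))) (conf w))"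
    by (rule ae_meas_born_sum) (auto intro!: borel_measurable_times borel_measurable_diff borel_measurable_lebesgue_integral simp: case_prod_beta')
  then show ?thesis by (simp add: conf_def Zcell_def[abs_def])
qed

lemma W_grid_convergent:
  assumes \<delta>: "0 < \<delta>"
  shows "AE w in M. convergent (\<lambda>j::nat. Wsum (\<lambda>_. 1) (\<delta> * real j) w)"
proof -
  define C where "C = 120 * (16 * (2 + m2)) / (1 - \<rho>)"
  have C: "0 \<le> C" using m2_nonneg \<rho> by (simp add: C_def)
  let ?X = "\<lambda>j w. Wsum (\<lambda>_. 1) (\<delta> * real (Suc j)) w - Wsum (\<lambda>_. 1) (\<delta> * real j) w"
  let ?a = "\<lambda>j. (1 + C) * exp (- (\<kappa> * \<delta> / 2)) ^ j"
  have am: "ae_meas (?X j)" for j by (intro ae_meas_diff ae_meas_Wsum) auto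
  have "AE w in M. summable (\<lambda>j. \<bar>?X j w\<bar>)"
  proof (rule AE_summable_abs[where a="?a"])
    show "ae_meas (?X j)" for j by (rule am)
    show "summable ?a" using \<kappa> \<delta> by (intro summable_mult summable_geometric) auto
    show "0 \<le> ?a j" for j using C by simp
    fix j :: nat
    obtain g where [measurable]: "g \<in> borel_measurable M" and g: "AE w in M. ?X j w = g w"
      using am[of j] by (auto simp: ae_meas_def)
    define t where "t = \<delta> * real j"
    \<comment> \<open>The square root of the decay exp (-\<kappa> t): since p \<le> 2 and e \<le> 1,
      e^(1-p) e^2 \<le> e, and both parts of the interpolation are of order e.\<close>
    define e where "e = exp (- (\<kappa> * t / 2))"
    have e: "0 < e" by (simp add: e_def)
    have t0: "0 \<le> t" using \<delta> by (simp add: t_def)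
    have "(\<integral>\<^sup>+w. ennreal \<bar>?X j w\<bar> \<partial>M) = (\<integral>\<^sup>+w. ennreal \<bar>g w\<bar> \<partial>M)"
      by (intro nn_integral_cong_AE, use g in eventually_elim) simp
    also have "\<dots> \<le> (\<integral>\<^sup>+w. ennreal e + ennreal (e powr (1 - p)) * ennreal (\<bar>g w\<bar> powr p) \<partial>M)"
    proof (intro nn_integral_mono)
      fix w
      have "ennreal \<bar>g w\<bar> \<le> ennreal (e + e powr (1 - p) * \<bar>g w\<bar> powr p)"
        using abs_le_plus_powr[OF e, of p "g w"] p by (intro ennreal_leI) auto
      then show "ennreal \<bar>g w\<bar> \<le> ennreal e + ennreal (e powr (1 - p)) * ennreal (\<bar>g w\<bar> powr p)"
        using e by (simp add: ennreal_plus ennreal_mult)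
    qed
    also have "\<dots> = ennreal e + ennreal (e powr (1 - p)) * (\<integral>\<^sup>+w. ennreal (\<bar>g w\<bar> powr p) \<partial>M)"
      by (simp add: nn_integral_add nn_integral_cmult emeasure_space_1)
    also have "(\<integral>\<^sup>+w. ennreal (\<bar>g w\<bar> powr p) \<partial>M) = (\<integral>\<^sup>+w. ennreal (\<bar>?X j w\<bar> powr p) \<partial>M)"
      by (intro nn_integral_cong_AE, use g in eventually_elim) simp
    also have "ennreal e + ennreal (e powr (1 - p)) * \<dots> \<le> ennreal e + ennreal (e powr (1 - p)) * ennreal (C * exp (- \<kappa> * t))"
      unfolding C_def t_def by (intro add_left_mono mult_left_mono W_increment_moment) (use \<delta> in auto)
    also have "\<dots> = ennreal (e + e powr (1 - p) * (C * exp (- \<kappa> * t)))"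
      using e C by (simp add: ennreal_plus ennreal_mult)
    also have "\<dots> \<le> ennreal (?a j)"
    proof (rule ennreal_leI)
      have "e powr (1 - p) = exp ((p - 1) * (\<kappa> * t / 2))" unfolding e_def exp_powr_real by (simp add: field_simps)
      also have "\<dots> \<le> exp (1 * (\<kappa> * t / 2))" unfolding exp_le_cancel_iff using p \<kappa> t0 by (intro mult_right_mono) auto
      finally have "e powr (1 - p) * (C * exp (- \<kappa> * t)) \<le> exp (1 * (\<kappa> * t / 2)) * (C * exp (- \<kappa> * t))"
        using C by (intro mult_right_mono) auto
      also have "\<dots> = C * e" unfolding e_def by (simp add: exp_add[symmetric] mult.left_commute)
      finally have "e + e powr (1 - p) * (C * exp (- \<kappa> * t)) \<le> (1 + C) * e" by (simp add: algebra_simps)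
      moreover have "e = exp (- (\<kappa> * \<delta> / 2)) ^ j" unfolding e_def t_def by (simp add: exp_of_nat_mult[symmetric] algebra_simps)
      ultimately show "e + e powr (1 - p) * (C * exp (- \<kappa> * t)) \<le> ?a j" by metis
    qed
    finally show "(\<integral>\<^sup>+w. ennreal \<bar>?X j w\<bar> \<partial>M) \<le> ennreal (?a j)" .
  qed
  then show ?thesis
  proof eventually_elim
    case (elim w)
    then have "summable (\<lambda>j. ?X j w)" by (rule summable_rabs_cancel)
    then have "convergent (\<lambda>n. \<Sum>j<n. ?X j w)" by (simp add: summable_iff_convergent)
    then have "convergent (\<lambda>n. Wsum (\<lambda>_. 1) (\<delta> * real n) w - Wsum (\<lambda>_. 1) (\<delta> * real 0) w)"
      using sum_lessThan_telescope[of "\<lambda>j. Wsum (\<lambda>_. 1) (\<delta> * real j) w"] by simp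
    then have "convergent (\<lambda>n. (Wsum (\<lambda>_. 1) (\<delta> * real n) w - Wsum (\<lambda>_. 1) (\<delta> * real 0) w) + Wsum (\<lambda>_. 1) (\<delta> * real 0) w)"
      by (intro convergent_add convergent_const)
    then show ?case by simp
  qed
qed

lemma Zcell_grid:
  assumes \<delta>: "0 < \<delta>" "\<delta> \<le> 1"
  shows "AE w in M. (\<lambda>j::nat. Zcell \<delta> (\<delta> * real j) w) \<longlonglongrightarrow> 0"
proof (rule AE_tendsto_zero_moment[where p=p])
  let ?C = "120 * (16 * (Cp + m2 + eps \<delta> powr p)) / (1 - \<rho>)"
  have C: "0 \<le> ?C" using Cp_pos m2_nonneg \<rho> by simp
  let ?a = "\<lambda>j. ?C * exp (- (\<kappa> * \<delta>)) ^ j"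
  show "summable ?a" using \<kappa> \<delta> by (intro summable_mult summable_geometric) auto
  show "0 \<le> ?a j" for j by (intro mult_nonneg_nonneg C) simp
  show "(\<integral>\<^sup>+w. ennreal (\<bar>Zcell \<delta> (\<delta> * real j) w\<bar> powr p) \<partial>M) \<le> ennreal (?a j)" for j
  proof -
    have "exp (- (\<kappa> * \<delta>)) ^ j = exp (- \<kappa> * (\<delta> * real j))" by (simp add: exp_of_nat_mult[symmetric] algebra_simps)
    then show ?thesis using Zcell_moment[OF \<delta>, of "\<delta> * real j"] by simp
  qed
qed (use p ae_meas_Zcell in auto)

end

section \<open>Test functions of Gaussian mean zero on a grid\<close>

text \<open>As f has Gaussian mean zero, F is the Gaussian mean of f((y + \<surd>(t - s) z) /
  \<surd>t) - f(z). The argument moves by y / \<surd>t and by at most (s / t) |z|, where s / t \<le>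
  s / \<surd>t because t \<ge> 1.\<close>

lemma Ff_bound:
  assumes f[measurable]: "f \<in> borel_measurable borel" and K: "\<And>x. \<bar>f x\<bar> \<le> K" and Lip: "\<And>x y. \<bar>f x - f y\<bar> \<le> K * \<bar>x - y\<bar>"
    and \<gamma>: "(\<integral>z. std_normal_density z * f z \<partial>lborel) = 0" and t: "1 \<le> t" and s: "0 \<le> s" "s \<le> t"
  shows "\<bar>Ff f t s y\<bar> \<le> K * (\<bar>y\<bar> + s) / sqrt t"
proof -
  have K0: "0 \<le> K" using K[of 0] by linarith
  define h where "h z = f ((y + sqrt (t - s) * z) / sqrt t)" for z
  have [measurable]: "h \<in> borel_measurable borel" unfolding h_def by measurable
  have ih: "integrable lborel (\<lambda>z. std_normal_density z * h z)" using K by (intro integrable_gauss_mult[where K=K]) (auto simp: h_def)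
  have if': "integrable lborel (\<lambda>z. std_normal_density z * f z)" using K by (intro integrable_gauss_mult[where K=K]) auto
  have m2: "has_bochner_integral lborel (\<lambda>x. std_normal_density x * x ^ (2 * 1)) (fact (2 * 1) / (2^1 * fact 1))"
    by (rule std_normal_moment_even)
  let ?a = "\<bar>y\<bar> / sqrt t" and ?b = "s / sqrt t"
  have ab: "\<bar>h z - f z\<bar> \<le> K * (?a + ?b * ((1 + z\<^sup>2) / 2))" for z
  proof -
    let ?\<theta> = "sqrt (t - s) / sqrt t"
    have "?\<theta> = sqrt ((t - s) / t)" by (simp add: real_sqrt_divide)
    moreover have x01: "0 \<le> (t - s) / t" "(t - s) / t \<le> 1" using s t by auto
    then have "(t - s) / t \<le> sqrt ((t - s) / t)" by (intro real_le_rsqrt) (simp only: power2_eq_square mult_left_le)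
    moreover have "sqrt ((t - s) / t) \<le> 1" using x01 by simp
    moreover have "1 - (t - s) / t = s / t" using t by (simp add: field_simps)
    ultimately have th: "0 \<le> 1 - ?\<theta>" "1 - ?\<theta> \<le> s / t" by linarith+
    have "sqrt t \<le> t" using t by (intro real_le_lsqrt) (auto simp: power2_eq_square mult_left_le)
    then have "s / t \<le> ?b" using s t by (intro divide_left_mono) auto
    with th have th2: "\<bar>1 - ?\<theta>\<bar> \<le> ?b" by linarith
    have "(y + sqrt (t - s) * z) / sqrt t - z = y / sqrt t - (1 - ?\<theta>) * z"
      using t by (simp add: field_simps)
    then have "\<bar>(y + sqrt (t - s) * z) / sqrt t - z\<bar> \<le> \<bar>y / sqrt t\<bar> + \<bar>(1 - ?\<theta>) * z\<bar>"
      using abs_triangle_ineq4 by metis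
    also have "\<dots> \<le> ?a + ?b * \<bar>z\<bar>" unfolding abs_mult using th2 t by (intro add_mono mult_right_mono) auto
    also have "\<dots> \<le> ?a + ?b * ((1 + z\<^sup>2) / 2)"
    proof (intro add_left_mono mult_left_mono)
      \<comment> \<open>Replacing |z| by (1 + z^2) / 2 leaves only the second moment to be computed,
        and the constant is still exactly 1.\<close>
      have "0 \<le> (1 - \<bar>z\<bar>)\<^sup>2" by simp
      then show "\<bar>z\<bar> \<le> (1 + z\<^sup>2) / 2" by (simp add: power2_diff)
    qed (use s t in auto)
    finally have "\<bar>(y + sqrt (t - s) * z) / sqrt t - z\<bar> \<le> ?a + ?b * ((1 + z\<^sup>2) / 2)" .
    then show ?thesis unfolding h_def using Lip K0 by (meson mult_left_mono order_trans)
  qed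
  have alg: "w * (K * (a + b * ((1 + z\<^sup>2) / 2))) = K * (a + b / 2) * w + K * b / 2 * (w * z ^ (2 * 1))" for w a b z :: real
    by (simp add: field_simps power2_eq_square)
  have i2: "integrable lborel (\<lambda>z. std_normal_density z * (K * (?a + ?b * ((1 + z\<^sup>2) / 2))))"
  proof -
    have "integrable lborel (\<lambda>z. K * (?a + ?b / 2) * std_normal_density z + K * ?b / 2 * (std_normal_density z * z ^ (2 * 1)))"
      using m2 by (auto simp: has_bochner_integral_iff)
    then show ?thesis unfolding alg .
  qed
  have "\<bar>Ff f t s y\<bar> = \<bar>(\<integral>z. std_normal_density z * h z \<partial>lborel) - (\<integral>z. std_normal_density z * f z \<partial>lborel)\<bar>"
    using \<gamma> by (simp add: Ff_def h_def)
  also have "\<dots> = \<bar>\<integral>z. std_normal_density z * (h z - f z) \<partial>lborel\<bar>"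
    using ih if' by (simp add: right_diff_distrib)
  also have "\<dots> \<le> (\<integral>z. \<bar>std_normal_density z * (h z - f z)\<bar> \<partial>lborel)" by (rule integral_abs_bound)
  also have "\<dots> \<le> (\<integral>z. std_normal_density z * (K * (?a + ?b * ((1 + z\<^sup>2) / 2))) \<partial>lborel)"
  proof (rule integral_mono)
    show "integrable lborel (\<lambda>z. \<bar>std_normal_density z * (h z - f z)\<bar>)"
      using ih if' by (simp only: right_diff_distrib) (intro integrable_abs Bochner_Integration.integrable_diff)
    show "\<bar>std_normal_density z * (h z - f z)\<bar> \<le> std_normal_density z * (K * (?a + ?b * ((1 + z\<^sup>2) / 2)))" for z
      unfolding abs_mult using ab[of z] by (simp add: mult_left_mono)
  qed (rule i2)
  also have "\<dots> = (\<integral>z. K * (?a + ?b / 2) * std_normal_density z + K * ?b / 2 * (std_normal_density z * z ^ (2 * 1)) \<partial>lborel)"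
    unfolding alg ..
  also have "\<dots> = K * (?a + ?b / 2) + K * ?b / 2"
    using m2 by (simp add: has_bochner_integral_iff)
  also have "\<dots> = K * (\<bar>y\<bar> + s) / sqrt t" by (simp add: add_divide_distrib distrib_left)
  finally show ?thesis .
qed

context bbm_beta begin

text \<open>A Chernoff bound in the generation: for labels shorter than n one has 1 \<le> R^(-n)
  R^|u|. Weakening the survival factor from rate 2 to rate k1 extracts exp (-k1 t) and leaves a
  convergent series with ratio R * 2 / (2 - k1).\<close>

lemma early_moment:
  assumes R: "0 < R" "R < 1" and k1: "0 < k1" "k1 < 2" "R * (2 / (2 - k1)) < 1"
  shows "(\<integral>\<^sup>+w. ennreal (\<Sum>u\<in>{u\<in>born w t. length u < n}. cw \<beta> c (conf w) u * (own t (cbirth (conf w) u) (D u w) * 1)) \<partial>M)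
    \<le> ennreal ((1 / R) ^ n * (exp (- k1 * t) / (1 - R * (2 / (2 - k1)))))"
proof -
  define h where "h u x = ennreal (R ^ length u) * ennreal (cw \<beta> c x u * own t (cbirth x u) (x u))" for u x
  have hm[measurable]: "h u \<in> borel_measurable conf_space" for u unfolding h_def by measurable
  define S where "S m w = ennreal ((1 / R) ^ n) * (\<Sum>u\<in>lab m. h u (conf w))" for m w
  have [measurable]: "S m \<in> borel_measurable M" for m unfolding S_def by measurable
  have hE: "(\<integral>\<^sup>+w. h u (conf w) \<partial>M) \<le> ennreal (exp (- k1 * t)) * (ennreal (if 0 \<le> length u then R ^ length u else 0) * (\<integral>\<^sup>+w. ennreal (cw \<beta> (c - k1) (conf w) u) \<partial>M))" for u
  proof -
    have "(\<integral>\<^sup>+w. h u (conf w) \<partial>M) = (\<integral>\<^sup>+w. \<integral>\<^sup>+w'. h u ((conf w)(u := D u w')) \<partial>M \<partial>M)"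
      by (rule resample_nn_integral) measurable
    also have "\<dots> \<le> (\<integral>\<^sup>+w. ennreal (exp (- k1 * t)) * (ennreal (R ^ length u) * ennreal (cw \<beta> (c - k1) (conf w) u)) \<partial>M)"
    proof (intro nn_integral_mono)
      fix w
      let ?s = "cbirth (conf w) u"
      have "(\<integral>\<^sup>+w'. h u ((conf w)(u := D u w')) \<partial>M) = (\<integral>\<^sup>+w'. ennreal (R ^ length u * cw \<beta> c (conf w) u) * ennreal (own t ?s (D u w')) \<partial>M)"
        using R by (intro nn_integral_cong) (simp add: h_def cw_upd prefix_upd ennreal_mult mult.assoc)
      also have "\<dots> = ennreal (R ^ length u * cw \<beta> c (conf w) u) * (\<integral>\<^sup>+w'. ennreal (own t ?s (D u w')) \<partial>M)"
        by (rule nn_integral_cmult) measurable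
      also have "\<dots> \<le> ennreal (R ^ length u * cw \<beta> c (conf w) u) * ennreal (exp (- k1 * (t - ?s)))"
      proof (intro mult_left_mono)
        show "(\<integral>\<^sup>+w'. ennreal (own t ?s (D u w')) \<partial>M) \<le> ennreal (exp (- k1 * (t - ?s)))"
        proof (cases "?s \<le> t")
          case True
          then have "k1 * (t - ?s) \<le> 2 * (t - ?s)" using k1 by (intro mult_right_mono) auto
          then show ?thesis using True by (simp add: own_mean ennreal_leI)
        qed (simp add: own_def)
      qed simp
      also have "\<dots> = ennreal (exp (- k1 * t) * (R ^ length u * cw \<beta> (c - k1) (conf w) u))"
      proof -
        have "cw \<beta> c (conf w) u * exp (- k1 * (t - ?s)) = exp (- k1 * t) * cw \<beta> (c - k1) (conf w) u"
          by (simp add: cw_def exp_add[symmetric] algebra_simps)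
        then show ?thesis using R by (simp add: ennreal_mult[symmetric] mult.assoc mult.left_commute)
      qed
      finally show "(\<integral>\<^sup>+w'. h u ((conf w)(u := D u w')) \<partial>M) \<le> ennreal (exp (- k1 * t)) * (ennreal (R ^ length u) * ennreal (cw \<beta> (c - k1) (conf w) u))"
        using R by (simp add: ennreal_mult)
    qed
    also have "\<dots> = ennreal (exp (- k1 * t)) * (ennreal (R ^ length u) * (\<integral>\<^sup>+w. ennreal (cw \<beta> (c - k1) (conf w) u) \<partial>M))"
      by (simp add: nn_integral_cmult)
    finally show ?thesis by simp
  qed
  have den: "1 + (c - k1) - \<beta>\<^sup>2 / 2 = 2 - k1" by (simp add: c_beta_def)
  have SE: "(\<integral>\<^sup>+w. S m w \<partial>M) \<le> ennreal ((1 / R) ^ n * (exp (- k1 * t) / (1 - R * (2 / (2 - k1)))))" for m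
  proof -
    have "(\<integral>\<^sup>+w. S m w \<partial>M) = ennreal ((1 / R) ^ n) * (\<Sum>u\<in>lab m. \<integral>\<^sup>+w. h u (conf w) \<partial>M)"
      unfolding S_def by (simp add: nn_integral_cmult nn_integral_sum)
    also have "\<dots> \<le> ennreal ((1 / R) ^ n) * (\<Sum>u\<in>lab m. ennreal (exp (- k1 * t)) * (ennreal (if 0 \<le> length u then R ^ length u else 0) * (\<integral>\<^sup>+w. ennreal (cw \<beta> (c - k1) (conf w) u) \<partial>M)))"
      by (intro mult_left_mono sum_mono hE) auto
    also have "\<dots> = ennreal ((1 / R) ^ n) * (ennreal (exp (- k1 * t)) * (\<Sum>u\<in>lab m. (ennreal (if 0 \<le> length u then R ^ length u else 0) * (\<integral>\<^sup>+w. ennreal (cw \<beta> (c - k1) (conf w) u) \<partial>M))))"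
      by (simp only: sum_distrib_left)
    also have "\<dots> \<le> ennreal ((1 / R) ^ n) * (ennreal (exp (- k1 * t)) * ennreal ((R * (2 / (2 - k1))) ^ 0 / (1 - R * (2 / (2 - k1)))))"
      using cw_lab_moment[of "c - k1" \<beta> R 0 m] R k1 unfolding den by (intro mult_left_mono) auto
    also have "\<dots> = ennreal ((1 / R) ^ n * (exp (- k1 * t) / (1 - R * (2 / (2 - k1)))))"
      using R k1 by (simp only: ennreal_mult[symmetric] power_0 zero_le_power exp_ge_zero divide_nonneg_nonneg zero_le_one less_imp_le diff_ge_0_iff_ge mult_nonneg_nonneg) simp
    finally show ?thesis .
  qed
  have "(\<integral>\<^sup>+w. ennreal (\<Sum>u\<in>{u\<in>born w t. length u < n}. cw \<beta> c (conf w) u * (own t (cbirth (conf w) u) (D u w) * 1)) \<partial>M)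
     \<le> (\<integral>\<^sup>+w. liminf (\<lambda>m. S m w) \<partial>M)"
  proof (intro nn_integral_mono_AE, use AE_good in eventually_elim)
    fix w assume g: "good w"
    obtain m0 where m0: "\<And>m. m0 \<le> m \<Longrightarrow> born w t \<subseteq> lab m" using finite_subset_lab[OF finite_born[OF g, of t]] by blast
    let ?a = "\<lambda>u. cw \<beta> c (conf w) u * own t (cbirth (conf w) u) (D u w)"
    have "ennreal (\<Sum>u\<in>{u\<in>born w t. length u < n}. cw \<beta> c (conf w) u * (own t (cbirth (conf w) u) (D u w) * 1)) \<le> S m w" if m: "m0 \<le> m" for m
    proof -
      have "(\<Sum>u\<in>{u\<in>born w t. length u < n}. cw \<beta> c (conf w) u * (own t (cbirth (conf w) u) (D u w) * 1)) \<le> (\<Sum>u\<in>{u\<in>born w t. length u < n}. (1 / R) ^ n * (R ^ length u * ?a u))"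
      proof (intro sum_mono)
        fix u assume u: "u \<in> {u\<in>born w t. length u < n}"
        have "R ^ n \<le> R ^ length u" using u R by (intro power_decreasing) auto
        then have "1 \<le> (1 / R) ^ n * R ^ length u" using R by (simp add: power_divide field_simps)
        then have "1 * ?a u \<le> (1 / R) ^ n * R ^ length u * ?a u" by (intro mult_right_mono) auto
        then show "cw \<beta> c (conf w) u * (own t (cbirth (conf w) u) (D u w) * 1) \<le> (1 / R) ^ n * (R ^ length u * ?a u)" by (simp add: mult.assoc)
      qed
      also have "\<dots> \<le> (\<Sum>u\<in>lab m. (1 / R) ^ n * (R ^ length u * ?a u))"
        using m0[OF m] R by (intro sum_mono2) auto
      finally have "ennreal (\<Sum>u\<in>{u\<in>born w t. length u < n}. cw \<beta> c (conf w) u * (own t (cbirth (conf w) u) (D u w) * 1)) \<le> ennreal (\<Sum>u\<in>lab m. (1 / R) ^ n * (R ^ length u * ?a u))"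
        by (rule ennreal_leI)
      also have "\<dots> = S m w"
        using R unfolding S_def h_def sum_distrib_left
        by (subst sum_ennreal[symmetric]) (auto simp: ennreal_mult conf_def)
      finally show ?thesis .
    qed
    then show "ennreal (\<Sum>u\<in>{u\<in>born w t. length u < n}. cw \<beta> c (conf w) u * (own t (cbirth (conf w) u) (D u w) * 1)) \<le> liminf (\<lambda>m. S m w)"
      by (intro Liminf_bounded) (auto simp: eventually_sequentially)
  qed
  also have "\<dots> \<le> liminf (\<lambda>m. \<integral>\<^sup>+w. S m w \<partial>M)" by (rule nn_integral_liminf) measurable
  also have "\<dots> \<le> ennreal ((1 / R) ^ n * (exp (- k1 * t) / (1 - R * (2 / (2 - k1)))))"
    using SE by (intro Liminf_le) auto
  finally show ?thesis .
qed

text \<open>Exponential moments dominate |y| + s, and the weight times such an exponential is again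
  of the form \<open>cw\<close>. One sum over all labels bounds every t and n at once: its
  generation factor 2 / (2 - k1 - k1^2 / 2) slightly exceeds 1, is compensated by R per generation,
  and reappears as R^(-n).\<close>

lemma line_bound:
  assumes R: "0 < R" "R < 1" and k1: "0 < k1" "0 < 2 - k1 - k1\<^sup>2 / 2" "R * (2 / (2 - k1 - k1\<^sup>2 / 2)) < 1"
  shows "AE w in M. \<exists>G\<ge>0. \<forall>t n. (\<Sum>u\<in>{u\<in>born w t. length u = n}. cw \<beta> c (conf w) u * (\<bar>yst \<beta> (conf w) u\<bar> + cbirth (conf w) u)) \<le> (1 / R) ^ n * G"
proof -
  \<comment> \<open>For e = 1 and e = -1 this is the weight times exp (e k1 y + k1 s), with y the
    starting point in the moving frame and s the birth time.\<close>
  define v where "v e x u = cw (\<beta> + e * k1) (c + e * k1 * \<beta> - k1) x u" for e x u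
  have fin: "AE w in M. \<exists>K. \<forall>m. (\<Sum>u\<in>lab m. ennreal (R ^ length u * v e (conf w) u)) \<le> ennreal K" if e: "e\<^sup>2 = 1" for e
  proof (rule AE_lab_sum_finite)
    show "(\<lambda>w. ennreal (R ^ length u * v e (conf w) u)) \<in> borel_measurable M" for u
      unfolding v_def by measurable
    fix m
    \<comment> \<open>The cross term e k1 \<beta> cancels, so both signs have the same generation
      factor.\<close>
    have den: "1 + (c + e * k1 * \<beta> - k1) - (\<beta> + e * k1)\<^sup>2 / 2 = 2 - k1 - k1\<^sup>2 / 2"
      using e by (simp add: c_beta_def power2_sum power_mult_distrib field_simps)
    have "(\<Sum>u\<in>lab m. \<integral>\<^sup>+w. ennreal (R ^ length u * v e (conf w) u) \<partial>M) =
      (\<Sum>u\<in>lab m. ennreal (if 0 \<le> length u then R ^ length u else 0) * (\<integral>\<^sup>+w. ennreal (v e (conf w) u) \<partial>M))"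
    proof (intro sum.cong refl)
      fix u
      have "(\<integral>\<^sup>+w. ennreal (R ^ length u * v e (conf w) u) \<partial>M) = (\<integral>\<^sup>+w. ennreal (R ^ length u) * ennreal (v e (conf w) u) \<partial>M)"
        using R by (simp add: ennreal_mult v_def)
      then show "(\<integral>\<^sup>+w. ennreal (R ^ length u * v e (conf w) u) \<partial>M) = ennreal (if 0 \<le> length u then R ^ length u else 0) * (\<integral>\<^sup>+w. ennreal (v e (conf w) u) \<partial>M)"
        by (simp add: nn_integral_cmult v_def)
    qed
    also have "\<dots> \<le> ennreal (1 / (1 - R * (2 / (2 - k1 - k1\<^sup>2 / 2))))"
      using cw_lab_moment[of "c + e * k1 * \<beta> - k1" "\<beta> + e * k1" R 0 m] R k1 unfolding den v_def by simp
    finally show "(\<Sum>u\<in>lab m. \<integral>\<^sup>+w. ennreal (R ^ length u * v e (conf w) u) \<partial>M) \<le> ennreal (1 / (1 - R * (2 / (2 - k1 - k1\<^sup>2 / 2))))" .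
  qed
  have "(1::real)\<^sup>2 = 1" "(-1::real)\<^sup>2 = 1" by auto
  from fin[OF this(1)] fin[OF this(2)] AE_good cbirth_nonneg show ?thesis
  proof eventually_elim
    case (elim w)
    obtain K1 where K1: "\<And>m. (\<Sum>u\<in>lab m. ennreal (R ^ length u * v 1 (conf w) u)) \<le> ennreal K1" using elim(1) by blast
    obtain K2 where K2: "\<And>m. (\<Sum>u\<in>lab m. ennreal (R ^ length u * v (-1) (conf w) u)) \<le> ennreal K2" using elim(2) by blast
    have vn: "0 \<le> v e (conf w) u" for e u by (simp add: v_def)
    have real_le: "(\<Sum>u\<in>lab m. R ^ length u * v e (conf w) u) \<le> \<bar>K\<bar>"
      if "\<And>m. (\<Sum>u\<in>lab m. ennreal (R ^ length u * v e (conf w) u)) \<le> ennreal K" for e K m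
    proof -
      have "ennreal (\<Sum>u\<in>lab m. R ^ length u * v e (conf w) u) = (\<Sum>u\<in>lab m. ennreal (R ^ length u * v e (conf w) u))"
        using R vn by (subst sum_ennreal) auto
      also have "\<dots> \<le> ennreal \<bar>K\<bar>" by (rule order_trans[OF that[of m]]) (simp add: ennreal_leI)
      finally have "ennreal (\<Sum>u\<in>lab m. R ^ length u * v e (conf w) u) \<le> ennreal \<bar>K\<bar>" .
      then show ?thesis by (subst (asm) ennreal_le_iff) auto
    qed
    let ?G = "(2 / k1) * (\<bar>K1\<bar> + \<bar>K2\<bar>)"
    have "(\<Sum>u\<in>{u\<in>born w t. length u = n}. cw \<beta> c (conf w) u * (\<bar>yst \<beta> (conf w) u\<bar> + cbirth (conf w) u)) \<le> (1 / R) ^ n * ?G" for t n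
    proof -
      obtain m where m: "born w t \<subseteq> lab m" using finite_subset_lab[OF finite_born[OF elim(3), of t]] by blast
      have "(\<Sum>u\<in>{u\<in>born w t. length u = n}. cw \<beta> c (conf w) u * (\<bar>yst \<beta> (conf w) u\<bar> + cbirth (conf w) u)) \<le>
        (\<Sum>u\<in>{u\<in>born w t. length u = n}. (1 / R) ^ n * ((2 / k1) * (R ^ length u * v 1 (conf w) u + R ^ length u * v (-1) (conf w) u)))"
      proof (intro sum_mono)
        fix u assume u: "u \<in> {u\<in>born w t. length u = n}"
        let ?s = "cbirth (conf w) u" and ?y = "yst \<beta> (conf w) u" and ?A = "cw \<beta> c (conf w) u"
        have s: "0 \<le> ?s" using elim(4) by auto
        define X where "X = exp (k1 * ?y) + exp (- (k1 * ?y))"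
        define Y where "Y = exp (k1 * ?s)"
        have vX: "v 1 (conf w) u + v (-1) (conf w) u = ?A * (X * Y)"
          by (simp add: v_def cw_def X_def Y_def yst_def exp_add[symmetric] algebra_simps)
        have Y1: "1 \<le> Y" "k1 * ?s \<le> Y"
        proof -
          show "1 \<le> Y" using s k1 by (simp add: Y_def)
          show "k1 * ?s \<le> Y" unfolding Y_def using exp_ge_add_one_self[of "k1 * ?s"] by linarith
        qed
        have X1: "1 + k1 * \<bar>?y\<bar> \<le> X"
        proof -
          have "1 + \<bar>z\<bar> \<le> exp z + exp (- z)" for z :: real
            by (smt (verit) exp_ge_add_one_self exp_gt_zero)
          from this[of "k1 * ?y"] show ?thesis using k1 by (simp add: X_def abs_mult)
        qed
        have "0 \<le> X" by (simp add: X_def)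
        then have "k1 * \<bar>?y\<bar> \<le> X * Y" using X1 Y1 k1 mult_mono[of "k1 * \<bar>?y\<bar>" X 1 Y] by auto
        moreover have "k1 * ?s \<le> X * Y"
        proof -
          have "1 \<le> X" using X1 k1 by (smt (verit) mult_nonneg_nonneg abs_ge_zero)
          then have "1 * (k1 * ?s) \<le> X * Y" using Y1 s k1 by (intro mult_mono) auto
          then show ?thesis by simp
        qed
        ultimately have "k1 * (\<bar>?y\<bar> + ?s) \<le> 2 * (X * Y)" by (simp add: distrib_left)
        then have "\<bar>?y\<bar> + ?s \<le> (2 / k1) * (X * Y)" using k1 by (simp add: field_simps)
        then have "?A * (\<bar>?y\<bar> + ?s) \<le> ?A * ((2 / k1) * (X * Y))" by (intro mult_left_mono) auto
        also have "\<dots> = (2 / k1) * (v 1 (conf w) u + v (-1) (conf w) u)" unfolding vX by simp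
        also have "\<dots> = (1 / R) ^ n * ((2 / k1) * (R ^ length u * v 1 (conf w) u + R ^ length u * v (-1) (conf w) u))"
        proof -
          have alg: "(a * r) * (q * (x + y)) = a * (q * (r * x + r * y))" for a r q x y :: real by (simp add: algebra_simps)
          have "(1 / R) ^ n * R ^ length u = 1" using u R by (simp add: power_divide)
          then show ?thesis using alg[of "(1 / R) ^ n" "R ^ length u" "2 / k1" "v 1 (conf w) u" "v (-1) (conf w) u"] by simp
        qed
        finally show "?A * (\<bar>?y\<bar> + ?s) \<le> (1 / R) ^ n * ((2 / k1) * (R ^ length u * v 1 (conf w) u + R ^ length u * v (-1) (conf w) u))" .
      qed
      also have "\<dots> \<le> (\<Sum>u\<in>lab m. (1 / R) ^ n * ((2 / k1) * (R ^ length u * v 1 (conf w) u + R ^ length u * v (-1) (conf w) u)))"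
        using m R k1 vn by (intro sum_mono2) auto
      also have "\<dots> = (1 / R) ^ n * ((2 / k1) * ((\<Sum>u\<in>lab m. R ^ length u * v 1 (conf w) u) + (\<Sum>u\<in>lab m. R ^ length u * v (-1) (conf w) u)))"
        by (simp only: sum_distrib_left[symmetric] sum.distrib)
      also have "\<dots> \<le> (1 / R) ^ n * ?G"
        using R k1 real_le[OF K1] real_le[OF K2] by (intro mult_left_mono add_mono) auto
      finally show ?thesis .
    qed
    moreover have "0 \<le> ?G" using k1 by auto
    ultimately show ?case by blast
  qed
qed

text \<open>Split at generation n(j). Particles still alive in an earlier generation carry
  exponentially small mass; the late part is centred up to the terms F on generation n(j), and these
  are small because f has mean zero. What remains is a choice of constants that balances the three
  parts.\<close>

lemma grid_zero:
  assumes f[measurable]: "f \<in> borel_measurable borel" and K: "\<And>x. \<bar>f x\<bar> \<le> K" and Lip: "\<And>x y. \<bar>f x - f y\<bar> \<le> K * \<bar>x - y\<bar>"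
    and \<gamma>: "(\<integral>z. std_normal_density z * f z \<partial>lborel) = 0" and \<delta>: "0 < \<delta>"
  shows "AE w in M. (\<lambda>j::nat. Wsum f (\<delta> * real j) w) \<longlonglongrightarrow> 0"
proof -
  have K0: "0 \<le> K" using K[of 0] by linarith
  \<comment> \<open>Then \<rho>^n \<le> (j + 1)^(-2) for n \<ge> N ln (j + 1), which is
    summable.\<close>
  define N where "N = 2 / - ln \<rho>"
  have N: "0 < N" "N * ln \<rho> = - 2" using \<rho> by (auto simp: N_def field_simps ln_less_zero)
  \<comment> \<open>Then R^(-n) is of order (j + 1)^(1/4), half the exponent available from
    \<surd>t.\<close>
  define R where "R = exp (- (1 / (4 * N)))"
  have R: "0 < R" "R < 1" using N by (auto simp: R_def)
  \<comment> \<open>With R = 1 - k1, both ratios are below 1 because k1^2 / 2 < k1.\<close>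
  define k1 where "k1 = 1 - R"
  have k1: "0 < k1" "k1 < 1" using R by (auto simp: k1_def)
  have sq: "k1\<^sup>2 \<le> k1" using k1 by (simp add: power2_eq_square mult_left_le)
  have Rk: "R = 1 - k1" by (simp add: k1_def)
  have c1: "0 < 2 - k1 - k1\<^sup>2 / 2" "R * (2 / (2 - k1 - k1\<^sup>2 / 2)) < 1" "R * (2 / (2 - k1)) < 1"
    unfolding Rk using k1 sq by (auto simp: field_simps)
  define n where "n j = nat \<lceil>N * ln (real j + 1)\<rceil>" for j :: nat
  have nb: "N * ln (real j + 1) \<le> real (n j)" "real (n j) \<le> N * ln (real j + 1) + 1" for j
  proof -
    have "0 \<le> N * ln (real j + 1)" using N by simp
    then have "real (n j) = real_of_int \<lceil>N * ln (real j + 1)\<rceil>" unfolding n_def by simp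
    then show "N * ln (real j + 1) \<le> real (n j)" "real (n j) \<le> N * ln (real j + 1) + 1" by linarith+
  qed
  have \<rho>n: "\<rho> ^ n j \<le> 1 / (real j + 1)\<^sup>2" for j
  proof -
    have "\<rho> ^ n j = exp (real (n j) * ln \<rho>)" using \<rho> by (simp add: exp_of_nat_mult)
    also have "\<dots> \<le> exp ((N * ln (real j + 1)) * ln \<rho>)"
      unfolding exp_le_cancel_iff using nb(1)[of j] \<rho> by (intro mult_right_mono_neg) (auto intro: less_imp_le)
    also have "(N * ln (real j + 1)) * ln \<rho> = (N * ln \<rho>) * ln (real j + 1)" by simp
    also have "\<dots> = - (2 * ln (real j + 1))" unfolding N(2) by simp
    also have "exp \<dots> = 1 / (real j + 1)\<^sup>2" by (simp add: exp_minus exp_double field_simps)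
    finally show ?thesis .
  qed
  have Rn: "(1 / R) ^ n j \<le> (1 / R) * (real j + 1) powr (1 / 4)" for j
  proof -
    have "(1 / R) ^ n j = exp (real (n j) * (1 / (4 * N)))"
      unfolding R_def exp_of_nat_mult by (simp add: exp_minus field_simps)
    also have "\<dots> \<le> exp ((N * ln (real j + 1) + 1) * (1 / (4 * N)))"
      unfolding exp_le_cancel_iff using nb(2)[of j] N by (intro mult_right_mono) auto
    also have "(N * ln (real j + 1) + 1) * (1 / (4 * N)) = 1 / (4 * N) + 1 / 4 * ln (real j + 1)" using N by (simp add: field_simps)
    also have "exp \<dots> = (1 / R) * (real j + 1) powr (1 / 4)"
    proof -
      have "1 / R = exp (1 / (4 * N))" by (simp add: R_def exp_minus field_simps)
      moreover have "(real j + 1) powr (1 / 4) = exp (1 / 4 * ln (real j + 1))" by (simp add: powr_def)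
      ultimately show ?thesis by (simp only: exp_add)
    qed
    finally show ?thesis .
  qed
  let ?t = "\<lambda>j::nat. \<delta> * real j"
  let ?o = "\<lambda>w t u. cw \<beta> c (conf w) u * (own t (cbirth (conf w) u) (D u w) * f (npos t (cbirth (conf w) u) (yst \<beta> (conf w) u) (D u w)))"
  define late where "late j w = (\<Sum>u\<in>{u\<in>born w (?t j). n j \<le> length u}. ?o w (?t j) u)
     - (\<Sum>u\<in>{u\<in>born w (?t j). length u = n j}. cw \<beta> c (conf w) u * Ff f (?t j) (cbirth (conf w) u) (yst \<beta> (conf w) u))" for j w
  define early where "early j w = (\<Sum>u\<in>{u\<in>born w (?t j). length u < n j}. cw \<beta> c (conf w) u * (own (?t j) (cbirth (conf w) u) (D u w) * 1))" for j w
  have A1: "AE w in M. (\<lambda>j. late j w) \<longlonglongrightarrow> 0"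
  proof (rule AE_tendsto_zero_moment[where p=p])
    let ?C = "120 * ((K + 1) powr p * (4 * (1 + m2) * exp (\<kappa> * 1))) / (1 - \<rho>)"
    have C: "0 \<le> ?C" using m2_nonneg \<rho> by (intro divide_nonneg_nonneg mult_nonneg_nonneg) auto
    show "(\<integral>\<^sup>+w. ennreal (\<bar>late j w\<bar> powr p) \<partial>M) \<le> ennreal (?C * (1 / (real j + 1)\<^sup>2))" for j
    proof -
      have "(\<integral>\<^sup>+w. ennreal (\<bar>late j w\<bar> powr p) \<partial>M) \<le> ennreal (120 * ((K + 1) powr p * (4 * (1 + m2) * exp (\<kappa> * 1))) * \<rho> ^ n j / (1 - \<rho>))"
        unfolding late_def by (rule late_moment[OF f K]) (use \<delta> in auto)
      also have "120 * ((K + 1) powr p * (4 * (1 + m2) * exp (\<kappa> * 1))) * \<rho> ^ n j / (1 - \<rho>) = ?C * \<rho> ^ n j" by simp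
      also have "ennreal (?C * \<rho> ^ n j) \<le> ennreal (?C * (1 / (real j + 1)\<^sup>2))"
        by (intro ennreal_leI mult_left_mono \<rho>n C)
      finally show ?thesis .
    qed
    have "summable (\<lambda>j. inverse (real (Suc j) ^ 2))"
      using inverse_power_summable[of 2, where 'a=real] by (subst summable_Suc_iff) auto
    then show "summable (\<lambda>j. ?C * (1 / (real j + 1)\<^sup>2))" by (intro summable_mult) (simp add: inverse_eq_divide add.commute)
    show "0 \<le> ?C * (1 / (real j + 1)\<^sup>2)" for j by (intro mult_nonneg_nonneg C) auto
    show "ae_meas (late j)" for j
    proof -
      have "ae_meas (\<lambda>w. \<Sum>u\<in>{u\<in>born w (?t j). length u = n j}. (\<lambda>x. cw \<beta> c x u * Ff f (?t j) (cbirth x u) (yst \<beta> x u)) (conf w))"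
        by (rule ae_meas_born_sum) (simp add: yst_def)
      then show ?thesis unfolding late_def[abs_def] by (intro ae_meas_diff ae_meas_own_sum) auto
    qed
  qed (use p in auto)
  have A2: "AE w in M. (\<lambda>j. early j w) \<longlonglongrightarrow> 0"
  proof (rule AE_tendsto_zero_moment[where p=1])
    \<comment> \<open>Half of the exponential decay is spent on the polynomial factor
      R^(-n).\<close>
    define a where "a = k1 * \<delta> / 2"
    have a: "0 < a" using k1 \<delta> by (simp add: a_def)
    let ?D = "1 / (1 - R * (2 / (2 - k1)))"
    have D: "0 \<le> ?D" using c1 by simp
    let ?C = "(1 / R) * ?D * (exp a / a)"
    have C: "0 \<le> ?C" using R D a by (intro mult_nonneg_nonneg) auto
    show "(\<integral>\<^sup>+w. ennreal (\<bar>early j w\<bar> powr 1) \<partial>M) \<le> ennreal (?C * exp (- a) ^ j)" for j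
    proof -
      have "0 \<le> early j w" for w unfolding early_def by (intro sum_nonneg) auto
      then have "(\<integral>\<^sup>+w. ennreal (\<bar>early j w\<bar> powr 1) \<partial>M) = (\<integral>\<^sup>+w. ennreal (early j w) \<partial>M)" by simp
      also have "\<dots> \<le> ennreal ((1 / R) ^ n j * (exp (- k1 * ?t j) / (1 - R * (2 / (2 - k1)))))"
        unfolding early_def by (rule early_moment) (use R k1 c1 in auto)
      also have "\<dots> \<le> ennreal (?C * exp (- a) ^ j)"
      proof (rule ennreal_leI)
        have pw: "(real j + 1) powr (1/4) \<le> exp (a * (real j + 1)) / a"
        proof -
          have "(real j + 1) powr (1/4) \<le> (real j + 1) powr 1" by (intro powr_mono) auto
          then have "a * (real j + 1) powr (1/4) \<le> a * (real j + 1)" using a by (intro mult_left_mono) auto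
          also have "\<dots> \<le> exp (a * (real j + 1))" using exp_ge_add_one_self[of "a * (real j + 1)"] by linarith
          finally show ?thesis using a by (simp add: pos_le_divide_eq mult.commute)
        qed
        have "(1 / R) ^ n j * (exp (- k1 * ?t j) * ?D) \<le> ((1 / R) * (exp (a * (real j + 1)) / a)) * (exp (- k1 * ?t j) * ?D)"
          using R D by (intro mult_right_mono order_trans[OF Rn] mult_left_mono pw) auto
        also have "\<dots> = (1 / R) * ?D * (exp (a * (real j + 1)) * exp (- k1 * ?t j) / a)" by simp
        also have "exp (a * (real j + 1)) * exp (- k1 * ?t j) = exp a * exp (- a) ^ j"
          unfolding exp_of_nat_mult[symmetric] exp_add[symmetric] by (simp add: a_def field_simps)
        finally show "(1 / R) ^ n j * (exp (- k1 * ?t j) / (1 - R * (2 / (2 - k1)))) \<le> ?C * exp (- a) ^ j" by simp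
      qed
      finally show ?thesis .
    qed
    show "summable (\<lambda>j. ?C * exp (- a) ^ j)" using a by (intro summable_mult summable_geometric) auto
    show "0 \<le> ?C * exp (- a) ^ j" for j by (intro mult_nonneg_nonneg C) auto
    show "ae_meas (early j)" for j
      unfolding early_def[abs_def] by (rule ae_meas_own_sum[of "\<lambda>_. 1"]) auto
  qed auto
  have A3: "AE w in M. \<exists>G\<ge>0. \<forall>t n. (\<Sum>u\<in>{u\<in>born w t. length u = n}. cw \<beta> c (conf w) u * (\<bar>yst \<beta> (conf w) u\<bar> + cbirth (conf w) u)) \<le> (1 / R) ^ n * G"
    by (rule line_bound[OF R k1(1) c1(1,2)])
  from A1 A2 A3 AE_good cbirth_nonneg show ?thesis
  proof eventually_elim
    case (elim w)
    obtain G where G: "0 \<le> G" "\<And>t n. (\<Sum>u\<in>{u\<in>born w t. length u = n}. cw \<beta> c (conf w) u * (\<bar>yst \<beta> (conf w) u\<bar> + cbirth (conf w) u)) \<le> (1 / R) ^ n * G"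
      using elim(3) by blast
    let ?A = "\<lambda>u. cw \<beta> c (conf w) u" and ?s = "\<lambda>u. cbirth (conf w) u" and ?y = "\<lambda>u. yst \<beta> (conf w) u"
    \<comment> \<open>The bound for generation n(j), with j + 1 \<le> 2 j: of order j^(1/4) /
      j^(1/2).\<close>
    let ?e = "\<lambda>j. (1 / R) * (2 * real j) powr (1/4) * (G * K) / sqrt (?t j)"
    have bd: "\<bar>Wsum f (?t j) w\<bar> \<le> K * early j w + \<bar>late j w\<bar> + ?e j" if j: "1 \<le> ?t j" "1 \<le> j" for j
    proof -
      have fin: "finite (born w (?t j))" by (rule finite_born[OF elim(4)])
      have "Wsum f (?t j) w = (\<Sum>u\<in>{u\<in>born w (?t j). length u < n j}. ?o w (?t j) u) + (\<Sum>u\<in>{u\<in>born w (?t j). n j \<le> length u}. ?o w (?t j) u)"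
        unfolding Wsum_def using fin by (subst sum.union_disjoint[symmetric]) (auto intro!: sum.cong)
      also have "\<dots> = (\<Sum>u\<in>{u\<in>born w (?t j). length u < n j}. ?o w (?t j) u) + late j w +
          (\<Sum>u\<in>{u\<in>born w (?t j). length u = n j}. ?A u * Ff f (?t j) (?s u) (?y u))"
        by (simp add: late_def)
      finally have W: "Wsum f (?t j) w = (\<Sum>u\<in>{u\<in>born w (?t j). length u < n j}. ?o w (?t j) u) + late j w +
          (\<Sum>u\<in>{u\<in>born w (?t j). length u = n j}. ?A u * Ff f (?t j) (?s u) (?y u))" .
      have e1: "\<bar>\<Sum>u\<in>{u\<in>born w (?t j). length u < n j}. ?o w (?t j) u\<bar> \<le> K * early j w"
      proof -
        have "\<bar>\<Sum>u\<in>{u\<in>born w (?t j). length u < n j}. ?o w (?t j) u\<bar> \<le> (\<Sum>u\<in>{u\<in>born w (?t j). length u < n j}. K * (?A u * (own (?t j) (?s u) (D u w) * 1)))"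
        proof (rule order_trans[OF sum_abs sum_mono])
          fix u
          have "(?A u * own (?t j) (?s u) (D u w)) * \<bar>f (npos (?t j) (?s u) (?y u) (D u w))\<bar> \<le> (?A u * own (?t j) (?s u) (D u w)) * K"
            using K by (intro mult_left_mono) auto
          then show "\<bar>?o w (?t j) u\<bar> \<le> K * (?A u * (own (?t j) (?s u) (D u w) * 1))" by (simp add: abs_mult ac_simps)
        qed
        then show ?thesis by (simp add: early_def sum_distrib_left)
      qed
      have e2: "\<bar>\<Sum>u\<in>{u\<in>born w (?t j). length u = n j}. ?A u * Ff f (?t j) (?s u) (?y u)\<bar> \<le> ?e j"
      proof -
        have "\<bar>\<Sum>u\<in>{u\<in>born w (?t j). length u = n j}. ?A u * Ff f (?t j) (?s u) (?y u)\<bar> \<le>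
          (\<Sum>u\<in>{u\<in>born w (?t j). length u = n j}. (K / sqrt (?t j)) * (?A u * (\<bar>?y u\<bar> + ?s u)))"
        proof (rule order_trans[OF sum_abs sum_mono])
          fix u assume u: "u \<in> {u\<in>born w (?t j). length u = n j}"
          then have "\<bar>Ff f (?t j) (?s u) (?y u)\<bar> \<le> K * (\<bar>?y u\<bar> + ?s u) / sqrt (?t j)"
            using elim(5) by (intro Ff_bound[OF f K Lip \<gamma> j(1)]) (auto simp: born_def)
          then have "?A u * \<bar>Ff f (?t j) (?s u) (?y u)\<bar> \<le> ?A u * (K * (\<bar>?y u\<bar> + ?s u) / sqrt (?t j))" by (intro mult_left_mono) auto
          then show "\<bar>?A u * Ff f (?t j) (?s u) (?y u)\<bar> \<le> (K / sqrt (?t j)) * (?A u * (\<bar>?y u\<bar> + ?s u))" by (simp add: abs_mult ac_simps)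
        qed
        also have "\<dots> = (K / sqrt (?t j)) * (\<Sum>u\<in>{u\<in>born w (?t j). length u = n j}. ?A u * (\<bar>?y u\<bar> + ?s u))" by (simp only: sum_distrib_left)
        also have "\<dots> \<le> (K / sqrt (?t j)) * ((1 / R) ^ n j * G)" using K0 j G(2) by (intro mult_left_mono) auto
        also have "\<dots> \<le> (K / sqrt (?t j)) * (((1 / R) * (2 * real j) powr (1/4)) * G)"
        proof (intro mult_left_mono mult_right_mono)
          have "(real j + 1) powr (1/4) \<le> (2 * real j) powr (1/4)" using j by (intro powr_mono2) auto
          then show "(1 / R) ^ n j \<le> (1 / R) * (2 * real j) powr (1/4)"
            using R by (intro order_trans[OF Rn] mult_left_mono) auto
        qed (use G K0 j in auto)
        also have "\<dots> = ?e j" by (simp add: ac_simps)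
        finally show ?thesis .
      qed
      show ?thesis unfolding W using e1 e2 by linarith
    qed
    have e0: "?e \<longlonglongrightarrow> 0"
    proof -
      have "(\<lambda>j. ((1 / R) * 2 powr (1/4) * (G * K) / sqrt \<delta>) * real j powr (- (1/4))) \<longlonglongrightarrow> ((1 / R) * 2 powr (1/4) * (G * K) / sqrt \<delta>) * 0"
        by (intro tendsto_mult tendsto_const tendsto_neg_powr filterlim_real_sequentially) auto
      moreover have "?e j = ((1 / R) * 2 powr (1/4) * (G * K) / sqrt \<delta>) * real j powr (- (1/4))" if "1 \<le> j" for j
      proof -
        have "sqrt (real j) = real j powr (1/4) * real j powr (1/4)" using that by (simp add: powr_add[symmetric] powr_half_sqrt)
        then have "real j powr (1/4) / sqrt (real j) = real j powr (- (1/4))" using that by (simp add: powr_minus field_simps)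
        then have "real j powr (1/4) = real j powr (- (1/4)) * sqrt (real j)" using that by (simp add: field_simps)
        then show ?thesis using that \<delta> by (simp add: powr_mult real_sqrt_mult field_simps)
      qed
      then have "\<forall>\<^sub>F j in sequentially. ((1 / R) * 2 powr (1/4) * (G * K) / sqrt \<delta>) * real j powr (- (1/4)) = ?e j"
        unfolding eventually_sequentially by metis
      ultimately show ?thesis by (auto intro: Lim_transform_eventually)
    qed
    have lim: "(\<lambda>j. K * early j w + \<bar>late j w\<bar> + ?e j) \<longlonglongrightarrow> K * 0 + \<bar>0\<bar> + 0"
      by (intro tendsto_add tendsto_mult tendsto_const tendsto_rabs e0 elim(1,2))
    obtain j0 :: nat where j0: "1 / \<delta> \<le> real j0" using real_arch_simple by blast
    have "\<forall>\<^sub>F j in sequentially. norm (Wsum f (?t j) w) \<le> K * early j w + \<bar>late j w\<bar> + ?e j"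
      unfolding eventually_sequentially
    proof (intro exI[of _ "max 1 j0"] allI impI)
      fix j assume j: "max 1 j0 \<le> j"
      then have "real j0 \<le> real j" by simp
      then have "\<delta> * real j0 \<le> \<delta> * real j" using \<delta> by (intro mult_left_mono) auto
      moreover have "1 \<le> \<delta> * real j0" using j0 \<delta> by (simp add: field_simps)
      ultimately have "1 \<le> \<delta> * real j" by linarith
      then show "norm (Wsum f (?t j) w) \<le> K * early j w + \<bar>late j w\<bar> + ?e j" using bd[of j] j by simp
    qed
    then show ?case by (rule Lim_null_comparison) (use lim in simp)
  qed
qed

end

section \<open>Convergence in continuous time\<close>

lemma nice_const: "nice \<bar>a\<bar> (\<lambda>_. a)"
  by (auto simp: nice_def)

text \<open>For the scaling clause: if |x| > 2 R, both x and \<theta> x with \<theta> \<ge> 1/2 lie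
  outside the support; if |x| \<le> 2 R, the Lipschitz bound gives L * 2 R * (1 - \<theta>).\<close>

lemma nice_compact_support:
  assumes L: "0 \<le> L" "\<And>x y. \<bar>g x - g y\<bar> \<le> L * \<bar>x - y\<bar>" and R: "0 < R" "\<And>x. R \<le> \<bar>x\<bar> \<Longrightarrow> g x = 0"
  shows "nice (L * (1 + 2 * R)) g"
proof -
  have c1: "L * 1 \<le> L * (1 + 2 * R)" using L(1) R(1) by (intro mult_left_mono) auto
  have c2: "L * (2 * R) \<le> L * (1 + 2 * R)" using L(1) R(1) by (intro mult_left_mono) auto
  have "\<bar>g x\<bar> \<le> L * (1 + 2 * R)" for x
  proof (cases "R \<le> \<bar>x\<bar>")
    case True then show ?thesis using R L by simp
  next
    case False
    have "\<bar>g x\<bar> = \<bar>g x - g R\<bar>" using R(2)[of R] R(1) by simp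
    also have "\<dots> \<le> L * \<bar>x - R\<bar>" by (rule L)
    also have "\<dots> \<le> L * (2 * R)" using False L by (intro mult_left_mono) auto
    finally show ?thesis using c2 by linarith
  qed
  moreover have "\<bar>g x - g y\<bar> \<le> L * (1 + 2 * R) * \<bar>x - y\<bar>" for x y
    using L(2)[of x y] mult_right_mono[OF c1, of "\<bar>x - y\<bar>"] by simp
  moreover have "\<bar>g (\<theta> * x) - g x\<bar> \<le> L * (1 + 2 * R) * (1 - \<theta>)" if th: "1/2 \<le> \<theta>" "\<theta> \<le> 1" for \<theta> x
  proof (cases "\<bar>x\<bar> \<le> 2 * R")
    case True
    have "\<bar>g (\<theta> * x) - g x\<bar> \<le> L * \<bar>\<theta> * x - x\<bar>" by (rule L)
    also have "\<bar>\<theta> * x - x\<bar> = \<bar>x\<bar> * (1 - \<theta>)"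
    proof -
      have "\<theta> * x - x = - (x * (1 - \<theta>))" by (simp add: algebra_simps)
      then show ?thesis using th by (simp add: abs_mult)
    qed
    also have "L * (\<bar>x\<bar> * (1 - \<theta>)) \<le> L * (2 * R * (1 - \<theta>))" using True L th by (intro mult_left_mono mult_right_mono) auto
    also have "\<dots> = L * (2 * R) * (1 - \<theta>)" by simp
    also have "\<dots> \<le> L * (1 + 2 * R) * (1 - \<theta>)" using c2 th by (intro mult_right_mono) auto
    finally show ?thesis .
  next
    case False
    have "1/2 * \<bar>x\<bar> \<le> \<theta> * \<bar>x\<bar>" using th by (intro mult_right_mono) auto
    then have "R \<le> \<bar>\<theta> * x\<bar>" using False th by (simp add: abs_mult)
    then have "g (\<theta> * x) = 0" "g x = 0" using False R by auto
    then show ?thesis using L R th by simp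
  qed
  ultimately show ?thesis unfolding nice_def by blast
qed

section \<open>Approximation of bounded continuous functions\<close>

definition cutoff :: "nat \<Rightarrow> real \<Rightarrow> real" where
  "cutoff n x = max 0 (min 1 (real n + 1 - \<bar>x\<bar>))"

lemma cutoff_01: "0 \<le> cutoff n x" "cutoff n x \<le> 1" by (auto simp: cutoff_def)

lemma cutoff_Lip: "\<bar>cutoff n x - cutoff n y\<bar> \<le> \<bar>x - y\<bar>"
  by (auto simp: cutoff_def max_def min_def)

lemma cutoff_zero: "real n + 1 \<le> \<bar>x\<bar> \<Longrightarrow> cutoff n x = 0" by (auto simp: cutoff_def)

lemma measurable_cutoff [measurable]: "cutoff n \<in> borel_measurable borel"
  unfolding cutoff_def[abs_def] by measurable

lemma nice_cutoff: "nice (1 * (1 + 2 * (real n + 1))) (cutoff n)"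
  by (rule nice_compact_support) (auto simp: cutoff_Lip cutoff_zero)

lemma cutoff_mean: "(\<lambda>n. \<integral>z. std_normal_density z * cutoff n z \<partial>lborel) \<longlonglongrightarrow> 1"
proof -
  have "(\<lambda>n. \<integral>z. std_normal_density z * cutoff n z \<partial>lborel) \<longlonglongrightarrow> (\<integral>z. std_normal_density z \<partial>lborel)"
  proof (rule integral_dominated_convergence)
    show "AE z in lborel. (\<lambda>n. std_normal_density z * cutoff n z) \<longlonglongrightarrow> std_normal_density z"
    proof (intro AE_I2)
      fix z :: real
      obtain n0 :: nat where n0: "\<bar>z\<bar> \<le> real n0" using real_arch_simple by blast
      have "cutoff n z = 1" if "n0 \<le> n" for n
      proof -
        have "real n0 \<le> real n" using that by simp
        then show ?thesis using n0 by (auto simp: cutoff_def)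
      qed
      then have "\<forall>\<^sub>F n in sequentially. std_normal_density z * cutoff n z = std_normal_density z"
        unfolding eventually_sequentially by (metis mult.right_neutral)
      then show "(\<lambda>n. std_normal_density z * cutoff n z) \<longlonglongrightarrow> std_normal_density z" by (rule tendsto_eventually)
    qed
    show "AE z in lborel. norm (std_normal_density z * cutoff n z) \<le> std_normal_density z" for n
      using cutoff_01 by (auto simp: abs_mult mult_left_le)
  qed auto
  then show ?thesis by simp
qed

text \<open>A polynomial approximation on a compact interval, multiplied by the cutoff. Outside the
  interval the error is as large as the bound of f, but it is expressed through 1 - cutoff, a
  function whose weighted sum over the particles has a known limit.\<close>

lemma nice_approximation:
  fixes f :: "real \<Rightarrow> real"
  assumes cont: "continuous_on UNIV f" and M: "\<And>x. \<bar>f x\<bar> \<le> M"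
  obtains g K where "nice K g" "g \<in> borel_measurable borel" "\<And>x. \<bar>f x - g x\<bar> \<le> M * (1 - cutoff n x) + 1 / (real n + 1)"
proof -
  define R where "R = real n + 1"
  have R: "0 < R" by (simp add: R_def)
  let ?S = "{-R..R}"
  have "continuous_on ?S f" using cont by (rule continuous_on_subset) auto
  then obtain q where q: "real_polynomial_function q" "\<And>x. x \<in> ?S \<Longrightarrow> \<bar>f x - q x\<bar> < 1 / (real n + 1)"
    by (rule Stone_Weierstrass_real_polynomial_function[where e="1 / (real n + 1)" and S="?S" and f=f, OF compact_Icc]) auto
  obtain q' where q': "real_polynomial_function q'" "\<And>x. (q has_real_derivative q' x) (at x)"
    using has_real_derivative_polynomial_function[OF q(1)] by blast
  have pc: "continuous_on UNIV h" if "real_polynomial_function h" for h :: "real \<Rightarrow> real"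
    using that by (metis continuous_on_polymonial_function real_polynomial_function_eq)
  have bdd: "\<exists>C. \<forall>x\<in>?S. \<bar>h x\<bar> \<le> C" if h: "real_polynomial_function h" for h :: "real \<Rightarrow> real"
  proof -
    have "compact (h ` ?S)" by (intro compact_continuous_image continuous_on_subset[OF pc[OF h]]) auto
    then have "bounded (h ` ?S)" by (rule compact_imp_bounded)
    then show ?thesis unfolding bounded_real by blast
  qed
  obtain C1 where C1: "\<And>x. x \<in> ?S \<Longrightarrow> \<bar>q x\<bar> \<le> C1" using bdd[OF q(1)] by blast
  obtain C2 where C2: "\<And>x. x \<in> ?S \<Longrightarrow> \<bar>q' x\<bar> \<le> C2" using bdd[OF q'(1)] by blast
  have C0: "0 \<le> C1" "0 \<le> C2" using C1[of 0] C2[of 0] R by (auto intro: order_trans[OF abs_ge_zero])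
  have qL: "\<bar>q x - q y\<bar> \<le> C2 * \<bar>x - y\<bar>" if "x \<in> ?S" "y \<in> ?S" for x y
    using field_differentiable_bound[of ?S q q' C2 x y] q'(2) C2 that
    by (auto intro: has_field_derivative_at_within)
  \<comment> \<open>Clamping the argument to the interval turns the polynomial into a bounded and
    globally Lipschitz function.\<close>
  define cl where "cl x = max (-R) (min R x)" for x
  have cl: "cl x \<in> ?S" "\<bar>cl x - cl y\<bar> \<le> \<bar>x - y\<bar>" for x y using R by (auto simp: cl_def max_def min_def)
  have cleq: "cl x = x" if "x \<in> ?S" for x using that by (auto simp: cl_def)
  define g where "g x = q (cl x) * cutoff n x" for x
  have gL: "\<bar>g x - g y\<bar> \<le> (C1 + C2) * \<bar>x - y\<bar>" for x y
  proof -
    have "g x - g y = q (cl x) * (cutoff n x - cutoff n y) + (q (cl x) - q (cl y)) * cutoff n y" by (simp add: g_def algebra_simps)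
    then have "\<bar>g x - g y\<bar> \<le> \<bar>q (cl x)\<bar> * \<bar>cutoff n x - cutoff n y\<bar> + \<bar>q (cl x) - q (cl y)\<bar> * \<bar>cutoff n y\<bar>"
      by (metis abs_mult abs_triangle_ineq)
    also have "\<dots> \<le> C1 * \<bar>x - y\<bar> + (C2 * \<bar>x - y\<bar>) * 1"
    proof (intro add_mono mult_mono)
      show "\<bar>q (cl x) - q (cl y)\<bar> \<le> C2 * \<bar>x - y\<bar>"
        using qL[OF cl(1) cl(1), of x y] mult_left_mono[OF cl(2)[of x y] C0(2)] by linarith
    qed (use C1 cl cutoff_Lip cutoff_01 C0 in auto)
    finally show ?thesis by (simp add: algebra_simps)
  qed
  have "nice ((C1 + C2) * (1 + 2 * R)) g"
    using C0 R gL by (intro nice_compact_support) (auto simp: g_def R_def cutoff_zero)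
  moreover have "g \<in> borel_measurable borel"
  proof -
    have [measurable]: "q \<in> borel_measurable borel" by (rule borel_measurable_continuous_onI[OF pc[OF q(1)]])
    have [measurable]: "cl \<in> borel_measurable borel" unfolding cl_def[abs_def] by measurable
    show ?thesis unfolding g_def[abs_def] by measurable
  qed
  moreover have "\<bar>f x - g x\<bar> \<le> M * (1 - cutoff n x) + 1 / (real n + 1)" for x
  proof (cases "x \<in> ?S")
    case True
    have "f x - g x = f x * (1 - cutoff n x) + (f x - q x) * cutoff n x" using cleq[OF True] by (simp add: g_def algebra_simps)
    then have "\<bar>f x - g x\<bar> \<le> \<bar>f x\<bar> * \<bar>1 - cutoff n x\<bar> + \<bar>f x - q x\<bar> * \<bar>cutoff n x\<bar>" by (metis abs_mult abs_triangle_ineq)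
    also have "\<dots> \<le> M * (1 - cutoff n x) + 1 / (real n + 1) * 1"
      using M[of x] q(2)[OF True] cutoff_01[of n x] by (intro add_mono mult_mono) (auto intro: less_imp_le)
    finally show ?thesis by simp
  next
    case False
    then have "cutoff n x = 0" by (intro cutoff_zero) (auto simp: R_def)
    then show ?thesis using M[of x] by (simp add: g_def add_increasing2)
  qed
  ultimately show thesis by (rule that)
qed

context bbm_beta begin

lemma Wsum_mono:
  assumes "\<And>x. f x \<le> g x" shows "Wsum f t w \<le> Wsum g t w"
  unfolding Wsum_def using assms by (intro sum_mono mult_left_mono) auto

lemma Wsum_lin: "Wsum (\<lambda>x. a * f x + b * g x) t w = a * Wsum f t w + b * Wsum g t w"
  unfolding Wsum_def by (simp add: sum_distrib_left sum.distrib[symmetric] algebra_simps)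

lemma Wsum_abs_le:
  assumes "\<And>x. \<bar>f x\<bar> \<le> g x" shows "\<bar>Wsum f t w\<bar> \<le> Wsum g t w"
proof -
  have "Wsum f t w \<le> Wsum g t w" using assms by (intro Wsum_mono) (meson abs_le_D1)
  moreover have "- Wsum f t w \<le> Wsum g t w"
    using Wsum_mono[of "\<lambda>x. - f x" g t w] Wsum_lin[of "-1" f 0 f t w] assms by (simp add: abs_le_D2)
  ultimately show ?thesis by linarith
qed

lemma Wsum_nonneg: "0 \<le> Wsum (\<lambda>_. 1) t w"
  unfolding Wsum_def by (intro sum_nonneg) auto

definition Wlim :: "'a \<Rightarrow> real" where "Wlim w = lim (\<lambda>j::nat. Wsum (\<lambda>_. 1) (real j) w)"

text \<open>Subtracting the Gaussian mean reduces to mean zero plus a multiple of W. Only meshes 1 /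
  (N + 1) occur, so there are countably many null sets and every grid contains the integers, which
  forces a common limit of W.\<close>

lemma grid_limit:
  assumes f[measurable]: "f \<in> borel_measurable borel" and f: "nice K f"
  shows "AE w in M. \<forall>N::nat. (\<lambda>j::nat. Wsum (\<lambda>_. 1) (1 / (real N + 1) * real j) w) \<longlonglongrightarrow> Wlim w \<and>
     (\<lambda>j::nat. Wsum f (1 / (real N + 1) * real j) w) \<longlonglongrightarrow> (\<integral>z. std_normal_density z * f z \<partial>lborel) * Wlim w"
proof -
  define \<gamma> where "\<gamma> = (\<integral>z. std_normal_density z * f z \<partial>lborel)"
  define g where "g x = f x - \<gamma>" for x
  have fK: "\<And>x. \<bar>f x\<bar> \<le> K" and fL: "\<And>x y. \<bar>f x - f y\<bar> \<le> K * \<bar>x - y\<bar>" using f by (auto simp: nice_def)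
  have \<gamma>K: "\<bar>\<gamma>\<bar> \<le> K" using Ff_abs_le[OF assms(1) fK, of 1 0 0] by (simp add: Ff_def \<gamma>_def)
  have K0: "0 \<le> K" using fK[of 0] by linarith
  have [measurable]: "g \<in> borel_measurable borel" unfolding g_def by measurable
  have gK: "\<bar>g x\<bar> \<le> 2 * K" for x using fK[of x] \<gamma>K unfolding g_def by linarith
  have gL: "\<bar>g x - g y\<bar> \<le> 2 * K * \<bar>x - y\<bar>" for x y
  proof -
    have "K * \<bar>x - y\<bar> \<le> 2 * K * \<bar>x - y\<bar>" using K0 by (intro mult_right_mono) auto
    then show ?thesis using fL[of x y] by (simp add: g_def)
  qed
  have g0: "(\<integral>z. std_normal_density z * g z \<partial>lborel) = 0"
    using integrable_gauss_mult[OF assms(1) fK] by (simp add: g_def right_diff_distrib \<gamma>_def)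
  have "AE w in M. \<forall>N::nat. convergent (\<lambda>j::nat. Wsum (\<lambda>_. 1) (1 / (real N + 1) * real j) w)"
    unfolding AE_all_countable by (intro allI W_grid_convergent) auto
  moreover have "AE w in M. \<forall>N::nat. (\<lambda>j::nat. Wsum g (1 / (real N + 1) * real j) w) \<longlonglongrightarrow> 0"
    unfolding AE_all_countable by (intro allI grid_zero[where K="2 * K"] gK gL g0) auto
  ultimately show ?thesis
  proof eventually_elim
    case (elim w)
    have Wl: "(\<lambda>j::nat. Wsum (\<lambda>_. 1) (real j) w) \<longlonglongrightarrow> Wlim w"
      using elim(1)[rule_format, of 0] unfolding Wlim_def by (simp add: convergent_LIMSEQ_iff)
    have 1: "(\<lambda>j::nat. Wsum (\<lambda>_. 1) (1 / (real N + 1) * real j) w) \<longlonglongrightarrow> Wlim w" for N :: nat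
    proof -
      obtain l where l: "(\<lambda>j::nat. Wsum (\<lambda>_. 1) (1 / (real N + 1) * real j) w) \<longlonglongrightarrow> l"
        using elim(1) by (auto simp: convergent_def)
      \<comment> \<open>Every (N + 1)-th grid point is an integer.\<close>
      have sm: "strict_mono (\<lambda>i::nat. Suc N * i)" by (intro strict_monoI mult_strict_left_mono) auto
      have "(\<lambda>i::nat. Wsum (\<lambda>_. 1) (1 / (real N + 1) * real (Suc N * i)) w) \<longlonglongrightarrow> l"
        using LIMSEQ_subseq_LIMSEQ[OF l sm] by (simp add: comp_def)
      moreover have "1 / (real N + 1) * real (Suc N * i) = real i" for i
        by (simp add: field_simps)
      ultimately have "(\<lambda>i::nat. Wsum (\<lambda>_. 1) (real i) w) \<longlonglongrightarrow> l" by simp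
      then have "l = Wlim w" using Wl by (rule LIMSEQ_unique)
      then show ?thesis using l by simp
    qed
    have "(\<lambda>j::nat. Wsum f (1 / (real N + 1) * real j) w) \<longlonglongrightarrow> \<gamma> * Wlim w" for N :: nat
    proof -
      have eq: "Wsum f t w = Wsum g t w + \<gamma> * Wsum (\<lambda>_. 1) t w" for t
        using Wsum_lin[of 1 g \<gamma> "\<lambda>_. 1" t w] by (simp add: g_def)
      have "(\<lambda>j::nat. Wsum g (1 / (real N + 1) * real j) w + \<gamma> * Wsum (\<lambda>_. 1) (1 / (real N + 1) * real j) w) \<longlonglongrightarrow> 0 + \<gamma> * Wlim w"
        using elim(2) 1 by (intro tendsto_add tendsto_mult tendsto_const) auto
      then show ?thesis unfolding eq by simp
    qed
    with 1 show ?case by (simp add: \<gamma>_def)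
  qed
qed

text \<open>For a fixed mesh the oscillation over cells is asymptotically at most K
  \<open>eps \<delta>\<close> times the limit of W, since \<open>Zcell\<close> tends to 0; the mesh
  is chosen path by path to make this smaller than the tolerance.\<close>

lemma nice_limit:
  assumes fm[measurable]: "f \<in> borel_measurable borel" and f: "nice K f"
  shows "AE w in M. ((\<lambda>t. Wsum f t w) \<longlongrightarrow> (\<integral>z. std_normal_density z * f z \<partial>lborel) * Wlim w) at_top"
proof -
  define \<gamma> where "\<gamma> = (\<integral>z. std_normal_density z * f z \<partial>lborel)"
  have K0: "0 \<le> K" using f unfolding nice_def by (meson abs_ge_zero order_trans)
  have "AE w in M. \<forall>N::nat. (\<lambda>j::nat. Zcell (1 / (real N + 1)) (1 / (real N + 1) * real j) w) \<longlonglongrightarrow> 0"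
    unfolding AE_all_countable by (intro allI Zcell_grid) auto
  from this grid_limit[OF fm f] AE_good show ?thesis
  proof eventually_elim
    case (elim w)
    have W0: "0 \<le> Wlim w"
      using elim(2)[rule_format, of 0] by (auto intro: LIMSEQ_le_const Wsum_nonneg)
    show ?case unfolding \<gamma>_def[symmetric]
    proof (rule tendstoI)
      fix e :: real assume e: "0 < e"
      have "(\<lambda>N. K * (eps (1 / (real N + 1)) * Wlim w)) \<longlonglongrightarrow> K * ((Co + 3) * sqrt 0 * exp 2 * Wlim w)"
      proof -
        have "(\<lambda>N. 1 / (real N + 1)) \<longlonglongrightarrow> 0"
          using LIMSEQ_inverse_real_of_nat by (simp add: inverse_eq_divide add.commute)
        then show ?thesis unfolding eps_def by (intro tendsto_intros)
      qed
      then have "\<forall>\<^sub>F N in sequentially. K * (eps (1 / (real N + 1)) * Wlim w) < e"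
        using e by (intro order_tendstoD) auto
      then obtain N where N: "K * (eps (1 / (real N + 1)) * Wlim w) < e" by (auto simp: eventually_sequentially)
      define \<delta> where "\<delta> = 1 / (real N + 1)"
      have \<delta>: "0 < \<delta>" "\<delta> \<le> 1" by (auto simp: \<delta>_def)
      have l1: "(\<lambda>j::nat. Wsum (\<lambda>_. 1) (\<delta> * real j) w) \<longlonglongrightarrow> Wlim w"
        and lf: "(\<lambda>j::nat. Wsum f (\<delta> * real j) w) \<longlonglongrightarrow> \<gamma> * Wlim w"
        and lZ: "(\<lambda>j::nat. Zcell \<delta> (\<delta> * real j) w) \<longlonglongrightarrow> 0"
        using elim(1,2) by (auto simp: \<delta>_def \<gamma>_def)
      define r where "r j = K * (eps \<delta> * Wsum (\<lambda>_. 1) (\<delta> * real (Suc j)) w + Zcell \<delta> (\<delta> * real j) w)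
          + K * (1 / \<delta> * (1 / real j)) * Wsum (\<lambda>_. 1) (\<delta> * real j) w + \<bar>Wsum f (\<delta> * real j) w - \<gamma> * Wlim w\<bar>" for j :: nat
      have "r \<longlonglongrightarrow> K * (eps \<delta> * Wlim w + 0) + K * (1 / \<delta> * 0) * Wlim w + \<bar>\<gamma> * Wlim w - \<gamma> * Wlim w\<bar>"
        unfolding r_def by (intro tendsto_intros l1 lf lZ LIMSEQ_Suc[OF l1] lim_1_over_n)
      then have "\<forall>\<^sub>F j in sequentially. r j < e"
        using N by (intro order_tendstoD) (auto simp: \<delta>_def)
      then obtain j0 where j0: "\<And>j. j0 \<le> j \<Longrightarrow> r j < e" by (auto simp: eventually_sequentially)
      \<comment> \<open>The summand 2 guarantees that the left grid point of the cell is at least 1,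
        as \<open>cell_bound\<close> requires.\<close>
      have "dist (Wsum f t w) (\<gamma> * Wlim w) < e" if t: "\<delta> * (real j0 + 1) + 2 \<le> t" for t
      proof -
        define j where "j = nat \<lfloor>t / \<delta>\<rfloor>"
        have "0 \<le> \<delta> * (real j0 + 1)" using \<delta> by simp
        then have "0 \<le> t" using t by linarith
        then have t0: "0 \<le> t / \<delta>" using \<delta> by simp
        have fl: "real j = real_of_int \<lfloor>t / \<delta>\<rfloor>" using t0 by (simp add: j_def)
        have "real j \<le> t / \<delta>" "t / \<delta> < real j + 1" unfolding fl by linarith+
        then have b: "\<delta> * real j \<le> t" "t \<le> \<delta> * real j + \<delta>" using \<delta> by (auto simp: field_simps)
        have "\<delta> * (real j0 + 1) = \<delta> * real j0 + \<delta>" by (simp add: algebra_simps)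
        then have "\<delta> * real j0 \<le> \<delta> * real j" using t b by linarith
        then have jj: "j0 \<le> j" using \<delta> by simp
        have tj: "1 \<le> \<delta> * real j"
        proof -
          have "0 \<le> \<delta> * (real j0 + 1)" using \<delta> by simp
          then show ?thesis using t b \<delta> by linarith
        qed
        have "\<bar>Wsum f t w - Wsum f (\<delta> * real j) w\<bar> \<le> K * Vcell \<delta> (\<delta> * real j) w + K / (\<delta> * real j) * Wsum (\<lambda>_. 1) (\<delta> * real j) w"
          by (rule cell_bound[OF elim(3) f tj \<delta> b])
        also have "\<dots> \<le> K * (eps \<delta> * Wsum (\<lambda>_. 1) (\<delta> * real (Suc j)) w + Zcell \<delta> (\<delta> * real j) w) + K / (\<delta> * real j) * Wsum (\<lambda>_. 1) (\<delta> * real j) w"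
        proof (intro add_right_mono mult_left_mono K0)
          have "\<delta> * real (Suc j) = \<delta> * real j + \<delta>" by (simp add: algebra_simps)
          then show "Vcell \<delta> (\<delta> * real j) w \<le> eps \<delta> * Wsum (\<lambda>_. 1) (\<delta> * real (Suc j)) w + Zcell \<delta> (\<delta> * real j) w"
            using Vcell_le[OF elim(3) \<delta>, of "\<delta> * real j"] by simp
        qed
        finally have "\<bar>Wsum f t w - \<gamma> * Wlim w\<bar> \<le> r j" unfolding r_def by simp
        also have "\<dots> < e" by (rule j0[OF jj])
        finally show ?thesis by (simp add: dist_real_def)
      qed
      then show "\<forall>\<^sub>F t in at_top. dist (Wsum f t w) (\<gamma> * Wlim w) < e"
        unfolding eventually_at_top_linorder by blast
    qed
  qed
qed

lemma W_limit: "AE w in M. ((\<lambda>t. Wsum (\<lambda>_. 1) t w) \<longlongrightarrow> Wlim w) at_top"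
  using nice_limit[of "\<lambda>_. 1" "\<bar>1\<bar>"] nice_const[of 1] by simp

text \<open>The error of replacing f by the n-th approximation is at most \<open>Wsum\<close> of Mf
  (1 - cutoff) + 1 / (n + 1). Constants and cutoffs are themselves \<open>nice\<close>, so the limit
  of this error is known: d n times the limit of W, with d n tending to 0. Thus no mass escapes to
  infinity on the scale \<surd>t.\<close>

lemma Wsum_limit:
  assumes cont: "continuous_on UNIV f" and Mf: "\<And>x. \<bar>f x\<bar> \<le> Mf"
  shows "AE w in M. ((\<lambda>t. Wsum f t w) \<longlongrightarrow> (\<integral>z. std_normal_density z * f z \<partial>lborel) * Wlim w) at_top"
proof -
  have fm[measurable]: "f \<in> borel_measurable borel" by (rule borel_measurable_continuous_onI[OF cont])
  have M0: "0 \<le> Mf" using Mf[of 0] by linarith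
  define \<gamma> where "\<gamma> h = (\<integral>z. std_normal_density z * h z \<partial>lborel)" for h :: "real \<Rightarrow> real"
  have "\<exists>g K. nice K g \<and> g \<in> borel_measurable borel \<and> (\<forall>x. \<bar>f x - g x\<bar> \<le> Mf * (1 - cutoff n x) + 1 / (real n + 1))" for n
    using nice_approximation[OF cont Mf, of n] by metis
  then obtain g K where gn: "\<And>n. nice (K n) (g n)" and gm[measurable]: "\<And>n. g n \<in> borel_measurable borel"
    and gb: "\<And>n x. \<bar>f x - g n x\<bar> \<le> Mf * (1 - cutoff n x) + 1 / (real n + 1)" by metis
  have "AE w in M. \<forall>n. ((\<lambda>t. Wsum (g n) t w) \<longlongrightarrow> \<gamma> (g n) * Wlim w) at_top"
    unfolding AE_all_countable \<gamma>_def using nice_limit[OF gm gn] by blast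
  moreover have "AE w in M. \<forall>n. ((\<lambda>t. Wsum (cutoff n) t w) \<longlongrightarrow> \<gamma> (cutoff n) * Wlim w) at_top"
    unfolding AE_all_countable \<gamma>_def using nice_limit[OF measurable_cutoff nice_cutoff] by blast
  ultimately show ?thesis using W_limit
  proof eventually_elim
    case (elim w)
    have W0: "0 \<le> Wlim w" using elim(3) by (rule tendsto_lowerbound) (auto simp: Wsum_nonneg)
    define d where "d n = Mf * (1 - \<gamma> (cutoff n)) + 1 / (real n + 1)" for n
    have d0: "d \<longlonglongrightarrow> 0"
    proof -
      have "d \<longlonglongrightarrow> Mf * (1 - 1) + 0"
        unfolding d_def \<gamma>_def
        using LIMSEQ_inverse_real_of_nat by (intro tendsto_intros cutoff_mean) (simp add: inverse_eq_divide add.commute)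
      then show ?thesis by simp
    qed
    have ic: "integrable lborel (\<lambda>z. std_normal_density z * cutoff n z)" for n
      using cutoff_01 by (intro integrable_gauss_mult[where K=1]) auto
    have \<gamma>d: "\<bar>\<gamma> f - \<gamma> (g n)\<bar> \<le> d n" for n
    proof -
      have if1: "integrable lborel (\<lambda>z. std_normal_density z * f z)" by (rule integrable_gauss_mult[OF fm Mf])
      have ig: "integrable lborel (\<lambda>z. std_normal_density z * g n z)"
        using gn[of n] by (intro integrable_gauss_mult[where K="K n"] gm) (auto simp: nice_def)
      have "\<bar>\<gamma> f - \<gamma> (g n)\<bar> = \<bar>\<integral>z. std_normal_density z * (f z - g n z) \<partial>lborel\<bar>"
        using if1 ig by (simp add: \<gamma>_def right_diff_distrib)
      also have "\<dots> \<le> (\<integral>z. \<bar>std_normal_density z * (f z - g n z)\<bar> \<partial>lborel)" by (rule integral_abs_bound)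
      also have "\<dots> \<le> (\<integral>z. (Mf + 1 / (real n + 1)) * std_normal_density z - Mf * (std_normal_density z * cutoff n z) \<partial>lborel)"
      proof (rule integral_mono)
        show "integrable lborel (\<lambda>z. \<bar>std_normal_density z * (f z - g n z)\<bar>)"
          using if1 ig by (simp only: right_diff_distrib) (intro integrable_abs Bochner_Integration.integrable_diff)
        show "integrable lborel (\<lambda>z. (Mf + 1 / (real n + 1)) * std_normal_density z - Mf * (std_normal_density z * cutoff n z))"
          using ic by (intro Bochner_Integration.integrable_diff integrable_mult_right) auto
        fix z :: real
        have "\<bar>std_normal_density z * (f z - g n z)\<bar> \<le> std_normal_density z * (Mf * (1 - cutoff n z) + 1 / (real n + 1))"
          unfolding abs_mult using gb[of z n] by (simp add: mult_left_mono)
        then show "\<bar>std_normal_density z * (f z - g n z)\<bar> \<le> (Mf + 1 / (real n + 1)) * std_normal_density z - Mf * (std_normal_density z * cutoff n z)"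
          by (simp add: algebra_simps)
      qed
      also have "\<dots> = d n" using ic by (simp add: d_def \<gamma>_def algebra_simps)
      finally show ?thesis .
    qed
    show ?case unfolding \<gamma>_def[symmetric]
    proof (rule tendstoI)
      fix e :: real assume e: "0 < e"
      have "(\<lambda>n. d n * Wlim w + d n * Wlim w) \<longlonglongrightarrow> 0 * Wlim w + 0 * Wlim w" by (intro tendsto_intros d0)
      then have "\<forall>\<^sub>F n in sequentially. d n * Wlim w + d n * Wlim w < e" using e by (intro order_tendstoD) auto
      then obtain n where n: "d n * Wlim w + d n * Wlim w < e" by (auto simp: eventually_sequentially)
      \<comment> \<open>The error function, written as a linear combination of 1 and the cutoff for
        the sake of \<open>Wsum_lin\<close>.\<close>
      define h where "h x = (Mf + 1 / (real n + 1)) * 1 + - Mf * cutoff n x" for x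
      define r where "r t = Wsum h t w + \<bar>Wsum (g n) t w - \<gamma> (g n) * Wlim w\<bar> + d n * Wlim w" for t
      have "(r \<longlongrightarrow> ((Mf + 1 / (real n + 1)) * Wlim w + - Mf * (\<gamma> (cutoff n) * Wlim w)) + \<bar>\<gamma> (g n) * Wlim w - \<gamma> (g n) * Wlim w\<bar> + d n * Wlim w) at_top"
        unfolding r_def h_def Wsum_lin by (intro tendsto_intros elim(3) elim(1)[rule_format] elim(2)[rule_format])
      moreover have "((Mf + 1 / (real n + 1)) * Wlim w + - Mf * (\<gamma> (cutoff n) * Wlim w)) + \<bar>\<gamma> (g n) * Wlim w - \<gamma> (g n) * Wlim w\<bar> + d n * Wlim w = d n * Wlim w + d n * Wlim w"
        by (simp add: d_def algebra_simps)
      ultimately have "(r \<longlongrightarrow> d n * Wlim w + d n * Wlim w) at_top" by simp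
      then have "\<forall>\<^sub>F t in at_top. r t < e" using n by (rule order_tendstoD)
      then show "\<forall>\<^sub>F t in at_top. dist (Wsum f t w) (\<gamma> f * Wlim w) < e"
      proof eventually_elim
        case (elim t)
        have 1: "\<bar>Wsum f t w - Wsum (g n) t w\<bar> \<le> Wsum h t w"
        proof -
          have "Wsum (\<lambda>x. f x - g n x) t w = Wsum f t w - Wsum (g n) t w" using Wsum_lin[of 1 f "-1" "g n" t w] by simp
          moreover have "\<bar>Wsum (\<lambda>x. f x - g n x) t w\<bar> \<le> Wsum h t w"
            by (intro Wsum_abs_le order_trans[OF gb]) (simp add: h_def algebra_simps)
          ultimately show ?thesis by simp
        qed
        have 2: "\<bar>\<gamma> (g n) * Wlim w - \<gamma> f * Wlim w\<bar> \<le> d n * Wlim w"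
        proof -
          have "\<bar>\<gamma> (g n) * Wlim w - \<gamma> f * Wlim w\<bar> = \<bar>\<gamma> f - \<gamma> (g n)\<bar> * Wlim w"
            using W0 by (simp add: left_diff_distrib[symmetric] abs_mult abs_minus_commute)
          also have "\<dots> \<le> d n * Wlim w" using \<gamma>d W0 by (intro mult_right_mono) auto
          finally show ?thesis .
        qed
        have "\<bar>Wsum f t w - \<gamma> f * Wlim w\<bar> \<le> r t" unfolding r_def using 1 2 by linarith
        then show ?case using elim by (simp add: dist_real_def)
      qed
    qed
  qed
qed

section \<open>Convergence in \<open>L^p\<close>\<close>

lemma ae_meas_Wlim: "ae_meas Wlim"
proof -
  have "\<exists>g. \<forall>j. g j \<in> borel_measurable M \<and> (AE w in M. Wsum (\<lambda>_. 1) (real j) w = g j w)"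
    using ae_meas_Wsum[of "\<lambda>_. 1"] unfolding ae_meas_def by (intro choice) simp
  then obtain g where g[measurable]: "\<And>j. g j \<in> borel_measurable M" and eq: "\<And>j. AE w in M. Wsum (\<lambda>_. 1) (real j) w = g j w" by blast
  have "AE w in M. \<forall>j. Wsum (\<lambda>_. 1) (real j) w = g j w" using eq by (simp add: AE_all_countable)
  then have "AE w in M. Wlim w = lim (\<lambda>j. g j w)" by eventually_elim (simp add: Wlim_def)
  moreover have "(\<lambda>w. lim (\<lambda>j. g j w)) \<in> borel_measurable M" by measurable
  ultimately show ?thesis unfolding ae_meas_def by blast
qed

text \<open>Fatou's lemma along the times t + j: the increment bound is uniform in the later
  time.\<close>

lemma Wlim_moment:
  assumes t: "0 \<le> t"
  shows "(\<integral>\<^sup>+w. ennreal (\<bar>Wsum (\<lambda>_. 1) t w - Wlim w\<bar> powr p) \<partial>M) \<le> ennreal (120 * (16 * (2 + m2)) / (1 - \<rho>) * exp (- \<kappa> * t))"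
proof -
  let ?X = "\<lambda>j::nat. \<lambda>w. Wsum (\<lambda>_. 1) (t + real j) w - Wsum (\<lambda>_. 1) t w"
  have "\<exists>g. \<forall>j. g j \<in> borel_measurable M \<and> (AE w in M. ?X j w = g j w)"
    using ae_meas_diff[OF ae_meas_Wsum ae_meas_Wsum, of "\<lambda>_. 1" "\<lambda>_. 1"] unfolding ae_meas_def by (intro choice) simp
  then obtain g where g[measurable]: "\<And>j. g j \<in> borel_measurable M" and eq: "\<And>j. AE w in M. ?X j w = g j w" by blast
  have "(\<integral>\<^sup>+w. ennreal (\<bar>Wsum (\<lambda>_. 1) t w - Wlim w\<bar> powr p) \<partial>M) = (\<integral>\<^sup>+w. liminf (\<lambda>j. ennreal (\<bar>g j w\<bar> powr p)) \<partial>M)"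
  proof (rule nn_integral_cong_AE)
    have "AE w in M. \<forall>j. ?X j w = g j w" using eq by (simp add: AE_all_countable)
    then show "AE w in M. ennreal (\<bar>Wsum (\<lambda>_. 1) t w - Wlim w\<bar> powr p) = liminf (\<lambda>j. ennreal (\<bar>g j w\<bar> powr p))"
      using W_limit
    proof eventually_elim
      case (elim w)
      have "filterlim (\<lambda>j::nat. t + real j) at_top sequentially"
        by (intro filterlim_tendsto_add_at_top[OF tendsto_const] filterlim_real_sequentially)
      then have "(\<lambda>j. Wsum (\<lambda>_. 1) (t + real j) w) \<longlonglongrightarrow> Wlim w" by (rule filterlim_compose[OF elim(2)])
      then have "(\<lambda>j. \<bar>?X j w\<bar> powr p) \<longlonglongrightarrow> \<bar>Wlim w - Wsum (\<lambda>_. 1) t w\<bar> powr p"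
        using p by (intro tendsto_powr' tendsto_rabs tendsto_diff tendsto_const) auto
      then have lim: "(\<lambda>j. ennreal (\<bar>g j w\<bar> powr p)) \<longlonglongrightarrow> ennreal (\<bar>Wlim w - Wsum (\<lambda>_. 1) t w\<bar> powr p)"
        using elim(1) by (intro tendsto_ennrealI) simp
      show ?case using lim_imp_Liminf[OF _ lim] by (simp add: abs_minus_commute)
    qed
  qed
  also have "\<dots> \<le> liminf (\<lambda>j. \<integral>\<^sup>+w. ennreal (\<bar>g j w\<bar> powr p) \<partial>M)" by (rule nn_integral_liminf) measurable
  also have "\<dots> \<le> ennreal (120 * (16 * (2 + m2)) / (1 - \<rho>) * exp (- \<kappa> * t))"
  proof (intro Liminf_le always_eventually allI)
    fix j :: nat
    have "(\<integral>\<^sup>+w. ennreal (\<bar>g j w\<bar> powr p) \<partial>M) = (\<integral>\<^sup>+w. ennreal (\<bar>?X j w\<bar> powr p) \<partial>M)"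
      by (intro nn_integral_cong_AE, use eq[of j] in eventually_elim) simp
    also have "\<dots> \<le> ennreal (120 * (16 * (2 + m2)) / (1 - \<rho>) * exp (- \<kappa> * t))"
      by (rule W_increment_moment) (use t in auto)
    finally show "(\<integral>\<^sup>+w. ennreal (\<bar>g j w\<bar> powr p) \<partial>M) \<le> ennreal (120 * (16 * (2 + m2)) / (1 - \<rho>) * exp (- \<kappa> * t))" .
  qed simp
  finally show ?thesis .
qed

lemma Wlim_powr_finite: "(\<integral>\<^sup>+w. ennreal (\<bar>Wlim w\<bar> powr p) \<partial>M) < \<infinity>"
proof -
  have p': "1 \<le> p" "p \<le> 2" using p by auto
  obtain g where [measurable]: "g \<in> borel_measurable M" and g: "AE w in M. Wlim w = g w"
    using ae_meas_Wlim by (auto simp: ae_meas_def)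
  \<comment> \<open>With positive lifetimes the root is the only particle born by time 0. Comparing
    the limit with this constant gives its p-th moment.\<close>
  have W0: "AE w in M. Wsum (\<lambda>_. 1) 0 w = 1"
    using AE_good
  proof eventually_elim
    case (elim w)
    have pos: "0 < tau u w" for u using elim by (simp add: good_def)
    have "0 < cbirth (conf w) (i # u)" for i u
      using pos by (induction u arbitrary: i) (auto simp: conf_def intro: add_pos_pos)
    then have "born w 0 = {[]}"
      by (auto simp: born_def) (metis cbirth.elims not_le)
    then show ?case using elim pos[of "[]"] by (simp add: Wsum_def cw_def own_def good_def B_zero)
  qed
  have "(\<integral>\<^sup>+w. ennreal (\<bar>Wlim w\<bar> powr p) \<partial>M) \<le> (\<integral>\<^sup>+w. ennreal 4 * (ennreal (\<bar>1 - g w\<bar> powr p) + 1) \<partial>M)"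
  proof (intro nn_integral_mono_AE, use g in eventually_elim)
    fix w assume "Wlim w = g w"
    have "\<bar>(g w - 1) + 1\<bar> powr p \<le> 4 * (\<bar>g w - 1\<bar> powr p + \<bar>1\<bar> powr p)" by (rule abs_add_powr_le_4[OF p'])
    then have "\<bar>g w\<bar> powr p \<le> 4 * (\<bar>1 - g w\<bar> powr p + 1)" by (simp add: abs_minus_commute)
    then have "ennreal (\<bar>g w\<bar> powr p) \<le> ennreal (4 * (\<bar>1 - g w\<bar> powr p + 1))" by (rule ennreal_leI)
    also have "\<dots> = ennreal 4 * (ennreal (\<bar>1 - g w\<bar> powr p) + 1)"
      by (simp only: ennreal_mult ennreal_plus ennreal_1 zero_le_numeral zero_le_one add_nonneg_nonneg powr_ge_zero)
    finally show "ennreal (\<bar>Wlim w\<bar> powr p) \<le> ennreal 4 * (ennreal (\<bar>1 - g w\<bar> powr p) + 1)"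
      unfolding \<open>Wlim w = g w\<close> .
  qed
  also have "\<dots> = ennreal 4 * ((\<integral>\<^sup>+w. ennreal (\<bar>1 - g w\<bar> powr p) \<partial>M) + 1)"
    by (subst nn_integral_cmult) (auto simp: nn_integral_add emeasure_space_1)
  also have "(\<integral>\<^sup>+w. ennreal (\<bar>1 - g w\<bar> powr p) \<partial>M) = (\<integral>\<^sup>+w. ennreal (\<bar>Wsum (\<lambda>_. 1) 0 w - Wlim w\<bar> powr p) \<partial>M)"
    by (intro nn_integral_cong_AE, use W0 g in eventually_elim) simp
  also have "ennreal 4 * (\<dots> + 1) \<le> ennreal 4 * (ennreal (120 * (16 * (2 + m2)) / (1 - \<rho>) * exp (- \<kappa> * 0)) + 1)"
    by (intro mult_left_mono add_right_mono Wlim_moment) auto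
  also have "\<dots> < \<infinity>" by (simp add: ennreal_mult_less_top)
  finally show ?thesis .
qed

text \<open>The p-th power Y of the error is at most Kp D + H, where D is the p-th power of the
  distance of W at time t to its limit and H is integrable and independent of t. Hence Y \<le> Kp D
  + min Y H. The mean of D decays exponentially, and min Y H tends to 0 almost surely and is
  dominated by H.\<close>

lemma Wsum_limit_Lp:
  assumes cont: "continuous_on UNIV f" and Mf: "\<And>x. \<bar>f x\<bar> \<le> Mf"
  shows "((\<lambda>t. \<integral>\<^sup>+w. ennreal (\<bar>Wsum f t w - (\<integral>z. std_normal_density z * f z \<partial>lborel) * Wlim w\<bar> powr p) \<partial>M) \<longlongrightarrow> 0) at_top"
proof -
  have p': "1 \<le> p" "p \<le> 2" using p by auto
  have fm[measurable]: "f \<in> borel_measurable borel" by (rule borel_measurable_continuous_onI[OF cont])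
  define \<gamma> where "\<gamma> = (\<integral>z. std_normal_density z * f z \<partial>lborel)"
  have \<gamma>M: "\<bar>\<gamma>\<bar> \<le> Mf" using Ff_abs_le[OF fm Mf, of 1 0 0] by (simp add: Ff_def \<gamma>_def)
  have M0: "0 \<le> Mf" using Mf[of 0] by linarith
  define Kp where "Kp = 4 * Mf powr p"
  have Kp: "0 \<le> Kp" by (simp add: Kp_def)
  define C where "C = 120 * (16 * (2 + m2)) / (1 - \<rho>)"
  have C: "0 \<le> C" using m2_nonneg \<rho> by (simp add: C_def)
  show ?thesis unfolding \<gamma>_def[symmetric]
  \<comment> \<open>Passing to arbitrary sequences of times leaves countably many almost sure
    identities, as dominated convergence and the measurable versions require.\<close>
  proof (rule tendsto_at_topI_sequentially)
    fix X :: "nat \<Rightarrow> real" assume X: "filterlim X at_top sequentially"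
    let ?Y = "\<lambda>n w. \<bar>Wsum f (X n) w - \<gamma> * Wlim w\<bar> powr p"
    let ?D = "\<lambda>n w. \<bar>Wsum (\<lambda>_. 1) (X n) w - Wlim w\<bar> powr p"
    let ?H = "\<lambda>w. Kp * (2 powr p * \<bar>Wlim w\<bar> powr p)"
    have YDH: "?Y n w \<le> Kp * ?D n w + ?H w" for n w
    proof -
      have "\<bar>Wsum f (X n) w\<bar> \<le> Wsum (\<lambda>x. Mf * 1 + 0 * 1) (X n) w" using Mf by (intro Wsum_abs_le) simp
      then have "\<bar>Wsum f (X n) w\<bar> \<le> Mf * Wsum (\<lambda>_. 1) (X n) w" unfolding Wsum_lin by simp
      moreover have "\<bar>\<gamma> * Wlim w\<bar> \<le> Mf * \<bar>Wlim w\<bar>" unfolding abs_mult using \<gamma>M by (intro mult_right_mono) auto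
      moreover have "Mf * Wsum (\<lambda>_. 1) (X n) w \<le> Mf * (\<bar>Wsum (\<lambda>_. 1) (X n) w - Wlim w\<bar> + \<bar>Wlim w\<bar>)"
        using M0 by (intro mult_left_mono) auto
      ultimately have "\<bar>Wsum f (X n) w - \<gamma> * Wlim w\<bar> \<le> Mf * (\<bar>Wsum (\<lambda>_. 1) (X n) w - Wlim w\<bar> + \<bar>Wlim w\<bar>) + Mf * \<bar>Wlim w\<bar>"
        by linarith
      also have "\<dots> = Mf * (\<bar>Wsum (\<lambda>_. 1) (X n) w - Wlim w\<bar> + 2 * \<bar>Wlim w\<bar>)" by (simp add: algebra_simps)
      finally have "?Y n w \<le> (Mf * (\<bar>Wsum (\<lambda>_. 1) (X n) w - Wlim w\<bar> + 2 * \<bar>Wlim w\<bar>)) powr p" using p by (intro powr_mono2) auto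
      also have "\<dots> = Mf powr p * \<bar>\<bar>Wsum (\<lambda>_. 1) (X n) w - Wlim w\<bar> + 2 * \<bar>Wlim w\<bar>\<bar> powr p" using M0 by (simp add: powr_mult)
      also have "\<dots> \<le> Mf powr p * (4 * (\<bar>\<bar>Wsum (\<lambda>_. 1) (X n) w - Wlim w\<bar>\<bar> powr p + \<bar>2 * \<bar>Wlim w\<bar>\<bar> powr p))"
        by (intro mult_left_mono abs_add_powr_le_4 p') auto
      also have "\<dots> = Kp * ?D n w + ?H w" by (simp add: Kp_def powr_mult algebra_simps)
      finally show ?thesis .
    qed
    have amD: "ae_meas (?D n)" for n
      by (rule ae_meas_compose[OF ae_meas_diff[OF ae_meas_Wsum ae_meas_Wlim], of "\<lambda>_. 1" "\<lambda>x. \<bar>x\<bar> powr p"]) auto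
    have amG: "ae_meas (\<lambda>w. \<gamma> * Wlim w)" by (rule ae_meas_compose[OF ae_meas_Wlim]) auto
    have amY: "ae_meas (?Y n)" for n
      by (rule ae_meas_compose[OF ae_meas_diff[OF ae_meas_Wsum[OF fm] amG], of "\<lambda>x. \<bar>x\<bar> powr p"]) auto
    have amH: "ae_meas ?H" by (rule ae_meas_compose[OF ae_meas_Wlim, of "\<lambda>x. Kp * (2 powr p * \<bar>x\<bar> powr p)"]) auto
    have "\<exists>g. \<forall>n. g n \<in> borel_measurable M \<and> (AE w in M. ?Y n w = g n w)"
      using amY unfolding ae_meas_def by (intro choice) simp
    then obtain y where ym[measurable]: "\<And>n. y n \<in> borel_measurable M" and y: "\<And>n. AE w in M. ?Y n w = y n w" by blast
    obtain h where hm[measurable]: "h \<in> borel_measurable M" and h: "AE w in M. ?H w = h w"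
      using amH unfolding ae_meas_def by blast
    have yall: "AE w in M. \<forall>n. ?Y n w = y n w" using y by (simp add: AE_all_countable)
    have min0: "(\<lambda>n. \<integral>\<^sup>+w. ennreal (min (y n w) (h w)) \<partial>M) \<longlonglongrightarrow> (\<integral>\<^sup>+w. 0 \<partial>M)"
    proof (rule nn_integral_dominated_convergence)
      show "AE w in M. ennreal (min (y n w) (h w)) \<le> ennreal (h w)" for n by (intro AE_I2 ennreal_leI) auto
      have "(\<integral>\<^sup>+w. ennreal (h w) \<partial>M) = (\<integral>\<^sup>+w. ennreal (Kp * 2 powr p) * ennreal (\<bar>Wlim w\<bar> powr p) \<partial>M)"
        by (intro nn_integral_cong_AE, use h in eventually_elim) (use Kp in \<open>simp add: ennreal_mult[symmetric] mult.assoc\<close>)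
      also have "\<dots> < \<infinity>"
      proof -
        obtain g where [measurable]: "g \<in> borel_measurable M" and g: "AE w in M. Wlim w = g w"
          using ae_meas_Wlim by (auto simp: ae_meas_def)
        have "(\<integral>\<^sup>+w. ennreal (Kp * 2 powr p) * ennreal (\<bar>Wlim w\<bar> powr p) \<partial>M) = (\<integral>\<^sup>+w. ennreal (Kp * 2 powr p) * ennreal (\<bar>g w\<bar> powr p) \<partial>M)"
          by (intro nn_integral_cong_AE, use g in eventually_elim) simp
        also have "\<dots> = ennreal (Kp * 2 powr p) * (\<integral>\<^sup>+w. ennreal (\<bar>g w\<bar> powr p) \<partial>M)" by (rule nn_integral_cmult) measurable
        also have "(\<integral>\<^sup>+w. ennreal (\<bar>g w\<bar> powr p) \<partial>M) = (\<integral>\<^sup>+w. ennreal (\<bar>Wlim w\<bar> powr p) \<partial>M)"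
          by (intro nn_integral_cong_AE, use g in eventually_elim) simp
        also have "ennreal (Kp * 2 powr p) * \<dots> < \<infinity>"
          using Wlim_powr_finite by (simp add: ennreal_mult_less_top)
        finally show ?thesis .
      qed
      finally show "(\<integral>\<^sup>+w. ennreal (h w) \<partial>M) < \<infinity>" .
      show "AE w in M. (\<lambda>n. ennreal (min (y n w) (h w))) \<longlonglongrightarrow> 0"
        using yall h Wsum_limit[OF cont Mf]
      proof eventually_elim
        case (elim w)
        have "(\<lambda>n. Wsum f (X n) w) \<longlonglongrightarrow> \<gamma> * Wlim w" unfolding \<gamma>_def by (rule filterlim_compose[OF elim(3) X])
        then have "(\<lambda>n. ?Y n w) \<longlonglongrightarrow> \<bar>\<gamma> * Wlim w - \<gamma> * Wlim w\<bar> powr p"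
          using p by (intro tendsto_powr' tendsto_rabs tendsto_diff tendsto_const) auto
        then have "(\<lambda>n. y n w) \<longlonglongrightarrow> 0" using elim(1) p by simp
        then have "(\<lambda>n. min (y n w) (h w)) \<longlonglongrightarrow> min 0 (h w)" by (intro tendsto_min tendsto_const)
        moreover have "0 \<le> h w" using elim(2) Kp by (metis mult_nonneg_nonneg powr_ge_zero)
        ultimately have "(\<lambda>n. ennreal (min (y n w) (h w))) \<longlonglongrightarrow> ennreal 0" by (intro tendsto_ennrealI) simp
        then show ?case by simp
      qed
    qed measurable
    have D0: "(\<lambda>n. ennreal (Kp * (C * exp (- \<kappa> * X n)))) \<longlonglongrightarrow> ennreal (Kp * (C * 0))"
    proof (intro tendsto_ennrealI tendsto_mult tendsto_const)
      have "filterlim (\<lambda>n. \<kappa> * X n) at_top sequentially"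
        using \<kappa> X by (intro filterlim_tendsto_pos_mult_at_top[OF tendsto_const]) auto
      then have "filterlim (\<lambda>n. - (\<kappa> * X n)) at_bot sequentially" by (simp add: filterlim_uminus_at_bot)
      then have "(\<lambda>n. exp (- (\<kappa> * X n))) \<longlonglongrightarrow> 0" by (rule filterlim_compose[OF exp_at_bot])
      then show "(\<lambda>n. exp (- \<kappa> * X n)) \<longlonglongrightarrow> 0" by simp
    qed
    have ub: "\<forall>\<^sub>F n in sequentially. (\<integral>\<^sup>+w. ennreal (?Y n w) \<partial>M) \<le> ennreal (Kp * (C * exp (- \<kappa> * X n))) + (\<integral>\<^sup>+w. ennreal (min (y n w) (h w)) \<partial>M)"
    proof -
      have "\<forall>\<^sub>F n in sequentially. 0 \<le> X n" using X by (simp add: filterlim_at_top)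
      then show ?thesis
      proof eventually_elim
        case (elim n)
        obtain q where [measurable]: "q \<in> borel_measurable M" and q: "AE w in M. ?D n w = q w"
          using amD[of n] unfolding ae_meas_def by blast
        have "(\<integral>\<^sup>+w. ennreal (?Y n w) \<partial>M) \<le> (\<integral>\<^sup>+w. ennreal Kp * ennreal (q w) + ennreal (min (y n w) (h w)) \<partial>M)"
        proof (intro nn_integral_mono_AE, use q y[of n] h in eventually_elim)
          fix w assume e: "?D n w = q w" "?Y n w = y n w" "?H w = h w"
          have nn: "0 \<le> q w" "0 \<le> y n w" "0 \<le> h w" using e Kp by (metis powr_ge_zero mult_nonneg_nonneg)+
          have "y n w \<le> Kp * q w + min (y n w) (h w)"
            using YDH[of n w] e nn Kp by (auto simp: min_def)
          then have "ennreal (y n w) \<le> ennreal (Kp * q w + min (y n w) (h w))" by (rule ennreal_leI)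
          then show "ennreal (?Y n w) \<le> ennreal Kp * ennreal (q w) + ennreal (min (y n w) (h w))"
            using e nn Kp by (simp add: ennreal_plus ennreal_mult)
        qed
        also have "\<dots> = ennreal Kp * (\<integral>\<^sup>+w. ennreal (q w) \<partial>M) + (\<integral>\<^sup>+w. ennreal (min (y n w) (h w)) \<partial>M)"
          by (subst nn_integral_add) (auto simp: nn_integral_cmult)
        also have "(\<integral>\<^sup>+w. ennreal (q w) \<partial>M) = (\<integral>\<^sup>+w. ennreal (?D n w) \<partial>M)"
          by (intro nn_integral_cong_AE, use q in eventually_elim) simp
        also have "ennreal Kp * \<dots> \<le> ennreal Kp * ennreal (C * exp (- \<kappa> * X n))"
          unfolding C_def by (intro mult_left_mono Wlim_moment elim) auto
        finally show ?case using Kp C by (simp add: ennreal_mult)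
      qed
    qed
    show "(\<lambda>n. \<integral>\<^sup>+w. ennreal (?Y n w) \<partial>M) \<longlonglongrightarrow> 0"
    proof (rule tendsto_sandwich[OF _ ub tendsto_const])
      show "(\<lambda>n. ennreal (Kp * (C * exp (- \<kappa> * X n))) + (\<integral>\<^sup>+w. ennreal (min (y n w) (h w)) \<partial>M)) \<longlonglongrightarrow> 0"
        using tendsto_add[OF D0 min0] by simp
    qed auto
  qed
qed

lemma W_inf_eq_Wlim: "AE w in M. W_inf tau L B \<beta> w = Wlim w"
  using W_limit AE_good
proof eventually_elim
  case (elim w)
  have "((\<lambda>t. W_add tau L B \<beta> t w) \<longlongrightarrow> Wlim w) at_top"
    using elim(1) W_add_eq_Wsum[OF elim(2)] by simp
  then show ?case unfolding W_inf_def by (intro tendsto_Lim) auto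
qed

lemma W_f_limit:
  assumes cont: "continuous_on UNIV f" and Mf: "\<And>x. \<bar>f x\<bar> \<le> Mf"
  shows "AE w in M. ((\<lambda>t. W_f tau L B \<beta> f t w) \<longlongrightarrow> W_inf tau L B \<beta> w * (\<integral>x. f x * std_normal_density x \<partial>lborel)) at_top"
  using Wsum_limit[OF assms] W_inf_eq_Wlim AE_good
  by eventually_elim (simp add: W_f_eq_Wsum mult.commute)

lemma W_f_limit_Lp:
  assumes cont: "continuous_on UNIV f" and Mf: "\<And>x. \<bar>f x\<bar> \<le> Mf"
  shows "((\<lambda>t. \<integral>\<^sup>+w. ennreal (\<bar>W_f tau L B \<beta> f t w - W_inf tau L B \<beta> w * (\<integral>x. f x * std_normal_density x \<partial>lborel)\<bar> powr p) \<partial>M) \<longlongrightarrow> 0) at_top"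
proof -
  have "(\<integral>\<^sup>+w. ennreal (\<bar>W_f tau L B \<beta> f t w - W_inf tau L B \<beta> w * (\<integral>x. f x * std_normal_density x \<partial>lborel)\<bar> powr p) \<partial>M)
    = (\<integral>\<^sup>+w. ennreal (\<bar>Wsum f t w - (\<integral>z. std_normal_density z * f z \<partial>lborel) * Wlim w\<bar> powr p) \<partial>M)" for t
    by (intro nn_integral_cong_AE, use W_inf_eq_Wlim AE_good in eventually_elim) (simp add: W_f_eq_Wsum mult.commute)
  then show ?thesis using Wsum_limit_Lp[OF assms] by simp
qed

text \<open>The first moment is at most e + e^(1-p) times the p-th moment, for every e > 0; the p-th
  moment tends to 0 with e fixed.\<close>

lemma W_f_limit_L1:
  assumes cont: "continuous_on UNIV f" and Mf: "\<And>x. \<bar>f x\<bar> \<le> Mf"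
  shows "((\<lambda>t. \<integral>\<^sup>+w. ennreal (\<bar>W_f tau L B \<beta> f t w - W_inf tau L B \<beta> w * (\<integral>x. f x * std_normal_density x \<partial>lborel)\<bar> powr 1) \<partial>M) \<longlongrightarrow> 0) at_top"
proof -
  let ?X = "\<lambda>t w. W_f tau L B \<beta> f t w - W_inf tau L B \<beta> w * (\<integral>x. f x * std_normal_density x \<partial>lborel)"
  have fm: "f \<in> borel_measurable borel" by (rule borel_measurable_continuous_onI[OF cont])
  have am: "\<exists>g. g \<in> borel_measurable M \<and> (AE w in M. ?X t w = g w)" for t
  proof -
    have "ae_meas (\<lambda>w. Wlim w * (\<integral>x. f x * std_normal_density x \<partial>lborel))" by (rule ae_meas_compose[OF ae_meas_Wlim]) auto
    then have "ae_meas (\<lambda>w. Wsum f t w - Wlim w * (\<integral>x. f x * std_normal_density x \<partial>lborel))"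
      by (intro ae_meas_diff ae_meas_Wsum fm)
    then obtain g where g: "g \<in> borel_measurable M" "AE w in M. Wsum f t w - Wlim w * (\<integral>x. f x * std_normal_density x \<partial>lborel) = g w"
      unfolding ae_meas_def by blast
    have "AE w in M. ?X t w = g w" using g(2) W_inf_eq_Wlim AE_good by eventually_elim (simp add: W_f_eq_Wsum)
    then show ?thesis using g(1) by blast
  qed
  define I where "I t = (\<integral>\<^sup>+w. ennreal (\<bar>?X t w\<bar> powr p) \<partial>M)" for t
  have I0: "(I \<longlongrightarrow> 0) at_top" unfolding I_def by (rule W_f_limit_Lp[OF assms])
  have bd: "(\<integral>\<^sup>+w. ennreal (\<bar>?X t w\<bar> powr 1) \<partial>M) \<le> ennreal e + ennreal (e powr (1 - p)) * I t" if e: "0 < e" for t e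
  proof -
    obtain g where [measurable]: "g \<in> borel_measurable M" and g: "AE w in M. ?X t w = g w" using am by blast
    have "(\<integral>\<^sup>+w. ennreal (\<bar>?X t w\<bar> powr 1) \<partial>M) \<le> (\<integral>\<^sup>+w. ennreal e + ennreal (e powr (1 - p)) * ennreal (\<bar>g w\<bar> powr p) \<partial>M)"
    proof (intro nn_integral_mono_AE, use g in eventually_elim)
      fix w assume eq: "?X t w = g w"
      have "ennreal \<bar>g w\<bar> \<le> ennreal (e + e powr (1 - p) * \<bar>g w\<bar> powr p)"
        using abs_le_plus_powr[OF e, of p "g w"] p by (intro ennreal_leI) auto
      then show "ennreal (\<bar>?X t w\<bar> powr 1) \<le> ennreal e + ennreal (e powr (1 - p)) * ennreal (\<bar>g w\<bar> powr p)"
        unfolding eq using e by (simp add: ennreal_plus ennreal_mult)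
    qed
    also have "\<dots> = ennreal e + ennreal (e powr (1 - p)) * (\<integral>\<^sup>+w. ennreal (\<bar>g w\<bar> powr p) \<partial>M)"
      by (simp add: nn_integral_add nn_integral_cmult emeasure_space_1)
    also have "(\<integral>\<^sup>+w. ennreal (\<bar>g w\<bar> powr p) \<partial>M) = I t"
      unfolding I_def by (intro nn_integral_cong_AE, use g in eventually_elim) simp
    finally show ?thesis .
  qed
  show ?thesis
  proof (rule order_tendstoI)
    fix a :: ennreal assume a: "0 < a"
    obtain e where e: "0 < e" "ennreal e < a"
    proof (cases a)
      case (real r)
      then have "0 < r / 2" "ennreal (r / 2) < a" using a by (auto simp: ennreal_less_iff)
      then show ?thesis by (rule that)
    next
      case top
      then show ?thesis using that[of 1] by simp
    qed
    have "((\<lambda>t. ennreal e + ennreal (e powr (1 - p)) * I t) \<longlongrightarrow> ennreal e + ennreal (e powr (1 - p)) * 0) at_top"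
      by (intro tendsto_add tendsto_const tendsto_mult_ennreal I0) auto
    then have "\<forall>\<^sub>F t in at_top. ennreal e + ennreal (e powr (1 - p)) * I t < a"
      using e by (intro order_tendstoD) auto
    then show "\<forall>\<^sub>F t in at_top. (\<integral>\<^sup>+w. ennreal (\<bar>?X t w\<bar> powr 1) \<partial>M) < a"
      by eventually_elim (rule le_less_trans[OF bd[OF e(1)]])
  qed simp
qed

end

section \<open>Admissible exponents and the theorem\<close>

text \<open>One has 1 + p c - (p \<beta>)^2 / 2 = 2 + (p - 1) (1 - p \<beta>^2 / 2), and the surplus
  over 2 is positive for 1 < p < 2 / \<beta>^2. Half of it serves as \<kappa>.\<close>

lemma bbm_beta_exists:
  assumes "bbm_model M \<mu> tau L B" and \<beta>: "0 \<le> \<beta>" and p: "1 < p" "p \<le> 2" "\<beta> \<noteq> 0 \<longrightarrow> p < 2 / \<beta>\<^sup>2"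
  shows "\<exists>\<kappa>. bbm_beta M \<mu> tau L B \<beta> p \<kappa>"
proof -
  have "p * \<beta>\<^sup>2 < 2" using p by (cases "\<beta> = 0") (auto simp: field_simps)
  then have pos: "0 < (p - 1) * (1 - p * \<beta>\<^sup>2 / 2)" using p by (intro mult_pos_pos) auto
  define \<kappa> where "\<kappa> = (p - 1) * (1 - p * \<beta>\<^sup>2 / 2) / 2"
  have \<kappa>: "0 < \<kappa>" using pos by (simp add: \<kappa>_def)
  have "1 + p * c_beta \<beta> - (p * \<beta>)\<^sup>2 / 2 = 2 + 2 * \<kappa>"
    by (simp add: c_beta_def \<kappa>_def field_simps power2_eq_square)
  then have "2 < 1 + (p * c_beta \<beta> - \<kappa>) - (p * \<beta>)\<^sup>2 / 2" using \<kappa> by linarith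
  moreover note \<kappa>
  ultimately have "bbm_beta M \<mu> tau L B \<beta> p \<kappa>"
    using assms by (intro bbm_beta.intro bbm_beta_axioms.intro) auto
  then show ?thesis ..
qed

theorem theorem4p1:
  fixes M :: "'a measure" and \<mu> :: "nat pmf"
    and tau :: "nat list \<Rightarrow> 'a \<Rightarrow> real" and L :: "nat list \<Rightarrow> 'a \<Rightarrow> nat"
    and B :: "nat list \<Rightarrow> 'a \<Rightarrow> real \<Rightarrow> real"
    and \<beta> :: real and f :: "real \<Rightarrow> real"
  assumes mean: "measure_pmf.expectation \<mu> real = 2"
    and second: "integrable (measure_pmf \<mu>) (\<lambda>k. (real k)\<^sup>2)"
    and bbm: "BBM_randomness M \<mu> tau L B"
    and beta: "0 \<le> \<beta>" "\<beta> < sqrt 2"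
    and f_cont: "continuous_on UNIV f"
    and f_bdd: "bounded (range f)"
  shows "(AE \<omega> in M. ((\<lambda>t. W_f tau L B \<beta> f t \<omega>) \<longlongrightarrow>
              W_inf tau L B \<beta> \<omega> * (\<integral>x. f x * std_normal_density x \<partial>lborel)) at_top)
       \<and> (\<forall>p::real. 1 \<le> p \<and> p \<le> 2 \<and> (\<beta> \<noteq> 0 \<longrightarrow> p < (sqrt 2)\<^sup>2 / \<beta>\<^sup>2) \<longrightarrow>
            ((\<lambda>t. \<integral>\<^sup>+\<omega>. ennreal (\<bar>W_f tau L B \<beta> f t \<omega>
                 - W_inf tau L B \<beta> \<omega> * (\<integral>x. f x * std_normal_density x \<partial>lborel)\<bar> powr p) \<partial>M)
              \<longlongrightarrow> 0) at_top)"
proof -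
  have model: "bbm_model M \<mu> tau L B" by (rule bbm_model.intro[OF mean second bbm])
  obtain Mf where Mf: "\<And>x. \<bar>f x\<bar> \<le> Mf" using f_bdd unfolding bounded_real by auto
  have b2: "\<beta>\<^sup>2 < 2" using beta by (metis abs_of_nonneg real_sqrt_abs real_sqrt_less_iff)
  \<comment> \<open>Since \<beta>^2 < 2, some exponent above 1 is admissible; the almost sure
    statement and the case p = 1 both go through it.\<close>
  obtain p0 where p0: "1 < p0" "p0 \<le> 2" "\<beta> \<noteq> 0 \<longrightarrow> p0 < 2 / \<beta>\<^sup>2"
  proof (cases "\<beta> = 0")
    case True then show ?thesis using that[of 2] by auto
  next
    case False
    then have "1 < min 2 (2 / \<beta>\<^sup>2)" using b2 by (simp add: field_simps)
    then obtain q where "1 < q" "q < min 2 (2 / \<beta>\<^sup>2)" using dense by blast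
    then show ?thesis using that[of q] by auto
  qed
  obtain \<kappa>0 where "bbm_beta M \<mu> tau L B \<beta> p0 \<kappa>0" using bbm_beta_exists[OF model beta(1) p0] ..
  then interpret P0: bbm_beta M \<mu> tau L B \<beta> p0 \<kappa>0 .
  have Lp: "((\<lambda>t. \<integral>\<^sup>+\<omega>. ennreal (\<bar>W_f tau L B \<beta> f t \<omega> - W_inf tau L B \<beta> \<omega> * (\<integral>x. f x * std_normal_density x \<partial>lborel)\<bar> powr p) \<partial>M) \<longlongrightarrow> 0) at_top"
    if p: "1 \<le> p" "p \<le> 2" "\<beta> \<noteq> 0 \<longrightarrow> p < (sqrt 2)\<^sup>2 / \<beta>\<^sup>2" for p :: real
  \<comment> \<open>For p = 1 the weights are critical and have no slack \<kappa>, so this case is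
    inherited from \<open>p0\<close>.\<close>
  proof (cases "p = 1")
    case True
    then show ?thesis using P0.W_f_limit_L1[OF f_cont Mf] by simp
  next
    case False
    then obtain \<kappa> where "bbm_beta M \<mu> tau L B \<beta> p \<kappa>" using bbm_beta_exists[OF model beta(1), of p] p by auto
    then interpret P: bbm_beta M \<mu> tau L B \<beta> p \<kappa> .
    show ?thesis by (rule P.W_f_limit_Lp[OF f_cont Mf])
  qed
  show ?thesis using P0.W_f_limit[OF f_cont Mf] Lp by blast
qed

end
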